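(* There is a c.c.c. poset whose generic extensions contain continuum many distinct piecewise proper families of reals of size $\omega_2$.
   Context: A family of reals $\mathfrak{X}\subseteq\mathcal{P}(\mathbb{N})$ is proper if it is arithmetically closed (contains every set arithmetically definable from any of its members) and the poset $\mathfrak{X}/\mathrm{Fin}$ — the infinite members of $\mathfrak{X}$ ordered by almost inclusion ($A\leq B$ iff $A\setminus B$ finite) — is a proper poset in the sense of Shelah. A family is piecewise proper if it is the union of a chain (under inclusion) of proper families each of size $\leq\omega_1$. *)

theory Defs
  imports Main
begin

section \<open>First-order formulas in the language of set theory\<close>

datatype set_fm =
    Mem_fm nat nat
  | Eq_fm nat nat
  | Neg_fm set_fm
  | Conj_fm set_fm set_fm
  | Forall_fm nat set_fm

primrec set_sat :: "'a set \<Rightarrow> ('a \<Rightarrow> 'a \<Rightarrow> bool) \<Rightarrow> set_fm \<Rightarrow> (nat \<Rightarrow> 'a) \<Rightarrow> bool" where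
  "set_sat S E (Mem_fm i j) e \<longleftrightarrow> E (e i) (e j)"
| "set_sat S E (Eq_fm i j) e \<longleftrightarrow> e i = e j"
| "set_sat S E (Neg_fm f) e \<longleftrightarrow> \<not> set_sat S E f e"
| "set_sat S E (Conj_fm f g) e \<longleftrightarrow> set_sat S E f e \<and> set_sat S E g e"
| "set_sat S E (Forall_fm i f) e \<longleftrightarrow> (\<forall>a\<in>S. set_sat S E f (e(i := a)))"


section \<open>Arithmetical definability from finitely many sets of naturals\<close>

datatype arith_tm =
    Var_tm nat
  | Zero_tm
  | Succ_tm arith_tm
  | Plus_tm arith_tm arith_tm
  | Times_tm arith_tm arith_tm

primrec tm_val :: "arith_tm \<Rightarrow> (nat \<Rightarrow> nat) \<Rightarrow> nat" where
  "tm_val (Var_tm i) v = v i"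
| "tm_val Zero_tm v = 0"
| "tm_val (Succ_tm t) v = Suc (tm_val t v)"
| "tm_val (Plus_tm t u) v = tm_val t v + tm_val u v"
| "tm_val (Times_tm t u) v = tm_val t v * tm_val u v"

text \<open>Only number quantifiers; \<open>In_fm t k\<close> says that \<open>t\<close> belongs to the \<open>k\<close>-th set
  parameter, so each formula uses only finitely many of the parameters.\<close>

datatype arith_fm =
    Eq_afm arith_tm arith_tm
  | In_afm arith_tm nat
  | Neg_afm arith_fm
  | Conj_afm arith_fm arith_fm
  | Forall_afm nat arith_fm

primrec arith_sat :: "(nat \<Rightarrow> nat set) \<Rightarrow> arith_fm \<Rightarrow> (nat \<Rightarrow> nat) \<Rightarrow> bool" where
  "arith_sat A (Eq_afm t u) v \<longleftrightarrow> tm_val t v = tm_val u v"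
| "arith_sat A (In_afm t k) v \<longleftrightarrow> tm_val t v \<in> A k"
| "arith_sat A (Neg_afm f) v \<longleftrightarrow> \<not> arith_sat A f v"
| "arith_sat A (Conj_afm f g) v \<longleftrightarrow> arith_sat A f v \<and> arith_sat A g v"
| "arith_sat A (Forall_afm i f) v \<longleftrightarrow> (\<forall>n. arith_sat A f (v(i := n)))"

definition arith_definable_from :: "nat set set \<Rightarrow> nat set \<Rightarrow> bool" where
  "arith_definable_from \<X> B \<longleftrightarrow>
     (\<exists>A f. (\<forall>k. A k \<in> \<X>) \<and> B = {n. arith_sat A f ((\<lambda>_. 0)(0 := n))})"

definition arith_closed :: "nat set set \<Rightarrow> bool" where
  "arith_closed \<X> \<longleftrightarrow> (\<forall>B. arith_definable_from \<X> B \<longrightarrow> B \<in> \<X>)"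


section \<open>Set-theoretic notions evaluated in a membership structure\<close>

text \<open>A structure \<open>(M, E)\<close> for the language of set theory. All notions below are the usual
  set-theoretic ones relativized to \<open>(M, E)\<close>: quantifiers over sets range over \<open>M\<close>, and
  functions, bijections, antichains, dense sets and submodels must be elements of \<open>M\<close>.
  The structures of interest are well-founded models of ZFC (up to isomorphism, the transitive
  models). Their \<open>\<omega>\<close> is the true one, so that finiteness, arithmetical definability and
  satisfaction of formulas in a set structure are absolute for them; these three notions are
  therefore evaluated outside the structure.\<close>

locale set_structure =
  fixes M :: "'a set" and E :: "'a \<Rightarrow> 'a \<Rightarrow> bool"
begin

definition ext :: "'a \<Rightarrow> 'a set" where
  "ext x = {y \<in> M. E y x}"

text \<open>\<open>opair z x y\<close>: \<open>z\<close> is the Kuratowski pair of \<open>x\<close> and \<open>y\<close>.\<close>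

definition opair :: "'a \<Rightarrow> 'a \<Rightarrow> 'a \<Rightarrow> bool" where
  "opair z x y \<longleftrightarrow> z \<in> M \<and>
     (\<exists>s\<in>M. \<exists>t\<in>M. ext s = {x} \<and> ext t = {x, y} \<and> ext z = {s, t})"

definition is_Pow :: "'a \<Rightarrow> 'a \<Rightarrow> bool" where
  "is_Pow p x \<longleftrightarrow> p \<in> M \<and> ext p = {y \<in> M. ext y \<subseteq> ext x}"


subsection \<open>The axioms of ZFC\<close>

definition ax_extensionality :: bool where
  "ax_extensionality \<longleftrightarrow> (\<forall>x\<in>M. \<forall>y\<in>M. ext x = ext y \<longrightarrow> x = y)"

definition ax_foundation :: bool where
  "ax_foundation \<longleftrightarrow> (\<forall>x\<in>M. ext x \<noteq> {} \<longrightarrow> (\<exists>y\<in>ext x. ext y \<inter> ext x = {}))"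

definition ax_pairing :: bool where
  "ax_pairing \<longleftrightarrow> (\<forall>x\<in>M. \<forall>y\<in>M. \<exists>z\<in>M. ext z = {x, y})"

definition ax_union :: bool where
  "ax_union \<longleftrightarrow> (\<forall>x\<in>M. \<exists>u\<in>M. ext u = (\<Union>y\<in>ext x. ext y))"

definition ax_powerset :: bool where
  "ax_powerset \<longleftrightarrow> (\<forall>x\<in>M. \<exists>p. is_Pow p x)"

definition ax_infinity :: bool where
  "ax_infinity \<longleftrightarrow> (\<exists>w\<in>M. (\<exists>z\<in>ext w. ext z = {}) \<and>
     (\<forall>x\<in>ext w. \<exists>y\<in>ext w. ext y = insert x (ext x)))"

definition ax_separation :: bool where
  "ax_separation \<longleftrightarrow> (\<forall>f e. \<forall>x\<in>M. range e \<subseteq> M \<longrightarrow>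
     (\<exists>y\<in>M. ext y = {z \<in> ext x. set_sat M E f (e(0 := z))}))"

definition ax_replacement :: bool where
  "ax_replacement \<longleftrightarrow> (\<forall>f e. \<forall>x\<in>M. range e \<subseteq> M \<longrightarrow>
     (\<forall>u\<in>ext x. \<exists>!v. v \<in> M \<and> set_sat M E f (e(0 := u, 1 := v))) \<longrightarrow>
     (\<exists>y\<in>M. ext y = {v \<in> M. \<exists>u\<in>ext x. set_sat M E f (e(0 := u, 1 := v))}))"

definition ax_choice :: bool where
  "ax_choice \<longleftrightarrow> (\<forall>x\<in>M.
     (\<forall>y\<in>ext x. ext y \<noteq> {}) \<and> (\<forall>y\<in>ext x. \<forall>z\<in>ext x. y \<noteq> z \<longrightarrow> ext y \<inter> ext z = {}) \<longrightarrow>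
     (\<exists>c\<in>M. \<forall>y\<in>ext x. \<exists>!v. v \<in> ext y \<inter> ext c))"

definition ZFC :: bool where
  "ZFC \<longleftrightarrow> ax_extensionality \<and> ax_foundation \<and> ax_pairing \<and> ax_union \<and> ax_powerset \<and>
     ax_infinity \<and> ax_separation \<and> ax_replacement \<and> ax_choice"

definition wf_model_ZFC :: bool where
  "wf_model_ZFC \<longleftrightarrow> ZFC \<and> wfp_on M E"


subsection \<open>Relations, functions and cardinality\<close>

definition rel :: "'a \<Rightarrow> ('a \<times> 'a) set" where
  "rel r = {(x, y). \<exists>z\<in>ext r. opair z x y}"

definition is_rel :: "'a \<Rightarrow> 'a \<Rightarrow> 'a \<Rightarrow> bool" where
  "is_rel r a b \<longleftrightarrow> r \<in> M \<and> (\<forall>z\<in>ext r. \<exists>x\<in>ext a. \<exists>y\<in>ext b. opair z x y)"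

definition is_fun :: "'a \<Rightarrow> 'a \<Rightarrow> 'a \<Rightarrow> bool" where
  "is_fun f a b \<longleftrightarrow> is_rel f a b \<and> (\<forall>x\<in>ext a. \<exists>!y. (x, y) \<in> rel f)"

definition is_inj :: "'a \<Rightarrow> 'a \<Rightarrow> 'a \<Rightarrow> bool" where
  "is_inj f a b \<longleftrightarrow> is_fun f a b \<and>
     (\<forall>x x' y. (x, y) \<in> rel f \<and> (x', y) \<in> rel f \<longrightarrow> x = x')"

definition is_bij :: "'a \<Rightarrow> 'a \<Rightarrow> 'a \<Rightarrow> bool" where
  "is_bij f a b \<longleftrightarrow> is_inj f a b \<and> (\<forall>y\<in>ext b. \<exists>x. (x, y) \<in> rel f)"

definition card_le :: "'a \<Rightarrow> 'a \<Rightarrow> bool" where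
  "card_le a b \<longleftrightarrow> (\<exists>f. is_inj f a b)"

definition card_eq :: "'a \<Rightarrow> 'a \<Rightarrow> bool" where
  "card_eq a b \<longleftrightarrow> (\<exists>f. is_bij f a b)"

definition card_less :: "'a \<Rightarrow> 'a \<Rightarrow> bool" where
  "card_less a b \<longleftrightarrow> card_le a b \<and> \<not> card_eq a b"


subsection \<open>Ordinals and cardinals\<close>

definition is_transitive :: "'a \<Rightarrow> bool" where
  "is_transitive x \<longleftrightarrow> x \<in> M \<and> (\<forall>y\<in>ext x. ext y \<subseteq> ext x)"

definition is_ordinal :: "'a \<Rightarrow> bool" where
  "is_ordinal x \<longleftrightarrow> is_transitive x \<and> (\<forall>y\<in>ext x. is_transitive y)"

definition is_limit :: "'a \<Rightarrow> bool" where
  "is_limit x \<longleftrightarrow> is_ordinal x \<and> ext x \<noteq> {} \<and>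
     (\<forall>y\<in>ext x. \<exists>z\<in>ext x. ext z = insert y (ext y))"

definition is_omega :: "'a \<Rightarrow> bool" where
  "is_omega w \<longleftrightarrow> is_limit w \<and> (\<forall>x\<in>ext w. \<not> is_limit x)"

definition is_cardinal :: "'a \<Rightarrow> bool" where
  "is_cardinal k \<longleftrightarrow> is_ordinal k \<and> (\<forall>x\<in>ext k. \<not> card_eq x k)"

definition is_next_cardinal :: "'a \<Rightarrow> 'a \<Rightarrow> bool" where
  "is_next_cardinal l k \<longleftrightarrow> is_cardinal l \<and> k \<in> ext l \<and>
     (\<forall>x\<in>ext l. is_cardinal x \<longrightarrow> k \<notin> ext x)"

primrec is_omega_n :: "nat \<Rightarrow> 'a \<Rightarrow> bool" where
  "is_omega_n 0 k \<longleftrightarrow> is_omega k"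
| "is_omega_n (Suc n) k \<longleftrightarrow> (\<exists>j. is_omega_n n j \<and> is_next_cardinal k j)"

definition is_countable :: "'a \<Rightarrow> bool" where
  "is_countable x \<longleftrightarrow> (\<exists>w. is_omega w \<and> card_le x w)"

definition is_regular_uncountable :: "'a \<Rightarrow> bool" where
  "is_regular_uncountable l \<longleftrightarrow> is_cardinal l \<and> \<not> is_countable l \<and>
     (\<forall>a\<in>ext l. \<forall>f. is_fun f a l \<longrightarrow> (\<exists>b\<in>ext l. \<forall>x y. (x, y) \<in> rel f \<longrightarrow> y \<in> ext b))"

definition is_trcl :: "'a \<Rightarrow> 'a \<Rightarrow> bool" where
  "is_trcl t x \<longleftrightarrow> is_transitive t \<and> ext x \<subseteq> ext t \<and>
     (\<forall>u. is_transitive u \<and> ext x \<subseteq> ext u \<longrightarrow> ext t \<subseteq> ext u)"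

text \<open>\<open>is_H h l\<close>: \<open>h\<close> is the set \<open>H\<^sub>l\<close> of all sets of hereditary cardinality less than \<open>l\<close>.\<close>

definition is_H :: "'a \<Rightarrow> 'a \<Rightarrow> bool" where
  "is_H h l \<longleftrightarrow> h \<in> M \<and> ext h = {x \<in> M. \<exists>t. is_trcl t x \<and> card_less t l}"

definition is_elementary :: "'a \<Rightarrow> 'a \<Rightarrow> bool" where
  "is_elementary x h \<longleftrightarrow> x \<in> M \<and> ext x \<subseteq> ext h \<and>
     (\<forall>f e. range e \<subseteq> ext x \<longrightarrow> (set_sat (ext x) E f e \<longleftrightarrow> set_sat (ext h) E f e))"


subsection \<open>Posets\<close>

text \<open>A forcing notion is given by its underlying set \<open>p\<close> and its order \<open>r\<close>, both elements
  of \<open>M\<close>; \<open>(x, y) \<in> rel r\<close> means \<open>x \<le> y\<close>, i.e. \<open>x\<close> is the stronger condition.\<close>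

definition is_preorder :: "'a \<Rightarrow> 'a \<Rightarrow> bool" where
  "is_preorder p r \<longleftrightarrow> p \<in> M \<and> is_rel r p p \<and> refl_on (ext p) (rel r) \<and> trans (rel r)"

definition is_poset :: "'a \<Rightarrow> 'a \<Rightarrow> bool" where
  "is_poset p r \<longleftrightarrow> is_preorder p r \<and> ext p \<noteq> {} \<and> antisym (rel r)"

definition compatible :: "'a \<Rightarrow> 'a \<Rightarrow> 'a \<Rightarrow> 'a \<Rightarrow> bool" where
  "compatible p r x y \<longleftrightarrow> (\<exists>z\<in>ext p. (z, x) \<in> rel r \<and> (z, y) \<in> rel r)"

definition is_ccc :: "'a \<Rightarrow> 'a \<Rightarrow> bool" where
  "is_ccc p r \<longleftrightarrow> (\<forall>a\<in>M. ext a \<subseteq> ext p \<and>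
     (\<forall>x\<in>ext a. \<forall>y\<in>ext a. x \<noteq> y \<longrightarrow> \<not> compatible p r x y) \<longrightarrow> is_countable a)"

definition is_dense :: "'a \<Rightarrow> 'a \<Rightarrow> 'a \<Rightarrow> bool" where
  "is_dense p r d \<longleftrightarrow> d \<in> M \<and> ext d \<subseteq> ext p \<and> (\<forall>x\<in>ext p. \<exists>y\<in>ext d. (y, x) \<in> rel r)"

text \<open>\<open>q\<close> is an \<open>(x, p)\<close>-generic condition: \<open>q\<close> forces the generic filter to meet
  \<open>d \<inter> x\<close> for every dense set \<open>d \<in> x\<close>, i.e. each such \<open>d \<inter> x\<close> is predense below \<open>q\<close>.\<close>

definition is_generic_condition :: "'a \<Rightarrow> 'a \<Rightarrow> 'a \<Rightarrow> 'a \<Rightarrow> bool" where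
  "is_generic_condition p r x q \<longleftrightarrow> q \<in> ext p \<and>
     (\<forall>d\<in>ext x. is_dense p r d \<longrightarrow>
       (\<forall>s\<in>ext p. (s, q) \<in> rel r \<longrightarrow> (\<exists>c \<in> ext d \<inter> ext x. compatible p r c s)))"

text \<open>Shelah's properness: for all regular \<open>l > 2\<^bsup>|p|\<^esup>\<close> with \<open>(p, r) \<in> H\<^sub>l\<close> and all countable
  \<open>x \<prec> H\<^sub>l\<close> with \<open>(p, r) \<in> x\<close>, below every condition in \<open>x\<close> there is an \<open>(x, p)\<close>-generic one.\<close>

definition is_proper :: "'a \<Rightarrow> 'a \<Rightarrow> bool" where
  "is_proper p r \<longleftrightarrow> is_preorder p r \<and>
     (\<forall>l h z pw x. is_regular_uncountable l \<and> is_Pow pw p \<and> card_less pw l \<and> is_H h l \<and>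
        opair z p r \<and> z \<in> ext h \<and> is_elementary x h \<and> is_countable x \<and> z \<in> ext x \<longrightarrow>
        (\<forall>c \<in> ext p \<inter> ext x. \<exists>q. (q, c) \<in> rel r \<and> is_generic_condition p r x q))"


subsection \<open>Proper and piecewise proper families of reals\<close>

primrec numeral_of :: "nat \<Rightarrow> 'a \<Rightarrow> bool" where
  "numeral_of 0 x \<longleftrightarrow> x \<in> M \<and> ext x = {}"
| "numeral_of (Suc n) x \<longleftrightarrow> x \<in> M \<and> (\<exists>y. numeral_of n y \<and> ext x = insert y (ext y))"

definition nat_set :: "'a \<Rightarrow> nat set" where
  "nat_set x = {n. \<exists>y\<in>ext x. numeral_of n y}"

definition is_family_of_reals :: "'a \<Rightarrow> bool" where
  "is_family_of_reals F \<longleftrightarrow> F \<in> M \<and> (\<exists>w. is_omega w \<and> (\<forall>x\<in>ext F. ext x \<subseteq> ext w))"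

text \<open>\<open>is_mod_Fin F p r\<close>: \<open>(p, r)\<close> is the set of infinite members of \<open>F\<close>, ordered by almost
  inclusion. This is a preorder, as usual for forcing notions; no quotient is taken.\<close>

definition is_mod_Fin :: "'a \<Rightarrow> 'a \<Rightarrow> 'a \<Rightarrow> bool" where
  "is_mod_Fin F p r \<longleftrightarrow> p \<in> M \<and> ext p = {x \<in> ext F. infinite (ext x)} \<and> is_rel r p p \<and>
     rel r = {(x, y). x \<in> ext p \<and> y \<in> ext p \<and> finite (ext x - ext y)}"

definition is_proper_family :: "'a \<Rightarrow> bool" where
  "is_proper_family F \<longleftrightarrow> is_family_of_reals F \<and> arith_closed (nat_set ` ext F) \<and>
     (\<exists>p r. is_mod_Fin F p r \<and> is_proper p r)"

definition is_piecewise_proper_family :: "'a \<Rightarrow> bool" where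
  "is_piecewise_proper_family F \<longleftrightarrow> is_family_of_reals F \<and>
     (\<exists>C\<in>M. (\<forall>X\<in>ext C. \<forall>Y\<in>ext C. ext X \<subseteq> ext Y \<or> ext Y \<subseteq> ext X) \<and>
        (\<forall>X\<in>ext C. is_proper_family X \<and> (\<exists>k. is_omega_n 1 k \<and> card_le X k)) \<and>
        ext F = (\<Union>X\<in>ext C. ext X))"

definition continuum_many_piecewise_proper_of_size_omega2 :: bool where
  "continuum_many_piecewise_proper_of_size_omega2 \<longleftrightarrow>
     (\<exists>S\<in>M. (\<forall>F\<in>ext S. is_piecewise_proper_family F \<and> (\<exists>k. is_omega_n 2 k \<and> card_eq F k)) \<and>
        (\<exists>w c. is_omega w \<and> is_Pow c w \<and> card_eq S c))"


subsection \<open>Generic extensions\<close>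

definition is_generic_filter :: "'a \<Rightarrow> 'a \<Rightarrow> 'a set \<Rightarrow> bool" where
  "is_generic_filter p r G \<longleftrightarrow> G \<subseteq> ext p \<and> G \<noteq> {} \<and>
     (\<forall>x\<in>G. \<forall>y\<in>ext p. (x, y) \<in> rel r \<longrightarrow> y \<in> G) \<and>
     (\<forall>x\<in>G. \<forall>y\<in>G. \<exists>z\<in>G. (z, x) \<in> rel r \<and> (z, y) \<in> rel r) \<and>
     (\<forall>d. is_dense p r d \<longrightarrow> G \<inter> ext d \<noteq> {})"

inductive is_name :: "'a \<Rightarrow> 'a \<Rightarrow> bool" for p where
  "\<lbrakk>t \<in> M; \<And>z. z \<in> ext t \<Longrightarrow> \<exists>s c. opair z s c \<and> c \<in> ext p \<and> is_name p s\<rbrakk> \<Longrightarrow> is_name p t"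

text \<open>The names of the elements of \<open>val\<^sub>G(t)\<close>.\<close>

definition active :: "'a set \<Rightarrow> 'a \<Rightarrow> 'a set" where
  "active G t = {s. \<exists>c\<in>G. (s, c) \<in> rel t}"

text \<open>\<open>same_val G s t\<close> expresses \<open>val\<^sub>G(s) = val\<^sub>G(t)\<close>, where
  \<open>val\<^sub>G(t) = {val\<^sub>G(s) | s. \<exists>c\<in>G. (s, c) \<in> t}\<close>. If \<open>E\<close> is well-founded, the recursion
  has exactly one solution, so that the choice of the greatest one is immaterial.\<close>

coinductive same_val :: "'a set \<Rightarrow> 'a \<Rightarrow> 'a \<Rightarrow> bool" for G where
  "\<lbrakk>\<forall>s'\<in>active G s. \<exists>t'\<in>active G t. same_val G s' t';
    \<forall>t'\<in>active G t. \<exists>s'\<in>active G s. same_val G s' t'\<rbrakk> \<Longrightarrow> same_val G s t"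

text \<open>As there is no ambient universe of sets, the value of a name is represented by the class
  of all names with the same value; lemma \<open>ext_val\<close> below is the usual recursion for \<open>val\<^sub>G\<close>.\<close>

definition val :: "'a \<Rightarrow> 'a set \<Rightarrow> 'a \<Rightarrow> 'a set" where
  "val p G t = {s. is_name p s \<and> same_val G s t}"

definition gen_ext :: "'a \<Rightarrow> 'a set \<Rightarrow> 'a set set" where
  "gen_ext p G = val p G ` {t. is_name p t}"

definition gen_mem :: "'a \<Rightarrow> 'a set \<Rightarrow> 'a set \<Rightarrow> 'a set \<Rightarrow> bool" where
  "gen_mem p G X Y \<longleftrightarrow>
     (\<exists>s t. is_name p s \<and> is_name p t \<and> s \<in> active G t \<and> X = val p G s \<and> Y = val p G t)"

lemma same_val_refl: "same_val G s s"
  by (rule same_val.coinduct[where X = "(=)"]) (simp, blast)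

lemma same_valD:
  assumes "same_val G s t"
  shows "s' \<in> active G s \<Longrightarrow> \<exists>t'\<in>active G t. same_val G s' t'"
    and "t' \<in> active G t \<Longrightarrow> \<exists>s'\<in>active G s. same_val G s' t'"
  using assms by (simp_all add: same_val.simps[of G s t])

lemma same_val_sym:
  assumes "same_val G s t" shows "same_val G t s"
proof (rule same_val.coinduct[where X = "\<lambda>s t. same_val G t s"])
  fix x y assume yx: "same_val G y x"
  have "\<forall>s'\<in>active G x. \<exists>t'\<in>active G y. same_val G t' s'"
    using same_valD(2)[OF yx] by simp
  moreover have "\<forall>t'\<in>active G y. \<exists>s'\<in>active G x. same_val G t' s'"
    using same_valD(1)[OF yx] by simp
  ultimately show "\<exists>s t. x = s \<and> y = t \<and>
      (\<forall>s'\<in>active G s. \<exists>t'\<in>active G t. same_val G t' s' \<or> same_val G s' t') \<and>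
      (\<forall>t'\<in>active G t. \<exists>s'\<in>active G s. same_val G t' s' \<or> same_val G s' t')"
    by metis
qed (fact assms)

lemma same_val_trans:
  assumes "same_val G s t" "same_val G t u" shows "same_val G s u"
proof (rule same_val.coinduct[where X = "\<lambda>s u. \<exists>t. same_val G s t \<and> same_val G t u"])
  show "\<exists>t. same_val G s t \<and> same_val G t u" using assms by blast
next
  fix x z assume "\<exists>t. same_val G x t \<and> same_val G t z"
  then obtain y where xy: "same_val G x y" and yz: "same_val G y z" by blast
  have "\<exists>t'\<in>active G z. \<exists>t. same_val G s' t \<and> same_val G t t'" if "s' \<in> active G x" for s'
    using same_valD(1)[OF xy that] same_valD(1)[OF yz] by metis
  moreover
  have "\<exists>s'\<in>active G x. \<exists>t. same_val G s' t \<and> same_val G t t'" if "t' \<in> active G z" for t'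
    using same_valD(2)[OF yz that] same_valD(2)[OF xy] by metis
  ultimately show "\<exists>s t. x = s \<and> z = t \<and>
      (\<forall>s'\<in>active G s. \<exists>t'\<in>active G t.
        (\<exists>t. same_val G s' t \<and> same_val G t t') \<or> same_val G s' t') \<and>
      (\<forall>t'\<in>active G t. \<exists>s'\<in>active G s.
        (\<exists>t. same_val G s' t \<and> same_val G t t') \<or> same_val G s' t')"
    by metis
qed

lemma val_eq_iff:
  assumes "is_name p s" "is_name p t"
  shows "val p G s = val p G t \<longleftrightarrow> same_val G s t"
proof
  assume "val p G s = val p G t"
  moreover have "s \<in> val p G s" using assms(1) same_val_refl unfolding val_def by simp
  ultimately show "same_val G s t" unfolding val_def by simp
next
  assume st: "same_val G s t"
  have "same_val G u s \<longleftrightarrow> same_val G u t" for u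
    using same_val_trans[OF _ st] same_val_trans[OF _ same_val_sym[OF st]] by metis
  then show "val p G s = val p G t" unfolding val_def by simp
qed

lemma opair_inject:
  assumes "opair z x y" "opair z x' y'" shows "x = x' \<and> y = y'"
proof -
  obtain s t where 1: "ext s = {x}" "ext t = {x, y}" "ext z = {s, t}"
    using assms(1) unfolding opair_def by blast
  obtain s' t' where 2: "ext s' = {x'}" "ext t' = {x', y'}" "ext z = {s', t'}"
    using assms(2) unfolding opair_def by blast
  have "s = s' \<and> t = t' \<or> s = t' \<and> t = s'"
    using 1(3) 2(3) by (metis doubleton_eq_iff)
  then show ?thesis
    using 1(1,2) 2(1,2) by (auto simp: doubleton_eq_iff)
qed

lemma is_name_active:
  assumes "is_name p t" "s \<in> active G t" shows "is_name p s"
proof -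
  obtain z c where z: "z \<in> ext t" "opair z s c"
    using assms(2) unfolding active_def rel_def by auto
  obtain s' c' where "opair z s' c'" "is_name p s'"
    using assms(1) z(1) by (cases rule: is_name.cases) metis
  then show ?thesis using opair_inject[OF z(2)] by simp
qed

lemma ext_val:
  assumes "is_name p t"
  shows "set_structure.ext (gen_ext p G) (gen_mem p G) (val p G t) = val p G ` active G t"
proof (intro equalityI subsetI)
  fix X assume "X \<in> set_structure.ext (gen_ext p G) (gen_mem p G) (val p G t)"
  then obtain s u where su: "is_name p s" "is_name p u" "s \<in> active G u"
      "X = val p G s" "val p G t = val p G u"
    unfolding set_structure.ext_def gen_mem_def by blast
  then have "same_val G u t" using assms val_eq_iff by metis
  then obtain s' where "s' \<in> active G t" "same_val G s s'"
    using su(3) same_valD(1) by blast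
  then show "X \<in> val p G ` active G t"
    using su(1,4) assms is_name_active val_eq_iff by (metis imageI)
next
  fix X assume "X \<in> val p G ` active G t"
  then show "X \<in> set_structure.ext (gen_ext p G) (gen_mem p G) (val p G t)"
    using assms is_name_active unfolding set_structure.ext_def gen_mem_def gen_ext_def by blast
qed

end

end

theory Submission
 imports Defs
begin

text \<open>Force with finite partial functions to add Cohen reals \<open>g i\<close>, where \<open>i = (\<xi>, \<gamma>, \<alpha>)\<close> with \<open>\<xi>\<close> in a set
  closed under countable subsets, \<open>\<gamma> < \<omega>\<^sub>2\<close> and \<open>\<alpha> < \<omega>\<^sub>1\<close>. By recursion on \<open>(\<gamma>, \<alpha>)\<close>, stage \<open>i\<close> produces
  countably many sets of naturals: the sets of earlier stages with a code below \<open>\<alpha>\<close>, pseudo-intersections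
  of decreasing sequences of those sets that \<open>g i\<close> guides, the graph of \<open>g i\<close>, and everything obtained
  from these by the operations that evaluate arithmetical formulas. For fixed \<open>\<xi>\<close>, the sets of the stages
  up to \<open>\<gamma>\<close> form an arithmetically closed family of size \<open>\<omega>\<^sub>1\<close>, and these families increase with \<open>\<gamma>\<close>.

  Such a family is proper. The trace \<open>\<delta>\<close> of a countable elementary submodel on \<open>\<omega>\<^sub>1\<close> is a closure point, so
  that by the countable chain condition the part below \<open>\<delta>\<close> of a dense set of the submodel does not depend
  on the Cohen real of stage \<open>(\<gamma>, \<delta>)\<close>. This real is generic over it, so its pseudo-intersections are almost
  included in an element of that part: they are generic conditions.

  Distinct \<open>\<xi>\<close> give distinct unions, since a Cohen real does not belong to the extension by the others. A
  nice name of a real is a countable set and is coded by some \<open>\<xi>\<close>, so that there are continuum many \<open>\<xi>\<close>.\<close>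

text \<open>A poset of size omega_1 has more dense sets than the construction has stages of
  countable index, and all of them are dense sets of the final extension, so they cannot be listed
  in advance and treated one by one. A Cohen real replaces the bookkeeping: whatever dense set is
  given, a finite part of the real steers a decreasing sequence into its trace below a closure
  point. Each stage may use only countably many sets, because the sequence is guided by a function
  on numbers; this is the reason for cutting the codes off at \<open>\<alpha>\<close>. The second
  obstacle is the absence of an ambient universe. A set may be used only after it has been shown to
  be an element of the ground model or of the extension, which means tracking definability at every
  step. The construction of the families is therefore done twice: as a HOL recursion, which is
  convenient to reason about, and inside the extension, where all values are subsets of omega and
  separation suffices to form the table.\<close>

notation iff (infixr "<->" 25)

section \<open>Definability over a membership structure\<close>

primrec ren :: "(nat => nat) => set_fm => set_fm" where
 "ren r (Mem_fm i j) = Mem_fm (r i) (r j)"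
| "ren r (Eq_fm i j) = Eq_fm (r i) (r j)"
| "ren r (Neg_fm f) = Neg_fm (ren r f)"
| "ren r (Conj_fm f g) = Conj_fm (ren r f) (ren r g)"
| "ren r (Forall_fm i f) = Forall_fm (r i) (ren r f)"

primrec vbound :: "set_fm => nat" where
 "vbound (Mem_fm i j) = Suc (max i j)"
| "vbound (Eq_fm i j) = Suc (max i j)"
| "vbound (Neg_fm f) = vbound f"
| "vbound (Conj_fm f g) = max (vbound f) (vbound g)"
| "vbound (Forall_fm i f) = max (Suc i) (vbound f)"

lemma set_sat_cong:
 "(!!n. n < vbound f ==> e n = e' n) ==> set_sat S E f e = set_sat S E f e'"
proof (induction f arbitrary: e e')
 case (Forall_fm i f)
 have "set_sat S E f (e(i := a)) = set_sat S E f (e'(i := a))" for a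
  by (rule Forall_fm.IH) (use Forall_fm.prems in auto)
 then show ?case by simp
next
 case (Neg_fm f)
 then show ?case by (metis set_sat.simps(3) vbound.simps(3))
next
 case (Conj_fm f g)
 have "set_sat S E f e = set_sat S E f e'" by (rule Conj_fm.IH(1)) (use Conj_fm.prems in auto)
 moreover have "set_sat S E g e = set_sat S E g e'"
  by (rule Conj_fm.IH(2)) (use Conj_fm.prems in auto)
 ultimately show ?case by simp
next
 case (Mem_fm i j)
 from Mem_fm[of i] Mem_fm[of j] show ?case by simp
next
 case (Eq_fm i j)
 from Eq_fm[of i] Eq_fm[of j] show ?case by simp
qed

text \<open>Bound variables are renamed along with the free ones, so injectivity on all indices
  below \<open>vbound f\<close> is what rules out capture.\<close>

lemma set_sat_ren:
 "inj_on r {..<vbound f} ==> set_sat S E (ren r f) e = set_sat S E f (e \<circ> r)"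
proof (induction f arbitrary: e)
 case (Conj_fm f g)
 have "inj_on r {..<vbound f}" "inj_on r {..<vbound g}"
  by (rule inj_on_subset[OF Conj_fm.prems]; auto)+
 then show ?case using Conj_fm.IH by simp
next
 case (Forall_fm i f)
 have inj: "inj_on r {..<vbound f}" by (rule inj_on_subset[OF Forall_fm.prems]) auto
 have "set_sat S E f (e(r i := a) \<circ> r) = set_sat S E f ((e \<circ> r)(i := a))" for a
 proof (rule set_sat_cong)
  fix n assume "n < vbound f"
  then show "(e(r i := a) \<circ> r) n = ((e \<circ> r)(i := a)) n"
   using Forall_fm.prems by (auto simp: inj_on_def)
 qed
 then show ?case by (simp only: ren.simps set_sat.simps Forall_fm.IH[OF inj])
qed auto

text \<open>Even positions hold the free variables, odd positions the parameters.\<close>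
definition mix :: "(nat => 'a) => (nat => 'a) => nat => 'a" where
 "mix e c n = (if even n then e (n div 2) else c (n div 2))"

lemma mix_simps [simp]: "mix e c (2 * n) = e n" "mix e c (Suc (2 * n)) = c n"
 by (simp_all add: mix_def)

lemma mix_range: "range e <= S ==> range c <= S ==> range (mix e c) <= S"
 by (auto simp: mix_def)

definition push :: "'a => (nat => 'a) => nat => 'a" where
 "push x e n = (case n of 0 => x | Suc k => e k)"

lemma push_simps [simp]: "push x e 0 = x" "push x e (Suc n) = e n"
 by (simp_all add: push_def)

lemma push_range: "x:S ==> range e <= S ==> range (push x e) <= S"
 by (auto simp: push_def image_subset_iff split: nat.splits)

text \<open>\<open>Def P\<close>: the predicate \<open>P\<close> of environments is defined over \<open>S\<close> by a formula with parameters from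
  \<open>C\<close>. The rules \<open>def_intro\<close> follow the syntax of \<open>P\<close>; \<open>e 0\<close> is the variable bound last.\<close>

named_theorems def_intro

text \<open>Two instances are intended: \<open>S = C = M\<close>, for definability with arbitrary
  parameters, and \<open>S\<close> the members of some \<open>H\<close> with \<open>C\<close> an
  elementary submodel of it. In the latter a definable predicate can be reflected into the submodel
  only because its parameters lie there.\<close>

locale dstr = set_structure M E for M :: "'a set" and E +
 fixes S C :: "'a set"
 assumes SM: "S <= M" and CS: "C <= S" and C0: "C ~= {}"
  and S_trans: "x:S ==> ext x <= S"
begin

definition Def :: "((nat => 'a) => bool) => bool" where
 "Def P <-> (EX f c. range c <= C & (ALL e. range e <= S --> (P e <-> set_sat S E f (mix e c))))"

definition DefF :: "((nat => 'a) => 'a) => bool" where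
 "DefF t <-> (ALL e. range e <= S --> t e:S) & Def (%e. e 0 = t (%n. e (Suc n)))"

lemma Def_cong:
 assumes "Def P" "!!e. range e <= S ==> Q e <-> P e" shows "Def Q"
 using assms unfolding Def_def by metis

lemma Def_Neg [def_intro]: assumes "Def P" shows "Def (%e. ~P e)"
proof -
 obtain f c where "range c <= C" "ALL e. range e <= S --> (P e <-> set_sat S E f (mix e c))"
  using assms unfolding Def_def by blast
 then show ?thesis unfolding Def_def by (intro exI[of _ "Neg_fm f"] exI[of _ c]) simp
qed

lemma Def_Conj [def_intro]: assumes "Def P" "Def Q" shows "Def (%e. P e & Q e)"
proof -
 obtain f c where f: "range c <= C" "ALL e. range e <= S --> (P e <-> set_sat S E f (mix e c))"
  using assms unfolding Def_def by blast
 obtain g d where g: "range d <= C" "ALL e. range e <= S --> (Q e <-> set_sat S E g (mix e d))"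
  using assms unfolding Def_def by blast
 \<comment> \<open>Parameter \<open>k\<close> sits at position \<open>2 * k + 1\<close>. The
   renamings turn it into parameter \<open>2 * k\<close> for \<open>f\<close> and
   \<open>2 * k + 1\<close> for \<open>g\<close>, so that \<open>mix c d\<close> supplies both
   lists. Even positions stay fixed, since the free variables are shared.\<close>
 let ?r1 = "%n::nat. if even n then n else 2 * n - 1"
 let ?r2 = "%n::nat. if even n then n else 2 * n + 1"
 have i1: "inj ?r1"
 proof (rule injI)
  fix x y assume "?r1 x = ?r1 y"
  then show "x = y" by (cases "even x"; cases "even y"; simp; presburger)
 qed
 have i2: "inj ?r2"
 proof (rule injI)
  fix x y assume "?r2 x = ?r2 y"
  then show "x = y" by (cases "even x"; cases "even y"; simp; presburger)
 qed
 have m1: "mix e (mix c d) \<circ> ?r1 = mix e c" for e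
 proof
  fix n show "(mix e (mix c d) \<circ> ?r1) n = mix e c n"
  proof (cases "even n")
   case True then show ?thesis by (simp add: mix_def)
  next
   case False
   then obtain k where "n = Suc (2 * k)" by (auto elim!: oddE)
   moreover have "2 * Suc (2 * k) - 1 = Suc (2 * (2 * k))" by simp
   ultimately show ?thesis by (simp only: o_def mix_simps if_False even_Suc dvd_triv_left not_True_eq_False)
  qed
 qed
 have m2: "mix e (mix c d) \<circ> ?r2 = mix e d" for e
 proof
  fix n show "(mix e (mix c d) \<circ> ?r2) n = mix e d n"
  proof (cases "even n")
   case True then show ?thesis by (simp add: mix_def)
  next
   case False
   then obtain k where "n = Suc (2 * k)" by (auto elim!: oddE)
   moreover have "2 * Suc (2 * k) + 1 = Suc (2 * (Suc (2 * k)))" by simp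
   ultimately show ?thesis by (simp only: o_def mix_simps if_False even_Suc dvd_triv_left not_True_eq_False)
  qed
 qed
 have "set_sat S E (ren ?r1 f) (mix e (mix c d)) = set_sat S E f (mix e c)" for e
  using set_sat_ren[OF inj_on_subset[OF i1 subset_UNIV], of S E f "mix e (mix c d)"] unfolding m1 .
 moreover have "set_sat S E (ren ?r2 g) (mix e (mix c d)) = set_sat S E g (mix e d)" for e
  using set_sat_ren[OF inj_on_subset[OF i2 subset_UNIV], of S E g "mix e (mix c d)"] unfolding m2 .
 ultimately show ?thesis unfolding Def_def using f g mix_range
  by (intro exI[of _ "Conj_fm (ren ?r1 f) (ren ?r2 g)"] exI[of _ "mix c d"]) simp
qed

lemma Def_Ball_S [def_intro]:
 assumes "Def (%e. P (e 0) (%n. e (Suc n)))" shows "Def (%e. ALL x:S. P x e)"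
proof -
 obtain f c where f: "range c <= C"
   "!!e. range e <= S ==> P (e 0) (%n. e (Suc n)) <-> set_sat S E f (mix e c)"
  using assms unfolding Def_def by blast
 \<comment> \<open>An even position out of the reach of \<open>f\<close>. It takes over the variable
   to be bound; the other free variables move down by one place, which is two positions in
   \<open>mix\<close>.\<close>
 define i where "i = 2 * vbound f"
 define r where "r n = (if n = 0 then i else if even n then n - 2 else n)" for n :: nat
 have par: "even (r n) <-> even n" for n by (auto simp: r_def i_def)
 have sm: "r n ~= i" if "n < vbound f" "n ~= 0" for n using that by (auto simp: r_def i_def)
 have inj: "inj_on r {..<vbound f}"
 proof (rule inj_onI)
  fix x y assume xy: "x:{..<vbound f}" "y:{..<vbound f}" "r x = r y"
  show "x = y"
  proof (cases "x = 0 \<or> y = 0")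
   case True
   moreover have "r 0 = i" by (simp add: r_def)
   ultimately show ?thesis using sm xy by (metis lessThan_iff)
  next
   case False
   have "even x = even y" using xy par by metis
   moreover have "r n + 2 = n" if "even n" "n ~= 0" for n
    using that by (cases n rule: nat.exhaust) (auto simp: r_def elim!: oddE)
   moreover have "odd n ==> r n = n" for n by (auto simp: r_def)
   ultimately show ?thesis using xy False by metis
  qed
 qed
 have "(ALL x:S. P x e) <-> set_sat S E (Forall_fm i (ren r f)) (mix e c)" if "range e <= S" for e
 proof -
  have "P x e <-> set_sat S E (ren r f) ((mix e c)(i := x))" if x: "x:S" for x
  proof -
   have "P x e <-> set_sat S E f (mix (push x e) c)"
    using f(2)[OF push_range[OF x \<open>range e <= S\<close>]] by simp
   also have "... <-> set_sat S E f ((mix e c)(i := x) \<circ> r)"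
   proof (rule set_sat_cong)
    fix n assume n: "n < vbound f"
    show "mix (push x e) c n = ((mix e c)(i := x) \<circ> r) n"
    proof (cases "n = 0")
     case False
     then have "r n ~= i" using n sm by blast
     moreover have "mix (push x e) c n = mix e c (r n)"
      using False by (auto simp: mix_def push_def r_def elim!: evenE oddE split: nat.splits)
     ultimately show ?thesis by simp
    qed (simp add: mix_def r_def)
   qed
   also have "... <-> set_sat S E (ren r f) ((mix e c)(i := x))"
    using set_sat_ren[OF inj] by metis
   finally show ?thesis .
  qed
  then show ?thesis by simp
 qed
 then show ?thesis unfolding Def_def using f(1) by blast
qed

lemma Def_reindex: assumes "Def P" "inj r" shows "Def (%e. P (%n. e (r n)))"
proof -
 obtain f c where f: "range c <= C"
   "!!e. range e <= S ==> P e <-> set_sat S E f (mix e c)"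
  using assms unfolding Def_def by blast
 let ?r = "%n::nat. if even n then 2 * r (n div 2) else n"
 have inj: "inj ?r"
 proof (rule injI)
  fix x y assume xy: "?r x = ?r y"
  have "even (?r n) <-> even n" for n by simp
  then have p: "even x = even y" using xy by metis
  show "x = y"
  proof (cases "even x")
   case True
   then have "r (x div 2) = r (y div 2)" using p xy by simp
   then have "x div 2 = y div 2" using assms(2) by (simp add: inj_eq)
   then show ?thesis using p True by (metis dvd_mult_div_cancel)
  qed (use p xy in simp)
 qed
 have "P (%n. e (r n)) <-> set_sat S E (ren ?r f) (mix e c)" if "range e <= S" for e
 proof -
  have "mix (%n. e (r n)) c = mix e c \<circ> ?r" by (auto simp: mix_def)
  moreover have "P (%n. e (r n)) <-> set_sat S E f (mix (%n. e (r n)) c)"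
   by (rule f(2)) (use that in auto)
  ultimately show ?thesis using set_sat_ren[OF inj_on_subset[OF inj subset_UNIV], of S E f "mix e c"] by argo
 qed
 then show ?thesis unfolding Def_def using f(1) by blast
qed

lemma Def_atomic: "Def (%e. E (e i) (e j))" "Def (%e. e i = e j)"
proof -
 obtain c where c: "c:C" using C0 by blast
 show "Def (%e. E (e i) (e j))" unfolding Def_def using c
  by (intro exI[of _ "Mem_fm (2*i) (2*j)"] exI[of _ "%_. c"]) auto
 show "Def (%e. e i = e j)" unfolding Def_def using c
  by (intro exI[of _ "Eq_fm (2*i) (2*j)"] exI[of _ "%_. c"]) auto
qed

lemma Def_eq_const: "c:C ==> Def (%e. e i = c)"
 unfolding Def_def by (intro exI[of _ "Eq_fm (2*i) 1"] exI[of _ "%_. c"]) (auto simp: mix_def)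

lemma Def_const [def_intro]: "Def (%_. b)"
proof (cases b)
 case True then show ?thesis using Def_cong[OF Def_atomic(2)[of 0 0]] by simp
next
 case False then show ?thesis using Def_cong[OF Def_Neg[OF Def_atomic(2)[of 0 0]]] by simp
qed

lemma Def_Disj [def_intro]: assumes "Def P" "Def Q" shows "Def (%e. P e \<or> Q e)"
 using Def_Neg[OF Def_Conj[OF Def_Neg[OF assms(1)] Def_Neg[OF assms(2)]]] by simp

lemma Def_Imp [def_intro]: assumes "Def P" "Def Q" shows "Def (%e. P e --> Q e)"
 using Def_Disj[OF Def_Neg[OF assms(1)] assms(2)] by (rule Def_cong) blast

lemma Def_Iff [def_intro]: assumes "Def P" "Def Q" shows "Def (%e. P e <-> Q e)"
 using Def_Conj[OF Def_Imp[OF assms] Def_Imp[OF assms(2,1)]] by (rule Def_cong) blast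

lemma Def_Bex_S [def_intro]:
 assumes "Def (%e. P (e 0) (%n. e (Suc n)))" shows "Def (%e. EX x:S. P x e)"
 using Def_Neg[OF Def_Ball_S[of "%x e. ~P x e", OF Def_Neg[OF assms]]] by simp

lemma DefF_var [def_intro]: "DefF (%e. e n)"
 unfolding DefF_def using Def_atomic(2)[of 0 "Suc n"] by auto

lemma DefF_const [def_intro]: "c:C ==> DefF (%e. c)"
 unfolding DefF_def using Def_eq_const CS by auto

lemma DefF_in: "DefF t ==> range e <= S ==> t e:S"
 unfolding DefF_def by blast

lemma DefF_shift: "DefF t ==> inj r ==> DefF (%e. t (%n. e (r n)))"
proof -
 assume t: "DefF t" and r: "inj r"
 let ?r = "%n. case n of 0 => 0 | Suc k => Suc (r k)"
 have "inj ?r"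
 proof (rule injI)
  fix x y assume "?r x = ?r y"
  then show "x = y" using inj_eq[OF r] by (cases x; cases y) simp_all
 qed
 moreover have "Def (%e. e 0 = t (%n. e (Suc n)))" using t unfolding DefF_def by blast
 ultimately have "Def (%e. e (?r 0) = t (%n. e (?r (Suc n))))"
  using Def_reindex[of "%e. e 0 = t (%n. e (Suc n))" ?r] by blast
 moreover have "t (%n. e (r n)):S" if "range e <= S" for e
  by (rule DefF_in[OF t]) (use that in auto)
 ultimately show ?thesis unfolding DefF_def by simp
qed

lemma Def_subst:
 assumes "Def (%e. P (e 0) (%n. e (Suc n)))" "DefF t" shows "Def (%e. P (t e) e)"
proof -
 have "Def (%e. EX x:S. x = t e & P x e)"
  by (rule Def_Bex_S, rule Def_Conj) (use assms in \<open>auto simp: DefF_def\<close>)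
 then show ?thesis by (rule Def_cong) (use assms(2) DefF_in in blast)
qed

lemma Def_R1: assumes "Def (%e. R (e 0))" "DefF s" shows "Def (%e. R (s e))"
 using Def_subst[of "%x e. R x", OF _ assms(2)] assms(1) by simp

lemma Def_R2:
 assumes "Def (%e. R (e 0) (e 1))" "DefF s" "DefF t" shows "Def (%e. R (s e) (t e))"
proof (rule Def_subst[of "%x e. R x (t e)", OF _ assms(2)])
 have "DefF (%e. t (%n. e (Suc n)))" by (rule DefF_shift[OF assms(3)]) simp
 moreover have "Def (%e. R (e 1) (e 0))"
  using Def_reindex[OF assms(1), of "%n. if n = 0 then 1 else if n = 1 then 0 else n"]
  by (auto simp: inj_def)
 ultimately show "Def (%e. R (e 0) (t (%n. e (Suc n))))"
  by (intro Def_subst[of "%x e. R (e 0) x"]) simp_all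
qed

lemma Def_R3:
 assumes "Def (%e. R (e 0) (e 1) (e 2))" "DefF s" "DefF t" "DefF u"
 shows "Def (%e. R (s e) (t e) (u e))"
proof (rule Def_subst[of "%x e. R x (t e) (u e)", OF _ assms(2)])
 have t: "DefF (%e. t (%n. e (Suc n)))" by (rule DefF_shift[OF assms(3)]) simp
 have u: "DefF (%e. u (%n. e (Suc (Suc n))))" by (rule DefF_shift[OF assms(4)]) (simp add: inj_def)
 let ?r = "%n::nat. if n = 0 then 2 else if n = 2 then 0 else n"
 have "Def (%e. R (e 2) (e 1) (e 0))"
  using Def_reindex[OF assms(1), of ?r] by (auto simp: inj_def)
 then have "Def (%e. R (e 1) (e 0) (u (%n. e (Suc (Suc n)))))"
  using Def_subst[of "%x e. R (e 1) (e 0) x", OF _ u] by (simp add: numeral_2_eq_2)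
 then show "Def (%e. R (e 0) (t (%n. e (Suc n))) (u (%n. e (Suc n))))"
  using Def_subst[of "%x e. R (e 0) x (u (%n. e (Suc n)))", OF _ t] by simp
qed

lemma Def_eq [def_intro]: "DefF s ==> DefF t ==> Def (%e. s e = t e)"
 by (rule Def_R2[of "(=)"]) (rule Def_atomic)

lemma Def_mem [def_intro]: assumes "DefF s" "DefF t" shows "Def (%e. s e:ext (t e))"
proof (rule Def_R2[OF _ assms])
 show "Def (%e. e 0:ext (e 1))"
  by (rule Def_cong[OF Def_atomic(1)[of 0 1]]) (use SM in \<open>auto simp: ext_def\<close>)
qed

lemma ext_S: "x:S ==> ext x <= S" by (rule S_trans)

lemma Def_Ball_ext [def_intro]:
 assumes "Def (%e. P (e 0) (%n. e (Suc n)))" "DefF t" shows "Def (%e. ALL x:ext (t e). P x e)"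
proof -
 have "DefF (%e. t (%n. e (Suc n)))" by (rule DefF_shift[OF assms(2)]) simp
 then have "Def (%e. ALL x:S. x:ext (t e) --> P x e)"
  by (intro Def_Ball_S Def_Imp Def_mem DefF_var assms(1))
 then show ?thesis by (rule Def_cong) (use ext_S DefF_in[OF assms(2)] in blast)
qed

lemma Def_Bex_ext [def_intro]:
 assumes "Def (%e. P (e 0) (%n. e (Suc n)))" "DefF t" shows "Def (%e. EX x:ext (t e). P x e)"
 using Def_Neg[OF Def_Ball_ext[of "%x e. ~P x e", OF Def_Neg[OF assms(1)] assms(2)]] by simp

lemma Def_subset [def_intro]: assumes "DefF s" "DefF t" shows "Def (%e. ext (s e) <= ext (t e))"
proof (rule Def_R2[OF _ assms])
 show "Def (%e. ext (e 0) <= ext (e 1))" unfolding subset_eq by (intro def_intro)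
qed

lemma opair_alt:
 assumes "z:M"
 shows "opair z x y <-> (EX s:ext z. EX t:ext z. ext s = {x} & ext t = {x, y} & ext z <= {s, t})"
proof
 assume "opair z x y"
 then obtain s t where "ext s = {x}" "ext t = {x, y}" "ext z = {s, t}" unfolding opair_def by blast
 then show "EX s:ext z. EX t:ext z. ext s = {x} & ext t = {x, y} & ext z <= {s, t}" by auto
next
 assume "EX s:ext z. EX t:ext z. ext s = {x} & ext t = {x, y} & ext z <= {s, t}"
 then obtain s t where st: "s:ext z" "t:ext z" "ext s = {x}" "ext t = {x, y}" "ext z <= {s, t}"
  by blast
 then have "s:M" "t:M" "ext z = {s, t}" by (auto simp: ext_def)
 then show "opair z x y" unfolding opair_def using st(3,4) assms by blast
qed

lemma Def_opair [def_intro]: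
 assumes "DefF s" "DefF t" "DefF u" shows "Def (%e. opair (s e) (t e) (u e))"
proof (rule Def_R3[OF _ assms])
 have "Def (%e. EX s:ext (e 0). EX t:ext (e 0).
   (e 1:ext s & (ALL x:ext s. x = e 1)) &
   (e 1:ext t & e 2:ext t & (ALL x:ext t. x = e 1 \<or> x = e 2)) &
   (ALL x:ext (e 0). x = s \<or> x = t))"
  by (intro def_intro)
 then show "Def (%e. opair (e 0) (e 1) (e 2))"
 proof (rule Def_cong)
  fix e :: "nat => 'a" assume "range e <= S"
  then have "e 0:M" using SM by blast
  have 1: "A = {a} <-> a:A & (ALL x:A. x = a)" for A and a :: 'a by blast
  have 2: "A = {a, b} <-> a:A & b:A & (ALL x:A. x = a \<or> x = b)" for A and a b :: 'a by blast
  have 3: "A <= {a, b} <-> (ALL x:A. x = a \<or> x = b)" for A and a b :: 'a by blast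
  show "opair (e 0) (e 1) (e 2) <-> (EX s:ext (e 0). EX t:ext (e 0).
   (e 1:ext s & (ALL x:ext s. x = e 1)) &
   (e 1:ext t & e 2:ext t & (ALL x:ext t. x = e 1 \<or> x = e 2)) &
   (ALL x:ext (e 0). x = s \<or> x = t))"
   unfolding opair_alt[OF \<open>e 0:M\<close>] 1 2 3 ..
 qed
qed

lemma Def_rel [def_intro]:
 assumes "DefF s" "DefF t" "DefF u" shows "Def (%e. (s e, t e):rel (u e))"
proof (rule Def_R3[of "%x y r. (x, y):rel r", OF _ assms])
 show "Def (%e. (e 0, e 1):rel (e 2))" unfolding rel_def mem_Collect_eq case_prod_conv
  by (intro def_intro)
qed

end

context dstr begin

lemma DefF_1:
 assumes "!!x. x:S ==> F x:S" "Def (%e. e 0 = F (e 1))" "DefF s"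
 shows "DefF (%e. F (s e))"
proof -
 have "DefF (%e. s (%n. e (Suc n)))" by (rule DefF_shift[OF assms(3)]) simp
 then have "Def (%e. e 0 = F (s (%n. e (Suc n))))"
  by (rule Def_R2[of "%x y. x = F y", OF assms(2) DefF_var])
 then show ?thesis unfolding DefF_def using assms(1) DefF_in[OF assms(3)] by blast
qed

lemma DefF_2:
 assumes "!!x y. x:S ==> y:S ==> F x y:S" "Def (%e. e 0 = F (e 1) (e 2))" "DefF s" "DefF t"
 shows "DefF (%e. F (s e) (t e))"
proof -
 have "DefF (%e. s (%n. e (Suc n)))" "DefF (%e. t (%n. e (Suc n)))"
  by (rule DefF_shift[OF assms(3)], simp) (rule DefF_shift[OF assms(4)], simp)
 then have "Def (%e. e 0 = F (s (%n. e (Suc n))) (t (%n. e (Suc n))))"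
  by (rule Def_R3[of "%x y z. x = F y z", OF assms(2) DefF_var])
 then show ?thesis unfolding DefF_def using assms(1) DefF_in[OF assms(3)] DefF_in[OF assms(4)] by blast
qed

end

text \<open>This is the fragment that will be verified in the generic extension, so every result
  here serves both the ground model and the extension. Foundation is taken as external
  well-foundedness, which permits induction along \<open>E\<close> for arbitrary HOL
  predicates.\<close>

locale zmod = set_structure M E for M :: "'a set" and E +
 assumes ext_eqI: "!!x y. x:M ==> y:M ==> ext x = ext y ==> x = y"
  and wfE: "wfp_on M E"
  and pairing: "!!x y. x:M ==> y:M ==> EX z:M. ext z = {x, y}"
  and union: "!!x. x:M ==> EX u:M. ext u = (UN y:ext x. ext y)"
  and power: "!!x. x:M ==> EX p:M. ext p = {y:M. ext y <= ext x}"
  and inf: "EX w:M. (EX z:ext w. ext z = {}) & (ALL x:ext w. EX y:ext w. ext y = insert x (ext x))"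
  and sep_ax: "!!f e x. x:M ==> range e <= M ==>
   EX y:M. ext y = {z:ext x. set_sat M E f (e(0 := z))}"
begin

lemma M_ne: "M ~= {}" using inf by blast

lemma ext_M: "y:ext x ==> y:M" by (simp add: ext_def)

sublocale dstr M E M M
 by unfold_locales (use M_ne in \<open>auto simp: ext_def\<close>)

lemma E_induct [consumes 1, case_names step]:
 assumes "x:M" "!!x. x:M ==> (!!y. y:ext x ==> P y) ==> P x"
 shows "P x"
proof -
 have "ALL x:M. (ALL y:M. E y x --> P y) --> P x" using assms(2) by (auto simp: ext_def)
 then show ?thesis using wfE assms(1) unfolding wfp_on_def by blast
qed

lemma E_irrefl: "x:M ==> x ~: ext x"
 by (induction rule: E_induct) blast

lemma E_asym: "x:M ==> y:ext x ==> x ~: ext y"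
proof (induction arbitrary: y rule: E_induct)
 case (step x)
 then show ?case by blast
qed

definition coded :: "'a set => bool" where "coded A <-> (EX x:M. ext x = A)"
definition mk :: "'a set => 'a" where "mk A = (THE x. x:M & ext x = A)"

lemma mk: assumes "coded A" shows mk_M: "mk A:M" and ext_mk: "ext (mk A) = A"
proof -
 have "EX! x. x:M & ext x = A" using assms ext_eqI unfolding coded_def by metis
 from theI'[OF this] show "mk A:M" "ext (mk A) = A" unfolding mk_def by auto
qed

lemma mk_eq: "x:M ==> ext x = A ==> mk A = x"
 using ext_eqI mk unfolding coded_def by metis

lemma coded_ext [simp]: "x:M ==> coded (ext x)" unfolding coded_def by blast

lemma coded_sub_M: "coded A ==> A <= M" unfolding coded_def ext_def by blast

lemma eq_mk_iff: assumes "coded A" "y:M" shows "y = mk A <-> (ALL x:M. x:ext y <-> x:A)"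
 using mk[OF assms(1)] ext_eqI[OF assms(2)] coded_sub_M[OF assms(1)] ext_M by blast

lemma coded_sep:
 assumes "a:M" "Def (%e. Q (e 0))" shows "coded {x:ext a. Q x}"
proof -
 obtain f c where f: "range c <= M"
   "!!e. range e <= M ==> Q (e 0) <-> set_sat M E f (mix e c)"
  using assms(2) unfolding Def_def by blast
 \<comment> \<open>The idle variable positions are filled with a parameter, because the axiom wants
   an environment with values in \<open>M\<close>.\<close>
 have "mix (%_. c 0) c = c \<circ> (%n. if even n then 0 else n div 2)" by (auto simp: mix_def)
 then have r: "range (mix (%_. c 0) c) <= M" using f(1) by auto
 have "Q z <-> set_sat M E f ((mix (%_. c 0) c)(0 := z))" if "z:ext a" for z
 proof -
  have "(mix (%_. c 0) c)(0 := z) = mix ((%_. c 0)(0 := z)) c"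
   by (rule ext) (auto simp: mix_def elim!: evenE)
  moreover have "range ((%_. c 0)(0 := z)) <= M" using f(1) ext_M[OF that] by auto
  note f(2)[OF this]
  ultimately show ?thesis by simp
 qed
 then have "{x:ext a. Q x} = {z:ext a. set_sat M E f ((mix (%_. c 0) c)(0 := z))}" by blast
 then show ?thesis using sep_ax[OF assms(1) r, of f] unfolding coded_def by metis
qed

lemma coded_pair: "x:M ==> y:M ==> coded {x, y}"
 using pairing unfolding coded_def by blast

lemma coded_Union: "x:M ==> coded (UN y:ext x. ext y)"
 using union unfolding coded_def by blast

lemma coded_Pow: "x:M ==> coded {y:M. ext y <= ext x}"
 using power unfolding coded_def by blast

lemma coded_Un: assumes "coded A" "coded B" shows "coded (A Un B)"
proof -
 obtain x y where xy: "x:M" "y:M" "ext x = A" "ext y = B" using assms unfolding coded_def by blast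
 then show ?thesis using coded_Union[OF mk_M[OF coded_pair[OF xy(1,2)]]] ext_mk[OF coded_pair[OF xy(1,2)]]
  by simp
qed

lemma coded_empty [simp]: "coded {}"
proof -
 obtain a where "a:M" using M_ne by blast
 then have "coded {x:ext a. False}" by (intro coded_sep def_intro)
 then show ?thesis by simp
qed

lemma coded_insert: "x:M ==> coded A ==> coded (insert x A)"
 using coded_Un[OF coded_pair[of x x]] by simp

lemma coded_finite: "finite A ==> A <= M ==> coded A"
 by (induction rule: finite_induct) (auto intro: coded_insert)

lemma DefF_mk:
 assumes "!!e. range e <= M ==> coded (A e)" "Def (%e. e 0:A (%n. e (Suc n)))"
 shows "DefF (%e. mk (A e))"
proof -
 have "Def (%e. e 0:A (%n. e (Suc (Suc n))))"
  using Def_reindex[OF assms(2), of "%n. case n of 0 => 0 | Suc k => Suc (Suc k)"]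
  by (simp add: inj_def split: nat.splits)
 then have "Def (%e. ALL x:M. x:ext (e 0) <-> x:A (%n. e (Suc n)))"
  by (intro def_intro)
 then have "Def (%e. e 0 = mk (A (%n. e (Suc n))))"
 proof (rule Def_cong)
  fix e :: "nat => 'a" assume e: "range e <= M"
  then have "range (%n. e (Suc n)) <= M" by auto
  then show "(e 0 = mk (A (%n. e (Suc n)))) = (ALL x:M. x:ext (e 0) <-> x:A (%n. e (Suc n)))"
   using eq_mk_iff[OF assms(1)[OF \<open>range (%n. e (Suc n)) <= M\<close>], of "e 0"] e by auto
 qed
 then show ?thesis unfolding DefF_def using mk_M[OF assms(1)] by blast
qed

section \<open>Pairs, products and functions as definable terms\<close>

definition emp where "emp = mk {}"
definition upr where "upr x y = mk {x, y}"
definition pr where "pr x y = upr (upr x x) (upr x y)"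
definition un where "un x = mk (UN y:ext x. ext y)"
definition pw where "pw x = mk {y:M. ext y <= ext x}"
definition cup where "cup x y = un (upr x y)"
definition suc where "suc x = cup x (upr x x)"
definition sepm where "sepm a Q = mk {x:ext a. Q x}"
definition times where "times a b = sepm (pw (pw (cup a b))) (%z. EX x:ext a. EX y:ext b. z = pr x y)"
text \<open>The union of all values at \<open>x\<close>: the value itself if there is exactly one,
  and the empty set if there is none. Application thus becomes a total definable term, and its
  default is the number 0.\<close>

definition ap where "ap g x = un (sepm (un (un g)) (%y. pr x y:ext g))"

lemma emp [simp]: "emp:M" "ext emp = {}"
 using mk[OF coded_empty] unfolding emp_def by auto

lemma upr [simp]: assumes "x:M" "y:M" shows "upr x y:M" "ext (upr x y) = {x, y}"
 using mk[OF coded_pair[OF assms]] unfolding upr_def by auto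

lemma un [simp]: assumes "x:M" shows "un x:M" "ext (un x) = (UN y:ext x. ext y)"
 using mk[OF coded_Union[OF assms]] unfolding un_def by auto

lemma pw [simp]: assumes "x:M" shows "pw x:M" "ext (pw x) = {y:M. ext y <= ext x}"
 using mk[OF coded_Pow[OF assms]] unfolding pw_def by auto

lemma cup [simp]: assumes "x:M" "y:M" shows "cup x y:M" "ext (cup x y) = ext x Un ext y"
 using assms unfolding cup_def by auto

lemma suc [simp]: assumes "x:M" shows "suc x:M" "ext (suc x) = insert x (ext x)"
 using assms unfolding suc_def by auto

lemma pr_M [simp]: "x:M ==> y:M ==> pr x y:M"
 unfolding pr_def by simp

lemma upr_eq_iff: "[|x:M; y:M; x':M; y':M|] ==> upr x y = upr x' y' <-> {x, y} = {x', y'}"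
 using upr ext_eqI by metis

lemma pr_inject [simp]:
 assumes "x:M" "y:M" "x':M" "y':M" shows "pr x y = pr x' y' <-> x = x' & y = y'"
 using assms unfolding pr_def by (auto simp: upr_eq_iff doubleton_eq_iff)

lemma ext_pr: "x:M ==> y:M ==> ext (pr x y) = {upr x x, upr x y}"
 unfolding pr_def by simp

lemma opair_pr: assumes "x:M" "y:M" shows "opair z x y <-> z = pr x y"
proof
 assume "opair z x y"
 then obtain s t where "z:M" "s:M" "t:M" "ext s = {x}" "ext t = {x, y}" "ext z = {s, t}"
  unfolding opair_def by blast
 moreover from this have "s = upr x x" "t = upr x y"
  using assms by (auto intro!: ext_eqI[of s] ext_eqI[of t])
 ultimately show "z = pr x y" using assms by (intro ext_eqI) (simp_all add: ext_pr)
next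
 assume "z = pr x y"
 then show "opair z x y" unfolding opair_def pr_def using assms
  by (intro conjI bexI[of _ "upr x x"] bexI[of _ "upr x y"]) auto
qed

lemma opair_M: assumes "opair z x y" shows "x:M & y:M"
proof -
 obtain t where "ext t = {x, y}" using assms unfolding opair_def by blast
 then show ?thesis using ext_M[of x t] ext_M[of y t] by auto
qed

lemma opair_iff: "opair z x y <-> x:M & y:M & z = pr x y"
 using opair_M opair_pr by metis

lemma rel_iff: "(x, y):rel r <-> x:M & y:M & pr x y:ext r"
 unfolding rel_def using opair_iff by auto

lemma pr_in_M: assumes "x:M" "y:M" "pr x y:ext r" "r:M"
 shows "x:ext (un (un r))" "y:ext (un (un r))"
proof -
 have "upr x y:ext (un r)" using assms ext_pr[OF assms(1,2)] by auto
 moreover have "x:ext (upr x y)" "y:ext (upr x y)" using assms by auto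
 ultimately show "x:ext (un (un r))" "y:ext (un (un r))"
  using un(2)[OF un(1)[OF assms(4)]] by blast+
qed

lemma DefF_emp [def_intro]: "DefF (%e. emp)" by (rule DefF_const) simp

lemma DefF_upr [def_intro]: "DefF s ==> DefF t ==> DefF (%e. upr (s e) (t e))"
proof (rule DefF_2[of upr])
 have "DefF (%e. mk {e 0, e 1})"
  by (rule DefF_mk[of "%e. {e 0, e 1}"]) (auto intro!: coded_pair def_intro simp: image_subset_iff)
 then show "Def (%e. e 0 = upr (e 1) (e 2))" unfolding upr_def DefF_def by (simp add: numeral_2_eq_2)
qed auto

lemma DefF_pr [def_intro]: "DefF s ==> DefF t ==> DefF (%e. pr (s e) (t e))"
 unfolding pr_def by (intro def_intro)

lemma DefF_un [def_intro]: "DefF s ==> DefF (%e. un (s e))"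
proof (rule DefF_1[of un])
 have "DefF (%e. mk (UN y:ext (e 0). ext y))"
 proof (rule DefF_mk[of "%e. UN y:ext (e 0). ext y"])
  show "Def (%e. e 0:(UN y:ext (e (Suc 0)). ext y))" unfolding UN_iff by (intro def_intro)
 qed (auto intro!: coded_Union simp: image_subset_iff)
 then show "Def (%e. e 0 = un (e 1))" unfolding un_def DefF_def by simp
qed auto

lemma DefF_pw [def_intro]: "DefF s ==> DefF (%e. pw (s e))"
proof (rule DefF_1[of pw])
 have "DefF (%e. mk {y:M. ext y <= ext (e 0)})"
 proof (rule DefF_mk[of "%e. {y:M. ext y <= ext (e 0)}"])
  have "Def (%e. ext (e 0) <= ext (e (Suc 0)))" by (intro def_intro)
  then show "Def (%e. e 0:{y:M. ext y <= ext (e (Suc 0))})" by (rule Def_cong) auto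
 qed (auto intro!: coded_Pow simp: image_subset_iff)
 then show "Def (%e. e 0 = pw (e 1))" unfolding pw_def DefF_def by simp
qed auto

lemma DefF_cup [def_intro]: "DefF s ==> DefF t ==> DefF (%e. cup (s e) (t e))"
 unfolding cup_def by (intro def_intro)

lemma DefF_suc [def_intro]: "DefF s ==> DefF (%e. suc (s e))"
 unfolding suc_def by (intro def_intro)

text \<open>The rules \<open>def_intro\<close> treat an environment as variable, whereas separation
  needs a predicate of one variable with fixed parameters. This is the bridge: all variables but the
  first are turned into parameters, with \<open>c\<close> interleaved behind them.\<close>

lemma Def_inst: assumes "Def (%e. Q (e 0) (%n. e (Suc n)))" "range d <= M" shows "Def (%e. Q (e 0) d)"
proof -
 obtain f c where f: "range c <= M"
   "!!e. range e <= M ==> Q (e 0) (%n. e (Suc n)) <-> set_sat M E f (mix e c)"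
  using assms(1) unfolding Def_def by blast
 let ?r = "%n::nat. if n = 0 then 0 else Suc (2 * n)"
 have "Q (e 0) d <-> set_sat M E (ren ?r f) (mix e (mix (push (d 0) d) c))" if "range e <= M" for e
 proof -
  have "mix e (mix (push (d 0) d) c) \<circ> ?r = mix (push (e 0) d) c"
  proof
   fix n show "(mix e (mix (push (d 0) d) c) \<circ> ?r) n = mix (push (e 0) d) c n"
   proof (cases "n = 0")
    case True then show ?thesis by (simp add: mix_def)
   next
    case False
    then have "(mix e (mix (push (d 0) d) c) \<circ> ?r) n = mix (push (d 0) d) c n"
     by (simp only: o_def if_False mix_simps)
    also have "... = mix (push (e 0) d) c n" using False
     by (auto simp: mix_def push_def elim!: evenE split: nat.splits)
    finally show ?thesis .
   qed
  qed
  moreover have "range (push (e 0) d) <= M" using that assms(2) by (intro push_range) auto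
  then have "Q (e 0) d <-> set_sat M E f (mix (push (e 0) d) c)" using f(2)[of "push (e 0) d"] by simp
  moreover have "inj_on ?r {..<vbound f}" by (rule inj_onI) (auto split: if_splits)
  ultimately show ?thesis using set_sat_ren[of ?r f M E "mix e (mix (push (d 0) d) c)"] by argo
 qed
 moreover have "range (mix (push (d 0) d) c) <= M"
  using assms(2) f(1) by (intro mix_range push_range) auto
 ultimately show ?thesis unfolding Def_def by blast
qed

lemma sepm: assumes "a:M" "Def (%e. Q (e 0))"
 shows sepm_M: "sepm a Q:M" and ext_sepm: "ext (sepm a Q) = {x:ext a. Q x}"
 using mk[OF coded_sep[OF assms]] unfolding sepm_def by auto

lemma DefF_sepm [def_intro]:
 assumes "Def (%e. Q (e 0) (%n. e (Suc n)))" "DefF a"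
 shows "DefF (%e. sepm (a e) (%x. Q x e))"
 unfolding sepm_def
proof (rule DefF_mk)
 fix e :: "nat => 'a" assume e: "range e <= M"
 show "coded {x:ext (a e). Q x e}"
  by (rule coded_sep[OF DefF_in[OF assms(2) e]]) (rule Def_inst[OF assms(1) e])
next
 have "DefF (%e. a (%n. e (Suc n)))" by (rule DefF_shift[OF assms(2)]) simp
 then show "Def (%e. e 0:{x:ext (a (%n. e (Suc n))). Q x (%n. e (Suc n))})"
  unfolding mem_Collect_eq using assms(1) by (intro def_intro)
qed

lemma times [simp]:
 assumes "a:M" "b:M"
 shows times_M: "times a b:M" and ext_times: "ext (times a b) = {pr x y | x y. x:ext a & y:ext b}"
proof -
 have "Def (%e. EX x:ext a. EX y:ext b. e 0 = pr x y)" using assms by (intro def_intro)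
 note * = sepm[OF _ this, of "pw (pw (cup a b))", folded times_def]
 show "times a b:M" using * assms by simp
 have "pr x y:ext (pw (pw (cup a b)))" if "x:ext a" "y:ext b" for x y
  using that ext_M assms unfolding pr_def by auto
 then show "ext (times a b) = {pr x y | x y. x:ext a & y:ext b}" using *(2) assms by auto
qed

lemma DefF_times [def_intro]: "DefF s ==> DefF t ==> DefF (%e. times (s e) (t e))"
proof (rule DefF_2[of times])
 have "DefF (%e. times (e 0) (e 1))" unfolding times_def by (intro def_intro)
 then show "Def (%e. e 0 = times (e 1) (e 2))" unfolding DefF_def by (simp add: numeral_2_eq_2)
qed auto

lemma ap_def': assumes "g:M" "x:M"
 shows "ap g x:M" "ext (ap g x) = \<Union>{ext y | y. y:M & pr x y:ext g}"
proof -
 have d: "Def (%e. pr x (e 0):ext g)" using assms by (intro def_intro)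
 note * = sepm[OF _ d, of "un (un g)"]
 show "ap g x:M" using * assms unfolding ap_def by simp
 show "ext (ap g x) = \<Union>{ext y | y. y:M & pr x y:ext g}"
 proof -
  have "{y:ext (un (un g)). pr x y:ext g} = {y. y:M & pr x y:ext g}"
   using pr_in_M[OF assms(2) _ _ assms(1)] ext_M by blast
  then show ?thesis using *(2) un(2)[OF *(1)] assms unfolding ap_def by auto
 qed
qed

lemma ap_eq: assumes "g:M" "x:M" "y:M" "pr x y:ext g" "!!y'. y':M ==> pr x y':ext g ==> y' = y"
 shows "ap g x = y"
proof (rule ext_eqI)
 have "{ext y' | y'. y':M & pr x y':ext g} = {ext y}"
  using assms(3,4) assms(5) by blast
 then show "ext (ap g x) = ext y" unfolding ap_def'(2)[OF assms(1,2)] by simp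
qed (simp_all add: assms(3) ap_def'(1)[OF assms(1,2)])

lemma ap_M [simp]: "g:M ==> x:M ==> ap g x:M" by (rule ap_def')

lemma DefF_ap [def_intro]: "DefF s ==> DefF t ==> DefF (%e. ap (s e) (t e))"
proof (rule DefF_2[of ap])
 have "DefF (%e. ap (e 0) (e 1))" unfolding ap_def by (intro def_intro)
 then show "Def (%e. e 0 = ap (e 1) (e 2))" unfolding DefF_def by (simp add: numeral_2_eq_2)
qed auto

lemma is_funD: assumes "is_fun g a b" "x:ext a"
 shows "ap g x:ext b" "pr x (ap g x):ext g" "!!y. pr x y:ext g ==> y:M ==> y = ap g x"
proof -
 have r: "g:M" "ALL z:ext g. EX x:ext a. EX y:ext b. opair z x y" "EX! y. (x, y):rel g"
  using assms unfolding is_fun_def is_rel_def by auto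
 then obtain y where y: "(x, y):rel g" "!!y'. (x, y'):rel g ==> y' = y" by blast
 have yM: "x:M" "y:M" "pr x y:ext g" using y(1) unfolding rel_iff by auto
 have e: "ap g x = y"
 proof (rule ap_eq[OF r(1) yM])
  fix y' assume "y':M" "pr x y':ext g"
  then show "y' = y" using y(2)[of y'] yM(1) unfolding rel_iff by blast
 qed
 obtain x' y' where "x':ext a" "y':ext b" "opair (pr x y) x' y'" using r(2) yM(3) by blast
 then have "x':M" "y':M" "pr x y = pr x' y'" using opair_iff by blast+
 then have "y:ext b" using pr_inject[OF yM(1,2), of x' y'] \<open>y':ext b\<close> by simp
 then show "ap g x:ext b" "pr x (ap g x):ext g" using e yM by simp_all
 show "v:M ==> v = ap g x" if "pr x v:ext g" for v
  using y(2)[of v] yM(1) e that unfolding rel_iff by blast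
qed

lemma is_fun_M: "is_fun g a b ==> g:M" unfolding is_fun_def is_rel_def by blast

lemma is_fun_mem: assumes "is_fun g a b" "z:ext g" shows "EX x:ext a. z = pr x (ap g x)"
proof -
 obtain x y where "x:ext a" "y:ext b" "opair z x y"
  using assms unfolding is_fun_def is_rel_def by blast
 then show ?thesis using is_funD(3)[OF assms(1), of x y] assms(2) by (auto simp: opair_iff)
qed

definition lam where "lam a b t = sepm (times a b) (%z. EX x:ext a. z = pr x (t x))"

lemma lam:
 assumes "a:M" "b:M" "!!x. x:ext a ==> t x:ext b" "DefF (%e. t (e 0))"
 shows lam_M: "lam a b t:M" and ext_lam: "ext (lam a b t) = {pr x (t x) | x. x:ext a}"
  and lam_fun: "is_fun (lam a b t) a b" and ap_lam: "x:ext a ==> ap (lam a b t) x = t x"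
proof -
 have "DefF (%e. t (e 0))" by (rule assms)
 from DefF_shift[OF this, of "%n. n"] have "Def (%e. EX x:ext a. e 0 = pr x (t x))"
  using assms by (intro def_intro) auto
 note * = sepm[OF _ this, of "times a b", folded lam_def]
 show M: "lam a b t:M" using * assms by simp
 show ext: "ext (lam a b t) = {pr x (t x) | x. x:ext a}"
  using *(2)[OF times_M[OF assms(1,2)]] assms(3) unfolding ext_times[OF assms(1,2)] by blast
 have r: "(x, y):rel (lam a b t) <-> x:ext a & y = t x" for x y
 proof
  assume "(x, y):rel (lam a b t)"
  then obtain x' where x': "x:M" "y:M" "x':ext a" "pr x y = pr x' (t x')"
   unfolding rel_iff ext by blast
  have "x':M" "t x':M" using ext_M[OF x'(3)] ext_M[OF assms(3)[OF x'(3)]] by auto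
  then show "x:ext a & y = t x" using x' by simp
 next
  assume *: "x:ext a & y = t x"
  then have "x:M" "y:M" using ext_M assms(3) by blast+
  then show "(x, y):rel (lam a b t)" unfolding rel_iff ext using * by blast
 qed
 show f: "is_fun (lam a b t) a b" unfolding is_fun_def is_rel_def r
 proof (intro conjI ballI M)
  fix z assume "z:ext (lam a b t)"
  then obtain x where x: "x:ext a" "z = pr x (t x)" unfolding ext by blast
  then have "opair z x (t x)" using ext_M[of x a] ext_M[OF assms(3)[OF x(1)]] by (simp add: opair_iff)
  then show "EX x:ext a. EX y:ext b. opair z x y" using x assms(3) by blast
 next
  fix x assume "x:ext a" then show "EX! y. x:ext a & y = t x" by blast
 qed
 show "ap (lam a b t) x = t x" if "x:ext a"
 proof -
  have "pr x (t x):ext (lam a b t)" unfolding ext using that by blast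
  then show ?thesis using is_funD(3)[OF f that] ext_M[OF assms(3)[OF that]] by simp
 qed
qed

end

section \<open>Natural numbers and reals of the structure\<close>

context zmod begin

lemma emp_iff: "x:M ==> x = emp <-> ext x = {}"
 using ext_eqI[of x emp] by auto

primrec num :: "nat => 'a" where
 "num 0 = emp"
| "num (Suc n) = suc (num n)"

lemma num_M [simp, def_intro]: "num n:M" by (induction n) auto

lemma ext_num: "ext (num n) = num ` {..<n}"
 by (induction n) (auto simp: lessThan_Suc)

lemma num_mem_num: "num m:ext (num n) <-> m < n"
proof (induction n)
 case (Suc n)
 have "num m = num n ==> m = n"
 proof (rule ccontr)
  assume e: "num m = num n" "m ~= n"
  have "num i ~= num j" if "i < j" for i j
   using E_irrefl[OF num_M[of j]] that unfolding ext_num by (metis imageI lessThan_iff)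
  then show False using e by (metis linorder_neqE_nat)
 qed
 then show ?case using Suc by (auto simp: less_Suc_eq)
qed simp

lemma num_eq [simp]: "num m = num n <-> m = n"
 using num_mem_num E_irrefl num_M by (metis linorder_neqE_nat)

lemma numeral_of_iff: "numeral_of n x <-> x = num n"
proof (induction n arbitrary: x)
 case 0 then show ?case using emp_iff by (auto simp del: emp(2) simp: emp(2))
next
 case (Suc n)
 have "x:M & ext x = insert (num n) (ext (num n)) <-> x = suc (num n)"
  using ext_eqI[of x "suc (num n)"] by auto
 then show ?case using Suc by auto
qed

text \<open>The intersection of all inductive sets contains every \<open>num n\<close>. A further
  element that is minimal along \<open>E\<close> could be removed without destroying inductiveness,
  which contradicts membership in the intersection. Well-foundedness thus makes the omega of the
  structure standard.\<close>

lemma coded_range_num: "coded (range num)"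
proof -
 obtain w where w: "w:M" "EX z:ext w. ext z = {}" "ALL x:ext w. EX y:ext w. ext y = insert x (ext x)"
  using inf by blast
 define ind where "ind I <-> emp:ext I & (ALL x:ext I. suc x:ext I)" for I
 have "emp:ext w" using w(2) emp_iff ext_M by metis
 moreover have "suc x:ext w" if x: "x:ext w" for x
 proof -
  obtain y where "y:ext w" "ext y = insert x (ext x)" using w(3) x by blast
  then show ?thesis using ext_eqI[of y "suc x"] ext_M x by (metis suc)
 qed
 ultimately have indw: "ind w" unfolding ind_def by blast
 have dI: "Def (%e. ind (e i))" for i unfolding ind_def by (intro def_intro)
 define Om where "Om = {x:ext w. ALL I:ext (pw w). ind I --> x:ext I}"
 have cO: "coded Om" unfolding Om_def by (rule coded_sep[OF w(1)]) (intro def_intro dI w(1))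
 have numI: "num n:ext I" if "ind I" for n I
  by (induction n) (use that in \<open>auto simp: ind_def\<close>)
 then have sub: "range num <= Om" using indw unfolding Om_def by blast
 have "x:Om --> x:range num" if "x:M" for x using that
 proof (induction rule: E_induct)
  case (step x)
  show ?case
  proof (rule impI, rule ccontr)
   assume x: "x:Om" "x ~: range num"
   have c: "coded {y:ext (mk Om). y ~= x}"
    by (rule coded_sep[OF mk_M[OF cO]]) (intro def_intro step)
   define I where "I = mk {y:ext (mk Om). y ~= x}"
   have I: "I:M" "ext I = {y:Om. y ~= x}"
    using mk[OF c] ext_mk[OF cO] unfolding I_def by auto
   have sO: "suc y:Om" if "y:Om" for y
    using that \<open>!!x. x:ext w ==> suc x:ext w\<close> unfolding Om_def ind_def by blast
   have "ind I" unfolding ind_def I(2)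
   proof (intro conjI ballI CollectI)
    show "emp:Om" using sub num.simps(1) by (metis rangeI subsetD)
    show "emp ~= x" using x(2) num.simps(1) by (metis rangeI)
   next
    fix y assume y: "y:{y:Om. y ~= x}"
    then show "suc y:Om" using sO by blast
    show "suc y ~= x"
    proof
     assume "suc y = x"
     moreover have "y:M" using y ext_M unfolding Om_def by blast
     ultimately have "y:ext x" by auto
     then obtain n where "y = num n" using step y by blast
     then show False using \<open>suc y = x\<close> x(2) num.simps(2) by (metis rangeI)
    qed
   qed
   moreover have "I:ext (pw w)" using I w(1) unfolding Om_def by auto
   ultimately have "x:ext I" using x(1) unfolding Om_def by blast
   then show False using I(2) by blast
  qed
 qed
 then have "Om = range num" using sub unfolding Om_def using ext_M by blast
 then show ?thesis using cO by simp
qed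

definition om where "om = mk (range num)"

lemma om_M [simp, def_intro]: "om:M" and ext_om: "ext om = range num"
 using mk[OF coded_range_num] unfolding om_def by auto

lemma emp_M [def_intro]: "emp:M" by simp

definition dn :: "'a => nat" where "dn x = (if x:ext om then (THE n. x = num n) else 0)"
definition ns :: "'a => nat set" where "ns x = {n. num n:ext x}"
definition real :: "nat set => 'a" where "real A = mk (num ` A)"
text \<open>The reals of the structure, read as true sets of naturals.\<close>

definition RR :: "nat set set" where "RR = {A. coded (num ` A)}"

lemma dn_num [simp]: "dn (num n) = n" unfolding dn_def ext_om by auto

lemma num_dn: "x:ext om ==> num (dn x) = x" unfolding ext_om by auto

lemma dn_out: "x ~: ext om ==> dn x = 0" unfolding dn_def by simp

lemma nat_set_ns: "nat_set x = ns x" unfolding nat_set_def ns_def numeral_of_iff by auto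

lemma RR_D: assumes "A:RR" shows real_M [simp]: "real A:M" and ext_real: "ext (real A) = num ` A"
  and ns_real [simp]: "ns (real A) = A"
 using assms mk[of "num ` A"] unfolding real_def RR_def ns_def by auto

abbreviation DefN :: "((nat => 'a) => nat) => bool" where "DefN t \<equiv> DefF (%e. num (t e))"

lemma Def_nat_all [def_intro]:
 assumes "Def (%e. P (dn (e 0)) (%n. e (Suc n)))" shows "Def (%e. ALL n. P n e)"
proof -
 have "Def (%e. ALL x:ext om. P (dn x) e)" by (intro def_intro assms)
 then show ?thesis by (rule Def_cong) (auto simp: ext_om)
qed

lemma Def_nat_ex [def_intro]:
 assumes "Def (%e. P (dn (e 0)) (%n. e (Suc n)))" shows "Def (%e. EX n. P n e)"
proof -
 have "Def (%e. EX x:ext om. P (dn x) e)" by (intro def_intro assms)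
 then show ?thesis by (rule Def_cong) (auto simp: ext_om)
qed

lemma DefN_dn [def_intro]: assumes "DefF s" shows "DefN (%e. dn (s e))"
proof (rule DefF_1[OF _ _ assms])
 have "Def (%e. (e 1:ext om & e 0 = e 1) \<or> (e 1 ~: ext om & e 0 = emp))" by (intro def_intro)
 then show "Def (%e. e 0 = num (dn (e 1)))"
 proof (rule Def_cong)
  fix e :: "nat => 'a"
  show "e 0 = num (dn (e 1)) <-> (e 1:ext om & e 0 = e 1) \<or> (e 1 ~: ext om & e 0 = emp)"
   by (cases "e 1:ext om") (simp_all only: num_dn dn_out num.simps simp_thms)
 qed
qed simp

lemma DefN_Suc [def_intro]: "DefN s ==> DefN (%e. Suc (s e))"
 unfolding num.simps by (intro def_intro)

lemma Def_nat_eq [def_intro]: assumes "DefN s" "DefN t" shows "Def (%e. s e = t e)"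
 using Def_eq[OF assms] by simp

lemma Def_nat_less [def_intro]: assumes "DefN s" "DefN t" shows "Def (%e. s e < t e)"
 using Def_mem[OF assms] by (simp add: num_mem_num)

lemma Def_nat_le [def_intro]: assumes "DefN s" "DefN t" shows "Def (%e. s e <= t e)"
 unfolding less_Suc_eq_le[symmetric] by (intro def_intro assms)

lemma Def_ns [def_intro]: assumes "DefN s" "DefF t" shows "Def (%e. s e:ns (t e))"
 unfolding ns_def mem_Collect_eq by (intro def_intro assms)

lemma DefF_real [def_intro]:
 assumes "Def (%e. P (dn (e 0)) (%n. e (Suc n)))" shows "DefF (%e. real {n. P n e})"
proof -
 have "DefF (%e. sepm om (%x. P (dn x) e))" by (intro def_intro assms)
 moreover have "real {n. P n e} = sepm om (%x. P (dn x) e)" for e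
 proof -
  have "num ` {n. P n e} = {x:ext om. P (dn x) e}" unfolding ext_om by auto
  then show ?thesis unfolding real_def sepm_def by simp
 qed
 ultimately show ?thesis by simp
qed

lemma RR_Def: assumes "Def (%e. P (dn (e 0)))" shows "{n. P n}:RR"
proof -
 have "coded {x:ext om. P (dn x)}" by (intro coded_sep assms om_M)
 moreover have "{x:ext om. P (dn x)} = num ` {n. P n}" unfolding ext_om by auto
 ultimately show ?thesis unfolding RR_def by simp
qed

text \<open>A primitive recursion is defined by the existence of a finite computation. Finite sets
  of pairs are elements of the structure, so the internal and the external values agree.\<close>

lemma DefN_iter:
 assumes F: "!!x. F x 0 = b x" "!!x y. F x (Suc y) = h x y (F x y)"
  and D: "!!s. DefF s ==> DefN (%e. b (s e))"
   "!!s t u. DefF s ==> DefN t ==> DefN u ==> DefN (%e. h (s e) (t e) (u e))"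
  and st: "DefF s" "DefN t"
 shows "DefN (%e. F (s e) (t e))"
proof -
 \<comment> \<open>\<open>f\<close> is only asked to be closed under the recursion step below
   \<open>y\<close>, which forces the true value at \<open>y\<close> into it; uniqueness is demanded
   at \<open>y\<close> alone and identifies that value with \<open>z\<close>.\<close>
 define Q where "Q x y z f <-> pr emp (num (b x)):ext f &
   (ALL k u. k < y --> pr (num k) (num u):ext f --> pr (num (Suc k)) (num (h x k u)):ext f) &
   (ALL u. pr (num y) (num u):ext f --> u = z)" for y z :: nat and x f
 have q: "(EX f:M. Q x y z f) <-> z = F x y" for x y z
 proof
  assume "EX f:M. Q x y z f"
  then obtain f where f: "Q x y z f" by blast
  have "pr (num k) (num (F x k)):ext f" if "k <= y" for k
   using that by (induction k) (use f in \<open>auto simp: F Q_def\<close>)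
  then show "z = F x y" using f unfolding Q_def by blast
 next
  assume z: "z = F x y"
  have c: "coded ((%k. pr (num k) (num (F x k))) ` {..y})" by (rule coded_finite) auto
  have "Q x y z (mk ((%k. pr (num k) (num (F x k))) ` {..y}))"
  proof -
   have *: "pr (num k) (num u):(%k. pr (num k) (num (F x k))) ` {..y} <-> k <= y & u = F x k" for k u
    by (auto simp: image_iff simp del: num.simps)
   show ?thesis unfolding Q_def ext_mk[OF c] num.simps(1)[symmetric] * using z F by simp
  qed
  then show "EX f:M. Q x y z f" using mk_M[OF c] by blast
 qed
 have "DefF (%e. num (F (s e) (dn (num (t e)))))"
 proof (rule DefF_2[of "%x y. num (F x (dn y))", OF _ _ st])
  have "Def (%e. e 0:ext om & (EX f:M. Q (e 1) (dn (e 2)) (dn (e 0)) f))" unfolding Q_def by (intro def_intro D)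
  then show "Def (%e. e 0 = num (F (e 1) (dn (e 2))))" unfolding q by (rule Def_cong) (auto simp: ext_om)
 qed simp
 then show ?thesis by simp
qed

lemma DefN_plus [def_intro]: assumes "DefN s" "DefN t" shows "DefN (%e. s e + t e)"
proof -
 have "DefN (%e. dn (num (s e)) + t e)"
  by (rule DefN_iter[of "%x k. dn x + k" dn "%_ _ u. Suc u"]) (auto intro!: def_intro assms)
 then show ?thesis by simp
qed

lemma DefN_times [def_intro]: assumes "DefN s" "DefN t" shows "DefN (%e. s e * t e)"
proof -
 have "DefN (%e. dn (num (s e)) * t e)"
  by (rule DefN_iter[of "%x k. dn x * k" "%_. 0" "%x _ u. u + dn x"]) (auto intro!: def_intro DefF_const assms)
 then show ?thesis by simp
qed

subsection \<open>Ordinals\<close>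

lemma Def_is_ordinal [def_intro]: assumes "DefF s" shows "Def (%e. is_ordinal (s e))"
proof (rule Def_R1[OF _ assms])
 have "Def (%e. (ALL y:ext (e 0). ext y <= ext (e 0)) & (ALL x:ext (e 0). ALL y:ext x. ext y <= ext x))"
  by (intro def_intro)
 then show "Def (%e. is_ordinal (e 0))" unfolding is_ordinal_def is_transitive_def
  by (rule Def_cong) (use ext_M in blast)
qed

lemma ordM: "is_ordinal x ==> x:M" unfolding is_ordinal_def is_transitive_def by blast

lemma ord_trans: "is_ordinal x ==> y:ext x ==> z:ext y ==> z:ext x"
 unfolding is_ordinal_def is_transitive_def by blast

lemma ord_elem: "is_ordinal x ==> y:ext x ==> is_ordinal y"
 unfolding is_ordinal_def is_transitive_def by blast

lemma ord_linear: assumes "is_ordinal x" "is_ordinal y" shows "x:ext y \<or> x = y \<or> y:ext x"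
proof -
 have "is_ordinal x --> (ALL y:M. is_ordinal y --> x:ext y \<or> x = y \<or> y:ext x)" if "x:M" for x
  using that
 proof (induction rule: E_induct)
  case (step x)
  show ?case
  proof
   assume x: "is_ordinal x"
   have "is_ordinal y --> x:ext y \<or> x = y \<or> y:ext x" if "y:M" for y
    using that
   proof (induction rule: E_induct)
    case (step y)
    note IHx = \<open>!!y. y:ext x ==> _ y\<close>
    show ?case
    proof (intro impI)
     assume y: "is_ordinal y"
     show "x:ext y \<or> x = y \<or> y:ext x"
     proof (rule ccontr)
      assume n: "~(x:ext y \<or> x = y \<or> y:ext x)"
      have "ext x <= ext y"
      proof
       fix z assume z: "z:ext x"
       then have "z:ext y \<or> z = y \<or> y:ext z" using IHx[OF z] ord_elem[OF x z] y ordM by blast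
       then show "z:ext y" using n z ord_trans[OF x] by blast
      qed
      moreover have "ext y <= ext x"
      proof
       fix z assume z: "z:ext y"
       then have "x:ext z \<or> x = z \<or> z:ext x" using step.IH ord_elem[OF y z] by blast
       then show "z:ext x" using n z ord_trans[OF y] by blast
      qed
      ultimately have "x = y" using ext_eqI[OF ordM[OF x] ordM[OF y]] by blast
      then show False using n by blast
     qed
    qed
   qed
   then show "ALL y:M. is_ordinal y --> x:ext y \<or> x = y \<or> y:ext x" by blast
  qed
 qed
 then show ?thesis using assms ordM by blast
qed

lemma is_ordinalI:
 assumes "x:M" "!!y. y:ext x ==> is_ordinal y" "!!y. y:ext x ==> ext y <= ext x"
 shows "is_ordinal x"
 using assms unfolding is_ordinal_def is_transitive_def by blast

lemma ord_suc: assumes "is_ordinal x" shows "is_ordinal (suc x)"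
proof (rule is_ordinalI)
 have e: "ext (suc x) = insert x (ext x)" using ordM[OF assms] by simp
 show "suc x:M" using ordM[OF assms] by simp
 fix y assume "y:ext (suc x)"
 then have y: "y = x \<or> y:ext x" unfolding e by blast
 then show "is_ordinal y" using assms ord_elem[OF assms] by blast
 show "ext y <= ext (suc x)" unfolding e using y ord_trans[OF assms] by blast
qed

lemma ord_num: "is_ordinal (num n)"
proof (induction n)
 case 0 show ?case by (rule is_ordinalI) auto
qed (simp add: ord_suc)

lemma ord_om: "is_ordinal om"
proof (rule is_ordinalI)
 show "!!y. y:ext om ==> is_ordinal y" unfolding ext_om using ord_num by blast
 show "!!y. y:ext om ==> ext y <= ext om" unfolding ext_om using ext_num by blast
qed simp

lemma ord_least: assumes "is_ordinal x" "x':ext x" "P x'"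
 shows "EX y:ext x. P y & (ALL z:ext y. ~P z)"
proof -
 have "x':ext x --> P x' --> ?thesis" if "x':M" for x' using that
 proof (induction rule: E_induct)
  case (step y) then show ?case using ord_trans[OF assms(1)] by blast
 qed
 then show ?thesis using assms ext_M by blast
qed

lemma is_omega_iff: "is_omega w <-> w = om"
proof
 have suc_iff: "ext z = insert y (ext y) <-> z = suc y" if "y:M" "z:M" for y z
  using that ext_eqI[of z "suc y"] by auto
 have nl: "~is_limit (num n)" for n
 proof (cases n)
  case 0 then show ?thesis unfolding is_limit_def by simp
 next
  case (Suc k)
  show ?thesis
  proof
   assume "is_limit (num n)"
   moreover have "num k:ext (num n)" using Suc by simp
   ultimately obtain z where z: "z:ext (num n)" "ext z = insert (num k) (ext (num k))"
    unfolding is_limit_def by blast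
   then have "z = num n" using suc_iff[of "num k" z] ext_M[OF z(1)] Suc by simp
   then show False using z(1) E_irrefl num_M by blast
  qed
 qed
 have lim: "is_limit om" unfolding is_limit_def
 proof (intro conjI ord_om ballI)
  show "ext om ~= {}" unfolding ext_om by blast
  fix y assume "y:ext om"
  then obtain n where "y = num n" unfolding ext_om by blast
  then show "EX z:ext om. ext z = insert y (ext y)"
   unfolding ext_om using suc(2)[OF num_M[of n]] num.simps(2)[of n] by (metis rangeI)
 qed
 show "w = om ==> is_omega w" unfolding is_omega_def using lim nl ext_om by auto
 assume w: "is_omega w"
 then have wl: "is_ordinal w" "ext w ~= {}" "!!y. y:ext w ==> EX z:ext w. ext z = insert y (ext y)"
  "!!y. y:ext w ==> ~is_limit y" unfolding is_omega_def is_limit_def by blast+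
 have s: "suc y:ext w" if "y:ext w" for y using wl(3)[OF that] suc_iff ext_M that by metis
 have "num n:ext w" for n
 proof (induction n)
  case 0
  obtain v where v: "v:ext w" using wl(2) by blast
  then obtain y where y: "y:ext w" "ALL z:ext y. z ~: ext w"
   using ord_least[OF wl(1) v, of "%y. y:ext w"] by blast
  then have "ext y = {}" using ord_trans[OF wl(1)] by blast
  then have "y = emp" using emp_iff[OF ext_M[OF y(1)]] by blast
  then show ?case using y by simp
 qed (use s in simp)
 moreover have "x:ext w --> x:range num" if "x:M" for x using that
 proof (induction rule: E_induct)
  case (step x)
  show ?case
  proof
   assume x: "x:ext w"
   have o: "is_ordinal x" using ord_elem[OF wl(1) x] .
   show "x:range num"
   proof (cases "ext x = {}")
    case True then show ?thesis using emp_iff step num.simps(1) by (metis rangeI)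
   next
    case False
    then obtain y where y: "y:ext x" "ALL z:ext x. ext z ~= insert y (ext y)"
     using wl(4)[OF x] o unfolding is_limit_def by blast
    have yM: "y:M" and yo: "is_ordinal y" using y ext_M ord_elem[OF o] by auto
    have "suc y ~: ext x" using y(2) yM by auto
    moreover have "x ~: ext (suc y)" using y(1) E_asym[OF _ y(1)] E_irrefl step yM by auto
    ultimately have "x = suc y" using ord_linear[OF o ord_suc[OF yo]] by blast
    moreover obtain n where "y = num n" using step.IH[OF y(1)] ord_trans[OF wl(1) x y(1)] by blast
    ultimately show ?thesis using num.simps(2) by (metis rangeI)
   qed
  qed
 qed
 ultimately have "ext w = ext om" unfolding ext_om using ext_M by blast
 then show "w = om" using ext_eqI ordM[OF wl(1)] om_M by blast
qed

end

context zmod begin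

lemma Def_lift: assumes "DefF (%e. t (e 0))" "DefF s" shows "DefF (%e. t (s e))"
proof (rule DefF_1[OF _ _ assms(2)])
 obtain m where m: "m:M" using M_ne by blast
 show "t x:M" if "x:M" for x
  using DefF_in[OF assms(1), of "%_. x"] that by auto
 show "Def (%e. e 0 = t (e 1))" using assms(1) unfolding DefF_def by simp
qed

subsection \<open>Cardinality\<close>

lemma card_leI:
 assumes "a:M" "b:M" "!!x. x:ext a ==> t x:ext b" "DefF (%e. t (e 0))" "inj_on t (ext a)"
 shows "card_le a b"
proof -
 have l: "lam a b t:M" "ext (lam a b t) = {pr x (t x) | x. x:ext a}" "is_fun (lam a b t) a b"
  by (intro lam_M ext_lam lam_fun assms; assumption)+
 have "is_inj (lam a b t) a b" unfolding is_inj_def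
 proof (intro conjI allI impI l(3))
  fix x x' y assume "(x, y):rel (lam a b t) & (x', y):rel (lam a b t)"
  then have p: "pr x y:ext (lam a b t)" "pr x' y:ext (lam a b t)" and
   m: "x:M" "x':M" "y:M" unfolding rel_iff by auto
  have "x:ext a & y = t x" if h: "pr x y:ext (lam a b t)" "x:M" "y:M" for x y
  proof -
   obtain u where u: "u:ext a" "pr x y = pr u (t u)" using h(1) unfolding l(2) by blast
   then show ?thesis using h(2,3) ext_M[OF u(1)] ext_M[OF assms(3)[OF u(1)]] by simp
  qed
  then have "x:ext a" "x':ext a" "t x = t x'" using p m by metis+
  then show "x = x'" using assms(5) unfolding inj_on_def by blast
 qed
 then show ?thesis unfolding card_le_def by blast
qed

lemma card_leE:
 assumes "card_le a b"
 obtains g where "g:M" "is_fun g a b" "inj_on (ap g) (ext a)" "!!x. x:ext a ==> ap g x:ext b"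
proof -
 obtain g where g: "is_inj g a b" using assms unfolding card_le_def by blast
 then have f: "is_fun g a b" unfolding is_inj_def by blast
 have "inj_on (ap g) (ext a)"
 proof (rule inj_onI)
  fix x y assume xy: "x:ext a" "y:ext a" "ap g x = ap g y"
  then have "(x, ap g x):rel g" "(y, ap g x):rel g"
   using is_funD(1,2)[OF f xy(1)] is_funD(2)[OF f xy(2)] ext_M unfolding rel_iff by auto
  then show "x = y" using g unfolding is_inj_def by blast
 qed
 then show ?thesis using that is_fun_M[OF f] f is_funD(1)[OF f] by blast
qed

lemma card_eqI:
 assumes "a:M" "b:M" "DefF (%e. t (e 0))" "bij_betw t (ext a) (ext b)"
 shows "card_eq a b"
proof -
 have im: "t ` ext a = ext b" "inj_on t (ext a)" using assms(4) unfolding bij_betw_def by auto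
 then have tb: "!!x. x:ext a ==> t x:ext b" by blast
 have l: "lam a b t:M" "ext (lam a b t) = {pr x (t x) | x. x:ext a}" "is_fun (lam a b t) a b"
  by (intro lam_M ext_lam lam_fun assms tb; assumption)+
 have r: "(x, y):rel (lam a b t) <-> x:ext a & y = t x" for x y
 proof
  assume "(x, y):rel (lam a b t)"
  then obtain u where u: "x:M" "y:M" "u:ext a" "pr x y = pr u (t u)"
   unfolding rel_iff l(2) by blast
  then show "x:ext a & y = t x" using ext_M[OF u(3)] ext_M[OF tb[OF u(3)]] by simp
 next
  assume *: "x:ext a & y = t x"
  then have "x:M" "y:M" using ext_M tb by blast+
  then show "(x, y):rel (lam a b t)" unfolding rel_iff l(2) using * by blast
 qed
 have "is_bij (lam a b t) a b" unfolding is_bij_def is_inj_def r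
  using l(3) im unfolding inj_on_def by blast
 then show ?thesis unfolding card_eq_def by blast
qed

lemma card_eqE:
 assumes "card_eq a b"
 obtains g where "g:M" "is_fun g a b" "bij_betw (ap g) (ext a) (ext b)"
proof -
 obtain g where g: "is_bij g a b" using assms unfolding card_eq_def by blast
 then have f: "is_fun g a b" unfolding is_bij_def is_inj_def by blast
 have "inj_on (ap g) (ext a)"
 proof (rule inj_onI)
  fix x y assume xy: "x:ext a" "y:ext a" "ap g x = ap g y"
  then have "(x, ap g x):rel g" "(y, ap g x):rel g"
   using is_funD(1,2)[OF f xy(1)] is_funD(2)[OF f xy(2)] ext_M unfolding rel_iff by auto
  then show "x = y" using g unfolding is_bij_def is_inj_def by blast
 qed
 moreover have "ext b <= ap g ` ext a"
 proof
  fix y assume "y:ext b"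
  then obtain x where x: "(x, y):rel g" using g unfolding is_bij_def by blast
  then have "pr x y:ext g" "x:M" "y:M" unfolding rel_iff by auto
  moreover obtain x' where "x':ext a" "pr x y = pr x' (ap g x')"
   using is_fun_mem[OF f] \<open>pr x y:ext g\<close> by blast
  moreover from this have "x':M" "ap g x':M" using ext_M is_funD(1)[OF f] by blast+
  ultimately show "y:ap g ` ext a" by auto
 qed
 ultimately have "bij_betw (ap g) (ext a) (ext b)"
  using is_funD(1)[OF f] unfolding bij_betw_def by blast
 then show ?thesis using that is_fun_M[OF f] f by blast
qed

lemma card_le_sub: "a:M ==> b:M ==> ext a <= ext b ==> card_le a b"
 by (rule card_leI[of a b "%x. x"]) (auto intro: def_intro)

lemma card_le_trans: assumes "card_le a b" "card_le b c" "a:M" "c:M" shows "card_le a c"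
proof -
 obtain f where f: "f:M" "inj_on (ap f) (ext a)" "!!x. x:ext a ==> ap f x:ext b"
  using card_leE[OF assms(1)] by blast
 obtain g where g: "g:M" "inj_on (ap g) (ext b)" "!!x. x:ext b ==> ap g x:ext c"
  using card_leE[OF assms(2)] by blast
 show ?thesis
 proof (rule card_leI[OF assms(3,4), of "%x. ap g (ap f x)"])
  show "DefF (%e. ap g (ap f (e 0)))" by (intro def_intro f g)
  show "inj_on (%x. ap g (ap f x)) (ext a)"
   using f g unfolding inj_on_def by blast
 qed (use f g in blast)
qed

lemma card_eq_le: assumes "card_eq a b" "a:M" "b:M" shows "card_le a b"
proof -
 obtain g where "g:M" "bij_betw (ap g) (ext a) (ext b)" using card_eqE[OF assms(1)] by blast
 then show ?thesis using assms by (intro card_leI[of a b "ap g"]) (auto simp: bij_betw_def intro: def_intro)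
qed

text \<open>A definite description becomes a definable term as the union of a singleton.\<close>

lemma un_the: assumes "b:M" "z:ext b" "Def (%e. Q (e 0))" "Q z" "!!y. y:ext b ==> Q y ==> y = z"
 shows "un (sepm b Q) = z"
proof (rule ext_eqI)
 have "ext (sepm b Q) = {z}" unfolding ext_sepm[OF assms(1,3)] using assms(2,4,5) by blast
 then show "ext (un (sepm b Q)) = ext z" using sepm_M[OF assms(1,3)] by simp
qed (use sepm_M[OF assms(1,3)] ext_M[OF assms(2)] in simp_all)

lemma card_eq_sym: assumes "card_eq a b" "a:M" "b:M" shows "card_eq b a"
proof -
 obtain g where g: "g:M" "bij_betw (ap g) (ext a) (ext b)" using card_eqE[OF assms(1)] by blast
 let ?t = "%y. un (sepm a (%x. ap g x = y))"
 have t: "?t (ap g x) = x" if "x:ext a" for x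
 proof (rule un_the[OF assms(2) that])
  show "Def (%e. ap g (e 0) = ap g x)" using that ext_M[OF that] by (intro def_intro g ap_M)
  fix y assume "y:ext a" "ap g y = ap g x"
  then show "y = x" using g(2) that unfolding bij_betw_def inj_on_def by blast
 qed simp
 show ?thesis
 proof (rule card_eqI[OF assms(3,2)])
  show "DefF (%e. ?t (e 0))" by (intro def_intro assms g)
  show "bij_betw ?t (ext b) (ext a)"
  proof -
   have "ap g ` ext a = ext b" using g(2) unfolding bij_betw_def by blast
   have "ap g (?t y) = y & ?t y:ext a" if yb: "y:ext b" for y
   proof -
    obtain x where "x:ext a" "y = ap g x" using yb \<open>ap g ` ext a = ext b\<close> by blast
    then show ?thesis using t[of x] by simp
   qed
   then show ?thesis using t \<open>ap g ` ext a = ext b\<close>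
    by (intro bij_betw_byWitness[where f' = "ap g"] ballI subsetI) blast+
  qed
 qed
qed

theorem cantor_bernstein:
 assumes "card_le a b" "card_le b a" "a:M" "b:M" shows "card_eq a b"
proof -
 obtain f where f: "f:M" "inj_on (ap f) (ext a)" "!!x. x:ext a ==> ap f x:ext b"
  using card_leE[OF assms(1)] by blast
 obtain g where g: "g:M" "inj_on (ap g) (ext b)" "!!x. x:ext b ==> ap g x:ext a"
  using card_leE[OF assms(2)] by blast
 \<comment> \<open>The union \<open>S\<close> of all \<open>good\<close> sets is a greatest fixed
   point: a point belongs to it iff each of its preimages under \<open>g\<close> is an
   \<open>f\<close>-image of a point of \<open>S\<close>. Taking \<open>f\<close> on
   \<open>S\<close> and the inverse of \<open>g\<close> elsewhere gives the bijection, with no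
   iteration along omega.\<close>
 define good where "good Y <-> (ALL y:ext Y. ALL z:ext b. y = ap g z --> (EX w:ext Y. ap f w = z))" for Y
 define S where "S = sepm a (%x. EX Y:ext (pw a). x:ext Y & good Y)"
 have dS: "Def (%e. EX Y:ext (pw a). e 0:ext Y & good Y)"
  unfolding good_def by (intro def_intro assms f g)
 have S: "S:M" "!!x. x:ext S <-> x:ext a & (EX Y:ext (pw a). x:ext Y & good Y)"
  using sepm[OF assms(3) dS] unfolding S_def by auto
 have Sg: "EX w:ext S. ap f w = z" if hz: "ap g z:ext S" "z:ext b" for z
 proof -
  obtain Y where Y: "Y:ext (pw a)" "ap g z:ext Y" "good Y" using hz(1) S(2) by blast
  then obtain w where "w:ext Y" "ap f w = z" using hz(2) unfolding good_def by blast
  moreover have "w:ext a" using Y(1) calculation(1) assms(3) by auto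
  ultimately show ?thesis using S(2) Y by blast
 qed
 have Sc: "x:ext S" if "x:ext a" "ALL z:ext b. x = ap g z --> (EX w:ext S. ap f w = z)" for x
 proof -
  define Y where "Y = cup S (upr x x)"
  have xM: "x:M" using ext_M that by blast
  have Y: "Y:M" "ext Y = insert x (ext S)" unfolding Y_def using S(1) xM by auto
  have "good Y" unfolding good_def Y(2) using that(2) Sg by blast
  moreover have "Y:ext (pw a)" using Y S(2) that(1) assms(3) by auto
  ultimately show ?thesis using S(2) that(1) Y(2) by blast
 qed
 define P where "P x z <-> (x:ext S & z = ap f x) \<or> (x ~: ext S & ap g z = x)" for x z
 define h where "h x = un (sepm b (P x))" for x
 have dP: "Def (%e. P x (e 0))" if "x:M" for x unfolding P_def by (intro def_intro S f g that)
 have h1: "h x = ap f x" if "x:ext S" for x unfolding h_def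
 proof (rule un_the[OF assms(4)])
  show "ap f x:ext b" using f(3) S(2) that by blast
  show "Def (%e. P x (e 0))" using dP ext_M that by blast
 qed (use that in \<open>auto simp: P_def\<close>)
 have h2: "h (ap g z) = z" if "z:ext b" "ap g z ~: ext S" for z unfolding h_def
 proof (rule un_the[OF assms(4) that(1)])
  show "Def (%e. P (ap g z) (e 0))" using dP g(1) ext_M[OF that(1)] ap_M by blast
  fix y assume "y:ext b" "P (ap g z) y"
  then show "y = z" using that g(2) unfolding P_def inj_on_def by blast
 qed (use that in \<open>auto simp: P_def\<close>)
 have h3: "EX z:ext b. x = ap g z" if "x:ext a" "x ~: ext S" for x using Sc that by blast
 have "inj_on h (ext a)"
 proof (rule inj_onI)
  fix x y assume xy: "x:ext a" "y:ext a" "h x = h y"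
  have mixed: False if h: "x:ext S" "y:ext a" "y ~: ext S" "h x = h y" for x y
  proof -
   obtain z where z: "z:ext b" "y = ap g z" using h3[OF h(2,3)] by blast
   have "ap f x = z" using h1[OF h(1)] h2[OF z(1)] z(2) h(3,4) by simp
   then have "y:ext S" using Sc[OF h(2)] h(1) z g(2) unfolding inj_on_def by blast
   then show False using h by blast
  qed
  show "x = y"
  proof (cases "x:ext S <-> y:ext S")
   case True
   show ?thesis
   proof (cases "x:ext S")
    case True
    then have "ap f x = ap f y" using h1 xy \<open>x:ext S <-> y:ext S\<close> by metis
    then show ?thesis using f(2) xy unfolding inj_on_def by blast
   next
    case False
    then obtain z w where "z:ext b" "x = ap g z" "w:ext b" "y = ap g w"
     using h3 xy \<open>x:ext S <-> y:ext S\<close> by metis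
    then show ?thesis using h2 False xy \<open>x:ext S <-> y:ext S\<close> by metis
   qed
  qed (use mixed xy in metis)
 qed
 moreover have "h ` ext a = ext b"
 proof
  show "h ` ext a <= ext b"
  proof
   fix y assume "y:h ` ext a"
   then obtain x where x: "x:ext a" "y = h x" by blast
   show "y:ext b"
   proof (cases "x:ext S")
    case True then show ?thesis using h1 f(3) x by simp
   next
    case False then show ?thesis using h2 h3 x by metis
   qed
  qed
  show "ext b <= h ` ext a"
  proof
   fix z assume z: "z:ext b"
   show "z:h ` ext a"
   proof (cases "ap g z:ext S")
    case True
    then obtain w where "w:ext S" "ap f w = z" using Sg z by blast
    then show ?thesis using h1 S(2) by (metis imageI)
   next
    case False then show ?thesis using h2 g(3) z by (metis imageI)
   qed
  qed
 qed
 moreover have "DefF (%e. h (e 0))" unfolding h_def P_def by (intro def_intro S f g assms)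
 ultimately show ?thesis using card_eqI[OF assms(3,4), of h] unfolding bij_betw_def by blast
qed

text \<open>A surjection is split by selecting the preimage whose image under an embedding into an
  ordinal is least. This stands in for choice inside the extension, where the domains come with such
  embeddings.\<close>

lemma surj_back:
 assumes "card_le a w" "is_ordinal w" "a:M" "b:M" "DefF (%e. t (e 0))" "ext b <= t ` ext a"
 shows "card_le b a"
proof -
 obtain G where G: "G:M" "inj_on (ap G) (ext a)" "!!x. x:ext a ==> ap G x:ext w"
  using card_leE[OF assms(1)] by blast
 let ?Q = "%x z. t z = x & (ALL y:ext a. t y = x --> ap G y ~: ext (ap G z))"
 have dQ: "Def (%e. ?Q x (e 0))" if "x:M" for x by (intro def_intro that Def_lift[OF assms(5)] assms G)
 let ?l = "%x. un (sepm a (?Q x))"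
 have l: "?l x:ext a & t (?l x) = x" if x: "x:ext b" for x
 proof -
  obtain y where y: "y:ext a" "t y = x" using assms(6) x by blast
  obtain i where i: "EX z:ext a. t z = x & ap G z = i" "ALL j:ext i. ~(EX z:ext a. t z = x & ap G z = j)"
   using ord_least[OF assms(2) G(3)[OF y(1)], of "%i. EX z:ext a. t z = x & ap G z = i"] y by blast
  then obtain z where z: "z:ext a" "?Q x z" by blast
  have "?l x = z"
  proof (rule un_the[OF assms(3) z(1) dQ[OF ext_M[OF x]] z(2)])
   fix v assume v: "v:ext a" "?Q x v"
   then have "ap G v = ap G z" using ord_linear ord_elem[OF assms(2) G(3)] z by blast
   then show "v = z" using G(2) v z unfolding inj_on_def by blast
  qed
  then show ?thesis using z by simp
 qed
 show ?thesis
 proof (rule card_leI[OF assms(4,3), of ?l])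
  show "DefF (%e. ?l (e 0))" by (intro def_intro assms G Def_lift[OF assms(5)])
  show "inj_on ?l (ext b)" by (rule inj_on_inverseI[of _ t]) (use l in blast)
 qed (use l in blast)
qed

subsection \<open>Recursion\<close>

text \<open>The values come from well-founded recursion in HOL; the work lies in showing that
  initial segments of the graph are elements of the structure. The hypothesis \<open>coll\<close>
  isolates the step that collects values into a set: replacement in the ground model, separation
  from a bounding set in the extension.\<close>

lemma recursion:
 assumes A: "A:M" and wf: "wfp_on (ext A) lt"
  and tr: "transp lt"
  and ltD: "Def (%e. lt (e 0) (e 1))" and OpD: "DefF (%e. Op (e 0) (e 1))"
  and coll: "!!I F. I:M ==> ext I <= ext A ==> (!!j. j:ext I ==> F j:M) ==>
   (!!j. j:ext I ==> EX f:M. F j = Op j f) ==> Def (%e. e 0:ext I & e 1 = F (e 0)) ==>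
   coded {pr j (F j) | j. j:ext I}"
 obtains F where "!!i. i:ext A ==> F i = Op i (mk {pr j (F j) | j. j:ext A & lt j i})"
  "!!i. i:ext A ==> F i:M" "coded {pr j (F j) | j. j:ext A}"
  "!!i. i:ext A ==> coded {pr j (F j) | j. j:ext A & lt j i}"
proof -
 note tr = transpD[OF tr]
 define R where "R = {(j, i). j:ext A & i:ext A & lt j i}"
 have wfR: "wf R" unfolding wf_def
 proof (intro allI impI)
  fix P x assume h: "ALL x. (ALL y. (y, x):R --> P y) --> P x"
  show "P x"
  proof (cases "x:ext A")
   case True
   show ?thesis
   proof (rule wfp_on_induct[OF wf True])
    fix y assume "!!z. z:ext A ==> lt z y ==> P z"
    then have "ALL z. (z, y):R --> P z" unfolding R_def by blast
    then show "P y" using h by blast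
   qed
  next
   case False then show ?thesis using h unfolding R_def by blast
  qed
 qed
 have OpM: "Op i f:M" if "i:M" "f:M" for i f
  using DefF_in[OF OpD, of "%n. if n = 0 then i else f"] that by auto
 define F where "F = wfrec R (%f i. Op i (mk {pr j (f j) | j. (j, i):R}))"
 define tab where "tab i = {pr j (F j) | j. j:ext A & lt j i}" for i
 have Feq: "F i = Op i (mk (tab i))" if "i:ext A" for i
 proof -
  have "{pr j (cut F R i j) | j. (j, i):R} = tab i"
   unfolding tab_def R_def cut_def using that by (auto; blast)
  then show ?thesis using wfrec[OF wfR, of "%f i. Op i (mk {pr j (f j) | j. (j, i):R})" i]
   unfolding F_def[symmetric] by simp
 qed
 \<comment> \<open>Restriction to predecessors and the predicate of being a correct graph below
   \<open>j\<close> are definable. They give the internal definition of \<open>F\<close> that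
   \<open>coll\<close> asks for, since \<open>F\<close> itself is only an external function.\<close>
 define res where "res t k = sepm t (%z. EX k':ext A. lt k' k & (EX v:M. z = pr k' v))" for t k
 define appr where "appr j t <-> (ALL k:ext A. lt k j --> (ALL v:M. pr k v:ext t <-> v = Op k (res t k)))"
  for j t
 have ltD2: "DefF s ==> DefF t ==> Def (%e. lt (s e) (t e))" for s t by (rule Def_R2[OF ltD])
 have resD: "DefF s ==> DefF t ==> DefF (%e. res (s e) (t e))" for s t
 proof (rule DefF_2[of res])
  have d: "DefF (%e. res (e 0) (e 1))" unfolding res_def by (intro def_intro ltD2 A)
  then show "Def (%e. e 0 = res (e 1) (e 2))" unfolding DefF_def by (simp add: numeral_2_eq_2)
  show "res x y:M" if "x:M" "y:M" for x y
   using DefF_in[OF d, of "%n. if n = 0 then x else y"] that by auto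
 qed
 have OpD2: "DefF s ==> DefF t ==> DefF (%e. Op (s e) (t e))" for s t
 proof (rule DefF_2[of Op])
  show "Def (%e. e 0 = Op (e 1) (e 2))" using OpD unfolding DefF_def by (simp add: numeral_2_eq_2)
 qed (use OpM in blast)
 have apprD: "Def (%e. appr (e i) (e j))" for i j
  unfolding appr_def by (intro def_intro ltD2 OpD2 resD A)
 have ext_res: "ext (res t k) = {pr k' v | k' v. k':ext A & lt k' k & v:M & pr k' v:ext t}"
  if "t:M" "k:M" for t k
 proof -
  have d: "Def (%e. EX k':ext A. lt k' k & (EX v:M. e 0 = pr k' v))" by (intro def_intro ltD2 A that)
  show ?thesis unfolding res_def ext_sepm[OF that(1) d] by auto
 qed
 have appr_val: "res t j = mk (tab j)"
  if c: "!!k. k:ext A ==> lt k j \<or> k = j ==> coded (tab k)" and t: "t:M" and ap: "appr j t" and j: "j:ext A"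
  for j t
 proof -
  have "k:ext A & (lt k j \<or> k = j) --> res t k = mk (tab k)" for k
  proof (induction k rule: wf_induct[OF wfR])
   case (1 k)
   show ?case
   proof
    assume k: "k:ext A & (lt k j \<or> k = j)"
    have v: "pr k' v:ext t <-> v = F k'" if "k':ext A" "lt k' k" "v:M" for k' v
    proof -
     have "lt k' j" using k that tr by blast
     then have "pr k' v:ext t <-> v = Op k' (res t k')" using ap that unfolding appr_def by blast
     moreover have "res t k' = mk (tab k')" using 1 k that \<open>lt k' j\<close> unfolding R_def by blast
     ultimately show ?thesis using Feq[OF that(1)] by simp
    qed
    have FM: "F k':M" if "k':ext A" "lt k' k" for k'
    proof -
     have "coded (tab k')" using c k that tr by blast
     then show ?thesis using Feq[OF that(1)] OpM ext_M[OF that(1)] mk_M by metis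
    qed
    have "ext (res t k) = tab k" unfolding ext_res[OF t ext_M[OF conjunct1[OF k]]] tab_def
     using v FM by blast
    moreover have "res t k:M"
     using DefF_in[OF resD[OF DefF_var[of 0] DefF_var[of 1]], of "%n. if n = 0 then t else k"]
      t ext_M k by auto
    ultimately show "res t k = mk (tab k)" using mk_eq by metis
   qed
  qed
  then show ?thesis using j by blast
 qed
 have appr_ex: "appr j (mk (tab j))" if c: "!!k. k:ext A ==> lt k j \<or> k = j ==> coded (tab k)" "j:ext A" for j
  unfolding appr_def
 proof (intro ballI impI)
  fix k v assume k: "k:ext A" "lt k j" and v: "v:M"
  have cj: "coded (tab j)" using c by blast
  have FM: "F k':M" if "k':ext A" "lt k' j" for k'
  proof -
   have "coded (tab k')" using c that by blast
   then show ?thesis using Feq[OF that(1)] OpM ext_M[OF that(1)] mk_M by metis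
  qed
  have pt: "pr k' v:ext (mk (tab j)) <-> v = F k'" if "k':ext A" "lt k' j" "v:M" for k' v
  proof
   assume "pr k' v:ext (mk (tab j))"
   then have "pr k' v:tab j" unfolding ext_mk[OF cj] .
   then obtain i where i: "i:ext A" "lt i j" "pr k' v = pr i (F i)" unfolding tab_def by blast
   then have "k' = i & v = F i" using that FM ext_M pr_inject by metis
   then show "v = F k'" by blast
  next
   assume "v = F k'"
   then have "pr k' v:tab j" unfolding tab_def using that by blast
   then show "pr k' v:ext (mk (tab j))" unfolding ext_mk[OF cj] .
  qed
  have "ext (res (mk (tab j)) k) = tab k" unfolding ext_res[OF mk_M[OF cj] ext_M[OF k(1)]]
  proof (intro equalityI subsetI)
   fix z assume "z:{pr k' v |k' v. k':ext A & lt k' k & v:M & pr k' v:ext (mk (tab j))}"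
   then obtain k' v where "k':ext A" "lt k' k" "v:M" "pr k' v:ext (mk (tab j))" "z = pr k' v"
    by blast
   then show "z:tab k" using pt tr k(2) unfolding tab_def by blast
  next
   fix z assume "z:tab k"
   then obtain i where i: "i:ext A" "lt i k" "z = pr i (F i)" unfolding tab_def by blast
   then have "lt i j" using tr k(2) by blast
   then show "z:{pr k' v |k' v. k':ext A & lt k' k & v:M & pr k' v:ext (mk (tab j))}"
    using pt FM i by blast
  qed
  moreover have "res (mk (tab j)) k:M"
   using DefF_in[OF resD[OF DefF_var[of 0] DefF_var[of 1]], of "%n. if n = 0 then mk (tab j) else k"]
    mk_M[OF cj] ext_M k by auto
  ultimately have "res (mk (tab j)) k = mk (tab k)" using mk_eq by metis
  then show "pr k v:ext (mk (tab j)) <-> v = Op k (res (mk (tab j)) k)"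
   using pt[OF k v] Feq[OF k(1)] by simp
 qed
 have cod: "coded {pr j (F j) | j. j:ext I}"
  if I: "I:M" "ext I <= ext A"
   and c: "!!j k. j:ext I ==> k:ext A ==> lt k j \<or> k = j ==> coded (tab k)" for I
 proof (rule coll[OF I])
  fix j assume j: "j:ext I"
  then have "coded (tab j)" using c I by blast
  then show "F j:M" "EX f:M. F j = Op j f" using Feq[of j] OpM[of j] ext_M[OF j] mk_M I(2) j by auto
 next
  have "Def (%e. e 0:ext I & (EX t:M. appr (e 0) t & e 1 = Op (e 0) (res t (e 0))))"
   by (intro def_intro OpD2 resD I(1) Def_R2[OF apprD[of 0 1]])
  then show "Def (%e. e 0:ext I & e 1 = F (e 0))"
  proof (rule Def_cong)
   fix e :: "nat => 'a"
   have "(EX t:M. appr j t & v = Op j (res t j)) <-> v = F j" if j: "j:ext I" for j v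
   proof -
    have jA: "j:ext A" using I j by blast
    note cc = c[OF j]
    have "coded (tab j)" using cc[OF jA] by blast
    then show ?thesis using appr_val[OF cc _ _ jA] appr_ex[OF cc jA] Feq[OF jA] mk_M by metis
   qed
   then show "(e 0:ext I & e 1 = F (e 0)) = (e 0:ext I & (EX t:M. appr (e 0) t & e 1 = Op (e 0) (res t (e 0))))"
    by blast
  qed
 qed
 have codtab: "i:ext A --> coded (tab i)" for i
 proof (induction i rule: wf_induct[OF wfR])
  case (1 i)
  show ?case
  proof
   assume i: "i:ext A"
   have dI: "Def (%e. lt (e 0) i)" by (intro ltD2 def_intro ext_M[OF i])
   have "coded {pr j (F j) | j. j:ext (sepm A (%j. lt j i))}"
   proof (rule cod)
    show "sepm A (%j. lt j i):M" "ext (sepm A (%j. lt j i)) <= ext A" using sepm[OF A dI] by auto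
    fix j k assume "j:ext (sepm A (%j. lt j i))" "k:ext A" "lt k j \<or> k = j"
    then have "(k, i):R" using tr i unfolding ext_sepm[OF A dI] R_def by blast
    then show "coded (tab k)" using 1 \<open>k:ext A\<close> by blast
   qed
   then show "coded (tab i)" unfolding ext_sepm[OF A dI] tab_def by (simp add: conj_commute)
  qed
 qed
 show ?thesis
 proof (rule that[of F])
  show "!!i. i:ext A ==> F i = Op i (mk {pr j (F j) | j. j:ext A & lt j i})"
   using Feq unfolding tab_def by blast
  show "!!i. i:ext A ==> coded {pr j (F j) | j. j:ext A & lt j i}"
   using codtab unfolding tab_def by blast
  show "coded {pr j (F j) | j. j:ext A}" using cod[OF A] codtab by blast
  show "!!i. i:ext A ==> F i:M" using Feq codtab OpM ext_M mk_M by metis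
 qed
qed

text \<open>If all values lie in one set \<open>B\<close>, the graph is separated from a product
  with \<open>B\<close>. This is the form of recursion available in the extension.\<close>

lemma bounded_recursion:
 assumes A: "A:M" "B:M" and wf: "wfp_on (ext A) lt"
  and tr: "transp lt"
  and ltD: "Def (%e. lt (e 0) (e 1))" and OpD: "DefF (%e. Op (e 0) (e 1))"
  and OpB: "!!i f. i:ext A ==> f:M ==> Op i f:ext B"
 obtains F where "!!i. i:ext A ==> F i = Op i (mk {pr j (F j) | j. j:ext A & lt j i})"
  "!!i. i:ext A ==> F i:M" "coded {pr j (F j) | j. j:ext A}"
  "!!i. i:ext A ==> coded {pr j (F j) | j. j:ext A & lt j i}"
proof (rule recursion[OF A(1) wf tr ltD OpD])
 fix I F assume I: "I:M" "ext I <= ext A" "!!j. j:ext I ==> F j:M"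
  "!!j. j:ext I ==> EX f:M. F j = Op j f" "Def (%e. e 0:ext I & e 1 = F (e 0))"
 have "Def (%e. EX j:M. EX v:M. e 0 = pr j v & (j:ext I & v = F j))"
  by (intro def_intro Def_R2[of "%j v. j:ext I & v = F j", OF I(5)])
 then have "coded {z:ext (times I B). EX j:M. EX v:M. z = pr j v & (j:ext I & v = F j)}"
  using I(1) A(2) by (intro coded_sep) auto
 moreover have "F j:ext B" if "j:ext I" for j using I(2,4) OpB that by (metis subsetD)
 then have "{z:ext (times I B). EX j:M. EX v:M. z = pr j v & (j:ext I & v = F j)} = {pr j (F j) | j. j:ext I}"
  unfolding ext_times[OF I(1) A(2)] using I(3) ext_M by blast
 ultimately show "coded {pr j (F j) | j. j:ext I}" by simp
qed (use that in blast)+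

end

section \<open>Replacement, choice and recursion along membership\<close>

locale zfc = zmod +
 assumes repl_ax: "!!f e x. x:M ==> range e <= M ==>
   ALL u:ext x. EX! v. v:M & set_sat M E f (e(0 := u, 1 := v)) ==>
   EX y:M. ext y = {v:M. EX u:ext x. set_sat M E f (e(0 := u, 1 := v))}"
  and choice_ax: "!!x. x:M ==> ALL y:ext x. ext y ~= {} ==>
   ALL y:ext x. ALL z:ext x. y ~= z --> ext y Int ext z = {} ==>
   EX c:M. ALL y:ext x. EX! v. v:ext y Int ext c"
begin

lemma repl:
 assumes "a:M" "!!x. x:ext a ==> F x:M" "Def (%e. e 0:ext a & e 1 = F (e 0))"
 shows "coded (F ` ext a)"
proof -
 obtain f c where f: "range c <= M"
   "!!e. range e <= M ==> (e 0:ext a & e 1 = F (e 0)) <-> set_sat M E f (mix e c)"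
  using assms(3) unfolding Def_def by blast
 \<comment> \<open>In \<open>mix\<close> the second free variable sits at position 2, but the axiom
   reads the value at position 1, which holds a parameter. The swap reconciles the two.\<close>
 define sw where "sw n = (if n = 1 then 2 else if n = 2 then 1 else n)" for n :: nat
 have sw: "inj sw" "sw 0 = 0" "sw 1 = 2" "sw 2 = 1" "!!n. sw (sw n) = n"
  by (auto simp: sw_def inj_def)
 define m where "m = mix (%_. c 0) c"
 have mr: "range (m \<circ> sw) <= M" using f(1) mix_range[of "%_. c 0" M c] unfolding m_def by auto
 have eq: "set_sat M E (ren sw f) ((m \<circ> sw)(0 := u, 1 := v)) <-> u:ext a & v = F u"
  if uv: "u:M" "v:M" for u v
 proof -
  have "((m \<circ> sw)(0 := u, 1 := v)) \<circ> sw = mix ((%_. c 0)(0 := u, 1 := v)) c"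
  proof
   fix n
   have "sw n = 0 <-> n = 0" "sw n = 1 <-> n = 2" by (auto simp: sw_def)
   then show "(((m \<circ> sw)(0 := u, 1 := v)) \<circ> sw) n = mix ((%_. c 0)(0 := u, 1 := v)) c n"
    by (auto simp: mix_def m_def sw(5))
  qed
  moreover have "range ((%_. c 0)(0 := u, 1 := v)) <= M" using f(1) uv by auto
  note f(2)[OF this]
  ultimately show ?thesis
   using set_sat_ren[OF inj_on_subset[OF sw(1) subset_UNIV], of M E f "(m \<circ> sw)(0 := u, 1 := v)"] by simp
 qed
 have "ALL u:ext a. EX! v. v:M & set_sat M E (ren sw f) ((m \<circ> sw)(0 := u, 1 := v))"
 proof
  fix u assume u: "u:ext a"
  show "EX! v. v:M & set_sat M E (ren sw f) ((m \<circ> sw)(0 := u, 1 := v))"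
   using eq[OF ext_M[OF u]] assms(2)[OF u] u by blast
 qed
 from repl_ax[OF assms(1) mr this] obtain y where y: "y:M"
  "ext y = {v:M. EX u:ext a. set_sat M E (ren sw f) ((m \<circ> sw)(0 := u, 1 := v))}" by blast
 have "ext y = F ` ext a" unfolding y(2)
 proof (intro equalityI subsetI)
  fix v assume "v:{v:M. EX u:ext a. set_sat M E (ren sw f) ((m \<circ> sw)(0 := u, 1 := v))}"
  then show "v:F ` ext a" using eq ext_M by blast
 next
  fix v assume "v:F ` ext a"
  then show "v:{v:M. EX u:ext a. set_sat M E (ren sw f) ((m \<circ> sw)(0 := u, 1 := v))}"
   using eq ext_M assms(2) by blast
 qed
 then show ?thesis using y(1) unfolding coded_def by blast
qed

lemma repl_graph:
 assumes "a:M" "!!x. x:ext a ==> F x:M" "Def (%e. e 0:ext a & e 1 = F (e 0))"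
 shows "coded {pr x (F x) | x. x:ext a}"
proof -
 have c: "coded (F ` ext a)" by (rule repl) (use assms in blast)+
 define b where "b = mk (F ` ext a)"
 have b: "b:M" "ext b = F ` ext a" using mk[OF c] unfolding b_def by auto
 have "Def (%e. EX j:M. EX v:M. e 0 = pr j v & (j:ext a & v = F j))"
  by (intro def_intro Def_R2[of "%j v. j:ext a & v = F j", OF assms(3)])
 then have "coded {z:ext (times a b). EX j:M. EX v:M. z = pr j v & (j:ext a & v = F j)}"
  using assms(1) b by (intro coded_sep) auto
 moreover have "{z:ext (times a b). EX j:M. EX v:M. z = pr j v & (j:ext a & v = F j)} = {pr j (F j) | j. j:ext a}"
  unfolding ext_times[OF assms(1) b(1)] b(2) using assms(2) ext_M by blast
 ultimately show ?thesis by simp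
qed

lemma repl_DefF: assumes "a:M" "DefF (%e. F (e 0))" shows "coded (F ` ext a)"
proof (rule repl[OF assms(1)])
 show "F x:M" if "x:ext a" for x using DefF_in[OF assms(2), of "%_. x"] ext_M[OF that] by auto
 show "Def (%e. e 0:ext a & e 1 = F (e 0))" by (intro def_intro assms Def_lift[OF assms(2)])
qed

lemma DefF_img:
 assumes F: "DefF (%e. F (e 0) (%n. e (Suc n)))" and a: "DefF a"
 shows "DefF (%e. mk {F x e | x. x:ext (a e)})"
proof (rule DefF_mk[of "%e. {F x e | x. x:ext (a e)}"])
 fix e :: "nat => 'a" assume e: "range e <= M"
 have "Def (%d. EX v:M. EX x:M. d 0 = pr x v & v = F x (%n. d (Suc n)))"
  using DefF_shift[OF F, of "%n. case n of 0 => 0 | Suc k => Suc (Suc (Suc k))"]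
  by (intro def_intro) (simp add: inj_def split: nat.splits)
 from Def_inst[OF this e] have g: "Def (%d. EX v:M. EX x:M. d 0 = pr x v & v = F x e)" .
 have FM: "F x e:M" if x: "x:M" for x
  using DefF_in[OF F, of "push x e"] push_range[OF x e] by simp
 have "coded ((%x. F x e) ` ext (a e))"
 proof (rule repl[OF DefF_in[OF a e]])
  show "F x e:M" if "x:ext (a e)" for x using FM ext_M[OF that] by blast
  have "Def (%d. d 0:ext (a e) & (EX v:M. EX x:M. pr (d 0) (d 1) = pr x v & v = F x e))"
   by (intro def_intro DefF_in[OF a e] Def_R1[of "%z. EX v:M. EX x:M. z = pr x v & v = F x e", OF g])
  then show "Def (%d. d 0:ext (a e) & d 1 = F (d 0) e)"
  proof (rule Def_cong)
   fix d :: "nat => 'a" assume "range d <= M"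
   then have m: "d 0:M" "d 1:M" by auto
   show "(d 0:ext (a e) & d 1 = F (d 0) e) <->
    (d 0:ext (a e) & (EX v:M. EX x:M. pr (d 0) (d 1) = pr x v & v = F x e))"
    using m by (metis pr_inject)
  qed
 qed
 moreover have "(%x. F x e) ` ext (a e) = {F x e | x. x:ext (a e)}" by blast
 ultimately show "coded {F x e | x. x:ext (a e)}" by simp
next
 have a': "DefF (%e. a (%n. e (Suc n)))" by (rule DefF_shift[OF a]) simp
 have "Def (%e. EX x:ext (a (%n. e (Suc n))). e 0 = F x (%n. e (Suc n)))"
  using DefF_shift[OF F, of "%n. case n of 0 => 0 | Suc k => Suc (Suc k)"]
  by (intro def_intro a') (simp add: inj_def split: nat.splits)
 then show "Def (%e. e 0:{F x (%n. e (Suc n)) | x. x:ext (a (%n. e (Suc n)))})"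
  by (rule Def_cong) blast
qed

lemma is_funI:
 assumes "f:M" "!!z. z:ext f ==> EX x:ext a. EX y:ext b. z = pr x y"
  "!!x. x:ext a ==> EX y:ext b. pr x y:ext f & (ALL y':ext b. pr x y':ext f --> y' = y)"
 shows "is_fun f a b"
 unfolding is_fun_def is_rel_def
proof (intro conjI ballI assms(1))
 fix z assume "z:ext f"
 then show "EX x:ext a. EX y:ext b. opair z x y" using assms(2) ext_M unfolding opair_iff by blast
next
 fix x assume x: "x:ext a"
 then obtain y where y: "y:ext b" "pr x y:ext f" "ALL y':ext b. pr x y':ext f --> y' = y"
  using assms(3) by blast
 show "EX! y. (x, y):rel f"
 proof (rule ex1I[of _ y])
  show "(x, y):rel f" unfolding rel_iff using y x ext_M by blast
  fix y' assume "(x, y'):rel f"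
  then have y': "x:M" "y':M" "pr x y':ext f" unfolding rel_iff by auto
  then obtain x1 y1 where xy: "x1:ext a" "y1:ext b" "pr x y' = pr x1 y1" using assms(2) by blast
  then have "y' = y1" using y' pr_inject[OF y'(1,2), of x1 y1] ext_M[OF xy(1)] ext_M[OF xy(2)] by simp
  then show "y' = y" using y(3) xy(2) y'(3) by blast
 qed
qed

lemma choice:
 assumes "a:M" "b:M" "Def (%e. P (e 0) (e 1))" "!!x. x:ext a ==> EX y:ext b. P x y"
 obtains f where "f:M" "is_fun f a b" "!!x. x:ext a ==> P x (ap f x)"
proof -
 have PD: "DefF s ==> DefF t ==> Def (%e. P (s e) (t e))" for s t by (rule Def_R2[OF assms(3)])
 \<comment> \<open>The axiom yields a transversal of a disjoint family. Tagging each candidate with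
   its argument \<open>x\<close> makes the slices disjoint, and the transversal is then a choice
   function.\<close>
 define sl where "sl x = sepm (times a b) (%z. EX y:ext b. z = pr x y & P x y)" for x
 have slD: "DefF (%e. sl (e 0))" unfolding sl_def by (intro def_intro PD assms)
 have sl: "ext (sl x) = {pr x y | y. y:ext b & P x y}" if x: "x:ext a" for x
 proof -
  have d: "Def (%e. EX y:ext b. e 0 = pr x y & P x y)" by (intro def_intro PD assms ext_M[OF x])
  show ?thesis unfolding sl_def ext_sepm[OF times_M[OF assms(1,2)] d] ext_times[OF assms(1,2)]
   using x by blast
 qed
 define fam where "fam = mk (sl ` ext a)"
 have fam: "fam:M" "ext fam = sl ` ext a" using mk[OF repl_DefF[OF assms(1) slD]] unfolding fam_def by auto
 have ne: "ALL y:ext fam. ext y ~= {}" unfolding fam(2) using sl assms(4) by blast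
 have dj: "ALL y:ext fam. ALL z:ext fam. y ~= z --> ext y Int ext z = {}"
 proof (intro ballI impI)
  fix y z assume "y:ext fam" "z:ext fam" "y ~= z"
  then obtain u v where uv: "u:ext a" "v:ext a" "y = sl u" "z = sl v" "u ~= v" unfolding fam(2) by blast
  show "ext y Int ext z = {}" unfolding uv sl[OF uv(1)] sl[OF uv(2)]
   using uv(5) ext_M[OF uv(1)] ext_M[OF uv(2)] ext_M by auto
 qed
 obtain c where c: "c:M" "ALL y:ext fam. EX! v. v:ext y Int ext c" using choice_ax[OF fam(1) ne dj] by blast
 define f where "f = sepm (times a b) (%z. z:ext c & (EX x:ext a. EX y:ext b. z = pr x y & P x y))"
 have d: "Def (%e. e 0:ext c & (EX x:ext a. EX y:ext b. e 0 = pr x y & P x y))"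
  by (intro def_intro PD assms c(1))
 have f: "f:M" "ext f = {z:ext c. EX x:ext a. EX y:ext b. z = pr x y & P x y}"
  using sepm[OF times_M[OF assms(1,2)] d] ext_times[OF assms(1,2)] unfolding f_def by auto
 have pf: "pr x y:ext f <-> pr x y:ext c & P x y" if "x:ext a" "y:ext b" for x y
 proof
  assume "pr x y:ext f"
  then obtain x' y' where "pr x y:ext c" "x':ext a" "y':ext b" "pr x y = pr x' y'" "P x' y'"
   unfolding f(2) by blast
  then show "pr x y:ext c & P x y" using that ext_M pr_inject by metis
 qed (use that f(2) in blast)
 have un1: "EX y:ext b. pr x y:ext f & (ALL y':ext b. pr x y':ext f --> y' = y)" if x: "x:ext a" for x
 proof -
  have "EX! v. v:ext (sl x) Int ext c" using c(2) x fam(2) by blast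
  then obtain v where v: "v:ext (sl x)" "v:ext c" "!!w. w:ext (sl x) ==> w:ext c ==> w = v" by blast
  then obtain y where y: "v = pr x y" "y:ext b" "P x y" using sl[OF x] by blast
  have "pr x y:ext f" using pf[OF x y(2)] v y by blast
  moreover have "y' = y" if y': "y':ext b" "pr x y':ext f" for y'
  proof -
   have "pr x y':ext c" "P x y'" using pf[OF x y'(1)] y'(2) by blast+
   then have "pr x y' = v" using v(3) sl[OF x] y'(1) by blast
   then show ?thesis using y(1) ext_M[OF x] ext_M[OF y(2)] ext_M[OF y'(1)] by simp
  qed
  ultimately show ?thesis using y(2) by blast
 qed
 have ff: "is_fun f a b" by (rule is_funI[OF f(1)]) (use f(2) un1 in blast)+
 have "P x (ap f x)" if "x:ext a" for x using is_funD(1,2)[OF ff that] pf that by blast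
 then show ?thesis using that[of f] f(1) ff by blast
qed

lemma zfc_recursion:
 assumes A: "A:M" and wf: "wfp_on (ext A) lt"
  and tr: "transp lt"
  and ltD: "Def (%e. lt (e 0) (e 1))" and OpD: "DefF (%e. Op (e 0) (e 1))"
 obtains F where "!!i. i:ext A ==> F i = Op i (mk {pr j (F j) | j. j:ext A & lt j i})"
  "!!i. i:ext A ==> F i:M" "coded {pr j (F j) | j. j:ext A}"
  "!!i. i:ext A ==> coded {pr j (F j) | j. j:ext A & lt j i}"
 by (rule recursion[OF A wf tr ltD OpD]) (assumption | rule repl_graph | use that in blast)+

end

context zmod begin

definition p1 where "p1 z = un (sepm (un z) (%x. EX y:ext (un z). z = pr x y))"
definition p2 where "p2 z = un (sepm (un z) (%y. EX x:ext (un z). z = pr x y))"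

lemma DefF_p1 [def_intro]: "DefF s ==> DefF (%e. p1 (s e))"
 by (rule Def_lift[of p1]) (auto simp: p1_def intro!: def_intro)

lemma DefF_p2 [def_intro]: "DefF s ==> DefF (%e. p2 (s e))"
 by (rule Def_lift[of p2]) (auto simp: p2_def intro!: def_intro)

lemma p12 [simp]: assumes "x:M" "y:M" shows "p1 (pr x y) = x" "p2 (pr x y) = y"
proof -
 have u: "ext (un (pr x y)) = {x, y}" "un (pr x y):M" using assms by (auto simp: ext_pr)
 show "p1 (pr x y) = x" unfolding p1_def
 proof (rule un_the[OF u(2)])
  show "Def (%e. EX v:ext (un (pr x y)). pr x y = pr (e 0) v)" by (intro def_intro u assms pr_M)
  show "w = x" if "w:ext (un (pr x y))" "EX v:ext (un (pr x y)). pr x y = pr w v" for w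
   using that ext_M pr_inject[OF assms] by metis
 qed (use u in auto)
 show "p2 (pr x y) = y" unfolding p2_def
 proof (rule un_the[OF u(2)])
  show "Def (%e. EX v:ext (un (pr x y)). pr x y = pr v (e 0))" by (intro def_intro u assms pr_M)
  show "w = y" if "w:ext (un (pr x y))" "EX v:ext (un (pr x y)). pr x y = pr v w" for w
   using that ext_M pr_inject[OF assms] by metis
 qed (use u in auto)
qed

lemma pr_graph:
 assumes "coded {pr j (F j) | j. j:J}" "J <= M" "!!j. j:J ==> F j:M" "j:M" "v:M"
 shows "pr j v:ext (mk {pr j (F j) | j. j:J}) <-> j:J & v = F j"
proof
 assume "pr j v:ext (mk {pr j (F j) | j. j:J})"
 then obtain i where i: "i:J" "pr j v = pr i (F i)" unfolding ext_mk[OF assms(1)] by blast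
 then have "j = i & v = F i" using assms by (metis pr_inject subsetD)
 then show "j:J & v = F j" using i by blast
qed (use ext_mk[OF assms(1)] in blast)

lemma graph_ap:
 assumes "coded {pr j (F j) | j. j:J}" "J <= M" "!!j. j:J ==> F j:M" "j:J"
 shows "ap (mk {pr j (F j) | j. j:J}) j = F j"
proof -
 note g = pr_graph[OF assms(1,2)]
 have j: "j:M" "F j:M" using assms(2,3,4) by auto
 show ?thesis by (rule ap_eq[OF mk_M[OF assms(1)] j]) (use g assms(3,4) j in blast)+
qed

lemma card_le_times:
 assumes "card_le a c" "card_le b d" "a:M" "b:M" "c:M" "d:M"
 shows "card_le (times a b) (times c d)"
proof -
 obtain f where f: "f:M" "inj_on (ap f) (ext a)" "!!x. x:ext a ==> ap f x:ext c"
  using card_leE[OF assms(1)] by blast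
 obtain g where g: "g:M" "inj_on (ap g) (ext b)" "!!x. x:ext b ==> ap g x:ext d"
  using card_leE[OF assms(2)] by blast
 let ?t = "%z. pr (ap f (p1 z)) (ap g (p2 z))"
 have t: "?t (pr x y) = pr (ap f x) (ap g y)" if "x:ext a" "y:ext b" for x y
  using ext_M[OF that(1)] ext_M[OF that(2)] by simp
 show ?thesis
 proof (rule card_leI[of _ _ ?t])
  show "DefF (%e. ?t (e 0))" by (intro def_intro f g)
  fix z assume "z:ext (times a b)"
  then obtain x y where "x:ext a" "y:ext b" "z = pr x y" unfolding ext_times[OF assms(3,4)] by blast
  then show "?t z:ext (times c d)" using t[of x y] f(3)[of x] g(3)[of y]
   unfolding ext_times[OF assms(5,6)] by blast
 next
  show "inj_on ?t (ext (times a b))"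
  proof (rule inj_onI)
   fix z w assume zw: "z:ext (times a b)" "w:ext (times a b)" "?t z = ?t w"
   obtain x y where z: "x:ext a" "y:ext b" "z = pr x y"
    using zw(1) unfolding ext_times[OF assms(3,4)] by blast
   obtain x' y' where w: "x':ext a" "y':ext b" "w = pr x' y'"
    using zw(2) unfolding ext_times[OF assms(3,4)] by blast
   have "pr (ap f x) (ap g y) = pr (ap f x') (ap g y')" using zw(3) t z w by simp
   then have "ap f x = ap f x'" "ap g y = ap g y'"
    using ext_M[OF f(3)[OF z(1)]] ext_M[OF f(3)[OF w(1)]] ext_M[OF g(3)[OF z(2)]] ext_M[OF g(3)[OF w(2)]]
    by simp_all
   then show "z = w" using f(2) g(2) z w unfolding inj_on_def by blast
  qed
 qed (rule times_M[OF assms(3,4)], rule times_M[OF assms(5,6)])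
qed

definition ordlt where "ordlt x y <-> is_ordinal y & x:ext y"

lemma ordlt_trans: "transp ordlt"
 unfolding ordlt_def transp_def using ord_trans by blast

lemma Def_ordlt [def_intro]: "DefF s ==> DefF t ==> Def (%e. ordlt (s e) (t e))"
 unfolding ordlt_def by (intro def_intro)

lemma wfp_on_E: "wfp_on M (%x y. x:ext y)"
 unfolding wfp_on_def using E_induct by metis

lemma wfp_on_sub: "wfp_on B R ==> A <= B ==> (!!x y. x:A ==> y:A ==> Q x y ==> R x y) ==> wfp_on A Q"
 unfolding wfp_on_iff_ex_minimal by (meson subset_iff)

lemma wfp_on_ordlt: "A <= M ==> wfp_on A ordlt"
 by (rule wfp_on_sub[OF wfp_on_E]) (auto simp: ordlt_def)

end

context zfc begin

lemma tc_ex: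
 assumes x: "x:M"
 shows "EX t:M. ext x <= ext t & (ALL y:ext t. ext y <= ext t)"
proof -
 define rg where "rg n f = sepm (un (un f)) (%v. EX j:ext n. pr j v:ext f)" for n f
 define Op where "Op n f = cup x (un (un (rg n f)))" for n f
 have OpD: "DefF (%e. Op (e 0) (e 1))" unfolding Op_def rg_def by (intro def_intro x)
 have omM: "ext om <= M" using ext_M by blast
 obtain F where F: "!!i. i:ext om ==> F i = Op i (mk {pr j (F j) | j. j:ext om & ordlt j i})"
  "!!i. i:ext om ==> F i:M" "coded {pr j (F j) | j. j:ext om}"
  "!!i. i:ext om ==> coded {pr j (F j) | j. j:ext om & ordlt j i}"
  using zfc_recursion[OF om_M wfp_on_ordlt[OF omM] ordlt_trans Def_ordlt[OF DefF_var DefF_var] OpD]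
  by blast
 have FS: "ext (F (num n)) = ext x Un (UN k:{..<n}. UN y:ext (F (num k)). ext y)" for n
 proof -
  define f where "f = mk {pr j (F j) | j. j:ext om & ordlt j (num n)}"
  have J: "j:ext om & ordlt j (num n) <-> j:num ` {..<n}" for j
   unfolding ordlt_def ext_num using ord_num ext_om by auto
  have no: "num n:ext om" unfolding ext_om by blast
  have c: "coded {pr j (F j) | j. j:num ` {..<n}}" using F(4)[OF no] unfolding J .
  have f: "f = mk {pr j (F j) | j. j:num ` {..<n}}" unfolding f_def J ..
  have fM: "f:M" unfolding f by (rule mk_M[OF c])
  have g: "pr j v:ext f <-> j:num ` {..<n} & v = F j" if "j:M" "v:M" for j v
   unfolding f by (rule pr_graph[OF c]) (use that F(2) ext_om in auto)
  have d: "Def (%e. EX j:ext (num n). pr j (e 0):ext f)" by (intro def_intro fM)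
  have rM: "rg (num n) f:M" unfolding rg_def using sepm_M[OF _ d] fM by simp
  have "ext (rg (num n) f) = {v:ext (un (un f)). EX j:ext (num n). pr j v:ext f}"
   unfolding rg_def using ext_sepm[OF _ d] fM by simp
  also have "... = F ` num ` {..<n}"
  proof (intro equalityI subsetI)
   fix v assume v: "v:F ` num ` {..<n}"
   then obtain j where j: "j:num ` {..<n}" "v = F j" by blast
   then have m: "j:M" "v:M" using F(2) ext_om by auto
   then have "pr j v:ext f" using g j by blast
   then show "v:{v:ext (un (un f)). EX j:ext (num n). pr j v:ext f}"
    using pr_in_M(2)[OF m _ fM] j(1) unfolding ext_num by blast
  next
   fix v assume "v:{v:ext (un (un f)). EX j:ext (num n). pr j v:ext f}"
   then obtain j where "j:M" "v:M" "pr j v:ext f" using ext_M by blast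
   then show "v:F ` num ` {..<n}" using g by blast
  qed
  finally have "ext (rg (num n) f) = F ` num ` {..<n}" .
  then have "ext (Op (num n) f) = ext x Un (UN k:{..<n}. UN y:ext (F (num k)). ext y)"
   unfolding Op_def using rM x by auto
  then show ?thesis using F(1)[of "num n"] ext_om unfolding f_def by simp
 qed
 define g where "g = mk {pr j (F j) | j. j:ext om}"
 have gM: "g:M" unfolding g_def by (rule mk_M[OF F(3)])
 have ga: "ap g (num n) = F (num n)" for n unfolding g_def
  by (rule graph_ap[OF F(3) omM]) (use F(2) ext_om in auto)
 have c: "coded (ap g ` ext om)" by (rule repl_DefF[OF om_M]) (intro def_intro gM)
 define t where "t = un (mk (ap g ` ext om))"
 have t: "t:M" "ext t = (UN n. ext (F (num n)))"
  using mk[OF c] ga ext_om unfolding t_def by auto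
 have "ext x <= ext t" unfolding t(2) using FS by blast
 moreover have "ext y <= ext t" if yt: "y:ext t" for y
 proof -
  obtain n where "y:ext (F (num n))" using yt t(2) by blast
  then have "ext y <= ext (F (num (Suc n)))" unfolding FS[of "Suc n"] by auto
  then show ?thesis unfolding t(2) by blast
 qed
 ultimately show ?thesis using t(1) by blast
qed

text \<open>Membership in the transitive closure of \<open>y\<close>. Quantifying over all
  transitive sets that include \<open>y\<close> makes it definable without naming the
  closure.\<close>

definition tclt where
 "tclt x y <-> (ALL t:M. ext y <= ext t & (ALL z:ext t. ext z <= ext t) --> x:ext t)"

lemma tclt_trans: "transp tclt"
 unfolding tclt_def transp_def by blast

lemma Def_tclt: "Def (%e. tclt (e 0) (e 1))"
 unfolding tclt_def by (intro def_intro)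

lemma tclt_E: "x:ext y ==> tclt x y" unfolding tclt_def by blast

lemma tclt_cases: assumes "tclt y x" "x:M" shows "EX z:ext x. y = z \<or> tclt y z"
proof -
 obtain t where t: "t:M" "ext x <= ext t" "ALL y:ext t. ext y <= ext t" using tc_ex[OF assms(2)] by blast
 have d: "Def (%e. EX z:ext x. e 0 = z \<or> tclt (e 0) z)"
  by (intro def_intro assms Def_R2[OF Def_tclt])
 define u where "u = sepm t (%w. EX z:ext x. w = z \<or> tclt w z)"
 have u: "u:M" "ext u = {w:ext t. EX z:ext x. w = z \<or> tclt w z}"
  using sepm[OF t(1) d] unfolding u_def by auto
 have "ext x <= ext u" using t(2) u(2) by blast
 moreover have "ext y <= ext u" if yu: "y:ext u" for y
 proof
  fix w assume w: "w:ext y"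
  obtain z where z: "z:ext x" "y = z \<or> tclt y z" using yu u(2) by blast
  have "tclt w z" using z(2) tclt_E[OF w] transpD[OF tclt_trans, of w y z] by blast
  then show "w:ext u" using w yu t(3) z(1) u(2) by blast
 qed
 ultimately have "y:ext u" using assms(1) u(1) unfolding tclt_def by blast
 then show ?thesis using u(2) by blast
qed

lemma wfp_on_tclt: "wfp_on M tclt"
 unfolding wfp_on_def
proof (intro allI impI ballI)
 fix P x assume h: "ALL x:M. (ALL y:M. tclt y x --> P y) --> P x" and x: "x:M"
 have "ALL y:M. y = x \<or> tclt y x --> P y" using x
 proof (induction rule: E_induct)
  case (step x)
  have "ALL y:M. tclt y x --> P y" using tclt_cases[OF _ step(1)] step(2) by blast
  then show ?case using h step(1) by blast
 qed
 then show "P x" using x by blast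
qed

text \<open>The domain is all of \<open>M\<close>, which is not a set, so values are read off from
  correct graphs \<open>g\<close> on transitive sets \<open>T\<close>; \<open>uniq\<close> shows
  that the choice of graph is immaterial. This is what makes the map to canonical names
  definable.\<close>

lemma E_recursion:
 assumes OpD: "DefF (%e. Op (e 0) (e 1))"
 obtains F where "!!x. x:M ==> F x:M" "!!x. x:M ==> coded {pr y (F y) | y. y:ext x}"
  "!!x. x:M ==> F x = Op x (mk {pr y (F y) | y. y:ext x})" "DefF (%e. F (e 0))"
proof -
 define res where "res g y = sepm g (%z. EX k:ext y. EX v:M. z = pr k v)" for g y
 have resd: "DefF (%e. res (e 0) (e 1))" unfolding res_def by (intro def_intro)
 have resM: "res g y:M" if "g:M" "y:M" for g y
  using DefF_in[OF resd, of "%n. if n = 0 then g else y"] that by auto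
 have OpM: "Op i f:M" if "i:M" "f:M" for i f
  using DefF_in[OF OpD, of "%n. if n = 0 then i else f"] that by auto
 have resD: "DefF s ==> DefF t ==> DefF (%e. res (s e) (t e))" for s t
  by (rule DefF_2[of res]) (use resM resd in \<open>auto simp: DefF_def numeral_2_eq_2\<close>)
 have OpD2: "DefF s ==> DefF t ==> DefF (%e. Op (s e) (t e))" for s t
  by (rule DefF_2[of Op]) (use OpM OpD in \<open>auto simp: DefF_def numeral_2_eq_2\<close>)
 define appr where "appr T g <-> (ALL y:ext T. ext y <= ext T) &
   (ALL y:ext T. ALL v:M. pr y v:ext g <-> v = Op y (res g y))" for T g
 have apprD: "Def (%e. appr (e i) (e j))" for i j
  unfolding appr_def by (intro def_intro OpD2 resD)
 have er: "ext (res g y) = {pr k v | k v. k:ext y & v:M & pr k v:ext g}"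
  if "g:M" "y:M" for g y
 proof -
  have d: "Def (%e. EX k:ext y. EX v:M. e 0 = pr k v)" by (intro def_intro that)
  show ?thesis unfolding res_def ext_sepm[OF that(1) d] by auto
 qed
 have ex: "EX T:M. EX g:M. appr T g & x:ext T" if x: "x:M" for x
 proof -
  obtain T where T: "T:M" "ext (upr x x) <= ext T" "ALL y:ext T. ext y <= ext T"
   using tc_ex[of "upr x x"] x by auto
  have "ext T <= M" using ext_M by blast
  define Op' where "Op' i f = Op i (res f i)" for i f
  have OpD': "DefF (%e. Op' (e 0) (e 1))" unfolding Op'_def by (intro def_intro OpD2 resD)
  obtain F where F: "!!i. i:ext T ==> F i = Op' i (mk {pr j (F j) | j. j:ext T & tclt j i})"
   "!!i. i:ext T ==> F i:M" "coded {pr j (F j) | j. j:ext T}"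
   "!!i. i:ext T ==> coded {pr j (F j) | j. j:ext T & tclt j i}"
   using zfc_recursion[OF T(1) wfp_on_sub[OF wfp_on_tclt \<open>ext T <= M\<close>] tclt_trans Def_tclt OpD'] by blast
  define g where "g = mk {pr j (F j) | j. j:ext T}"
  have gM: "g:M" unfolding g_def by (rule mk_M[OF F(3)])
  have gp: "pr y v:ext g <-> y:ext T & v = F y" if "y:M" "v:M" for y v
   unfolding g_def by (rule pr_graph[OF F(3) \<open>ext T <= M\<close>]) (use F(2) that in blast)+
  have "pr y v:ext g <-> v = Op y (res g y)" if y: "y:ext T" and v: "v:M" for y v
  proof -
   define f where "f = mk {pr j (F j) | j. j:{j. j:ext T & tclt j y}}"
   have c: "coded {pr j (F j) | j. j:{j. j:ext T & tclt j y}}" using F(4)[OF y] by simp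
   have fp: "pr k v:ext f <-> k:ext T & tclt k y & v = F k" if "k:M" "v:M" for k v
    unfolding f_def using pr_graph[OF c _ _ that] F(2) ext_M by blast
   have fM: "f:M" unfolding f_def by (rule mk_M[OF c])
   have "res f y = res g y"
   proof (rule ext_eqI)
    have "pr k v:ext f <-> pr k v:ext g" if k: "k:ext y" "v:M" for k v
    proof -
     have "k:ext T" using T(3) y k(1) by blast
     then show ?thesis using fp[OF ext_M[OF k(1)] k(2)] gp[OF ext_M[OF k(1)] k(2)] tclt_E[OF k(1)] by simp
    qed
    then show "ext (res f y) = ext (res g y)"
     unfolding er[OF fM ext_M[OF y]] er[OF gM ext_M[OF y]] by blast
   qed (use resM fM gM ext_M[OF y] in auto)
   then have "F y = Op y (res g y)" using F(1)[OF y] unfolding Op'_def f_def by simp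
   then show ?thesis using gp[OF ext_M[OF y] v] y by simp
  qed
  then have "appr T g" unfolding appr_def using T(3) by blast
  moreover have "x:ext T" using T(2) x by auto
  ultimately show ?thesis using T(1) gM by blast
 qed
 have uniq: "res g x = res g' x"
  if a: "T:M" "g:M" "appr T g" "T':M" "g':M" "appr T' g'" and x: "x:M" "x:ext T" "x:ext T'"
  for T g T' g' x
  using x
 proof (induction rule: E_induct)
  case (step x)
  show ?case
  proof (rule ext_eqI)
   have "pr k v:ext g <-> pr k v:ext g'" if k: "k:ext x" "v:M" for k v
   proof -
    have "k:ext T" "k:ext T'" using a step k unfolding appr_def by blast+
    then show ?thesis using step.IH[OF k(1)] a k unfolding appr_def by auto
   qed
   then show "ext (res g x) = ext (res g' x)"
    unfolding er[OF a(2) step(1)] er[OF a(5) step(1)] by blast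
  qed (use resM a step in auto)
 qed
 define F where "F x = (THE v. EX T:M. EX g:M. appr T g & x:ext T & v = Op x (res g x))" for x
 have FI: "F x = Op x (res g x)" if a: "T:M" "g:M" "appr T g" "x:ext T" for x T g
  unfolding F_def
 proof (rule the_equality)
  show "EX T:M. EX g':M. appr T g' & x:ext T & Op x (res g x) = Op x (res g' x)" using a by blast
  fix v assume "EX T:M. EX g:M. appr T g & x:ext T & v = Op x (res g x)"
  then show "v = Op x (res g x)" using uniq a ext_M by metis
 qed
 have FM: "F x:M" if x: "x:M" for x
  using ex[OF x] FI OpM[OF x] resM x by metis
 have F3: "coded {pr y (F y) | y. y:ext x} & F x = Op x (mk {pr y (F y) | y. y:ext x})" if x: "x:M" for x
 proof -
  obtain T g where a: "T:M" "g:M" "appr T g" "x:ext T" using ex[OF x] by blast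
  have "ext (res g x) = {pr y (F y) | y. y:ext x}"
  proof -
   have "pr k v:ext g <-> v = F k" if k: "k:ext x" "v:M" for k v
   proof -
    have kT: "k:ext T" using a k unfolding appr_def by blast
    then show ?thesis using a(3) k FI[OF a(1-3) kT] unfolding appr_def by auto
   qed
   then show ?thesis unfolding er[OF a(2) x] using FM ext_M by blast
  qed
  moreover have "res g x:M" using resM a x by blast
  ultimately show ?thesis using FI[OF a] mk_eq unfolding coded_def by metis
 qed
 have "Def (%e. EX T:M. EX g:M. appr T g & e 1:ext T & e 0 = Op (e 1) (res g (e 1)))"
  by (intro def_intro OpD2 resD Def_R2[OF apprD[of 0 1]])
 then have "Def (%e. e 0 = F (e 1))"
 proof (rule Def_cong)
  fix e :: "nat => 'a" assume "range e <= M"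
  then have "e 1:M" by auto
  then show "e 0 = F (e 1) <-> (EX T:M. EX g:M. appr T g & e 1:ext T & e 0 = Op (e 1) (res g (e 1)))"
   using ex FI by metis
 qed
 then have "DefF (%e. F (e 0))" using FM unfolding DefF_def by auto
 then show ?thesis using that[of F] FM F3 by blast
qed

end

context zmod begin

lemma DefF_if [def_intro]:
 assumes "Def P" "DefF s" "DefF t" shows "DefF (%e. if P e then s e else t e)"
proof -
 have a: "Def (%e. P (%n. e (Suc n)))" by (rule Def_reindex[OF assms(1)]) simp
 have b: "DefF (%e. s (%n. e (Suc n)))" "DefF (%e. t (%n. e (Suc n)))"
  by (rule DefF_shift[OF assms(2)], simp) (rule DefF_shift[OF assms(3)], simp)
 have "Def (%e. (P (%n. e (Suc n)) & e 0 = s (%n. e (Suc n))) \<or>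
   (~P (%n. e (Suc n)) & e 0 = t (%n. e (Suc n))))" by (intro def_intro a b)
 then have "Def (%e. e 0 = (if P (%n. e (Suc n)) then s (%n. e (Suc n)) else t (%n. e (Suc n))))"
  by (rule Def_cong) simp
 then show ?thesis unfolding DefF_def using DefF_in[OF assms(2)] DefF_in[OF assms(3)] by simp
qed

definition rgm where "rgm f = sepm (un (un f)) (%v. EX j:ext (un (un f)). pr j v:ext f)"

lemma DefF_rgm [def_intro]: "DefF s ==> DefF (%e. rgm (s e))"
 by (rule Def_lift[of rgm]) (auto simp: rgm_def intro!: def_intro)

lemma rgm_M: assumes "f:M" shows "rgm f:M" "ext (rgm f) = {v. EX j:M. v:M & pr j v:ext f}"
proof -
 have d: "Def (%e. EX j:ext (un (un f)). pr j (e 0):ext f)" by (intro def_intro un assms)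
 have u: "un (un f):M" using assms by simp
 show "rgm f:M" unfolding rgm_def by (rule sepm_M[OF u d])
 show "ext (rgm f) = {v. EX j:M. v:M & pr j v:ext f}"
  unfolding rgm_def ext_sepm[OF u d] using pr_in_M[OF _ _ _ assms] ext_M by blast
qed

lemma rgm_graph:
 assumes "coded {pr j (F j) | j. j:J}" "J <= M" "!!j. j:J ==> F j:M"
 shows "ext (rgm (mk {pr j (F j) | j. j:J})) = F ` J"
proof -
 have "pr j v:ext (mk {pr j (F j) | j. j:J}) <-> j:J & v = F j" if "j:M" "v:M" for j v
  by (rule pr_graph[OF assms(1,2)]) (use assms(3) that in blast)+
 then show ?thesis unfolding rgm_M(2)[OF mk_M[OF assms(1)]] using assms(2,3) by blast
qed

section \<open>Hartogs numbers, well-orders and products of infinite cardinals\<close>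

definition hart where "hart a = mk {x. is_ordinal x & card_le x a}"

end

context zfc begin

lemma coded_hart: assumes a: "a:M" shows "coded {x. is_ordinal x & card_le x a}"
proof -
 \<comment> \<open>\<open>R\<close> is the image of the reflexive order of \<open>x\<close>. With
   the strict order the ordinals 0 and 1 would both give the empty relation; the reflexive one
   determines \<open>x\<close>, so that replacement over relations on \<open>a\<close> collects all
   ordinals embeddable into \<open>a\<close>.\<close>
 define iso where "iso R x f <-> is_ordinal x & (ALL u:ext x. ap f u:ext a) &
  (ALL u:ext x. ALL v:ext x. ap f u = ap f v --> u = v) &
  (ALL s:ext a. ALL t:ext a. pr s t:ext R <->
   (EX u:ext x. EX v:ext x. s = ap f u & t = ap f v & (u:ext v \<or> u = v)))" for R x f
 have isoD: "Def (%e. iso (e 0) (e 1) (e 2))" unfolding iso_def by (intro def_intro a)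
 have i1: "is_ordinal x" if "iso R x f" for R x f using that unfolding iso_def by simp
 have i2: "ap f u:ext a" if "iso R x f" "u:ext x" for R x f u using that unfolding iso_def by simp
 have i3: "u = v" if "iso R x f" "u:ext x" "v:ext x" "ap f u = ap f v" for R x f u v
  using that unfolding iso_def by simp
 have i4: "EX u:ext x. EX v:ext x. s = ap f u & t = ap f v & (u:ext v \<or> u = v)"
  if "iso R x f" "s:ext a" "t:ext a" "pr s t:ext R" for R x f s t
  using that unfolding iso_def by simp
 have i5: "pr (ap f u) (ap f v):ext R"
  if "iso R x f" "u:ext x" "v:ext x" "u:ext v \<or> u = v" for R x f u v
 proof -
  have "ALL s:ext a. ALL t:ext a. pr s t:ext R <->
   (EX u:ext x. EX v:ext x. s = ap f u & t = ap f v & (u:ext v \<or> u = v))"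
   using that(1) unfolding iso_def by simp
  from this[rule_format, OF i2[OF that(1,2)] i2[OF that(1,3)]] show ?thesis using that(2-4) by blast
 qed
 have sub: "ext x <= ext y" if i: "iso R x f" "iso R y g" for R x y f g
 proof -
  note R1 = i5[OF i(1)] and R2 = i5[OF i(2)] and X1 = i4[OF i(1)] and X2 = i4[OF i(2)]
   and fi = i3[OF i(1)] and gi = i3[OF i(2)] and fa = i2[OF i(1)] and ga = i2[OF i(2)]
  have xM: "x:M" "y:M" using ordM[OF i1[OF i(1)]] ordM[OF i1[OF i(2)]] .
  have "z:ext x --> z:ext y & ap g z = ap f z" if zM: "z:M" for z using zM
  proof (induction rule: E_induct)
   case (step z)
   show ?case
   proof
    assume z: "z:ext x"
    have "pr (ap f z) (ap f z):ext R" using R1[OF z z] by blast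
    from X2[OF fa[OF z] fa[OF z] this] obtain w where w: "w:ext y" "ap f z = ap g w" by blast
    have "ext w = ext z"
    proof (intro equalityI subsetI)
     fix v assume v: "v:ext w"
     then have vy: "v:ext y" using ord_trans[OF i1[OF i(2)] w(1)] by blast
     have p: "pr (ap g v) (ap g w):ext R" using R2[OF vy w(1)] v by blast
     obtain u1 u2 where u: "u1:ext x" "u2:ext x" "ap g v = ap f u1" "ap g w = ap f u2"
      "u1:ext u2 \<or> u1 = u2" using X1[OF ga[OF vy] ga[OF w(1)] p] by blast
     have u2: "u2 = z" by (rule fi[OF u(2) z]) (simp add: u(4)[symmetric] w(2))
     have "u1 ~= u2"
     proof
      assume "u1 = u2"
      then have "v = w" using gi[OF vy w(1)] u(3,4) by simp
      then show False using v E_irrefl[OF ext_M[OF w(1)]] by simp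
     qed
     then have u1: "u1:ext z" using u(5) u2 by blast
     then have "u1:ext y" "ap g u1 = ap f u1" using step.IH u(1) by blast+
     then have "u1 = v" using gi[of u1 v] u(3) vy by simp
     then show "v:ext z" using u1 by simp
    next
     fix v assume v: "v:ext z"
     then have vx: "v:ext x" using ord_trans[OF i1[OF i(1)] z] by blast
     have vy: "v:ext y" "ap g v = ap f v" using step.IH[OF v] vx by blast+
     have p: "pr (ap f v) (ap f z):ext R" using R1[OF vx z] v by blast
     obtain u1 u2 where u: "u1:ext y" "u2:ext y" "ap f v = ap g u1" "ap f z = ap g u2"
      "u1:ext u2 \<or> u1 = u2" using X2[OF fa[OF vx] fa[OF z] p] by blast
     have u2: "u2 = w" by (rule gi[OF u(2) w(1)]) (simp add: u(4)[symmetric] w(2))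
     have u1: "u1 = v" by (rule gi[OF u(1) vy(1)]) (simp add: u(3)[symmetric] vy(2))
     have "v ~= w"
     proof
      assume "v = w"
      then have "ap f v = ap f z" using vy w by simp
      then have "v = z" using fi[OF vx z] by blast
      then show False using v E_irrefl[OF step(1)] by simp
     qed
     then show "v:ext w" using u(5) u1 u2 by blast
    qed
    then have "w = z" using ext_eqI[of w z] ext_M[OF w(1)] step(1) by blast
    then show "z:ext y & ap g z = ap f z" using w by auto
   qed
  qed
  then show ?thesis using ext_M by blast
 qed
 have uniq: "x = y" if i: "iso R x f" "iso R y g" for R x y f g
  using sub[OF i] sub[OF i(2,1)] ext_eqI[OF ordM[OF i1[OF i(1)]] ordM[OF i1[OF i(2)]]] by blast
 define D where "D = sepm (pw (times a a)) (%R. EX x:M. EX f:M. iso R x f)"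
 have dD: "Def (%e. EX x:M. EX f:M. iso (e 0) x f)" by (intro def_intro Def_R3[OF isoD])
 have pM: "pw (times a a):M" using a by simp
 have D: "D:M" "ext D = {R:ext (pw (times a a)). EX x:M. EX f:M. iso R x f}"
  using sepm[OF pM dD] unfolding D_def by auto
 define F where "F R = (THE x. x:M & (EX f:M. iso R x f))" for R
 have F: "F R = x <-> (EX f:M. iso R x f)" if R: "R:ext D" and xM: "x:M" for R x
 proof -
  obtain y g where y: "y:M" "g:M" "iso R y g" using R D(2) by blast
  have "F R = y" unfolding F_def by (rule the_equality) (use y uniq in blast)+
  then show ?thesis using y uniq by blast
 qed
 have FM: "F R:M" if "R:ext D" for R using F[OF that] that D(2) by blast
 have "coded (F ` ext D)"
 proof (rule repl[OF D(1) FM])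
  have "Def (%e. e 0:ext D & (EX f:M. iso (e 0) (e 1) f))"
   by (intro def_intro Def_R3[OF isoD] D(1))
  then show "Def (%e. e 0:ext D & e 1 = F (e 0))"
  proof (rule Def_cong)
   fix e :: "nat => 'a" assume "range e <= M"
   then have "e 1:M" by auto
   then show "(e 0:ext D & e 1 = F (e 0)) <-> (e 0:ext D & (EX f:M. iso (e 0) (e 1) f))"
    using F by metis
  qed
 qed
 moreover have "{x. is_ordinal x & card_le x a} = F ` ext D"
 proof (intro equalityI subsetI)
  fix x assume "x:F ` ext D"
  then obtain R where R: "R:ext D" "x = F R" by blast
  then obtain f where f: "f:M" "iso R x f" using F[OF R(1) FM[OF R(1)]] by blast
  have "card_le x a"
  proof (rule card_leI[of x a "ap f"])
   show "x:M" using ordM[OF i1[OF f(2)]] .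
   show "inj_on (ap f) (ext x)" by (rule inj_onI) (rule i3[OF f(2)])
   show "DefF (%e. ap f (e 0))" by (intro def_intro f)
  qed (use a i2[OF f(2)] in blast)+
  then show "x:{x. is_ordinal x & card_le x a}" using i1[OF f(2)] by blast
 next
  fix x assume "x:{x. is_ordinal x & card_le x a}"
  then have x: "is_ordinal x" "card_le x a" by auto
  obtain f where f: "f:M" "inj_on (ap f) (ext x)" "!!u. u:ext x ==> ap f u:ext a"
   using card_leE[OF x(2)] by blast
  let ?Q = "%z. EX u:ext x. EX v:ext x. z = pr (ap f u) (ap f v) & (u:ext v \<or> u = v)"
  have dQ: "Def (%e. ?Q (e 0))" by (intro def_intro f ordM[OF x(1)])
  define R where "R = sepm (times a a) ?Q"
  have R: "R:M" "ext R = {z:ext (times a a). ?Q z}" using sepm[OF times_M[OF a a] dQ] unfolding R_def by auto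
  have "iso R x f" unfolding iso_def
  proof (intro conjI ballI impI x(1) f(3))
   show "u = v" if "u:ext x" "v:ext x" "ap f u = ap f v" for u v
    using f(2) that unfolding inj_on_def by blast
   fix s t assume st: "s:ext a" "t:ext a"
   have "pr s t:ext (times a a)" using st unfolding ext_times[OF a a] by blast
   moreover have "pr s t = pr (ap f u) (ap f v) <-> s = ap f u & t = ap f v"
    if "u:ext x" "v:ext x" for u v
    using pr_inject ext_M[OF st(1)] ext_M[OF st(2)] ext_M[OF f(3)[OF that(1)]] ext_M[OF f(3)[OF that(2)]] by simp
   ultimately show "pr s t:ext R <->
    (EX u:ext x. EX v:ext x. s = ap f u & t = ap f v & (u:ext v \<or> u = v))"
    unfolding R(2) by blast
  qed
  moreover have "R:ext (pw (times a a))" using R a by auto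
  ultimately have "R:ext D" "F R = x" using D(2) F f(1) ordM[OF x(1)] by blast+
  then show "x:F ` ext D" by blast
 qed
 ultimately show ?thesis by simp
qed

lemma hart: assumes a: "a:M"
 shows hart_M: "hart a:M" and hart_iff: "x:ext (hart a) <-> is_ordinal x & card_le x a"
  and ord_hart: "is_ordinal (hart a)" and hart_not: "~card_le (hart a) a"
proof -
 show h: "hart a:M" and e: "x:ext (hart a) <-> is_ordinal x & card_le x a" for x
  using mk[OF coded_hart[OF a]] unfolding hart_def by auto
 show o: "is_ordinal (hart a)"
 proof (rule is_ordinalI[OF h])
  fix x assume x: "x:ext (hart a)"
  then show "is_ordinal x" using e by blast
  show "ext x <= ext (hart a)"
  proof
   fix y assume y: "y:ext x"
   have x': "is_ordinal x" "card_le x a" using x e by auto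
   have "ext y <= ext x" using ord_trans[OF x'(1) y] by blast
   then have "card_le y x" using card_le_sub ext_M[OF y] ext_M[OF x] by blast
   then have "card_le y a" using card_le_trans x'(2) ext_M[OF y] a by blast
   then show "y:ext (hart a)" using e ord_elem[OF x'(1) y] by blast
  qed
 qed
 show "~card_le (hart a) a" using e o E_irrefl[OF h] by blast
qed

lemma next_hart: assumes "is_ordinal a" "is_cardinal a" shows "is_next_cardinal (hart a) a" "is_cardinal (hart a)"
proof -
 have aM: "a:M" using ordM assms by blast
 note h = hart[OF aM]
 have ah: "a:ext (hart a)" using h(2) assms(1) card_le_sub[OF aM aM] by blast
 show c: "is_cardinal (hart a)" unfolding is_cardinal_def
 proof (intro conjI ballI notI h(3))
  fix x assume x: "x:ext (hart a)" "card_eq x (hart a)"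
  then have "card_le (hart a) x"
   using card_eq_le[OF card_eq_sym[OF x(2) ext_M[OF x(1)] h(1)] h(1) ext_M[OF x(1)]] by blast
  moreover have "card_le x a" using x h(2) by blast
  ultimately show False using card_le_trans[OF _ _ h(1) aM] h(4) by blast
 qed
 have "a ~: ext x" if x: "x:ext (hart a)" "is_cardinal x" for x
 proof
  assume ax: "a:ext x"
  have xo: "is_ordinal x" "card_le x a" using x h(2) by blast+
  have "ext a <= ext x" using ord_trans[OF xo(1) ax] by blast
  then have "card_le a x" using card_le_sub aM ext_M[OF x(1)] by blast
  then have "card_eq a x" using cantor_bernstein xo(2) aM ext_M[OF x(1)] by blast
  then show False using x(2) ax unfolding is_cardinal_def by blast
 qed
 then show "is_next_cardinal (hart a) a" unfolding is_next_cardinal_def using c ah by blast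
qed

lemma card_le_surj:
 assumes "a:M" "b:M" "DefF (%e. t (e 0))" "ext a <= t ` ext b" shows "card_le a b"
proof -
 have "Def (%e. t (e 1) = e 0)" by (intro def_intro Def_lift[OF assms(3)])
 then obtain f where f: "f:M" "is_fun f a b" "!!x. x:ext a ==> t (ap f x) = x"
  using choice[OF assms(1,2), of "%x y. t y = x"] assms(4) by blast
 show ?thesis
 proof (rule card_leI[OF assms(1,2), of "ap f"])
  show "inj_on (ap f) (ext a)" by (rule inj_on_inverseI[of _ t]) (rule f(3))
 qed (use is_funD(1)[OF f(2)] f(1) in \<open>auto intro!: def_intro\<close>)
qed

lemma card_le_UN:
 assumes I: "I:M" and b: "b:M" and S: "DefF (%e. S (e 0))" and le: "!!i. i:ext I ==> card_le (S i) b"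
  and U: "U:M" "ext U <= (UN i:ext I. ext (S i))"
 shows "card_le U (times I b)"
proof -
 have SD: "DefF s ==> DefF (%e. S (s e))" for s by (rule Def_lift[OF S])
 have SM: "S i:M" if "i:M" for i using DefF_in[OF S, of "%_. i"] that by auto
 define V where "V = un (mk (S ` ext I))"
 have V: "V:M" "ext V = (UN i:ext I. ext (S i))"
  using mk[OF repl_DefF[OF I S]] unfolding V_def by auto
 define W where "W = pw (times V b)"
 have W: "W:M" using V b unfolding W_def by simp
 define P where "P i f <-> (ALL x:ext (S i). ap f x:ext b) & (ALL x:ext (S i). ALL y:ext (S i). ap f x = ap f y --> x = y)"
  for i f
 have PD: "Def (%e. P (e 0) (e 1))" unfolding P_def by (intro def_intro SD b)
 have ex: "EX f:ext W. P i f" if i: "i:ext I" for i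
 proof -
  obtain f where f: "f:M" "is_fun f (S i) b" "inj_on (ap f) (ext (S i))" "!!x. x:ext (S i) ==> ap f x:ext b"
   using card_leE[OF le[OF i]] by blast
  have "ext f <= ext (times V b)"
  proof
   fix z assume "z:ext f"
   then obtain x where "x:ext (S i)" "z = pr x (ap f x)" using is_fun_mem[OF f(2)] by blast
   then show "z:ext (times V b)" unfolding ext_times[OF V(1) b] using V(2) i f(4) by blast
  qed
  then have "f:ext W" unfolding W_def using f(1) V b by simp
  moreover have "P i f" unfolding P_def using f(3,4) unfolding inj_on_def by blast
  ultimately show ?thesis by blast
 qed
 obtain h where h: "h:M" "is_fun h I W" "!!i. i:ext I ==> P i (ap h i)"
  using choice[OF I W PD ex] by blast
 have "Def (%e. e 0:ext (S (e 1)))" by (intro def_intro SD)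
 then obtain c where c: "c:M" "is_fun c U I" "!!x. x:ext U ==> x:ext (S (ap c x))"
  using choice[OF U(1) I, of "%x i. x:ext (S i)"] U(2) by blast
 let ?t = "%x. pr (ap c x) (ap (ap h (ap c x)) x)"
 have cI: "ap c x:ext I" if "x:ext U" for x using is_funD(1)[OF c(2) that] .
 have hb: "ap (ap h (ap c x)) x:ext b" if "x:ext U" for x
  using h(3)[OF cI[OF that]] c(3)[OF that] unfolding P_def by blast
 show ?thesis
 proof (rule card_leI[OF U(1), of _ ?t])
  show "times I b:M" using I b by simp
  show "?t x:ext (times I b)" if "x:ext U" for x
   unfolding ext_times[OF I b] using cI[OF that] hb[OF that] by blast
  show "DefF (%e. ?t (e 0))" by (intro def_intro c h)
  show "inj_on ?t (ext U)"
  proof (rule inj_onI)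
   fix x y assume xy: "x:ext U" "y:ext U" "?t x = ?t y"
   have "ap c x = ap c y" "ap (ap h (ap c x)) x = ap (ap h (ap c y)) y"
    using xy(3) pr_inject[OF ext_M[OF cI[OF xy(1)]] ext_M[OF hb[OF xy(1)]] ext_M[OF cI[OF xy(2)]] ext_M[OF hb[OF xy(2)]]]
    by blast+
   then show "x = y" using h(3)[OF cI[OF xy(1)]] c(3)[OF xy(1)] c(3)[OF xy(2)] unfolding P_def by metis
  qed
 qed
qed

text \<open>Zermelo's argument: choosing elements of the remainder along \<open>hart K\<close> has
  to stop, since otherwise \<open>hart K\<close> would embed into \<open>K\<close>.\<close>

lemma well_order: assumes K: "K:M"
 obtains o' g where "is_ordinal o'" "g:M" "ext K <= ap g ` ext o'"
proof -
 define N where "N = sepm (pw K) (%X. EX x:ext X. x = x)"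
 have dN: "Def (%e. EX x:ext (e 0). x = x)" by (intro def_intro)
 have N: "N:M" "ext N = {X:M. ext X <= ext K & ext X ~= {}}"
  using sepm[OF pw(1)[OF K] dN] K unfolding N_def by auto
 have "Def (%e. e 1:ext (e 0))" by (intro def_intro)
 then obtain c where c: "c:M" "is_fun c N K" "!!X. X:ext N ==> ap c X:ext X"
  using choice[OF N(1) K, of "%X x. x:ext X"] N(2) by blast
 define rest where "rest f = sepm K (%x. x ~: ext (rgm f))" for f
 have restD: "DefF s ==> DefF (%e. rest (s e))" for s unfolding rest_def
  by (rule Def_lift[of "%f. sepm K (%x. x ~: ext (rgm f))"]) (intro def_intro K; assumption)+
 have rest: "rest f:M" "ext (rest f) = ext K - ext (rgm f)" if f: "f:M" for f
 proof -
  have d: "Def (%e. e 0 ~: ext (rgm f))" by (intro def_intro f)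
  show "rest f:M" "ext (rest f) = ext K - ext (rgm f)" using sepm[OF K d] unfolding rest_def by auto
 qed
 \<comment> \<open>The value \<open>K\<close> marks that nothing remains; it cannot be mistaken for
   an element, because no set is an element of itself.\<close>
 define Op where "Op i f = (if EX x:ext (rest f). x = x then ap c (rest f) else K)" for i f :: 'a
 have OpD: "DefF (%e. Op (e 0) (e 1))" unfolding Op_def by (intro def_intro restD c K)
 define k where "k = hart K"
 note k = hart[OF K, folded k_def]
 have kM: "ext k <= M" using ext_M by blast
 define B where "B = cup K (upr K K)"
 have B: "B:M" "ext B = insert K (ext K)" using K unfolding B_def by auto
 have restN: "rest f:ext N" if "f:M" "ext (rest f) ~= {}" for f using N(2) rest[OF that(1)] that(2) by auto
 have OpB: "Op i f:ext B" if f: "f:M" for i f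
  using c(3)[OF restN[OF f]] rest(2)[OF f] unfolding Op_def B(2) by auto
 obtain F where F: "!!i. i:ext k ==> F i = Op i (mk {pr j (F j) | j. j:ext k & ordlt j i})"
  "!!i. i:ext k ==> F i:M" "coded {pr j (F j) | j. j:ext k}"
  "!!i. i:ext k ==> coded {pr j (F j) | j. j:ext k & ordlt j i}"
  using bounded_recursion[OF k(1) B(1) wfp_on_ordlt[OF kM] ordlt_trans Def_ordlt[OF DefF_var DefF_var] OpD OpB]
  by blast
 define g where "g = mk {pr j (F j) | j. j:ext k}"
 have gM: "g:M" unfolding g_def by (rule mk_M[OF F(3)])
 have ga: "ap g j = F j" if "j:ext k" for j unfolding g_def
  by (rule graph_ap[OF F(3) kM]) (use F(2) that in blast)+
 have rg: "ext (rgm (mk {pr j (F j) | j. j:ext k & ordlt j i})) = F ` {j:ext k. ordlt j i}" if i: "i:ext k" for i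
  using rgm_graph[of F "{j:ext k. ordlt j i}"] F(4)[OF i] F(2) kM by auto
 have "EX i:ext k. F i = K"
 proof (rule ccontr)
  assume n: "~(EX i:ext k. F i = K)"
  have ne: "F i:ext K - F ` {j:ext k. ordlt j i}" if i: "i:ext k" for i
  proof -
   let ?f = "mk {pr j (F j) | j. j:ext k & ordlt j i}"
   have f: "?f:M" by (rule mk_M[OF F(4)[OF i]])
   have "Op i ?f ~= K" using n F(1)[OF i] i by metis
   then have "ext (rest ?f) ~= {}" "Op i ?f = ap c (rest ?f)" unfolding Op_def by (auto split: if_splits)
   then have "F i:ext (rest ?f)" using c(3)[OF restN[OF f]] F(1)[OF i] by simp
   then show ?thesis unfolding rest(2)[OF f] rg[OF i] .
  qed
  have "card_le k K"
  proof (rule card_leI[OF k(1) K, of "ap g"])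
   show "ap g x:ext K" if "x:ext k" for x using ga[OF that] ne[OF that] by auto
   show "DefF (%e. ap g (e 0))" by (intro def_intro gM)
   show "inj_on (ap g) (ext k)"
   proof (rule inj_onI)
    fix x y assume xy: "x:ext k" "y:ext k" "ap g x = ap g y"
    then have e: "F x = F y" using ga by simp
    have "~ordlt x y" using ne[OF xy(2)] e xy(1) by (metis (mono_tags, lifting) Diff_iff imageI mem_Collect_eq)
    moreover have "~ordlt y x" using ne[OF xy(1)] e xy(2) by (metis (mono_tags, lifting) Diff_iff imageI mem_Collect_eq)
    moreover have "is_ordinal x" "is_ordinal y" using ord_elem[OF k(3)] xy by blast+
    ultimately show "x = y" using ord_linear unfolding ordlt_def by blast
   qed
  qed
  then show False using k(4) by blast
 qed
 then obtain i where i: "i:ext k" "F i = K" by blast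
 let ?f = "mk {pr j (F j) | j. j:ext k & ordlt j i}"
 have f: "?f:M" by (rule mk_M[OF F(4)[OF i(1)]])
 have "ext (rest ?f) = {}"
 proof (rule ccontr)
  assume "ext (rest ?f) ~= {}"
  then have "Op i ?f:ext K" using c(3)[OF restN[OF f]] rest(2)[OF f] unfolding Op_def by auto
  then show False using F(1)[OF i(1)] i(2) E_irrefl[OF K] by simp
 qed
 then have KF: "ext K <= F ` {j:ext k. ordlt j i}" unfolding rest(2)[OF f] rg[OF i(1)] by blast
 have "ext K <= ap g ` ext i"
 proof
  fix x assume "x:ext K"
  then obtain j where "j:ext k" "ordlt j i" "x = F j" using KF by blast
  then show "x:ap g ` ext i" using ga[of j] unfolding ordlt_def by (metis imageI)
 qed
 then show ?thesis using that[of i g] ord_elem[OF k(3) i(1)] gM by blast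
qed

end

text \<open>An injective pairing made of sums and products only, hence definable by the rules for
  those. The sum \<open>m + n\<close> can be recovered because \<open>m\<close> is smaller than the
  gap to the next square.\<close>

definition enc :: "nat => nat => nat" where "enc m n = (m + n) * (m + n) + m"

lemma enc_ge: "m <= enc m n" "n <= enc m n"
proof -
 have "k <= k * k" for k :: nat by (cases k) auto
 from this[of "m + n"] show "m <= enc m n" "n <= enc m n" unfolding enc_def by linarith+
qed

lemma enc_inject [simp]: "enc m n = enc m' n' <-> m = m' & n = n'"
proof
 assume e: "enc m n = enc m' n'"
 have lt: "enc a b < enc a' b'" if "a + b < a' + b'" for a b a' b'
 proof -
  have "Suc (a + b) * Suc (a + b) <= (a' + b') * (a' + b')" using that by (intro mult_le_mono) auto
  then show ?thesis unfolding enc_def by simp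
 qed
 have "m + n = m' + n'" using e lt by (metis linorder_neqE_nat less_irrefl)
 then show "m = m' & n = n'" using e unfolding enc_def by simp
qed simp

context zmod begin

lemma DefN_enc [def_intro]: "DefN s ==> DefN t ==> DefN (%e. enc (s e) (t e))"
 unfolding enc_def by (intro def_intro)

lemma om_sq: "card_le (times om om) om"
proof (rule card_leI[of _ _ "%z. num (enc (dn (p1 z)) (dn (p2 z)))"])
 show "DefF (%e. num (enc (dn (p1 (e 0))) (dn (p2 (e 0)))))" by (intro def_intro)
 have e: "ext (times om om) = {pr (num m) (num n) | m n. True}" by (auto simp: ext_om)
 show "inj_on (%z. num (enc (dn (p1 z)) (dn (p2 z)))) (ext (times om om))"
  unfolding e by (rule inj_onI) auto
qed (auto simp: ext_om)

lemma infinite_om: "infinite (ext om)"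
 unfolding ext_om using finite_imageD[of num UNIV] num_eq by (auto simp: inj_on_def)

lemma is_cardinal_om: "is_cardinal om"
 unfolding is_cardinal_def
proof (intro conjI ord_om ballI notI)
 fix x assume x: "x:ext om" "card_eq x om"
 then obtain g where "bij_betw (ap g) (ext x) (ext om)" using card_eqE by metis
 moreover have "finite (ext x)" using x(1) unfolding ext_om using ext_num by auto
 ultimately show False using infinite_om bij_betw_finite by blast
qed

lemma is_countable_iff: "is_countable x <-> card_le x om"
 unfolding is_countable_def is_omega_iff by simp

lemma wfp_on_wf:
 assumes "wf R" "!!x y. x:A ==> y:A ==> Q x y ==> (x, y):R" shows "wfp_on A Q"
 unfolding wfp_on_def
proof (intro allI impI ballI)
 fix P x assume h: "ALL x:A. (ALL y:A. Q y x --> P y) --> P x" and x: "x:A"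
 have "x:A --> P x"
 proof (induction x rule: wf_induct[OF assms(1)])
  case (1 x) then show ?case using h assms(2) by blast
 qed
 then show "P x" using x by blast
qed

lemma wf_E: "wf {(x, y). y:M & x:ext y}"
 unfolding wf_def
proof (intro allI impI)
 fix P x assume h: "ALL x. (ALL y. (y, x):{(x, y). y:M & x:ext y} --> P y) --> P x"
 show "P x"
 proof (cases "x:M")
  case True
  then show ?thesis by (induction rule: E_induct) (use h in blast)
 qed (use h in blast)
qed

end

context zfc begin

text \<open>Pairs are ordered by their maximum and then lexicographically. An initial segment lies
  in the square of a successor of an ordinal below \<open>hart mu\<close>, so it has size at most
  \<open>mu\<close>; hence the collapse of this order takes its values in \<open>hart mu\<close> and
  is the injection sought.\<close>

lemma hart_square:
 assumes m: "is_ordinal mu" "card_le (times mu mu) mu" "a0:ext mu" "a1:ext mu" "a0 ~= a1"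
 shows "card_le (times (hart mu) (hart mu)) (hart mu)"
proof -
 have mM: "mu:M" using ordM m by blast
 define k where "k = hart mu"
 note k = hart[OF mM, folded k_def]
 have kM: "ext k <= M" using ext_M by blast
 have am: "a0:M" "a1:M" using m ext_M by blast+
 have suck: "card_le (suc x) mu" if x: "x:ext k" for x
 proof -
  have xM: "x:M" using x kM by blast
  have "card_le x mu" using k(2) x by blast
  then obtain f where f: "f:M" "inj_on (ap f) (ext x)" "!!u. u:ext x ==> ap f u:ext mu"
   using card_leE by metis
  \<comment> \<open>The second coordinate separates the extra element \<open>x\<close> of
    \<open>suc x\<close> from the old ones; this is where two distinct elements of \<open>mu\<close>
    are used.\<close>
  let ?t = "%u. if u:ext x then pr (ap f u) a0 else pr a0 a1"
  have "card_le (suc x) (times mu mu)"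
  proof (rule card_leI[of _ _ ?t])
   show "DefF (%e. ?t (e 0))" by (intro def_intro f am xM)
   show "?t u:ext (times mu mu)" if "u:ext (suc x)" for u
    unfolding ext_times[OF mM mM] using f(3) m(3,4) by auto
   show "inj_on ?t (ext (suc x))"
   proof (rule inj_onI)
    fix u v assume uv: "u:ext (suc x)" "v:ext (suc x)" "?t u = ?t v"
    have fM: "ap f w:M" if "w:ext x" for w using f(3)[OF that] ext_M by blast
    have e: "w = x" if "w:ext (suc x)" "w ~: ext x" for w using that xM by auto
    show "u = v"
    proof (cases "u:ext x"; cases "v:ext x")
     assume "u:ext x" "v:ext x"
     then show "u = v" using uv(3) fM am f(2) unfolding inj_on_def by simp
    next
     assume "u:ext x" "v ~: ext x"
     then show "u = v" using uv(3) fM[of u] am m(5) by simp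
    next
     assume "u ~: ext x" "v:ext x"
     then show "u = v" using uv(3) fM[of v] am m(5) by simp
    qed (use uv e in blast)
   qed
  qed (use xM mM in auto)
  then show ?thesis using card_le_trans m(2) xM mM suc by blast
 qed
 define T where "T = times k k"
 have TM: "T:M" unfolding T_def using k(1) by simp
 have T: "ext T = {pr x y | x y. x:ext k & y:ext k}" unfolding T_def using ext_times k(1) by blast
 have pT: "p1 z:ext k & p2 z:ext k & z = pr (p1 z) (p2 z)" if "z:ext T" for z
  using that unfolding T by (auto simp: ext_M[of _ k])
 have ko: "is_ordinal x" if "x:ext k" for x using ord_elem[OF k(3) that] .
 define mx where "mx z = cup (p1 z) (p2 z)" for z
 have mxk: "mx z:ext k & (p1 z = mx z \<or> p1 z:ext (mx z)) & (p2 z = mx z \<or> p2 z:ext (mx z))"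
  if z: "z:ext T" for z
 proof -
  have o: "is_ordinal (p1 z)" "is_ordinal (p2 z)" "p1 z:M" "p2 z:M" "p1 z:ext k" "p2 z:ext k"
   using pT[OF z] ko ext_M[of _ k] by auto
  have c: "cup a b = b" if "a:ext b \<or> a = b" "is_ordinal b" "a:M" "b:M" for a b
  proof (rule ext_eqI)
   have "ext a <= ext b" using that(1) ord_trans[OF that(2)] by blast
   then show "ext (cup a b) = ext b" using that by auto
  qed (use that in auto)
  have cc: "cup (p1 z) (p2 z) = cup (p2 z) (p1 z)" by (rule ext_eqI) (use o in auto)
  show ?thesis using ord_linear[OF o(1,2)] c[of "p1 z" "p2 z"] c[of "p2 z" "p1 z"] o cc
   unfolding mx_def by auto
 qed
 define L where "L z w <-> z:ext T & w:ext T & (mx z:ext (mx w) \<or> (mx z = mx w &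
   (p1 z:ext (p1 w) \<or> (p1 z = p1 w & p2 z:ext (p2 w)))))" for z w
 have LD: "Def (%e. L (e 0) (e 1))" unfolding L_def mx_def by (intro def_intro TM)
 have LD2: "DefF s ==> DefF t ==> Def (%e. L (s e) (t e))" for s t by (rule Def_R2[OF LD])
 have Ltr: "transp L"
 proof (rule transpI)
  fix x y z assume h: "L x y" "L y z"
  then have m: "x:ext T" "y:ext T" "z:ext T" unfolding L_def by auto
  have tr: "a:ext c" if "a:ext b" "b:ext c" "c:ext k" for a b c
   using ord_trans[OF ko[OF that(3)] that(2,1)] .
  have c: "mx z:ext k" "p1 z:ext k" "p2 z:ext k" using mxk[OF m(3)] pT[OF m(3)] by auto
  show "L x z" using h m tr[OF _ _ c(1), of "mx x" "mx y"] tr[OF _ _ c(2), of "p1 x" "p1 y"]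
   tr[OF _ _ c(3), of "p2 x" "p2 y"] unfolding L_def by (elim conjE disjE) simp_all
 qed
 let ?W = "{(x, y). y:M & x:ext y}"
 have wfS: "wf (inv_image (?W <*lex*> ?W <*lex*> ?W) (%z. (mx z, p1 z, p2 z)))"
  by (intro wf_inv_image wf_lex_prod wf_E)
 have "(z, w):inv_image (?W <*lex*> ?W <*lex*> ?W) (%z. (mx z, p1 z, p2 z))" if "L z w" for z w
 proof -
  have "mx w:M" "p1 w:M" "p2 w:M" using that mxk[of w] pT[of w] kM unfolding L_def by auto
  then show ?thesis using that unfolding L_def by auto
 qed
 then have Lwf: "wfp_on (ext T) L" by (rule wfp_on_wf[OF wfS])
 have Ltot: "L x y \<or> x = y \<or> L y x" if xy: "x:ext T" "y:ext T" for x y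
 proof -
  have "mx x:ext (mx y) \<or> mx x = mx y \<or> mx y:ext (mx x)" using ord_linear ko mxk xy by blast
  moreover have "p1 x:ext (p1 y) \<or> p1 x = p1 y \<or> p1 y:ext (p1 x)" using ord_linear ko pT xy by blast
  moreover have "p2 x:ext (p2 y) \<or> p2 x = p2 y \<or> p2 y:ext (p2 x)" using ord_linear ko pT xy by blast
  moreover have "p1 x = p1 y ==> p2 x = p2 y ==> x = y" using pT[OF xy(1)] pT[OF xy(2)] by metis
  ultimately show ?thesis using xy unfolding L_def by metis
 qed
 \<comment> \<open>The collapse: each pair is sent to the set of earlier values. The default
   \<open>k\<close> only provides an a priori bound for the recursion, and \<open>main\<close> shows
   that it never occurs.\<close>
 define Op where "Op z f = (if rgm f:ext k then rgm f else k)" for z f :: 'a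
 have OpD: "DefF (%e. Op (e 0) (e 1))" unfolding Op_def by (intro def_intro k(1))
 have OpB: "Op i f:ext (suc k)" for i f unfolding Op_def using k(1) by auto
 obtain F where F: "!!i. i:ext T ==> F i = Op i (mk {pr j (F j) | j. j:ext T & L j i})"
  "!!i. i:ext T ==> F i:M" "coded {pr j (F j) | j. j:ext T}"
  "!!i. i:ext T ==> coded {pr j (F j) | j. j:ext T & L j i}"
  using bounded_recursion[OF TM suc(1)[OF k(1)] Lwf Ltr LD OpD OpB] by blast
 have TsM: "ext T <= M" using ext_M by blast
 define g where "g = mk {pr j (F j) | j. j:ext T}"
 have gM: "g:M" unfolding g_def by (rule mk_M[OF F(3)])
 have ga: "ap g j = F j" if "j:ext T" for j unfolding g_def
  by (rule graph_ap[OF F(3) TsM]) (use F(2) that in blast)+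
 have main: "F z:ext k & ext (F z) = F ` {y:ext T. L y z}" if z: "z:ext T" for z
 proof (rule wfp_on_induct[OF Lwf z])
  fix z assume z: "z:ext T"
   and IH: "!!y. y:ext T ==> L y z ==> F y:ext k & ext (F y) = F ` {w:ext T. L w y}"
  define r where "r = rgm (mk {pr j (F j) | j. j:ext T & L j z})"
  have r: "r:M" "ext r = F ` {y:ext T. L y z}"
   using rgm_M(1)[OF mk_M[OF F(4)[OF z]]] rgm_graph[of F "{y:ext T. L y z}"] F(4)[OF z] F(2) TsM
   unfolding r_def by auto
  have ro: "is_ordinal r"
  proof (rule is_ordinalI[OF r(1)])
   fix v assume "v:ext r"
   then obtain y where y: "y:ext T" "L y z" "v = F y" unfolding r(2) by blast
   show "is_ordinal v" using IH[OF y(1,2)] ko y(3) by blast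
   have "ext v = F ` {w:ext T. L w y}" using IH[OF y(1,2)] y(3) by blast
   then show "ext v <= ext r" unfolding r(2) using transpD[OF Ltr _ y(2)] by blast
  qed
  have dL: "Def (%e. L (e 0) z)" by (intro LD2 def_intro ext_M[OF z])
  define sg where "sg = sepm T (%y. L y z)"
  have sg: "sg:M" "ext sg = {y:ext T. L y z}" using sepm[OF TM dL] unfolding sg_def by auto
  have m': "mx z:ext k" "mx z:M" using mxk[OF z] kM by auto
  have "ext sg <= ext (times (suc (mx z)) (suc (mx z)))"
  proof
   fix y assume "y:ext sg"
   then have y: "y:ext T" "L y z" unfolding sg(2) by auto
   have "mx y:ext (mx z) \<or> mx y = mx z" using y(2) unfolding L_def by blast
   then have "p1 y:ext (suc (mx z))" "p2 y:ext (suc (mx z))"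
    using mxk[OF y(1)] ord_trans[OF ko[OF m'(1)]] m'(2) by auto
   then show "y:ext (times (suc (mx z)) (suc (mx z)))"
    using pT[OF y(1)] ext_times[OF suc(1)[OF m'(2)] suc(1)[OF m'(2)]] by blast
  qed
  then have "card_le sg (times (suc (mx z)) (suc (mx z)))" using card_le_sub sg(1) m'(2) by simp
  moreover have "card_le (times (suc (mx z)) (suc (mx z))) (times mu mu)"
   by (rule card_le_times) (use suck[OF m'(1)] m'(2) mM in auto)
  moreover have "card_le r sg"
   by (rule card_le_surj[OF r(1) sg(1), of "ap g"])
     (use ga in \<open>auto simp: r sg intro!: def_intro gM\<close>)
  ultimately have "card_le r mu" using card_le_trans[OF _ _ r(1)] m(2) sg(1) mM m'(2) times_M suc(1) by meson
  then have "r:ext k" using k(2) ro by blast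
  then have "F z = r" using F(1)[OF z] unfolding Op_def r_def[symmetric] by simp
  then show "F z:ext k & ext (F z) = F ` {y:ext T. L y z}" using \<open>r:ext k\<close> r(2) by simp
 qed
 have nL: "~L x y" if "F x = F y" for x y
 proof
  assume "L x y"
  then have xy: "x:ext T" "y:ext T" unfolding L_def by auto
  have "F x:ext (F y)" using main[OF xy(2)] \<open>L x y\<close> xy(1) by blast
  then show False using that E_irrefl[OF F(2)[OF xy(2)]] by simp
 qed
 show ?thesis unfolding k_def[symmetric] T_def[symmetric]
 proof (rule card_leI[OF TM k(1), of "ap g"])
  show "DefF (%e. ap g (e 0))" by (intro def_intro gM)
  show "inj_on (ap g) (ext T)"
  proof (rule inj_onI)
   fix x y assume xy: "x:ext T" "y:ext T" "ap g x = ap g y"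
   then have "F x = F y" "F y = F x" using ga by auto
   then show "x = y" using Ltot[OF xy(1,2)] nL by blast
  qed
 qed (use ga main in auto)
qed

definition w1 where "w1 = hart om"
definition w2 where "w2 = hart w1"

lemma w1_M [simp, def_intro]: "w1:M" unfolding w1_def by (rule hart_M[OF om_M])
lemma w2_M [simp, def_intro]: "w2:M" unfolding w2_def by (rule hart_M[OF w1_M])

lemma ord_w: "is_ordinal w1" "is_ordinal w2"
 using ord_hart[OF om_M] ord_hart[OF w1_M] unfolding w2_def w1_def by blast+

lemma w1_iff: "x:ext w1 <-> is_ordinal x & card_le x om" unfolding w1_def by (rule hart_iff[OF om_M])
lemma w2_iff: "x:ext w2 <-> is_ordinal x & card_le x w1" unfolding w2_def by (rule hart_iff[OF w1_M])

lemma om_w1: "om:ext w1" unfolding w1_iff using ord_om card_le_sub[OF om_M om_M] by blast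
lemma w1_w2: "w1:ext w2" unfolding w2_iff using ord_w card_le_sub[OF w1_M w1_M] by blast

lemma num_w1: "num n:ext w1" using ord_trans[OF ord_w(1) om_w1] ext_om by blast
lemma num_w2: "num n:ext w2" using ord_trans[OF ord_w(2) w1_w2 num_w1] .

lemma w1_sq: "card_le (times w1 w1) w1" unfolding w1_def
proof (rule hart_square[OF ord_om om_sq])
 show "num 0:ext om" "num 1:ext om" unfolding ext_om by blast+
 show "num 0 ~= num 1" unfolding num_eq by simp
qed

lemma w2_sq: "card_le (times w2 w2) w2" unfolding w2_def
proof (rule hart_square[OF ord_w(1) w1_sq])
 show "num 0:ext w1" "num 1:ext w1" by (rule num_w1)+
 show "num 0 ~= num 1" unfolding num_eq by simp
qed

lemma not_w1: "~card_le w1 om" and not_w2: "~card_le w2 w1"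
 unfolding w2_def using hart_not[OF om_M] hart_not[OF w1_M] unfolding w1_def by auto

lemma is_cardinal_w1: "is_cardinal w1" unfolding w1_def by (rule next_hart[OF ord_om is_cardinal_om])

end

context zfc begin

text \<open>A member \<open>s\<close> of the domain of a name \<open>t\<close> is not an element of
  \<open>t\<close> but lies in its transitive closure, so induction on names runs along
  \<open>tclt\<close>.\<close>

lemma pair_induct [consumes 1, case_names step]:
 assumes "t:M" "!!t. t:M ==> (!!s c. s:M ==> c:M ==> pr s c:ext t ==> P s) ==> P t"
 shows "P t"
proof (rule wfp_on_induct[OF wfp_on_tclt assms(1)])
 fix t assume t: "t:M" and IH: "!!s. s:M ==> tclt s t ==> P s"
 show "P t"
 proof (rule assms(2)[OF t])
  fix s c assume s: "s:M" "c:M" "pr s c:ext t"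
  have "upr s c:ext (pr s c)" "s:ext (upr s c)" using s by (auto simp: ext_pr)
  then have "tclt s t" using tclt_E s(3) transpD[OF tclt_trans] by meson
  then show "P s" using IH s(1) by blast
 qed
qed

end

section \<open>Conditions and generic filters\<close>

locale forcing = zfc M E for M :: "'a set" and E +
 fixes p r one :: 'a and G :: "'a set"
 assumes pre: "is_preorder p r" and one: "one:ext p" "!!c. c:ext p ==> (c, one):rel r"
  and gen: "is_generic_filter p r G"
begin

definition le where "le x y <-> (x, y):rel r"

lemma prM [simp, def_intro]: "p:M" "r:M"
 using pre unfolding is_preorder_def is_rel_def by auto

lemma one_M [simp, def_intro]: "one:M" using one ext_M by blast

lemma Def_le [def_intro]: "DefF s ==> DefF t ==> Def (%e. le (s e) (t e))"
 unfolding le_def by (intro def_intro)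

lemma le_p: assumes "le x y" shows "x:ext p" "y:ext p"
proof -
 have "is_rel r p p" using pre unfolding is_preorder_def by blast
 moreover obtain z where z: "z:ext r" "opair z x y" using assms unfolding le_def rel_def by blast
 ultimately obtain x' y' where "x':ext p" "y':ext p" "opair z x' y'" unfolding is_rel_def by blast
 then show "x:ext p" "y:ext p" using opair_inject[OF z(2)] by blast+
qed

lemma le_refl: "x:ext p ==> le x x"
 using pre unfolding is_preorder_def refl_on_def le_def by blast

lemma le_trans: "le x y ==> le y z ==> le x z"
 using pre unfolding is_preorder_def trans_def le_def by blast

lemma le_one: "x:ext p ==> le x one" using one unfolding le_def by blast

lemma genD: "G <= ext p" "G ~= {}" "ALL x:G. ALL y:ext p. le x y --> y:G"
  "ALL x:G. ALL y:G. EX z:G. le z x & le z y" "!!d. is_dense p r d ==> G Int ext d ~= {}"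
 using gen unfolding is_generic_filter_def le_def by simp_all

lemma G_p: "x:G ==> x:ext p" using genD(1) by blast
lemma G_M: "x:G ==> x:M" using G_p ext_M by blast
lemma G_up: assumes "x:G" "le x y" shows "y:G"
 using genD(3) assms le_p(2)[OF assms(2)] by blast
lemma G_dir: "x:G ==> y:G ==> EX z:G. le z x & le z y"
 using genD(4) by blast
lemma one_G: "one:G"
proof -
 obtain x where "x:G" using genD(2) by blast
 then show ?thesis using G_up[OF _ le_one[OF G_p]] by blast
qed

text \<open>\<open>D\<close> is dense only below \<open>q\<close>; adding the conditions
  incompatible with \<open>q\<close> makes it dense everywhere, and no such condition lies in a
  filter that contains \<open>q\<close>. A definable \<open>D\<close> suffices, as separation turns
  it into a set.\<close>

lemma generic_below:
 assumes "q:G" "Def (%e. D (e 0))" "!!q'. le q' q ==> EX s. le s q' & D s"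
 shows "EX s:G. D s"
proof -
 have qM: "q:M" "q:ext p" using assms(1) G_M G_p by auto
 define d where "d = sepm p (%x. D x \<or> (ALL y:ext p. ~(le y x & le y q)))"
 have dd: "Def (%e. D (e 0) \<or> (ALL y:ext p. ~(le y (e 0) & le y q)))"
  by (intro def_intro assms(2) qM)
 have d: "d:M" "ext d = {x:ext p. D x \<or> (ALL y:ext p. ~(le y x & le y q))}"
  using sepm[OF prM(1) dd] unfolding d_def by auto
 have "is_dense p r d" unfolding is_dense_def
 proof (intro conjI ballI d(1))
  show "ext d <= ext p" using d(2) by blast
  fix x assume x: "x:ext p"
  show "EX y:ext d. (y, x):rel r"
  proof (cases "EX y:ext p. le y x & le y q")
   case True
   then obtain y where y: "le y x" "le y q" by blast
   obtain s where s: "le s y" "D s" using assms(3)[OF y(2)] by blast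
   have "s:ext d" unfolding d(2) using s le_p by blast
   moreover have "le s x" using le_trans s(1) y(1) by blast
   ultimately show ?thesis unfolding le_def by blast
  next
   case False
   then have "x:ext d" unfolding d(2) using x by blast
   then show ?thesis using le_refl[OF x] unfolding le_def by blast
  qed
 qed
 then obtain s where s: "s:G" "s:ext d" using genD(5) by blast
 obtain z where "le z s" "le z q" using G_dir s(1) assms(1) by blast
 then have "D s" using s(2) le_p unfolding d(2) by blast
 then show ?thesis using s(1) by blast
qed

subsection \<open>Names\<close>

lemma is_name_iff: "is_name p t <-> t:M & (ALL z:ext t. EX s:M. EX c:ext p. z = pr s c & is_name p s)"
proof
 assume "is_name p t"
 then show "t:M & (ALL z:ext t. EX s:M. EX c:ext p. z = pr s c & is_name p s)"
 proof (cases rule: is_name.cases)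
  case 1
  show ?thesis
  proof (intro conjI ballI 1(1))
   fix z assume "z:ext t"
   then obtain s c where "opair z s c" "c:ext p" "is_name p s" using 1(2) by blast
   then show "EX s:M. EX c:ext p. z = pr s c & is_name p s" unfolding opair_iff by blast
  qed
 qed
next
 assume a: "t:M & (ALL z:ext t. EX s:M. EX c:ext p. z = pr s c & is_name p s)"
 show "is_name p t"
 proof (rule is_name.intros)
  fix z assume "z:ext t"
  then obtain s c where "s:M" "c:ext p" "z = pr s c" "is_name p s" using a by blast
  then show "EX s c. opair z s c & c:ext p & is_name p s" unfolding opair_iff using ext_M by blast
 qed (use a in blast)
qed

lemma name_M: "is_name p t ==> t:M" using is_name_iff by blast

lemma name_pr: assumes "is_name p t" "pr s c:ext t" "s:M" "c:M" shows "is_name p s" "c:ext p"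
proof -
 obtain s' c' where "s':M" "c':ext p" "pr s c = pr s' c'" "is_name p s'"
  using assms(1,2) is_name_iff[of t] by blast
 then show "is_name p s" "c:ext p" using pr_inject[OF assms(3,4), of s' c'] ext_M by auto
qed

definition nset where
 "nset A <-> (ALL u:ext A. ALL z:ext u. EX s:ext A. EX c:ext p. z = pr s c)"

lemma Def_nset: "DefF s ==> Def (%e. nset (s e))"
 unfolding nset_def by (rule Def_R1[of "%A. ALL u:ext A. ALL z:ext u. EX s:ext A. EX c:ext p. z = pr s c"]) (intro def_intro; assumption)+

text \<open>\<open>is_name\<close> is an inductive predicate of HOL, about which the structure knows
  nothing. A set closed under passing to names inside its members witnesses it internally and makes
  it definable.\<close>

lemma name_nset: "is_name p t <-> (EX A:M. t:ext A & nset A)"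
proof
 assume "EX A:M. t:ext A & nset A"
 then obtain A where A: "A:M" "t:ext A" "nset A" by blast
 have "u:ext A --> is_name p u" if "u:M" for u using that
 proof (induction rule: pair_induct)
  case (step u)
  show ?case
  proof
   assume u: "u:ext A"
   have "EX s:M. EX c:ext p. z = pr s c & is_name p s" if z: "z:ext u" for z
   proof -
    obtain s c where sc: "s:ext A" "c:ext p" "z = pr s c" using A(3) u z unfolding nset_def by blast
    then have "is_name p s" using step.IH[of s c] ext_M z by blast
    then show ?thesis using sc ext_M by blast
   qed
   then show "is_name p u" using is_name_iff step(1) by blast
  qed
 qed
 then show "is_name p t" using A(2) ext_M by blast
next
 have "is_name p t --> (EX A:M. t:ext A & nset A)" if "t:M" for t using that
 proof (induction rule: pair_induct)
  case (step t)
  show ?case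
  proof
   assume t: "is_name p t"
   obtain T where T: "T:M" "ext (upr t t) <= ext T" "ALL y:ext T. ext y <= ext T"
    using tc_ex[of "upr t t"] step(1) by auto
   have Tp: "s:ext T" if u: "u:ext T" "pr s c:ext u" "s:M" "c:M" for u s c
   proof -
    have "pr s c:ext T" using T(3) u(1,2) by blast
    then have "upr s c:ext T" using T(3) u ext_pr by blast
    then show ?thesis using T(3) u(3,4) upr(2) by blast
   qed
   let ?Q = "%u. u = t \<or> (EX A':ext (pw T). nset A' & u:ext A')"
   have d: "Def (%e. ?Q (e 0))" by (intro def_intro step(1) T(1) Def_nset)
   \<comment> \<open>The witnesses for all names inside \<open>t\<close> are merged. Each of them is
     first cut down to the transitive set \<open>T\<close>, so that the union is separated from
     \<open>T\<close> and no witnesses have to be chosen.\<close>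
   define A where "A = sepm T ?Q"
   have A: "A:M" "ext A = {u:ext T. ?Q u}" using sepm[OF T(1) d] unfolding A_def by auto
   have tA: "t:ext A" unfolding A(2) using T(2) step(1) by auto
   have "nset A" unfolding nset_def
   proof (intro ballI)
    fix u z assume u: "u:ext A" and z: "z:ext u"
    have uT: "u:ext T" using u A(2) by blast
    show "EX s:ext A. EX c:ext p. z = pr s c"
    proof (cases "u = t")
     case True
     then obtain s c where sc: "s:M" "c:ext p" "z = pr s c" "is_name p s" using t z is_name_iff[of t] by blast
     have cM: "c:M" using sc ext_M by blast
     have "pr s c:ext t" using z sc(3) True by simp
     from step.IH[OF sc(1) cM this] obtain B where B: "B:M" "s:ext B" "nset B" using sc(4) by blast
     have dB: "Def (%e. e 0:ext B)" by (intro def_intro B)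
     define B' where "B' = sepm T (%x. x:ext B)"
     have B': "B':M" "ext B' = {x:ext T. x:ext B}" using sepm[OF T(1) dB] unfolding B'_def by auto
     have "nset B'" unfolding nset_def
     proof (intro ballI)
      fix u z assume uz: "u:ext B'" "z:ext u"
      then obtain s c where s: "s:ext B" "c:ext p" "z = pr s c" using B(3) B'(2) unfolding nset_def by blast
      then have "s:ext T" using Tp[of u s c] uz B'(2) ext_M by blast
      then show "EX s:ext B'. EX c:ext p. z = pr s c" using s B'(2) by blast
     qed
     moreover have sT: "s:ext T" using Tp[OF uT, of s c] z sc cM by blast
     moreover have "B':ext (pw T)" using B' T(1) by auto
     ultimately have "s:ext A" unfolding A(2) using B(2) B'(2) by blast
     then show ?thesis using sc by blast
    next
     case False
     then obtain A' where A': "A':ext (pw T)" "nset A'" "u:ext A'" using u A(2) by blast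
     then obtain s c where s: "s:ext A'" "c:ext p" "z = pr s c" using z unfolding nset_def by blast
     moreover have "s:ext T" using s(1) A'(1) T(1) by auto
     ultimately have "s:ext A" unfolding A(2) using A' by blast
     then show ?thesis using s by blast
    qed
   qed
   then show "EX A:M. t:ext A & nset A" using A(1) tA by blast
  qed
 qed
 then show "is_name p t ==> EX A:M. t:ext A & nset A" using name_M by blast
qed

lemma Def_is_name [def_intro]: "DefF s ==> Def (%e. is_name p (s e))"
 by (rule Def_R1[of "is_name p"], unfold name_nset) (intro def_intro Def_nset; assumption)+

lemma active_iff: "s:active G t <-> s:M & (EX c:G. pr s c:ext t)"
 unfolding active_def rel_iff using G_M by blast

subsection \<open>Forcing equality\<close>

text \<open>Equality is forced by a set-sized bisimulation, so no recursion on names is needed.\<close>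

definition half :: "('a => 'a => 'a => bool) => 'a => 'a => 'a => bool" where
 "half X q s t <-> (ALL s':M. ALL c:M. ALL q':ext p. pr s' c:ext s --> le q' q --> le q' c -->
   (EX q'':ext p. EX t':M. EX c':M. le q'' q' & pr t' c':ext t & le q'' c' & X q'' s' t'))"

definition bis where
 "bis R <-> (ALL q:ext p. ALL s:M. ALL t:M. pr q (pr s t):ext R -->
   half (%q s t. pr q (pr s t):ext R) q s t & half (%q t s. pr q (pr s t):ext R) q t s)"

definition feq where
 "feq q s t <-> q:ext p & (EX R:M. bis R & pr q (pr s t):ext R)"

lemma Def_feq [def_intro]: "DefF s ==> DefF t ==> DefF u ==> Def (%e. feq (s e) (t e) (u e))"
 by (rule Def_R3[of feq], unfold feq_def bis_def half_def) (intro def_intro; assumption)+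

lemma half_mono: "half X q s t ==> (!!q s t. q:ext p ==> s:M ==> t:M ==> X q s t ==> Y q s t) ==> half Y q s t"
 unfolding half_def by meson

lemma half_le: "half X q s t ==> le q' q ==> half X q' s t"
 unfolding half_def using le_trans by meson

lemma feq_unfold:
 assumes "feq q s t" "s:M" "t:M"
 shows "half feq q s t" "half (%q t s. feq q s t) q t s"
proof -
 obtain R where R: "R:M" "bis R" "pr q (pr s t):ext R" "q:ext p" using assms(1) unfolding feq_def by blast
 have h: "half (%q s t. pr q (pr s t):ext R) q s t" "half (%q t s. pr q (pr s t):ext R) q t s"
  using R(2)[unfolded bis_def, rule_format, OF R(4) assms(2,3) R(3)] by blast+
 show "half feq q s t" by (rule half_mono[OF h(1)]) (use R feq_def in blast)
 show "half (%q t s. feq q s t) q t s" by (rule half_mono[OF h(2)]) (use R feq_def in blast)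
qed

lemma half_T:
 assumes "half X q s t" "s:M" "t:M"
  "!!q s' t' c c'. q:ext p ==> s':M ==> t':M ==> c:M ==> c':M ==>
   pr s' c:ext s ==> pr t' c':ext t ==> X q s' t' ==> Y q s' t'"
 shows "half Y q s t"
 unfolding half_def
proof (intro ballI impI)
 fix s' c q' assume h: "s':M" "c:M" "q':ext p" "pr s' c:ext s" "le q' q" "le q' c"
 obtain q'' t' c' where q: "q'':ext p" "t':M" "c':M" "le q'' q'" "pr t' c':ext t" "le q'' c'" "X q'' s' t'"
  using assms(1)[unfolded half_def, rule_format, OF h] by blast
 have "Y q'' s' t'" by (rule assms(4)[OF q(1) h(1) q(2) h(2) q(3) h(4) q(5,7)])
 then show "EX q'':ext p. EX t':M. EX c':M. le q'' q' & pr t' c':ext t & le q'' c' & Y q'' s' t'"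
  using q by blast
qed

text \<open>\<open>feq\<close> is the union of all set-sized bisimulations. The part of it over a
  transitive set, enlarged by \<open>s\<close> and \<open>t\<close> at all conditions below
  \<open>q\<close>, is again a bisimulation: for the new triples both halves are inherited from
  \<open>q\<close>.\<close>

lemma feq_fold:
 assumes q: "q:ext p" "s:M" "t:M" and h: "half feq q s t" "half (%q t s. feq q s t) q t s"
 shows "feq q s t"
proof -
 obtain T where T: "T:M" "ext (upr s t) <= ext T" "ALL y:ext T. ext y <= ext T"
  using tc_ex[of "upr s t"] q by auto
 have Tp: "s':ext T" if u: "u:ext T" "pr s' c:ext u" "s':M" "c:M" for u s' c
 proof -
  have "pr s' c:ext T" using T(3) u(1,2) by blast
  then have "upr s' c:ext T" using T(3) u ext_pr by blast
  then show ?thesis using T(3) u(3,4) upr(2) by blast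
 qed
 have stT: "s:ext T" "t:ext T" using T(2) q by auto
 have qM: "q:M" using q ext_M by blast
 let ?Q = "%z. feq (p1 z) (p1 (p2 z)) (p2 (p2 z)) \<or> (le (p1 z) q & p2 z = pr s t)"
 have d: "Def (%e. ?Q (e 0))" by (intro def_intro q qM)
 have aM: "times p (times T T):M" using T(1) by simp
 define R where "R = sepm (times p (times T T)) ?Q"
 have R: "R:M" "ext R = {z:ext (times p (times T T)). ?Q z}" using sepm[OF aM d] unfolding R_def by auto
 have RI: "pr q0 (pr s0 t0):ext R <-> q0:ext p & s0:ext T & t0:ext T &
   (feq q0 s0 t0 \<or> (le q0 q & s0 = s & t0 = t))" if m: "q0:M" "s0:M" "t0:M" for q0 s0 t0
 proof -
  have "pr q0 (pr s0 t0):ext (times p (times T T)) <-> q0:ext p & s0:ext T & t0:ext T"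
  proof
   assume "pr q0 (pr s0 t0):ext (times p (times T T))"
   then obtain a b c where "a:ext p" "b:ext T" "c:ext T" "pr q0 (pr s0 t0) = pr a (pr b c)"
    using ext_times prM(1) T(1) times_M by auto
   then show "q0:ext p & s0:ext T & t0:ext T" using m ext_M pr_inject pr_M by metis
  next
   assume "q0:ext p & s0:ext T & t0:ext T"
   then show "pr q0 (pr s0 t0):ext (times p (times T T))"
    using ext_times prM(1) T(1) times_M by auto
  qed
  then show ?thesis unfolding R(2) using m q by simp
 qed
 have "bis R" unfolding bis_def
 proof (intro ballI impI)
  fix q0 s0 t0 assume m: "q0:ext p" "s0:M" "t0:M" and e: "pr q0 (pr s0 t0):ext R"
  have q0M: "q0:M" using m ext_M by blast
  have e': "q0:ext p & s0:ext T & t0:ext T & (feq q0 s0 t0 \<or> (le q0 q & s0 = s & t0 = t))"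
   using RI[OF q0M m(2,3)] e by blast
  have hh: "half feq q0 s0 t0 & half (%q t s. feq q s t) q0 t0 s0"
   using e' feq_unfold[OF _ m(2,3)] h half_le by blast
  have 1: "half (%q s t. pr q (pr s t):ext R) q0 s0 t0"
  proof (rule half_T[OF conjunct1[OF hh] m(2,3)])
   fix q s' t' c c' assume a: "q:ext p" "s':M" "t':M" "c:M" "c':M" "pr s' c:ext s0" "pr t' c':ext t0" "feq q s' t'"
   have "s':ext T" "t':ext T" using Tp[OF _ a(6) a(2,4)] Tp[OF _ a(7) a(3,5)] e' by blast+
   then show "pr q (pr s' t'):ext R" using RI[OF ext_M[OF a(1)] a(2,3)] a by blast
  qed
  have 2: "half (%q t s. pr q (pr s t):ext R) q0 t0 s0"
  proof (rule half_T[OF conjunct2[OF hh] m(3,2)])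
   fix q t' s' c c' assume a: "q:ext p" "t':M" "s':M" "c:M" "c':M" "pr t' c:ext t0" "pr s' c':ext s0" "feq q s' t'"
   have "t':ext T" "s':ext T" using Tp[OF _ a(6) a(2,4)] Tp[OF _ a(7) a(3,5)] e' by blast+
   then show "pr q (pr s' t'):ext R" using RI[OF ext_M[OF a(1)] a(3,2)] a by blast
  qed
  show "half (%q s t. pr q (pr s t):ext R) q0 s0 t0 & half (%q t s. pr q (pr s t):ext R) q0 t0 s0"
   using 1 2 by blast
 qed
 moreover have "pr q (pr s t):ext R" using RI[OF qM q(2,3)] q(1) stT le_refl by blast
 ultimately show ?thesis unfolding feq_def using R(1) q(1) by blast
qed

lemma feq_mono: assumes "feq q s t" "le q' q" "s:M" "t:M" shows "feq q' s t"
 using feq_fold[OF le_p(1)[OF assms(2)] assms(3,4)] feq_unfold[OF assms(1,3,4)] half_le[OF _ assms(2)] by blast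

text \<open>Coinduction: a match for a given member exists densely below a condition of the filter,
  hence the filter contains a condition that provides one.\<close>

lemma same_val_forced: assumes "q:G" "feq q s t" "s:M" "t:M" shows "same_val G s t"
proof (rule same_val.coinduct[where X = "%s t. s:M & t:M & (EX q:G. feq q s t)"])
 show "s:M & t:M & (EX q:G. feq q s t)" using assms by blast
next
 fix s t assume "s:M & t:M & (EX q:G. feq q s t)"
 then obtain q where q: "s:M" "t:M" "q:G" "feq q s t" by blast
 have main: "EX t':active G t. s':M & t':M & (EX q:G. X q s' t')"
  if h: "half X q s t" and XD: "Def (%e. X (e 0) (e 1) (e 2))" and m: "t:M" "s':active G s" for X s t s'
 proof -
  obtain c where c: "s':M" "c:G" "pr s' c:ext s" using m(2) unfolding active_iff by blast
  obtain q1 where q1: "q1:G" "le q1 q" "le q1 c" using G_dir q(3) c(2) by blast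
  let ?D = "%x. EX t':M. EX c':M. pr t' c':ext t & le x c' & X x s' t'"
  have dD: "Def (%e. ?D (e 0))" by (intro def_intro m c Def_R3[OF XD])
  have "EX x:G. ?D x"
  proof (rule generic_below[OF q1(1) dD])
   fix q' assume "le q' q1"
   then have "le q' q" "le q' c" "q':ext p" using q1 le_trans le_p by blast+
   then show "EX x. le x q' & ?D x" using h c G_M unfolding half_def by blast
  qed
  then obtain x t' c' where x: "x:G" "t':M" "c':M" "pr t' c':ext t" "le x c'" "X x s' t'" by blast
  then have "t':active G t" unfolding active_iff using G_up by blast
  then show ?thesis using c(1) x by blast
 qed
 have D1: "Def (%e. feq (e 0) (e 1) (e 2))" "Def (%e. feq (e 0) (e 2) (e 1))" by (intro def_intro)+
 have "ALL s':active G s. EX t':active G t. (s':M & t':M & (EX q:G. feq q s' t')) \<or> same_val G s' t'"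
  using main[OF feq_unfold(1)[OF q(4,1,2)] D1(1) q(2)] by blast
 moreover have "ALL t':active G t. EX s':active G s. (s':M & t':M & (EX q:G. feq q s' t')) \<or> same_val G s' t'"
  using main[OF feq_unfold(2)[OF q(4,1,2)] D1(2) q(1)] by blast
 ultimately show "EX s0 t0. s = s0 & t = t0 &
   (ALL s':active G s0. EX t':active G t0. (s':M & t':M & (EX q:G. feq q s' t')) \<or> same_val G s' t') &
   (ALL t':active G t0. EX s':active G s0. (s':M & t':M & (EX q:G. feq q s' t')) \<or> same_val G s' t')"
  by blast
qed

text \<open>Below every condition there is one that forces equality or one that is
  \<open>bad\<close>: it puts an element into one name and excludes every match in the other. The
  filter contains a condition of one of these kinds, and the induction hypothesis refutes the bad
  ones.\<close>

lemma same_val_ex_forced: "s:M ==> t:M ==> same_val G s t ==> EX q:G. feq q s t"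
proof (induction arbitrary: t rule: pair_induct)
 case (step s)
 define bad where "bad X s t x <-> (EX s':M. EX c:M. pr s' c:ext s & le x c &
   (ALL q'':ext p. ALL t':M. ALL c':M. le q'' x --> pr t' c':ext t --> le q'' c' --> ~X q'' s' t'))"
  for X :: "'a => 'a => 'a => bool" and s t x
 have badI: "EX x:ext p. le x q & bad X s t x" if "~half X q s t" for X q s t
  using that unfolding half_def bad_def by blast
 let ?D = "%x. feq x s t \<or> bad feq s t x \<or> bad (%q t s. feq q s t) t s x"
 have d: "Def (%e. ?D (e 0))" unfolding bad_def by (intro def_intro step)
 have "EX x:G. ?D x"
 proof (rule generic_below[OF one_G d])
  fix q' assume q': "le q' one"
  then have "q':ext p" using le_p by blast
  then show "EX x. le x q' & ?D x"
   using feq_fold[OF _ step(1,3)] badI[of feq q' s t] badI[of "%q t s. feq q s t" q' t s] le_refl by blast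
 qed
 then obtain x where x: "x:G" "?D x" by blast
 have nb: "~bad X u v x" if XD: "!!s'. s':active G u ==> EX t':active G v. EX q:G. X q s' t'"
  and Xm: "!!q q' s' t'. X q s' t' ==> le q' q ==> s':M ==> t':M ==> X q' s' t'" for X u v
 proof
  assume "bad X u v x"
  then obtain s' c where s: "s':M" "c:M" "pr s' c:ext u" "le x c"
   and n: "!!q'' t' c'. q'':ext p ==> t':M ==> c':M ==> le q'' x ==> pr t' c':ext v ==> le q'' c' ==> ~X q'' s' t'"
   unfolding bad_def by blast
  have "s':active G u" unfolding active_iff using s x G_up by blast
  then obtain t' q where t: "t':active G v" "q:G" "X q s' t'" using XD by blast
  then obtain c' where c': "t':M" "c':G" "pr t' c':ext v" unfolding active_iff by blast
  obtain y where y: "y:G" "le y x" "le y q" using G_dir x(1) t(2) by blast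
  obtain z where z: "z:G" "le z y" "le z c'" using G_dir y(1) c'(2) by blast
  have "X z s' t'" using Xm[OF t(3) _ s(1) c'(1)] le_trans[OF z(2) y(3)] by blast
  then show False using n[of z t' c'] z c' y le_trans G_p G_M by blast
 qed
 have "~bad feq s t x"
 proof (rule nb)
  fix s' assume s': "s':active G s"
  then obtain t' where t': "t':active G t" "same_val G s' t'" using same_valD(1)[OF step(4)] by blast
  obtain c where c: "s':M" "c:G" "pr s' c:ext s" using s' unfolding active_iff by blast
  have "t':M" using t'(1) unfolding active_iff by blast
  from step.IH[OF c(1) G_M[OF c(2)] c(3) this t'(2)] t'(1)
  show "EX t':active G t. EX q:G. feq q s' t'" by blast
 qed (rule feq_mono)
 moreover have "~bad (%q t s. feq q s t) t s x"
 proof (rule nb)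
  fix t' assume t': "t':active G t"
  then obtain s' where s': "s':active G s" "same_val G s' t'" using same_valD(2)[OF step(4)] by blast
  obtain c where c: "s':M" "c:G" "pr s' c:ext s" using s'(1) unfolding active_iff by blast
  have "t':M" using t' unfolding active_iff by blast
  from step.IH[OF c(1) G_M[OF c(2)] c(3) this s'(2)] s'(1)
  show "EX s':active G s. EX q:G. feq q s' t'" by blast
 qed (rule feq_mono)
 ultimately show ?case using x by blast
qed

lemma same_val_iff: "s:M ==> t:M ==> same_val G s t <-> (EX q:G. feq q s t)"
 using same_val_forced same_val_ex_forced by blast

end

section \<open>The forcing relation and the truth lemma\<close>

lemma (in dstr) Def_upd:
 assumes "Def (%e. P (e 0) (%n. e (Suc n)))" "inj sh" "a ~= b" "a ~: range sh" "b ~: range sh"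
 shows "Def (%e. P (e a) ((%n. e (sh n))(i := e b)))"
proof -
 define q where "q n = (case n of 0 => a | Suc k => if k = i then b else sh k)" for n
 have "inj q"
 proof (rule injI)
  fix x y assume "q x = q y"
  then show "x = y" using assms(3-5) inj_eq[OF assms(2)]
   unfolding q_def by (cases x; cases y) (auto split: if_splits)
 qed
 then have "Def (%e. P (e (q 0)) (%n. e (q (Suc n))))"
  using Def_reindex[OF assms(1)] by blast
 then show ?thesis
 proof (rule Def_cong)
  fix e :: "nat => 'a"
  have 1: "(%n. e (sh n))(i := e b) = (%n. e (q (Suc n)))" by (rule HOL.ext) (simp add: q_def)
  have 2: "q 0 = a" by (simp add: q_def)
  show "P (e a) ((%n. e (sh n))(i := e b)) = P (e (q 0)) (%n. e (q (Suc n)))" unfolding 1 2 ..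
 qed
qed

context forcing begin

abbreviation V where "V t \<equiv> val p G t"
definition N where "N = gen_ext p G"
definition EN where "EN = gen_mem p G"

abbreviation extN where "extN \<equiv> set_structure.ext N EN"

lemma N_iff: "X:N <-> (EX t. is_name p t & X = V t)"
 unfolding N_def gen_ext_def by blast

lemma V_N: "is_name p t ==> V t:N" unfolding N_iff by blast

lemma name_active: "is_name p t ==> s:active G t ==> is_name p s"
 using is_name_active by blast

lemma extN_V: "is_name p t ==> extN (V t) = V ` active G t"
 unfolding N_def EN_def by (rule ext_val)

lemma V_eq: "is_name p s ==> is_name p t ==> V s = V t <-> (EX q:G. feq q s t)"
 using val_eq_iff same_val_iff name_M by metis

lemma EN_iff: "X:N ==> EN X Y <-> X:extN Y"
 unfolding set_structure.ext_def by blast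

text \<open>A strong form of forced membership that may fail at a condition although it holds
  densely below it. The truth lemma only asks for some condition in \<open>G\<close>, and there the
  two forms agree.\<close>

definition fmem where
 "fmem q s t <-> (EX t':M. EX c:M. pr t' c:ext t & le q c & feq q s t')"

lemma Def_fmem [def_intro]: "DefF s ==> DefF t ==> DefF u ==> Def (%e. fmem (s e) (t e) (u e))"
 by (rule Def_R3[of fmem], unfold fmem_def) (intro def_intro; assumption)+

lemma fmem_mono: "fmem q s t ==> le q' q ==> s:M ==> fmem q' s t"
 unfolding fmem_def using feq_mono le_trans by meson

lemma fmem_truth: assumes "is_name p s" "is_name p t"
 shows "V s:extN (V t) <-> (EX q:G. fmem q s t)"
proof
 assume "V s:extN (V t)"
 then obtain t' where t': "t':active G t" "V s = V t'" unfolding extN_V[OF assms(2)] by blast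
 then obtain c where c: "t':M" "c:G" "pr t' c:ext t" unfolding active_iff by blast
 obtain q where q: "q:G" "feq q s t'" using V_eq[OF assms(1) name_active[OF assms(2) t'(1)]] t'(2) by blast
 obtain x where x: "x:G" "le x q" "le x c" using G_dir q(1) c(2) by blast
 have "feq x s t'" using feq_mono[OF q(2) x(2) name_M[OF assms(1)] c(1)] .
 then show "EX q:G. fmem q s t" unfolding fmem_def using x c G_M by blast
next
 assume "EX q:G. fmem q s t"
 then obtain q t' c where q: "q:G" "t':M" "c:M" "pr t' c:ext t" "le q c" "feq q s t'"
  unfolding fmem_def by blast
 have "t':active G t" unfolding active_iff using q G_up by blast
 moreover from this have "V s = V t'" using V_eq[OF assms(1) name_active[OF assms(2)]] q by blast
 ultimately show "V s:extN (V t)" unfolding extN_V[OF assms(2)] by blast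
qed

text \<open>Since the atomic clauses are not closed under density, the clause for
  \<open>Forall_fm\<close> has to ask for instances densely below \<open>q\<close> rather than at
  \<open>q\<close>.\<close>

primrec fc :: "set_fm => 'a => (nat => 'a) => bool" where
 "fc (Mem_fm i j) q e <-> fmem q (e i) (e j)"
| "fc (Eq_fm i j) q e <-> feq q (e i) (e j)"
| "fc (Neg_fm f) q e <-> (ALL q':ext p. le q' q --> ~fc f q' e)"
| "fc (Conj_fm f g) q e <-> fc f q e & fc g q e"
| "fc (Forall_fm i f) q e <-> (ALL a:M. is_name p a -->
   (ALL q':ext p. le q' q --> (EX q'':ext p. le q'' q' & fc f q'' (e(i := a)))))"

lemma fc_mono: "fc f q e ==> le q' q ==> range e <= M ==> fc f q' e"
proof (induction f arbitrary: q q' e)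
 case (Mem_fm i j)
 then have "e i:M" by blast
 then show ?case using Mem_fm fmem_mono unfolding fc.simps by blast
next
 case (Eq_fm i j)
 then have "e i:M" "e j:M" by blast+
 then show ?case using Eq_fm feq_mono unfolding fc.simps by blast
next
 case (Neg_fm f)
 then show ?case unfolding fc.simps using le_trans by blast
next
 case (Conj_fm f g)
 then show ?case unfolding fc.simps by blast
next
 case (Forall_fm i f)
 then show ?case unfolding fc.simps using le_trans by blast
qed

lemma Def_fc: "Def (%e. fc f (e 0) (%n. e (Suc n)))"
proof (induction f)
 case (Mem_fm i j) show ?case unfolding fc.simps by (intro def_intro)
next
 case (Eq_fm i j) show ?case unfolding fc.simps by (intro def_intro)
next
 case (Neg_fm f)
 have "Def (%e. fc f (e 0) (%n. e (Suc (Suc n))))"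
  using Def_reindex[OF Neg_fm.IH, of "%n. case n of 0 => 0 | Suc k => Suc (Suc k)"]
  by (simp add: inj_def split: nat.splits)
 then show ?case unfolding fc.simps by (intro def_intro)
next
 case (Conj_fm f g) then show ?case unfolding fc.simps by (intro def_intro)
next
 case (Forall_fm i f)
 have "Def (%e. fc f (e 0) ((%n. e (Suc (Suc (Suc (Suc n)))))(i := e (Suc (Suc 0)))))"
  by (rule Def_upd[OF Forall_fm.IH]) (auto simp: inj_def)
 then show ?case unfolding fc.simps by (intro def_intro)
qed

lemma truth:
 "(!!n. is_name p (e n)) ==> set_sat N EN f (%n. V (e n)) <-> (EX q:G. fc f q e)"
proof (induction f arbitrary: e)
 case (Mem_fm i j)
 have "EN (V (e i)) (V (e j)) <-> V (e i):extN (V (e j))" using EN_iff V_N Mem_fm by blast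
 then show ?case using fmem_truth Mem_fm by simp
next
 case (Eq_fm i j) then show ?case using V_eq by simp
next
 case (Neg_fm f)
 have eM: "range e <= M" using Neg_fm.prems name_M by blast
 have "(EX q:G. fc (Neg_fm f) q e) <-> ~(EX q:G. fc f q e)"
 proof
  assume "EX q:G. fc (Neg_fm f) q e"
  then obtain q where q: "q:G" "fc (Neg_fm f) q e" by blast
  show "~(EX q:G. fc f q e)"
  proof
   assume "EX q:G. fc f q e"
   then obtain q' where q': "q':G" "fc f q' e" by blast
   obtain x where x: "x:G" "le x q" "le x q'" using G_dir q(1) q'(1) by blast
   have "fc f x e" using fc_mono[OF q'(2) x(3) eM] .
   then show False using q(2) x G_p unfolding fc.simps by blast
  qed
 next
  assume n: "~(EX q:G. fc f q e)"
  let ?D = "%x. fc f x e \<or> fc (Neg_fm f) x e"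
  have "Def (%d. fc f (d 0) e \<or> fc (Neg_fm f) (d 0) e)"
   by (intro def_intro Def_inst[OF Def_fc eM])
  then have "EX x:G. ?D x"
  proof (rule generic_below[OF one_G])
   fix q' assume "le q' one"
   then have "q':ext p" using le_p by blast
   then show "EX s. le s q' & ?D s" using le_refl unfolding fc.simps by blast
  qed
  then show "EX q:G. fc (Neg_fm f) q e" using n by blast
 qed
 then show ?case using Neg_fm.IH[OF Neg_fm.prems] by simp
next
 case (Conj_fm f g)
 have eM: "range e <= M" using Conj_fm.prems name_M by blast
 have "(EX q:G. fc (Conj_fm f g) q e) <-> (EX q:G. fc f q e) & (EX q:G. fc g q e)"
 proof
  assume "(EX q:G. fc f q e) & (EX q:G. fc g q e)"
  then obtain q q' where q: "q:G" "fc f q e" "q':G" "fc g q' e" by blast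
  obtain x where "x:G" "le x q" "le x q'" using G_dir q(1,3) by blast
  then show "EX q:G. fc (Conj_fm f g) q e" using fc_mono q(2,4) eM unfolding fc.simps by blast
 qed auto
 then show ?case using Conj_fm.IH[OF Conj_fm.prems] by simp
next
 case (Forall_fm i f)
 have eM: "range e <= M" using Forall_fm.prems name_M by blast
 have upd: "range (e(i := a)) <= M" if "a:M" for a using eM that by auto
 have Df: "Def (%d. fc f (d 0) (e(i := a)))" if "a:M" for a by (rule Def_inst[OF Def_fc upd[OF that]])
 have IH: "set_sat N EN f ((%n. V (e n))(i := V a)) <-> (EX q:G. fc f q (e(i := a)))" if a: "is_name p a" for a
 proof -
  have eq: "(%n. V (e n))(i := V a) = (%n. V ((e(i := a)) n))" by (rule HOL.ext) simp
  have "is_name p ((e(i := a)) n)" for n using Forall_fm.prems a by simp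
  from Forall_fm.IH[OF this] show ?thesis unfolding eq .
 qed
 have "set_sat N EN (Forall_fm i f) (%n. V (e n)) <-> (ALL a. is_name p a --> (EX q:G. fc f q (e(i := a))))"
 proof -
  have NV: "(ALL X:N. R X) <-> (ALL a. is_name p a --> R (V a))" for R
   by (metis N_iff)
  show ?thesis unfolding set_sat.simps NV by (intro iff_allI imp_cong refl IH)
 qed
 also have "... <-> (EX q:G. fc (Forall_fm i f) q e)"
 proof
  assume "EX q:G. fc (Forall_fm i f) q e"
  then obtain q where q: "q:G" "fc (Forall_fm i f) q e" by blast
  show "ALL a. is_name p a --> (EX q:G. fc f q (e(i := a)))"
  proof (intro allI impI)
   fix a assume a: "is_name p a"
   show "EX q:G. fc f q (e(i := a))"
   proof (rule generic_below[OF q(1) Df[OF name_M[OF a]]])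
    fix q' assume "le q' q"
    then show "EX s. le s q' & fc f s (e(i := a))" using q(2) a name_M[OF a] le_p unfolding fc.simps by blast
   qed
  qed
 next
  assume h: "ALL a. is_name p a --> (EX q:G. fc f q (e(i := a)))"
  let ?B = "%x. EX a:M. is_name p a & (ALL q'':ext p. le q'' x --> ~fc f q'' (e(i := a)))"
  have "Def (%d. fc (Forall_fm i f) (d 0) e \<or> ?B (d 0))"
  proof (intro def_intro Def_inst[OF Def_fc eM])
   have "Def (%d. fc f (d 0) ((%n. d (Suc (Suc (Suc n))))(i := d (Suc 0))))"
    by (rule Def_upd[OF Def_fc]) (auto simp: inj_def)
   \<comment> \<open>\<open>Def_inst\<close> leaves a single variable free, so name and condition
     are packed into one pair and unpacked again afterwards.\<close>
   then have "Def (%d. (%x e'. ALL a:M. ALL q:M. x = pr a q --> fc f q (e'(i := a))) (d 0) (%n. d (Suc n)))"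
    by (intro def_intro)
   from Def_inst[OF this eM]
   have Df1: "Def (%d. ALL a:M. ALL q:M. d 0 = pr a q --> fc f q (e(i := a)))" .
   have "Def (%d. ALL a:M. ALL q:M. pr (d 1) (d 0) = pr a q --> fc f q (e(i := a)))"
    by (rule Def_R1[OF Df1]) (intro def_intro)
   then show "Def (%d. fc f (d 0) (e(i := d (Suc 0))))"
   proof (rule Def_cong)
    fix d :: "nat => 'a" assume "range d <= M"
    then have m: "d 0:M" "d (Suc 0):M" "d 1:M" by auto
    show "fc f (d 0) (e(i := d (Suc 0))) <-> (ALL a:M. ALL q:M. pr (d 1) (d 0) = pr a q --> fc f q (e(i := a)))"
     using m pr_inject[OF m(3,1)] by auto
   qed
  qed
  then have "EX x:G. fc (Forall_fm i f) x e \<or> ?B x"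
  proof (rule generic_below[OF one_G])
   fix q' assume "le q' one"
   then have q': "q':ext p" using le_p by blast
   show "EX s. le s q' & (fc (Forall_fm i f) s e \<or> ?B s)"
   proof (cases "fc (Forall_fm i f) q' e")
    case True then show ?thesis using le_refl[OF q'] by blast
   next
    case False
    then obtain a q where "a:M" "is_name p a" "le q q'" "ALL q'':ext p. le q'' q --> ~fc f q'' (e(i := a))"
     unfolding fc.simps by blast
    then show ?thesis by blast
   qed
  qed
  moreover have "~?B x" if x: "x:G" for x
  proof
   assume "?B x"
   then obtain a where a: "a:M" "is_name p a" "ALL q'':ext p. le q'' x --> ~fc f q'' (e(i := a))" by blast
   obtain q where q: "q:G" "fc f q (e(i := a))" using h a(2) by blast
   obtain y where y: "y:G" "le y x" "le y q" using G_dir x q(1) by blast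
   have "fc f y (e(i := a))" using fc_mono[OF q(2) y(3) upd[OF a(1)]] .
   then show False using a(3) y G_p by blast
  qed
  ultimately show "EX q:G. fc (Forall_fm i f) q e" by blast
 qed
 finally show ?case .
qed

lemma N_ext_eq: assumes "X:N" "Y:N" "extN X = extN Y" shows "X = Y"
proof -
 obtain s t where st: "is_name p s" "is_name p t" "X = V s" "Y = V t"
  using assms(1,2) unfolding N_iff by blast
 have e: "V ` active G s = V ` active G t" using assms(3) extN_V st by simp
 have sv: "V a = V b <-> same_val G a b" if "a:active G s" "b:active G t" for a b
  using val_eq_iff name_active[OF st(1) that(1)] name_active[OF st(2) that(2)] by blast
 have "same_val G s t"
 proof (rule same_val.intros; intro ballI)
  fix a assume a: "a:active G s"
  then obtain b where "b:active G t" "V a = V b" using e by blast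
  then show "EX b:active G t. same_val G a b" using sv a by blast
 next
  fix b assume b: "b:active G t"
  then obtain a where "a:active G s" "V a = V b" using e by (metis imageE imageI)
  then show "EX a:active G s. same_val G a b" using sv b by blast
 qed
 then show ?thesis using val_eq_iff st by blast
qed

lemma nameI: assumes "u:M" "!!z. z:ext u ==> EX s:M. EX c:ext p. z = pr s c & is_name p s" shows "is_name p u"
 using assms is_name_iff by blast

lemma dom_un: assumes "t:M" "pr s c:ext t" "s:M" "c:M" shows "s:ext (un (un t))"
 using pr_in_M[OF assms(3,4,2,1)] by blast

lemma name_sepm:
 assumes "a:M" "b:M" "Def (%e. Q (e 0))"
  "!!s c. s:ext a ==> c:ext b ==> Q (pr s c) ==> is_name p s & c:ext p"
 shows "is_name p (sepm (times a b) Q)"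
  "s:active G (sepm (times a b) Q) <-> s:ext a & (EX c:G. c:ext b & Q (pr s c))"
proof -
 have e: "sepm (times a b) Q:M" "ext (sepm (times a b) Q) = {z:ext (times a b). Q z}"
  using sepm[OF times_M[OF assms(1,2)] assms(3)] by auto
 have pe: "pr s c:ext (sepm (times a b) Q) <-> s:ext a & c:ext b & Q (pr s c)" if "s:M" "c:M" for s c
 proof -
  have "pr s c:ext (times a b) <-> s:ext a & c:ext b"
   unfolding ext_times[OF assms(1,2)] using that ext_M pr_inject by blast
  then show ?thesis unfolding e(2) by blast
 qed
 show "is_name p (sepm (times a b) Q)"
 proof (rule nameI[OF e(1)])
  fix z assume "z:ext (sepm (times a b) Q)"
  then obtain s c where "s:ext a" "c:ext b" "z = pr s c" "Q z"
   unfolding e(2) ext_times[OF assms(1,2)] by blast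
  then show "EX s:M. EX c:ext p. z = pr s c & is_name p s" using assms(4) ext_M by blast
 qed
 show "s:active G (sepm (times a b) Q) <-> s:ext a & (EX c:G. c:ext b & Q (pr s c))"
  unfolding active_iff using pe G_M ext_M by blast
qed

lemma N_sep:
 assumes "X:N" "range e <= N"
 shows "EX Y:N. extN Y = {z:extN X. set_sat N EN f (e(0 := z))}"
proof -
 obtain t where t: "is_name p t" "X = V t" using assms(1) unfolding N_iff by blast
 have "ALL n. EX s. is_name p s & e n = V s" using assms(2) N_iff by (metis rangeI subsetD)
 then obtain d where d: "!!n. is_name p (d n)" "!!n. e n = V (d n)" by metis
 have dM: "range d <= M" using d(1) name_M by blast
 have tM: "t:M" using t name_M by blast
 define D where "D = un (un t)"
 have DM: "D:M" unfolding D_def using tM by simp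
 let ?Q = "%z. EX c':M. pr (p1 z) c':ext t & le (p2 z) c' & fc f (p2 z) (d(0 := p1 z))"
 have "Def (%e. fc f (e (Suc 0)) ((%n. e (Suc (Suc (Suc n))))(0 := e 0)))"
  by (rule Def_upd[OF Def_fc]) (auto simp: inj_def)
 then have "Def (%e. (%x d. ALL q:M. ALL s:M. x = pr s q --> fc f q (d(0 := s))) (e 0) (%n. e (Suc n)))"
  by (intro def_intro)
 from Def_inst[OF this dM]
 have Df: "Def (%e. ALL q:M. ALL s:M. e 0 = pr s q --> fc f q (d(0 := s)))" .
 have fcD: "Def (%e. fc f (s e) (d(0 := u e)))" if "DefF s" "DefF u" for s u
 proof -
  have "Def (%e. ALL q:M. ALL v:M. pr (u e) (s e) = pr v q --> fc f q (d(0 := v)))"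
   by (rule Def_R1[OF Df]) (intro def_intro that)
  then show ?thesis
  proof (rule Def_cong)
   fix e :: "nat => 'a" assume "range e <= M"
   then have m: "u e:M" "s e:M" using DefF_in that by blast+
   show "fc f (s e) (d(0 := u e)) <-> (ALL q:M. ALL v:M. pr (u e) (s e) = pr v q --> fc f q (d(0 := v)))"
    using m pr_inject[OF m] by auto
  qed
 qed
 have dQ: "Def (%e. ?Q (e 0))" by (intro def_intro tM fcD)
 define u where "u = sepm (times D p) ?Q"
 have Qi: "?Q (pr s c) <-> (EX c':M. pr s c':ext t & le c c' & fc f c (d(0 := s)))" if "s:M" "c:M" for s c
  using that by simp
 have nm: "is_name p s & c:ext p" if "s:ext D" "c:ext p" "?Q (pr s c)" for s c
 proof -
  have "s:M" "c:M" using that(1,2) ext_M by blast+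
  then show ?thesis using that(3) Qi[of s c] name_pr[OF t(1)] that(2) by blast
 qed
 have u1: "is_name p u" unfolding u_def by (rule name_sepm(1)[OF DM prM(1) dQ nm])
 have u2: "s:active G u <-> s:ext D & (EX c:G. c:ext p & ?Q (pr s c))" for s
  unfolding u_def by (rule name_sepm(2)[OF DM prM(1) dQ nm])
 have sat: "set_sat N EN f (e(0 := V s)) <-> (EX q:G. fc f q (d(0 := s)))" if s: "is_name p s" for s
 proof -
  have eq: "e(0 := V s) = (%n. V ((d(0 := s)) n))" by (rule HOL.ext) (simp add: d(2))
  have "is_name p ((d(0 := s)) n)" for n using d(1) s by simp
  from truth[OF this] show ?thesis unfolding eq .
 qed
 have "extN (V u) = {z:extN X. set_sat N EN f (e(0 := z))}"
  unfolding extN_V[OF u1] t(2) extN_V[OF t(1)]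
 proof (intro equalityI subsetI)
  fix z assume "z:V ` active G u"
  then obtain s where su: "s:active G u" "z = V s" by blast
  obtain c where s: "s:ext D" "c:G" "c:ext p" "?Q (pr s c)" "z = V s"
   using su(1)[unfolded u2] su(2) by blast
  have m: "s:M" "c:M" using s ext_M by blast+
  then obtain c' where c': "c':M" "pr s c':ext t" "le c c'" "fc f c (d(0 := s))" using s(4) Qi by blast
  then have "s:active G t" unfolding active_iff using m(1) G_up s(2) by blast
  then show "z:{z:V ` active G t. set_sat N EN f (e(0 := z))}"
   using sat[OF name_active[OF t(1)]] c'(4) s by blast
 next
  fix z assume "z:{z:V ` active G t. set_sat N EN f (e(0 := z))}"
  then obtain s where s: "s:active G t" "z = V s" "set_sat N EN f (e(0 := V s))" by blast
  then obtain c' where c': "s:M" "c':G" "pr s c':ext t" unfolding active_iff by blast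
  have sn: "is_name p s" using name_active[OF t(1) s(1)] .
  obtain q where q: "q:G" "fc f q (d(0 := s))" using s(3) sat[OF sn] by blast
  obtain c where c: "c:G" "le c q" "le c c'" using G_dir q(1) c'(2) by blast
  have "range (d(0 := s)) <= M" using dM c'(1) by auto
  then have "fc f c (d(0 := s))" using fc_mono[OF q(2) c(2)] by blast
  then have "?Q (pr s c)" using Qi[OF c'(1) G_M[OF c(1)]] c' c G_M by blast
  moreover have "s:ext D" unfolding D_def using dom_un[OF tM c'(3,1)] G_M c'(2) by blast
  ultimately show "z:V ` active G u" unfolding s(2) using u2 c(1) G_p by blast
 qed
 then show ?thesis using V_N[OF u1] by blast
qed

end

section \<open>Canonical names and the axioms in the extension\<close>

context forcing begin

lemma chk_ex: "EX F. (ALL x:M. F x:M & ext (F x) = {pr (F y) one | y. y:ext x}) & DefF (%e. F (e 0))"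
proof -
 have "DefF (%e. times (rgm (e 1)) (upr one one))" by (intro def_intro)
 then obtain F where F: "!!x. x:M ==> F x:M" "!!x. x:M ==> coded {pr y (F y) | y. y:ext x}"
  "!!x. x:M ==> F x = times (rgm (mk {pr y (F y) | y. y:ext x})) (upr one one)" "DefF (%e. F (e 0))"
  using E_recursion[of "%x f. times (rgm f) (upr one one)"] by blast
 have "ext (F x) = {pr (F y) one | y. y:ext x}" if x: "x:M" for x
 proof -
  let ?f = "mk {pr y (F y) | y. y:ext x}"
  have r: "rgm ?f:M" using rgm_M(1)[OF mk_M[OF F(2)[OF x]]] .
  have "ext (rgm ?f) = F ` ext x"
   by (rule rgm_graph[OF F(2)[OF x]]) (use ext_M F(1) in blast)+
  then show ?thesis unfolding F(3)[OF x] ext_times[OF r upr(1)[OF one_M one_M]] by auto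
 qed
 then show ?thesis using F by blast
qed

definition chk where
 "chk = (SOME F. (ALL x:M. F x:M & ext (F x) = {pr (F y) one | y. y:ext x}) & DefF (%e. F (e 0)))"

lemma chk: "x:M ==> chk x:M" "x:M ==> ext (chk x) = {pr (chk y) one | y. y:ext x}" "DefF (%e. chk (e 0))"
 using someI_ex[OF chk_ex] unfolding chk_def[symmetric] by blast+

lemma Def_chk [def_intro]: "DefF s ==> DefF (%e. chk (s e))" by (rule Def_lift[OF chk(3)])

lemma name_chk: "x:M ==> is_name p (chk x)"
proof (induction rule: E_induct)
 case (step x)
 show ?case
 proof (rule nameI[OF chk(1)[OF step(1)]])
  fix z assume "z:ext (chk x)"
  then obtain y where y: "y:ext x" "z = pr (chk y) one" unfolding chk(2)[OF step(1)] by blast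
  then show "EX s:M. EX c:ext p. z = pr s c & is_name p s"
   using step(2)[OF y(1)] one(1) chk(1)[OF ext_M[OF y(1)]] by blast
 qed
qed

lemma active_chk: assumes "x:M" shows "active G (chk x) = chk ` ext x"
proof (intro equalityI subsetI)
 fix s assume "s:active G (chk x)"
 then obtain c where c: "s:M" "c:G" "pr s c:ext (chk x)" unfolding active_iff by blast
 then obtain y where y: "y:ext x" "pr s c = pr (chk y) one" unfolding chk(2)[OF assms] by blast
 then have "s = chk y" using c(1) G_M[OF c(2)] chk(1)[OF ext_M[OF y(1)]] by simp
 then show "s:chk ` ext x" using y by blast
next
 fix s assume "s:chk ` ext x"
 then obtain y where y: "y:ext x" "s = chk y" by blast
 then have "pr s one:ext (chk x)" unfolding chk(2)[OF assms] by blast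
 then show "s:active G (chk x)" unfolding active_iff using one_G y chk(1)[OF ext_M[OF y(1)]] by blast
qed

definition cv where "cv x = V (chk x)"

lemma cv_N [simp, intro]: "x:M ==> cv x:N" unfolding cv_def by (rule V_N[OF name_chk])

lemma ext_cv: "x:M ==> extN (cv x) = cv ` ext x"
 unfolding cv_def using extN_V[OF name_chk] active_chk by (simp add: image_image)

lemma cv_inj: "x:M ==> y:M ==> cv x = cv y ==> x = y"
proof (induction arbitrary: y rule: E_induct)
 case (step x)
 have e: "cv ` ext x = cv ` ext y" using step(4) ext_cv[OF step(1)] ext_cv[OF step(3)] by simp
 have "ext x = ext y"
 proof (intro equalityI subsetI)
  fix z assume z: "z:ext x"
  then have "cv z:cv ` ext y" using e by blast
  then obtain w where w: "w:ext y" "cv z = cv w" by blast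
  then show "z:ext y" using step.IH[OF z ext_M[OF w(1)] w(2)] by simp
 next
  fix w assume w: "w:ext y"
  then have "cv w:cv ` ext x" using e by blast
  then obtain z where z: "z:ext x" "cv w = cv z" by blast
  then show "w:ext x" using step.IH[OF z(1) ext_M[OF w] z(2)[symmetric]] by simp
 qed
 then show ?case using ext_eqI step(1,3) by blast
qed

lemma cv_eq [simp]: "x:M ==> y:M ==> cv x = cv y <-> x = y" using cv_inj by blast

lemma N_wf: "wfp_on N EN"
 unfolding wfp_on_def
proof (intro allI impI ballI)
 fix P X assume h: "ALL X:N. (ALL Y:N. EN Y X --> P Y) --> P X" and X: "X:N"
 have "is_name p t --> P (V t)" if "t:M" for t using that
 proof (induction rule: pair_induct)
  case (step t)
  show ?case
  proof
   assume t: "is_name p t"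
   have "P Y" if Y: "Y:N" "EN Y (V t)" for Y
   proof -
    have "Y:V ` active G t" using Y EN_iff extN_V[OF t] by blast
    then obtain s where s: "s:active G t" "Y = V s" by blast
    obtain c where c: "s:M" "c:G" "pr s c:ext t" using s(1) unfolding active_iff by blast
    show ?thesis using step.IH[OF c(1) G_M[OF c(2)] c(3)] name_active[OF t s(1)] s(2) by blast
   qed
   then show "P (V t)" using h V_N[OF t] by blast
  qed
 qed
 then show "P X" using X name_M unfolding N_iff by blast
qed

lemma N_pairing: assumes "X:N" "Y:N" shows "EX Z:N. extN Z = {X, Y}"
proof -
 obtain s t where st: "is_name p s" "is_name p t" "X = V s" "Y = V t" using assms unfolding N_iff by blast
 have m: "s:M" "t:M" using st name_M by blast+
 let ?Q = "%z::'a. True"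
 have d: "Def (%e. ?Q (e 0))" by (intro def_intro)
 have nm: "is_name p a & c:ext p" if "a:ext (upr s t)" "c:ext p" "?Q (pr a c)" for a c
  using that st m by auto
 note u = name_sepm[OF upr(1)[OF m] prM(1) d]
 have 1: "is_name p (sepm (times (upr s t) p) ?Q)" by (rule u(1)[OF nm])
 have 2: "a:active G (sepm (times (upr s t) p) ?Q) <-> a:ext (upr s t) & (EX c:G. c:ext p & ?Q (pr a c))" for a
  by (rule u(2)[OF nm])
 have "active G (sepm (times (upr s t) p) ?Q) = {s, t}" using 2 m one_G one(1) by auto
 then show ?thesis using extN_V[OF 1] V_N[OF 1] st by auto
qed

lemma N_union: assumes "X:N" shows "EX Z:N. extN Z = (UN y:extN X. extN y)"
proof -
 obtain t where t: "is_name p t" "X = V t" using assms unfolding N_iff by blast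
 have tM: "t:M" using t name_M by blast
 let ?D = "un (un (un (un t)))"
 let ?Q = "%z. EX s:M. EX c1:M. EX c2:M. pr s c1:ext t & pr (p1 z) c2:ext s & le (p2 z) c1 & le (p2 z) c2"
 have DM: "un ?D:M" using tM by simp
 have d: "Def (%e. ?Q (e 0))" by (intro def_intro tM)
 have nm: "is_name p a & c:ext p" if h: "a:ext (un ?D)" "c:ext p" "?Q (pr a c)" for a c
 proof -
  have m: "a:M" "c:M" using h ext_M by blast+
  then obtain s c1 c2 where "s:M" "c1:M" "c2:M" "pr s c1:ext t" "pr a c2:ext s" using h(3) by auto
  then show ?thesis using name_pr t(1) m h(2) by meson
 qed
 define u where "u = sepm (times (un ?D) p) ?Q"
 have u1: "is_name p u" unfolding u_def by (rule name_sepm(1)[OF DM prM(1) d nm])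
 have u2: "a:active G u <-> a:ext (un ?D) & (EX c:G. c:ext p & ?Q (pr a c))" for a
  unfolding u_def by (rule name_sepm(2)[OF DM prM(1) d nm])
 have u3: "a:active G u <-> (EX s:active G t. a:active G s)" for a
 proof
  assume a: "a:active G u"
  then obtain c where c: "c:G" "?Q (pr a c)" using u2 by blast
  have m: "a:M" "c:M" using a G_M[OF c(1)] unfolding active_iff by auto
  then obtain s c1 c2 where s: "s:M" "c1:M" "c2:M" "pr s c1:ext t" "pr a c2:ext s" "le c c1" "le c c2"
   using c(2) by auto
  then have "c1:G" "c2:G" using G_up c(1) by blast+
  then have "s:active G t" "a:active G s" unfolding active_iff using s m by blast+
  then show "EX s:active G t. a:active G s" by blast
 next
  assume "EX s:active G t. a:active G s"
  then obtain s where "s:active G t" "a:active G s" by blast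
  then obtain c1 c2 where s: "s:M" "c1:G" "pr s c1:ext t" "a:M" "c2:G" "pr a c2:ext s"
   unfolding active_iff by blast
  obtain c where c: "c:G" "le c c1" "le c c2" using G_dir s(2,5) by blast
  have "?Q (pr a c)" using s c G_M by auto
  moreover have "s:ext (un (un t))" using dom_un[OF tM s(3,1)] G_M s(2) by blast
  then have "pr a c2:ext (un (un (un t)))" using s(6) tM by auto
  then have "a:ext (un ?D)" using pr_in_M(1)[OF s(4) G_M[OF s(5)], of "un (un (un t))"] tM by simp
  ultimately show "a:active G u" using u2 c(1) G_p by blast
 qed
 have "active G u = (UN s:active G t. active G s)" using u3 by blast
 moreover have "(UN s:active G t. extN (V s)) = (UN s:active G t. V ` active G s)"
  by (rule SUP_cong) (use extN_V name_active[OF t(1)] in blast)+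
 ultimately have "extN (V u) = (UN y:extN X. extN y)"
  unfolding extN_V[OF u1] t(2) extN_V[OF t(1)] by (simp add: image_UN)
 then show ?thesis using V_N[OF u1] by blast
qed

text \<open>Every subset of \<open>X\<close> is the value of a name included in the product of the
  domain of \<open>t\<close> with the poset, namely of the pairs that force membership. All such
  names form a set of the ground model, which gives a superset of the power set; separation does the
  rest.\<close>

lemma N_power: assumes "X:N" shows "EX P:N. extN P = {Y:N. extN Y <= extN X}"
proof -
 obtain t where t: "is_name p t" "X = V t" using assms unfolding N_iff by blast
 have tM: "t:M" using t name_M by blast
 define D where "D = sepm (un (un t)) (is_name p)"
 have dD: "Def (%e. is_name p (e 0))" by (intro def_intro)
 have D: "D:M" "ext D = {s:ext (un (un t)). is_name p s}" using sepm[OF _ dD] tM unfolding D_def by auto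
 have WM: "pw (times D p):M" using D by simp
 let ?Q = "%z::'a. True"
 have d: "Def (%e. ?Q (e 0))" by (intro def_intro)
 have subname: "is_name p a" if "a:ext (pw (times D p))" for a
 proof (rule nameI)
  show "a:M" using that ext_M by blast
  fix z assume "z:ext a"
  then have "z:ext (times D p)" using that D(1) by auto
  then obtain s c where "s:ext D" "c:ext p" "z = pr s c" unfolding ext_times[OF D(1) prM(1)] by blast
  then show "EX s:M. EX c:ext p. z = pr s c & is_name p s" using D(2) ext_M by blast
 qed
 have nm: "is_name p a & c:ext p" if "a:ext (pw (times D p))" "c:ext p" "?Q (pr a c)" for a c
  using that subname by blast
 define u where "u = sepm (times (pw (times D p)) p) ?Q"
 have u1: "is_name p u" unfolding u_def by (rule name_sepm(1)[OF WM prM(1) d nm])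
 have u2: "a:active G u <-> a:ext (pw (times D p)) & (EX c:G. c:ext p & ?Q (pr a c))" for a
  unfolding u_def by (rule name_sepm(2)[OF WM prM(1) d nm])
 have cover: "Y:extN (V u)" if Y: "Y:N" "extN Y <= extN X" for Y
 proof -
  obtain y where y: "is_name p y" "Y = V y" using Y(1) unfolding N_iff by blast
  let ?R = "%z. fmem (p2 z) (p1 z) y"
  have dR: "Def (%e. ?R (e 0))" by (intro def_intro name_M[OF y(1)])
  have nmR: "is_name p a & c:ext p" if "a:ext D" "c:ext p" "?R (pr a c)" for a c
   using that D(2) by blast
  define v where "v = sepm (times D p) ?R"
  have v1: "is_name p v" unfolding v_def by (rule name_sepm(1)[OF D(1) prM(1) dR nmR])
  have v2: "a:active G v <-> a:ext D & (EX c:G. c:ext p & ?R (pr a c))" for a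
   unfolding v_def by (rule name_sepm(2)[OF D(1) prM(1) dR nmR])
  have v3: "a:active G v <-> a:ext D & V a:extN Y" for a
  proof (cases "a:ext D")
   case True
   then have n: "is_name p a" "a:M" using D(2) ext_M by blast+
   have "(EX c:G. c:ext p & ?R (pr a c)) <-> (EX c:G. fmem c a y)"
    using n(2) G_M G_p by auto
   then show ?thesis using v2 True fmem_truth[OF n(1) y(1)] y(2) by blast
  qed (use v2 in blast)
  have "extN (V v) = extN Y" unfolding extN_V[OF v1]
  proof (intro equalityI subsetI)
   fix z assume z: "z:extN Y"
   then have "z:V ` active G t" using Y(2) extN_V[OF t(1)] t(2) by blast
   then obtain s where s: "s:active G t" "z = V s" by blast
   then obtain c where c: "s:M" "c:G" "pr s c:ext t" unfolding active_iff by blast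
   have "s:ext D" unfolding D(2) using dom_un[OF tM c(3,1) G_M[OF c(2)]] name_active[OF t(1) s(1)] by blast
   then have "s:active G v" using v3 s(2) z by blast
   then show "z:V ` active G v" using s(2) by blast
  qed (use v3 in blast)
  then have "V v = Y" using N_ext_eq V_N[OF v1] Y(1) by blast
  moreover have "v:ext (pw (times D p))" unfolding v_def using sepm[OF times_M[OF D(1) prM(1)] dR] D(1) by auto
  then have "v:active G u" using u2 one_G one(1) by blast
  ultimately show ?thesis unfolding extN_V[OF u1] by blast
 qed
 let ?f = "Forall_fm 2 (Neg_fm (Conj_fm (Mem_fm 2 0) (Neg_fm (Mem_fm 2 1))))"
 obtain P where P: "P:N" "extN P = {z:extN (V u). set_sat N EN ?f ((%_. X)(0 := z))}"
  using N_sep[OF V_N[OF u1], of "%_. X" ?f] assms by auto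
 have "set_sat N EN ?f ((%_. X)(0 := z)) <-> extN z <= extN X" for z
  by (auto simp: set_structure.ext_def)
 then have "extN P = {Y:N. extN Y <= extN X}" unfolding P(2) using cover
  by (auto simp: set_structure.ext_def)
 then show ?thesis using P(1) by blast
qed

lemma N_inf: "EX w:N. (EX z:extN w. extN z = {}) & (ALL x:extN w. EX y:extN w. extN y = insert x (extN x))"
proof (rule bexI[of _ "cv om"], intro conjI ballI)
 show "cv om:N" by simp
 have e: "num 0:ext om" unfolding ext_om by blast
 have "extN (cv (num 0)) = {}" unfolding ext_cv[OF num_M] by simp
 moreover have "cv (num 0):extN (cv om)" using ext_cv[OF om_M] e by blast
 ultimately show "EX z:extN (cv om). extN z = {}" by blast
 fix x assume "x:extN (cv om)"
 then obtain n where n: "x = cv (num n)" unfolding ext_cv[OF om_M] ext_om by blast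
 have "num (Suc n):ext om" unfolding ext_om by blast
 then have "cv (num (Suc n)):extN (cv om)" using ext_cv[OF om_M] by blast
 moreover have "extN (cv (num (Suc n))) = insert x (extN x)" unfolding n ext_cv[OF num_M] by simp
 ultimately show "EX y:extN (cv om). extN y = insert x (extN x)" by blast
qed

text \<open>Replacement and choice are not needed in the extension.\<close>

sublocale NN: zmod N EN
 by unfold_locales (fact N_ext_eq N_wf N_pairing N_union N_power N_inf N_sep)+

text \<open>For subsets of a ground-model set, a relation \<open>Q\<close> between elements and
  conditions is handier than a name: membership of \<open>cv a\<close> becomes a statement about
  conditions of \<open>G\<close>, to which density arguments in the ground model apply.
  \<open>of_nice\<close> is the way back.\<close>

lemma nice_name:
 assumes "Z:N" "A:M"
 obtains Q where "Q:M" "ext Q <= ext (times A p)"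
  "!!a. a:ext A ==> cv a:extN Z <-> (EX c:G. pr a c:ext Q)"
  "!!a c c'. a:M ==> pr a c:ext Q ==> le c' c ==> pr a c':ext Q"
proof -
 obtain t where t: "is_name p t" "Z = V t" using assms unfolding N_iff by blast
 have tM: "t:M" using t name_M by blast
 let ?Q = "%z. fmem (p2 z) (chk (p1 z)) t"
 have d: "Def (%e. ?Q (e 0))" by (intro def_intro tM)
 define Q where "Q = sepm (times A p) ?Q"
 have Q: "Q:M" "ext Q = {z:ext (times A p). ?Q z}"
  using sepm[OF times_M[OF assms(2) prM(1)] d] unfolding Q_def by auto
 have pQ: "pr a c:ext Q <-> a:ext A & c:ext p & fmem c (chk a) t" if m: "a:M" "c:M" for a c
 proof -
  have "pr a c:ext (times A p) <-> a:ext A & c:ext p"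
   unfolding ext_times[OF assms(2) prM(1)] using m ext_M pr_inject by blast
  then show ?thesis unfolding Q(2) using m by simp
 qed
 show ?thesis
 proof (rule that[OF Q(1)])
  show "ext Q <= ext (times A p)" using Q(2) by blast
  show "cv a:extN Z <-> (EX c:G. pr a c:ext Q)" if a: "a:ext A" for a
  proof -
   have aM: "a:M" using ext_M a by blast
   show ?thesis unfolding t(2) cv_def fmem_truth[OF name_chk[OF aM] t(1)]
    using pQ[OF aM] a G_M G_p by blast
  qed
  show "pr a c':ext Q" if h: "a:M" "pr a c:ext Q" "le c' c" for a c c'
  proof -
   have m: "c:M" "c':M" "c':ext p" using le_p[OF h(3)] ext_M by blast+
   then show ?thesis using pQ h fmem_mono[OF _ h(3) chk(1)[OF h(1)]] by blast
  qed
 qed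
qed

lemma of_nice:
 assumes "A:M" "Q:M"
 shows "NN.coded (cv ` {a:ext A. EX c:G. pr a c:ext Q})"
proof -
 define B where "B = mk (chk ` ext A)"
 have B: "B:M" "ext B = chk ` ext A" using mk[OF repl_DefF[OF assms(1) chk(3)]] unfolding B_def by auto
 let ?Q = "%z. EX a:ext A. p1 z = chk a & pr a (p2 z):ext Q"
 have d: "Def (%e. ?Q (e 0))" by (intro def_intro assms)
 have nm: "is_name p a & c:ext p" if "a:ext B" "c:ext p" "?Q (pr a c)" for a c
 proof -
  have "a:chk ` ext A" using that(1) B(2) by simp
  then show ?thesis using name_chk ext_M that(2) by (metis imageE)
 qed
 define u where "u = sepm (times B p) ?Q"
 have u1: "is_name p u" unfolding u_def by (rule name_sepm(1)[OF B(1) prM(1) d nm])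
 have u2: "a:active G u <-> a:ext B & (EX c:G. c:ext p & ?Q (pr a c))" for a
  unfolding u_def by (rule name_sepm(2)[OF B(1) prM(1) d nm])
 have "extN (V u) = cv ` {a:ext A. EX c:G. pr a c:ext Q}" unfolding extN_V[OF u1]
 proof (intro equalityI subsetI)
  fix z assume "z:V ` active G u"
  then obtain s where s: "s:active G u" "z = V s" by blast
  then obtain c where c: "s:ext B" "c:G" "?Q (pr s c)" using u2 by blast
  then obtain a where "a:ext A" "s = chk a" "pr a c:ext Q" using G_M ext_M[OF c(1)] by auto
  then show "z:cv ` {a:ext A. EX c:G. pr a c:ext Q}" using s c unfolding cv_def by blast
 next
  fix z assume "z:cv ` {a:ext A. EX c:G. pr a c:ext Q}"
  then obtain a c where a: "a:ext A" "c:G" "pr a c:ext Q" "z = V (chk a)" unfolding cv_def by blast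
  have "chk a:M" "c:M" using chk(1) ext_M a(1) G_M a(2) by blast+
  then have "?Q (pr (chk a) c)" using a by auto
  moreover have "chk a:ext B" using a(1) B(2) by blast
  ultimately have "chk a:active G u" using u2 a(2) G_p by blast
  then show "z:V ` active G u" using a(4) by blast
 qed
 then show ?thesis unfolding NN.coded_def using V_N[OF u1] by blast
qed

lemma cv_emp: "cv emp = NN.emp"
 by (rule N_ext_eq) (auto simp: ext_cv)

lemma cv_upr: "x:M ==> y:M ==> cv (upr x y) = NN.upr (cv x) (cv y)"
 by (rule N_ext_eq) (auto simp: ext_cv)

lemma cv_pr: "x:M ==> y:M ==> cv (pr x y) = NN.pr (cv x) (cv y)"
 unfolding pr_def NN.pr_def by (simp add: cv_upr)

lemma cv_suc: "x:M ==> cv (suc x) = NN.suc (cv x)"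
 by (rule N_ext_eq) (auto simp: ext_cv)

lemma cv_num: "cv (num n) = NN.num n"
proof (induction n)
 case 0 show ?case by (simp add: cv_emp)
next
 case (Suc n)
 then show ?case using cv_suc[OF num_M[of n]] by simp
qed

lemma cv_om: "cv om = NN.om"
proof (rule N_ext_eq)
 show "extN (cv om) = extN NN.om" unfolding ext_cv[OF om_M] ext_om NN.ext_om image_image cv_num ..
qed auto

lemma cv_times: assumes "x:M" "y:M" shows "cv (times x y) = NN.times (cv x) (cv y)"
proof (rule N_ext_eq)
 show "extN (cv (times x y)) = extN (NN.times (cv x) (cv y))"
  unfolding ext_cv[OF times_M[OF assms]] NN.ext_times[OF cv_N[OF assms(1)] cv_N[OF assms(2)]]
   ext_times[OF assms] ext_cv[OF assms(1)] ext_cv[OF assms(2)]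
  using cv_pr ext_M by (auto simp: image_iff; metis)
qed (use assms in auto)

lemma cv_ordinal: assumes "is_ordinal x" shows "NN.is_ordinal (cv x)"
proof -
 have "is_ordinal x --> NN.is_ordinal (cv x)" if "x:M" for x using that
 proof (induction rule: E_induct)
  case (step x)
  show ?case
  proof
   assume x: "is_ordinal x"
   show "NN.is_ordinal (cv x)"
   proof (rule NN.is_ordinalI)
    fix y assume "y:extN (cv x)"
    then obtain z where z: "z:ext x" "y = cv z" unfolding ext_cv[OF step(1)] by blast
    show "NN.is_ordinal y" using step.IH[OF z(1)] ord_elem[OF x z(1)] z(2) by blast
    have "ext z <= ext x" using ord_trans[OF x z(1)] by blast
    then show "extN y <= extN (cv x)" using z(2) ext_cv[OF ext_M[OF z(1)]] ext_cv[OF step(1)] by auto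
   qed (use step in simp)
  qed
 qed
 then show ?thesis using assms ordM by blast
qed

lemma cv_mem: assumes "x:M" "a:M" shows "cv x:extN (cv a) <-> x:ext a"
proof
 assume "cv x:extN (cv a)"
 then obtain z where "z:ext a" "cv x = cv z" unfolding ext_cv[OF assms(2)] by blast
 then show "x:ext a" using cv_inj[OF assms(1) ext_M] by simp
qed (use ext_cv[OF assms(2)] in blast)

lemma pr_cv_iff: assumes "g:M" "x:M" "y:M"
 shows "NN.pr (cv x) (cv y):extN (cv g) <-> pr x y:ext g"
 using cv_mem[OF pr_M[OF assms(2,3)] assms(1)] cv_pr[OF assms(2,3)] by simp

lemma cv_ap: assumes "is_fun g a b" "x:ext a" shows "NN.ap (cv g) (cv x) = cv (ap g x)"
proof -
 have m: "g:M" "x:M" "ap g x:M" using is_fun_M[OF assms(1)] ext_M[OF assms(2)] by auto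
 show ?thesis
 proof (rule NN.ap_eq)
  show "NN.pr (cv x) (cv (ap g x)):extN (cv g)"
   using pr_cv_iff[OF m] is_funD(2)[OF assms] by blast
  fix y' assume y': "y':N" "NN.pr (cv x) y':extN (cv g)"
  then obtain z where z: "z:ext g" "NN.pr (cv x) y' = cv z" unfolding ext_cv[OF m(1)] by blast
  then obtain u where u: "u:ext a" "z = pr u (ap g u)" using is_fun_mem[OF assms(1)] by blast
  have um: "u:M" "ap g u:M" using ext_M u(1) m(1) by auto
  then have "NN.pr (cv x) y' = NN.pr (cv u) (cv (ap g u))" using z(2) u(2) cv_pr by simp
  then have "cv x = cv u & y' = cv (ap g u)"
   using NN.pr_inject[OF cv_N[OF m(2)] y'(1) cv_N[OF um(1)] cv_N[OF um(2)]] by simp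
  moreover from this have "x = u" using cv_inj[OF m(2) um(1)] by blast
  ultimately show "y' = cv (ap g x)" by simp
 qed (simp_all add: m)
qed

lemma cv_card_le: assumes "card_le a b" "a:M" "b:M" shows "NN.card_le (cv a) (cv b)"
proof -
 obtain g where g: "g:M" "is_fun g a b" "inj_on (ap g) (ext a)" "!!x. x:ext a ==> ap g x:ext b"
  using card_leE[OF assms(1)] by blast
 show ?thesis
 proof (rule NN.card_leI[of _ _ "NN.ap (cv g)"])
  fix x assume "x:extN (cv a)"
  then obtain u where u: "u:ext a" "x = cv u" unfolding ext_cv[OF assms(2)] by blast
  then show "NN.ap (cv g) x:extN (cv b)" using cv_ap[OF g(2) u(1)] g(4)[OF u(1)] ext_cv[OF assms(3)] by simp
 next
  show "NN.DefF (%e. NN.ap (cv g) (e 0))" using g(1) by (intro NN.DefF_ap NN.DefF_const NN.DefF_var) simp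
  show "inj_on (NN.ap (cv g)) (extN (cv a))"
  proof (rule inj_onI)
   fix x y assume xy: "x:extN (cv a)" "y:extN (cv a)" "NN.ap (cv g) x = NN.ap (cv g) y"
   obtain u v where u: "u:ext a" "x = cv u" "v:ext a" "y = cv v" using xy(1,2) unfolding ext_cv[OF assms(2)] by blast
   then have "cv (ap g u) = cv (ap g v)" using xy(3) cv_ap[OF g(2)] by simp
   then have "ap g u = ap g v" using cv_inj ext_M[OF u(1)] ext_M[OF u(3)] g(1) by simp
   then show "x = y" using g(3) u unfolding inj_on_def by blast
  qed
 qed (use assms in auto)
qed

end

context zmod begin

text \<open>Finiteness is evaluated in HOL; to use it in a definable predicate it is expressed by an
  internal injection into some \<open>num n\<close>, which exists because finite graphs are
  elements.\<close>

lemma finite_iff: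
 assumes "s:M"
 shows "finite (ext s) <-> (EX n. EX f:M. (ALL x:ext s. ap f x:ext (num n)) &
  (ALL x:ext s. ALL y:ext s. ap f x = ap f y --> x = y))"
proof
 assume fin: "finite (ext s)"
 then obtain h and n :: nat where h: "bij_betw h (ext s) {0..<n}" using ex_bij_betw_finite_nat by blast
 have "finite ((%x. pr x (num (h x))) ` ext s)" using fin by simp
 then have c: "coded {pr x (num (h x)) | x. x:ext s}"
  using coded_finite[of "(%x. pr x (num (h x))) ` ext s"] ext_M by (simp add: image_subset_iff setcompr_eq_image)
 let ?f = "mk {pr x (num (h x)) | x. x:ext s}"
 have a: "ap ?f x = num (h x)" if "x:ext s" for x
  by (rule graph_ap[OF c]) (use that ext_M in auto)
 have "ALL x:ext s. ap ?f x:ext (num n)"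
  using a h unfolding bij_betw_def by (auto simp: num_mem_num)
 moreover have "ALL x:ext s. ALL y:ext s. ap ?f x = ap ?f y --> x = y"
  using a h unfolding bij_betw_def inj_on_def by simp
 ultimately show "EX n. EX f:M. (ALL x:ext s. ap f x:ext (num n)) &
  (ALL x:ext s. ALL y:ext s. ap f x = ap f y --> x = y)" using mk_M[OF c] by blast
next
 assume "EX n. EX f:M. (ALL x:ext s. ap f x:ext (num n)) &
  (ALL x:ext s. ALL y:ext s. ap f x = ap f y --> x = y)"
 then obtain n f where f: "ALL x:ext s. ap f x:ext (num n)" "inj_on (ap f) (ext s)" unfolding inj_on_def by blast
 have "finite (ext (num n))" unfolding ext_num by simp
 have "finite (ap f ` ext s)" by (rule finite_subset[of _ "ext (num n)"]) (use f(1) in blast, simp add: ext_num)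
 then show "finite (ext s)" using f(2) finite_imageD by blast
qed

lemma Def_finite [def_intro]: assumes "DefF s" shows "Def (%e. finite (ext (s e)))"
proof (rule Def_R1[OF _ assms])
 have "Def (%e. EX n. EX f:M. (ALL x:ext (e 0). ap f x:ext (num n)) &
  (ALL x:ext (e 0). ALL y:ext (e 0). ap f x = ap f y --> x = y))" by (intro def_intro)
 then show "Def (%e. finite (ext (e 0)))" by (rule Def_cong) (rule finite_iff, auto)
qed

lemma finite_le_om: assumes "s:M" "finite (ext s)" shows "card_le s om"
proof -
 obtain n f where f: "f:M" "ALL x:ext s. ap f x:ext (num n)" "ALL x:ext s. ALL y:ext s. ap f x = ap f y --> x = y"
  using assms finite_iff by blast
 have "ext (num n) <= ext om" unfolding ext_num ext_om by blast
 then show ?thesis using f assms(1)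
  by (intro card_leI[of _ _ "ap f"] om_M) (auto simp: inj_on_def intro!: def_intro)
qed

end

context zfc begin

lemma card_le_UN':
 assumes "I:M" "b:M" "DefF (%e. S (e 0))" "!!i. i:ext I ==> card_le (S i) b"
  "U:M" "ext U <= (UN i:ext I. ext (S i))" "card_le I k" "card_le b k" "card_le (times k k) k" "k:M"
 shows "card_le U k"
proof -
 have "card_le U (times I b)" by (rule card_le_UN[OF assms(1-3) _ assms(5,6)]) (rule assms(4))
 moreover have "card_le (times I b) (times k k)" by (rule card_le_times[OF assms(7,8,1,2,10,10)])
 ultimately show ?thesis using card_le_trans assms(5,9,10) times_M[OF assms(1,2)] times_M[OF assms(10,10)] by meson
qed

lemma countable_Fin:
 assumes a: "a:M" "card_le a om" and F: "F:M" "!!x. x:ext F ==> finite (ext x) & ext x <= ext a"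
 shows "card_le F om"
proof -
 obtain g where g: "g:M" "inj_on (ap g) (ext a)" "!!x. x:ext a ==> ap g x:ext om"
  using card_leE[OF a(2)] by blast
 \<comment> \<open>Layers by the largest code of an element; each layer embeds into the power set of
   a finite set, so the union over omega is countable.\<close>
 define S where "S n = sepm F (%x. ALL y:ext x. ap g y:ext n)" for n
 have SD: "DefF (%e. S (e 0))" unfolding S_def by (intro def_intro F g)
 have S: "S n:M & ext (S n) = {x:ext F. ALL y:ext x. ap g y:ext n}" if "n:M" for n
 proof -
  have d: "Def (%e. ALL y:ext (e 0). ap g y:ext n)" by (intro def_intro g that)
  show ?thesis using sepm[OF F(1) d] unfolding S_def by auto
 qed
 have fin: "card_le (S n) om" if n: "n:ext om" for n
 proof (rule finite_le_om)
  have nM: "n:M" using n ext_M by blast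
  show "S n:M" using S[OF nM] by blast
  have fn: "finite (ext n)" using n unfolding ext_om by (auto simp: ext_num simp del: num.simps)
  have "inj_on (%x. ap g ` ext x) (ext (S n))"
  proof (rule inj_onI)
   fix x y assume xy: "x:ext (S n)" "y:ext (S n)" "ap g ` ext x = ap g ` ext y"
   then have s: "ext x <= ext a" "ext y <= ext a" "x:M" "y:M" using S[OF nM] F ext_M by blast+
   have "ext x = ext y" using xy(3) s(1,2) g(2) by (metis inj_on_image_eq_iff)
   then show "x = y" using ext_eqI s(3,4) by blast
  qed
  moreover have "(%x. ap g ` ext x) ` ext (S n) <= Pow (ext n)" using S[OF nM] by blast
  ultimately show "finite (ext (S n))" using fn by (meson finite_Pow_iff finite_imageD finite_subset)
 qed
 have cov: "ext F <= (UN n:ext om. ext (S n))"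
 proof
  fix x assume x: "x:ext F"
  have "finite (dn ` ap g ` ext x)" using F(2)[OF x] by simp
  then obtain k where k: "ALL i:dn ` ap g ` ext x. i < k" using finite_nat_set_iff_bounded by blast
  have "ap g y:ext (num k)" if y: "y:ext x" for y
  proof -
   have "ap g y:ext om" using g(3) F(2)[OF x] y by blast
   then have "ap g y = num (dn (ap g y))" using num_dn by simp
   then show ?thesis using k y num_mem_num by (metis imageI)
  qed
  then have "x:ext (S (num k))" using S[OF num_M] x by blast
  then show "x:(UN n:ext om. ext (S n))" unfolding ext_om by blast
 qed
 have oo: "card_le om om" by (rule card_le_sub) auto
 show ?thesis by (rule card_le_UN'[OF om_M om_M SD fin F(1) cov oo oo om_sq om_M])
qed

subsection \<open>Cohen conditions\<close>

definition cb where "cb J = times (times J om) om"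
definition cp where "cp J = sepm (pw (cb J)) (%s. finite (ext s) &
  (ALL x:M. ALL y:M. ALL z:M. pr x y:ext s --> pr x z:ext s --> y = z))"
definition cr where "cr J = sepm (times (cp J) (cp J)) (%z. ext (p2 z) <= ext (p1 z))"

abbreviation t3 where "t3 j k l \<equiv> pr (pr j (num k)) (num l)"

definition sfun where "sfun A <-> (ALL x:M. ALL y:M. ALL z:M. pr x y:A --> pr x z:A --> y = z)"

lemma cb: assumes "J:M" shows "cb J:M" "ext (cb J) = {t3 j k l | j k l. j:ext J}"
proof -
 show "cb J:M" unfolding cb_def using assms by simp
 show "ext (cb J) = {t3 j k l | j k l. j:ext J}"
  unfolding cb_def ext_times[OF times_M[OF assms om_M] om_M] ext_times[OF assms om_M] ext_om by blast
qed

lemma t3_M [simp]: "j:M ==> t3 j k l:M" by simp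

lemma DefF_cb [def_intro]: "DefF s ==> DefF (%e. cb (s e))"
 unfolding cb_def by (intro def_intro)

lemma DefF_cp [def_intro]: "DefF s ==> DefF (%e. cp (s e))"
 by (rule Def_lift[of cp]) (unfold cp_def, intro def_intro)

lemma cp: assumes "J:M"
 shows cp_M: "cp J:M" and cp_iff: "s:ext (cp J) <-> s:M & ext s <= ext (cb J) & finite (ext s) & sfun (ext s)"
proof -
 have d: "Def (%e. finite (ext (e 0)) &
   (ALL x:M. ALL y:M. ALL z:M. pr x y:ext (e 0) --> pr x z:ext (e 0) --> y = z))" by (intro def_intro)
 have pM: "pw (cb J):M" using cb(1)[OF assms] by simp
 show "cp J:M" unfolding cp_def by (rule sepm_M[OF pM d])
 show "s:ext (cp J) <-> s:M & ext s <= ext (cb J) & finite (ext s) & sfun (ext s)"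
  unfolding cp_def ext_sepm[OF pM d] sfun_def pw(2)[OF cb(1)[OF assms]] by blast
qed

lemma cp_sub: assumes "J:M" "s:ext (cp J)" "t:M" "ext t <= ext s" shows "t:ext (cp J)"
 unfolding cp_iff[OF assms(1)]
proof (intro conjI assms(3))
 have s: "ext s <= ext (cb J)" "finite (ext s)" "sfun (ext s)" using assms(2) unfolding cp_iff[OF assms(1)] by auto
 show "ext t <= ext (cb J)" "finite (ext t)" using s assms(4) finite_subset by auto
 show "sfun (ext t)" using s(3) assms(4) unfolding sfun_def by blast
qed

lemma cp_mono: assumes "J:M" "J':M" "ext J' <= ext J" "s:ext (cp J')" shows "s:ext (cp J)"
proof -
 have "ext (cb J') <= ext (cb J)" unfolding cb(2)[OF assms(1)] cb(2)[OF assms(2)] using assms(3) by blast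
 then show ?thesis using assms(4) unfolding cp_iff[OF assms(1)] cp_iff[OF assms(2)] by blast
qed

lemma cr_iff: assumes "J:M" shows "(s, t):rel (cr J) <-> s:ext (cp J) & t:ext (cp J) & ext t <= ext s"
  "cr J:M"
proof -
 have d: "Def (%e. ext (p2 (e 0)) <= ext (p1 (e 0)))" by (intro def_intro)
 note c = cp_M[OF assms]
 show "cr J:M" unfolding cr_def by (rule sepm_M[OF times_M[OF c c] d])
 show "(s, t):rel (cr J) <-> s:ext (cp J) & t:ext (cp J) & ext t <= ext s"
 proof (cases "s:M & t:M")
  case True
  then have "pr s t:ext (times (cp J) (cp J)) <-> s:ext (cp J) & t:ext (cp J)"
   unfolding ext_times[OF c c] using ext_M pr_inject by blast
  then show ?thesis unfolding rel_iff cr_def ext_sepm[OF times_M[OF c c] d] using True by simp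
 next
  case False then show ?thesis unfolding rel_iff using ext_M by blast
 qed
qed

lemma emp_cp: "J:M ==> emp:ext (cp J)" unfolding cp_iff by (simp add: sfun_def)

lemma cp_poset: assumes "J:M" shows "is_poset (cp J) (cr J)"
 unfolding is_poset_def is_preorder_def
proof (intro conjI)
 note r = cr_iff[OF assms]
 show "cp J:M" by (rule cp_M[OF assms])
 show "is_rel (cr J) (cp J) (cp J)" unfolding is_rel_def
 proof (intro conjI ballI r(2))
  fix z assume z: "z:ext (cr J)"
  have d: "Def (%e. ext (p2 (e 0)) <= ext (p1 (e 0)))" by (intro def_intro)
  have "z:ext (times (cp J) (cp J))" using z unfolding cr_def ext_sepm[OF times_M[OF cp_M[OF assms] cp_M[OF assms]] d] by blast
  then show "EX x:ext (cp J). EX y:ext (cp J). opair z x y"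
   unfolding ext_times[OF cp_M[OF assms] cp_M[OF assms]] opair_iff using ext_M by blast
 qed
 show "refl_on (ext (cp J)) (rel (cr J))" unfolding refl_on_def using r by auto
 show "trans (rel (cr J))" unfolding trans_def r by blast
 show "ext (cp J) ~= {}" using emp_cp[OF assms] by blast
 show "antisym (rel (cr J))" unfolding antisym_def r using ext_eqI ext_M by blast
qed

text \<open>The support of a condition, that is the indices about which it says something.\<close>

definition sup where "sup J q = sepm J (%j. EX k. EX l. t3 j k l:ext q)"

lemma sup: assumes "J:M" "q:M" shows "sup J q:M" "ext (sup J q) = {j:ext J. EX k l. t3 j k l:ext q}"
proof -
 have d: "Def (%e. EX k. EX l. t3 (e 0) k l:ext q)" by (intro def_intro assms)
 show "sup J q:M" "ext (sup J q) = {j:ext J. EX k l. t3 j k l:ext q}"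
  using sepm[OF assms(1) d] unfolding sup_def by auto
qed

lemma sup_cp: assumes "J:M" "U:M" "q:ext (cp J)" "ext (sup J q) <= ext U" shows "q:ext (cp U)"
proof -
 have q: "q:M" "ext q <= ext (cb J)" "finite (ext q)" "sfun (ext q)" using assms(3) unfolding cp_iff[OF assms(1)] by auto
 have "ext q <= ext (cb U)"
 proof
  fix z assume z: "z:ext q"
  then obtain j k l where j: "z = t3 j k l" "j:ext J" using q(2) unfolding cb(2)[OF assms(1)] by blast
  then have "j:ext U" using assms(4) z unfolding sup(2)[OF assms(1) q(1)] by blast
  then show "z:ext (cb U)" unfolding cb(2)[OF assms(2)] using j by blast
 qed
 then show ?thesis unfolding cp_iff[OF assms(2)] using q by blast
qed

lemma finite_sup: assumes "J:M" "q:ext (cp J)" shows "finite (ext (sup J q))"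
proof -
 have q: "q:M" "finite (ext q)" using assms(2) unfolding cp_iff[OF assms(1)] by auto
 have "ext (sup J q) <= (%z. p1 (p1 z)) ` ext q"
 proof
  fix j assume "j:ext (sup J q)"
  then obtain k l where j: "j:M" "t3 j k l:ext q" unfolding sup(2)[OF assms(1) q(1)] using ext_M by blast
  then have "p1 (p1 (t3 j k l)) = j" by simp
  then show "j:(%z. p1 (p1 z)) ` ext q" using j(2) by (metis imageI)
 qed
 then show ?thesis using q(2) finite_surj by blast
qed

lemma countable_cp: assumes "U:M" "card_le U om" shows "card_le (cp U) om"
proof (rule countable_Fin[OF cb(1)[OF assms(1)] _ cp_M[OF assms(1)]])
 have oo: "card_le om om" by (rule card_le_sub) auto
 have m: "times U om:M" "times om om:M" using assms by auto
 have 1: "card_le (times U om) om"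
  using card_le_trans[OF card_le_times[OF assms(2) oo assms(1) om_M om_M om_M] om_sq m(1) om_M] .
 show "card_le (cb U) om" unfolding cb_def
  using card_le_trans[OF card_le_times[OF 1 oo m(1) om_M om_M om_M] om_sq times_M[OF m(1) om_M] om_M] .
 show "finite (ext x) & ext x <= ext (cb U)" if "x:ext (cp U)" for x
  using that unfolding cp_iff[OF assms(1)] by blast
qed

lemma sfun_t3: assumes "sfun A" "j:M" "t3 j k l:A" "t3 j k l':A" shows "l = l'"
proof -
 have "num l = num l'" using assms pr_M[OF assms(2) num_M] num_M unfolding sfun_def by blast
 then show ?thesis by simp
qed

lemma amalg:
 assumes J: "J:M" and q: "q:ext (cp J)" "c:ext (cp J)"
  and key: "!!j k l l'. j:ext J ==> t3 j k l:ext q ==> t3 j k l':ext c ==> l = l'"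
 shows "cup q c:ext (cp J)"
proof -
 have qq: "cup q c:M" "ext (cup q c) = ext q Un ext c" using q ext_M by auto
 have qb: "ext q <= ext (cb J)" "finite (ext q)" "sfun (ext q)" "ext c <= ext (cb J)" "finite (ext c)" "sfun (ext c)"
  using q unfolding cp_iff[OF J] by auto
 have "sfun (ext (cup q c))" unfolding sfun_def qq(2)
 proof (intro ballI impI)
  have mix: "y = z" if h: "x:M" "y:M" "z:M" "pr x y:ext q" "pr x z:ext c" for x y z
  proof -
   obtain j k l where j: "pr x y = t3 j k l" "j:ext J" using qb(1) h(4) unfolding cb(2)[OF J] by blast
   obtain j' k' l' where j': "pr x z = t3 j' k' l'" "j':ext J" using qb(4) h(5) unfolding cb(2)[OF J] by blast
   have jm: "j:M" "j':M" using j j' ext_M by blast+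
   have x: "x = pr j (num k)" "y = num l" "x = pr j' (num k')" "z = num l'" using j(1) j'(1) h jm by simp_all
   then have e: "j' = j" "k' = k" using jm by auto
   have "t3 j k l':ext c" using h(5) j'(1) e by simp
   then show "y = z" using key[OF j(2)] h(4) j(1) x(2,4) by metis
  qed
  fix x y z assume a: "x:M" "y:M" "z:M" "pr x y:ext q Un ext c" "pr x z:ext q Un ext c"
  show "y = z" using a mix[OF a(1-3)] mix[OF a(1,3,2)] qb(3,6) unfolding sfun_def by blast
 qed
 then show ?thesis unfolding cp_iff[OF J] using qq qb by simp
qed

text \<open>Close a countable set of indices under a choice of extensions inside \<open>Q\<close>; the restriction of a
  condition of \<open>Q\<close> to that set then has an extension in \<open>Q\<close> supported there.\<close>

lemma closing:
 assumes J: "J:M" and Q: "Q:M" "ext Q <= ext (cp J)"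
 obtains U where "U:M" "ext U <= ext J" "card_le U om"
  "!!q. q:ext Q ==> EX q':ext Q. ext (sup J q') <= ext U & cup q q':ext (cp J)"
proof -
 \<comment> \<open>All restrictions of members of \<open>Q\<close>, each of which gets one chosen
   extension \<open>ap c s\<close> inside \<open>Q\<close>.\<close>
 define D where "D = sepm (cp J) (%s. EX q:ext Q. ext s <= ext q)"
 have dD: "Def (%e. EX q:ext Q. ext (e 0) <= ext q)" by (intro def_intro Q)
 have D: "D:M" "ext D = {s:ext (cp J). EX q:ext Q. ext s <= ext q}"
  using sepm[OF cp_M[OF J] dD] unfolding D_def by auto
 have "Def (%e. ext (e 0) <= ext (e 1))" by (intro def_intro)
 then obtain c where c: "c:M" "is_fun c D Q" "!!s. s:ext D ==> ext s <= ext (ap c s)"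
  using choice[OF D(1) Q(1), of "%s q. ext s <= ext q"] D(2) by blast
 have cQ: "ap c s:ext Q" if "s:ext D" for s using is_funD(1)[OF c(2) that] .
 have cM: "ap c s:M" if "s:ext D" for s using cQ[OF that] ext_M by blast
 define Dv where "Dv v = sepm D (%s. ext (sup J s) <= ext v)" for v
 \<comment> \<open>One round of the closure: the indices that occur in the chosen extensions of
   restrictions supported in \<open>v\<close>. Countably many finite supports, so countability is
   kept.\<close>
 define Ph where "Ph v = un (mk {sup J (ap c s) | s. s:ext (Dv v)})" for v
 have supD: "DefF s ==> DefF (%e. sup J (s e))" for s
  by (rule Def_lift[of "sup J"]) (unfold sup_def, intro def_intro J)
 have DvD: "DefF s ==> DefF (%e. Dv (s e))" for s
  by (rule Def_lift[of Dv]) (unfold Dv_def, intro def_intro D supD)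
 have PhD: "DefF s ==> DefF (%e. Ph (s e))" for s
 proof (rule Def_lift[of Ph])
  show "DefF (%e. Ph (e 0))" unfolding Ph_def
   by (intro DefF_un DefF_img[of "%x e. sup J (ap c x)"] DvD supD def_intro c)
 qed
 have Dv: "Dv v:M" "ext (Dv v) = {s:ext D. ext (sup J s) <= ext v}" if "v:M" for v
 proof -
  have d: "Def (%e. ext (sup J (e 0)) <= ext v)" by (intro def_intro supD that)
  show "Dv v:M" "ext (Dv v) = {s:ext D. ext (sup J s) <= ext v}" using sepm[OF D(1) d] unfolding Dv_def by auto
 qed
 have Ph: "Ph v:M" "ext (Ph v) = (UN s:ext (Dv v). ext (sup J (ap c s)))" if v: "v:M" for v
 proof -
  have "coded ((%s. sup J (ap c s)) ` ext (Dv v))"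
   by (rule repl_DefF[OF Dv(1)[OF v]]) (intro supD def_intro c)
  then have cc: "coded {sup J (ap c s) | s. s:ext (Dv v)}" by (simp add: setcompr_eq_image)
  show "Ph v:M" "ext (Ph v) = (UN s:ext (Dv v). ext (sup J (ap c s)))"
   using mk[OF cc] unfolding Ph_def by auto
 qed
 have oo: "card_le om om" by (rule card_le_sub) auto
 have Phc: "card_le (Ph v) om" if v: "v:M" "card_le v om" for v
 proof (rule card_le_UN'[OF Dv(1)[OF v(1)] om_M _ _ Ph(1)[OF v(1)] _ _ oo om_sq om_M])
  show "DefF (%e. sup J (ap c (e 0)))" by (intro supD def_intro c)
  show "card_le (sup J (ap c i)) om" if i: "i:ext (Dv v)" for i
  proof -
   have "i:ext D" using i Dv(2)[OF v(1)] by blast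
   then have "ap c i:ext (cp J)" "ap c i:M" using cQ cM Q(2) by blast+
   then show ?thesis using finite_le_om sup(1)[OF J] finite_sup[OF J] by blast
  qed
  show "ext (Ph v) <= (UN i:ext (Dv v). ext (sup J (ap c i)))" using Ph(2)[OF v(1)] by blast
  have "ext (Dv v) <= ext (cp v)" using Dv(2)[OF v(1)] D(2) sup_cp[OF J v(1)] by blast
  then show "card_le (Dv v) om"
   using card_le_trans[OF card_le_sub[OF Dv(1)[OF v(1)] cp_M[OF v(1)]] countable_cp[OF v]] Dv(1)[OF v(1)] om_M by blast
 qed
 define Op where "Op n f = un (mk {Ph v | v. v:ext (rgm f)})" for n f :: 'a
 have OpD: "DefF (%e. Op (e 0) (e 1))" unfolding Op_def
  by (intro DefF_un DefF_img[of "%x e. Ph x"] PhD def_intro)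
 have omM: "ext om <= M" using ext_M by blast
 obtain F where F: "!!i. i:ext om ==> F i = Op i (mk {pr j (F j) | j. j:ext om & ordlt j i})"
  "!!i. i:ext om ==> F i:M" "coded {pr j (F j) | j. j:ext om}"
  "!!i. i:ext om ==> coded {pr j (F j) | j. j:ext om & ordlt j i}"
  using zfc_recursion[OF om_M wfp_on_ordlt[OF omM] ordlt_trans Def_ordlt[OF DefF_var DefF_var] OpD] by blast
 have no: "num n:ext om" for n unfolding ext_om by blast
 define W where "W n = F (num n)" for n
 have WM: "W n:M" for n unfolding W_def using F(2) no by blast
 have W: "ext (W n) = (UN m<n. ext (Ph (W m)))" for n
 proof -
  have J': "j:ext om & ordlt j (num n) <-> j:num ` {..<n}" for j
   unfolding ordlt_def ext_num using ord_num ext_om by auto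
  have c': "coded {pr j (F j) | j. j:num ` {..<n}}" using F(4)[OF no[of n]] unfolding J' .
  let ?f = "mk {pr j (F j) | j. j:num ` {..<n}}"
  have r: "rgm ?f:M" "ext (rgm ?f) = W ` {..<n}"
  proof -
   show "rgm ?f:M" by (rule rgm_M(1)[OF mk_M[OF c']])
   have "ext (rgm ?f) = F ` num ` {..<n}" by (rule rgm_graph[OF c']) (use F(2) no in auto)
   then show "ext (rgm ?f) = W ` {..<n}" unfolding W_def by (simp add: image_image)
  qed
  have "coded (Ph ` ext (rgm ?f))" by (rule repl_DefF[OF r(1)]) (intro PhD def_intro)
  then have cc: "coded {Ph v | v. v:ext (rgm ?f)}" by (simp add: setcompr_eq_image)
  have "W n = Op (num n) ?f" unfolding W_def using F(1)[OF no[of n]] unfolding J' .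
  then show ?thesis unfolding Op_def using mk[OF cc] r(2) by auto
 qed
 have Wc: "card_le (W n) om" for n
 proof (induction n rule: less_induct)
  case (less n)
  define g where "g = mk {pr j (F j) | j. j:ext om}"
  have gM: "g:M" unfolding g_def by (rule mk_M[OF F(3)])
  have ga: "ap g (num m) = W m" for m unfolding g_def W_def
   by (rule graph_ap[OF F(3) omM]) (use F(2) no in auto)
  show ?case
  proof (rule card_le_UN'[OF num_M[of n] om_M _ _ WM _ _ oo om_sq om_M])
   show "DefF (%e. Ph (ap g (e 0)))" by (intro PhD def_intro gM)
   show "card_le (Ph (ap g i)) om" if "i:ext (num n)" for i
    using that less ga Phc WM unfolding ext_num by auto
   show "ext (W n) <= (UN i:ext (num n). ext (Ph (ap g i)))" unfolding W ext_num using ga by auto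
   show "card_le (num n) om" by (rule finite_le_om) (auto simp: ext_num simp del: num.simps)
  qed
 qed
 define g where "g = mk {pr j (F j) | j. j:ext om}"
 have gM: "g:M" unfolding g_def by (rule mk_M[OF F(3)])
 have ga: "ap g (num m) = W m" for m unfolding g_def W_def
  by (rule graph_ap[OF F(3) omM]) (use F(2) no in auto)
 have cg: "coded (ap g ` ext om)" by (rule repl_DefF[OF om_M]) (intro def_intro gM)
 define U where "U = un (mk (ap g ` ext om))"
 have U: "U:M" "ext U = (UN n. ext (W n))" using mk[OF cg] ga unfolding U_def ext_om by auto
 have mono: "ext (W m) <= ext (W n)" if "m <= n" for m n using that unfolding W by force
 show ?thesis
 proof (rule that[OF U(1)])
  show "ext U <= ext J"
  proof
   fix j assume "j:ext U"
   then obtain m where "j:ext (Ph (W m))" unfolding U(2) W by blast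
   then obtain s where s: "s:ext D" "j:ext (sup J (ap c s))" unfolding Ph(2)[OF WM] using Dv(2)[OF WM] by blast
   then show "j:ext J" unfolding sup(2)[OF J cM[OF s(1)]] by blast
  qed
  have "ext U <= (UN i:ext om. ext (ap g i))" unfolding U(2) ext_om using ga by auto
  then show "card_le U om"
  proof (rule card_le_UN'[OF om_M om_M _ _ U(1) _ oo oo om_sq om_M, rotated 2])
   show "DefF (%e. ap g (e 0))" by (intro def_intro gM)
   show "card_le (ap g i) om" if "i:ext om" for i using that Wc ga unfolding ext_om by auto
  qed
  fix q assume q: "q:ext Q"
  have qJ: "q:ext (cp J)" "q:M" using Q(2) q ext_M by blast+
  have ds: "Def (%e. p1 (p1 (e 0)):ext U)" by (intro def_intro U)
  \<comment> \<open>The restriction of \<open>q\<close> to \<open>U\<close>. Its support is finite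
    and hence already included in some \<open>W n\<close>, so that its chosen extension is supported
    in the next round.\<close>
  define s where "s = sepm q (%z. p1 (p1 z):ext U)"
  have s: "s:M" "ext s = {z:ext q. p1 (p1 z):ext U}" using sepm[OF qJ(2) ds] unfolding s_def by auto
  have sJ: "s:ext (cp J)" using cp_sub[OF J qJ(1) s(1)] s(2) by blast
  have sD: "s:ext D" unfolding D(2) using sJ q s(2) by blast
  have "ext (sup J s) <= ext U"
  proof
   fix j assume "j:ext (sup J s)"
   then obtain k l where j: "j:M" "t3 j k l:ext s" unfolding sup(2)[OF J s(1)] using ext_M by blast
   then have "p1 (p1 (t3 j k l)):ext U" using s(2) by blast
   then show "j:ext U" using j(1) by simp
  qed
  then have "ALL j:ext (sup J s). EX n. j:ext (W n)" unfolding U(2) by blast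
  then obtain h where h: "!!j. j:ext (sup J s) ==> j:ext (W (h j))" by metis
  have "finite (h ` ext (sup J s))" using finite_sup[OF J sJ] by simp
  then obtain n where n: "ALL i:h ` ext (sup J s). i <= n" using finite_nat_set_iff_bounded_le by blast
  have "ext (sup J s) <= ext (W n)" using h n mono by blast
  then have "s:ext (Dv (W n))" using Dv(2)[OF WM] sD by blast
  then have "ext (sup J (ap c s)) <= ext (Ph (W n))" unfolding Ph(2)[OF WM] by blast
  also have "... <= ext (W (Suc n))" unfolding W[of "Suc n"] by blast
  finally have sU: "ext (sup J (ap c s)) <= ext U" unfolding U(2) by blast
  let ?q = "ap c s"
  have q': "?q:ext Q" "?q:M" "?q:ext (cp J)" using cQ[OF sD] cM[OF sD] Q(2) by blast+
  \<comment> \<open>Where the two conditions overlap, the index lies in \<open>U\<close>, so the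
    value of \<open>q\<close> there belongs to \<open>s\<close> and thus to the extension of
    \<open>s\<close>. This makes \<open>q\<close> and \<open>?q\<close> compatible.\<close>
  have key: "t3 j k l:ext ?q" if "t3 j k l:ext q" "t3 j k l':ext ?q" "j:ext J" for j k l l'
  proof -
   have "j:ext (sup J ?q)" unfolding sup(2)[OF J q'(2)] using that by blast
   then have "p1 (p1 (t3 j k l)):ext U" using sU ext_M[OF that(3)] by auto
   then have "t3 j k l:ext s" unfolding s(2) using that(1) by blast
   then show ?thesis using c(3)[OF sD] by blast
  qed
  have qq: "cup q ?q:M" "ext (cup q ?q) = ext q Un ext ?q" using qJ(2) q'(2) by auto
  have qb: "sfun (ext ?q)" using q'(3) unfolding cp_iff[OF J] by blast
  have "cup q ?q:ext (cp J)"
  proof (rule amalg[OF J qJ(1) q'(3)])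
   fix j k l l' assume h: "j:ext J" "t3 j k l:ext q" "t3 j k l':ext ?q"
   show "l = l'" using sfun_t3[OF qb _ key[OF h(2,3,1)] h(3)] h(1) ext_M by blast
  qed
  then show "EX q':ext Q. ext (sup J q') <= ext U & cup q q':ext (cp J)" using q'(1) sU by blast
 qed
qed

text \<open>For an antichain, the compatible member supported in \<open>U\<close> that
  \<open>closing\<close> provides can only be \<open>q\<close> itself. All members therefore live
  over one countable set of indices, where there are only countably many conditions. This takes the
  place of the Delta-system lemma.\<close>

lemma cp_ccc: assumes J: "J:M" shows "is_ccc (cp J) (cr J)"
 unfolding is_ccc_def
proof (intro ballI impI)
 fix a assume a: "a:M" and h: "ext a <= ext (cp J) &
  (ALL x:ext a. ALL y:ext a. x ~= y --> ~compatible (cp J) (cr J) x y)"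
 obtain U where U: "U:M" "ext U <= ext J" "card_le U om"
  "!!q. q:ext a ==> EX q':ext a. ext (sup J q') <= ext U & cup q q':ext (cp J)"
  using closing[OF J a] h by blast
 have "ext a <= ext (cp U)"
 proof
  fix q assume q: "q:ext a"
  then obtain q' where q': "q':ext a" "ext (sup J q') <= ext U" "cup q q':ext (cp J)" using U(4) by blast
  have "q:M" "q':M" using q q' ext_M by blast+
  then have "ext q <= ext (cup q q')" "ext q' <= ext (cup q q')" by auto
  then have "compatible (cp J) (cr J) q q'" unfolding compatible_def cr_iff[OF J] using q q'(1,3) h by blast
  then have "q = q'" using h q q'(1) by blast
  then show "q:ext (cp U)" using sup_cp[OF J U(1)] q' h by blast
 qed
 then show "is_countable a" unfolding is_countable_iff
  using card_le_trans[OF card_le_sub[OF a cp_M[OF U(1)]] countable_cp[OF U(1,3)] a om_M] by blast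
qed

end

context zfc begin

lemma cp_insert:
 assumes "J:M" "s:ext (cp J)" "j:ext J" "!!l. t3 j k l ~: ext s"
 shows "cup s (upr (t3 j k l) (t3 j k l)):ext (cp J)" "ext (cup s (upr (t3 j k l) (t3 j k l))) = insert (t3 j k l) (ext s)"
proof -
 have j: "j:M" "s:M" using assms ext_M by blast+
 then show e: "ext (cup s (upr (t3 j k l) (t3 j k l))) = insert (t3 j k l) (ext s)" by simp
 have u: "upr (t3 j k l) (t3 j k l):ext (cp J)" unfolding cp_iff[OF assms(1)]
  using j cb(2)[OF assms(1)] assms(3) by (auto simp: sfun_def simp del: num.simps)
 show "cup s (upr (t3 j k l) (t3 j k l)):ext (cp J)"
 proof (rule amalg[OF assms(1,2) u])
  fix j' k' m m' assume h: "j':ext J" "t3 j' k' m:ext s" "t3 j' k' m':ext (upr (t3 j k l) (t3 j k l))"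
  have "t3 j' k' m' = t3 j k l" using h(3) j by simp
  then have "j' = j" "k' = k" using h(1) ext_M j by simp_all
  then show "m = m'" using assms(4) h(2) by blast
 qed
qed

lemma fresh: assumes "finite (ext s)" shows "EX k. ALL v:M. ALL l. t3 v k l ~: ext s"
proof -
 obtain k where k: "k ~: (%z. dn (p2 (p1 z))) ` ext s" using ex_new_if_finite[OF infinite_UNIV_nat finite_imageI[OF assms]] by blast
 have "k:(%z. dn (p2 (p1 z))) ` ext s" if "v:M" "t3 v k l:ext s" for v l
  by (rule image_eqI[OF _ that(2)]) (use that(1) in simp)
 then show ?thesis using k by blast
qed

end

section \<open>The generic Cohen reals\<close>

locale cohen = zfc M E for M :: "'a set" and E +
 fixes J :: 'a and G :: "'a set"
 assumes J [simp, def_intro]: "J:M" and cgen: "is_generic_filter (cp J) (cr J) G"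

sublocale cohen < forcing M E "cp J" "cr J" emp G
proof
 show "is_preorder (cp J) (cr J)" using cp_poset[OF J] unfolding is_poset_def by blast
 show "emp:ext (cp J)" by (rule emp_cp[OF J])
 show "(c, emp):rel (cr J)" if "c:ext (cp J)" for c using that emp_cp[OF J] unfolding cr_iff[OF J] by simp
qed (rule cgen)

context cohen begin

lemma le_iff: "le s t <-> s:ext (cp J) & t:ext (cp J) & ext t <= ext s" unfolding le_def cr_iff[OF J] ..

definition tr where "tr z <-> (EX c:G. z:ext c)"

lemma tr_fun: assumes "tr (t3 j k l)" "tr (t3 j k l')" "j:M" shows "l = l'"
proof -
 obtain c c' where c: "c:G" "t3 j k l:ext c" "c':G" "t3 j k l':ext c'" using assms unfolding tr_def by blast
 obtain d where d: "d:G" "le d c" "le d c'" using G_dir[OF c(1,3)] by blast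
 have "sfun (ext d)" using d(2) unfolding le_iff cp_iff[OF J] by blast
 moreover have "t3 j k l:ext d" "t3 j k l':ext d" using c d unfolding le_iff by blast+
 ultimately have "num l = num l'" unfolding sfun_def using pr_M[OF assms(3) num_M] num_M by blast
 then show ?thesis by simp
qed

lemma tr_cb: assumes "tr z" shows "z:ext (cb J)"
 using assms G_p unfolding tr_def cp_iff[OF J] by blast

lemma tr_total: assumes j: "j:ext J" shows "EX l. tr (t3 j k l)"
proof -
 have jM: "j:M" using j ext_M by blast
 have "EX s:G. EX l. t3 j k l:ext s"
 proof (rule generic_below[OF one_G])
  show "Def (%e. EX l. t3 j k l:ext (e 0))" by (intro def_intro jM)
  fix q assume "le q emp"
  then have q: "q:ext (cp J)" unfolding le_iff by blast
  show "EX s. le s q & (EX l. t3 j k l:ext s)"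
  proof (cases "EX l. t3 j k l:ext q")
   case True then show ?thesis using le_refl[OF q] by blast
  next
   case False
   then have f: "!!l. t3 j k l ~: ext q" by blast
   show ?thesis using cp_insert[OF J q j f, of 0] q unfolding le_iff by blast
  qed
 qed
 then show ?thesis unfolding tr_def by blast
qed

text \<open>The value 0 outside \<open>J\<close> lets one write \<open>g\<close> at every index even
  when the forcing has been restricted to a smaller set.\<close>

definition g where "g j k = (if j:ext J then THE l. tr (t3 j k l) else 0)"

lemma g_iff: assumes "j:ext J" shows "tr (t3 j k l) <-> g j k = l"
proof -
 have jM: "j:M" using assms ext_M by blast
 obtain l0 where l0: "tr (t3 j k l0)" using tr_total[OF assms] by blast
 then have "(THE l. tr (t3 j k l)) = l0" using tr_fun[OF _ _ jM] by blast
 then show ?thesis using l0 tr_fun[OF _ _ jM] assms unfolding g_def by auto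
qed

text \<open>All Cohen reals together as one element of the extension; constructions carried out
  there read \<open>g\<close> from it.\<close>

definition GG where "GG = NN.mk (cv ` {z:ext (cb J). tr z})"

lemma GG: "GG:N" "extN GG = cv ` {z:ext (cb J). tr z}"
proof -
 define Q where "Q = sepm (times (cb J) (cp J)) (%z. p1 z:ext (p2 z))"
 have d: "Def (%e. p1 (e 0):ext (p2 (e 0)))" by (intro def_intro)
 have c: "cb J:M" using cb[OF J] by blast
 have Q: "Q:M" "ext Q = {z:ext (times (cb J) (cp J)). p1 z:ext (p2 z)}"
  using sepm[OF times_M[OF c prM(1)] d] unfolding Q_def by auto
 have "pr a q:ext Q <-> q:ext (cp J) & a:ext q" if "a:ext (cb J)" "q:M" for a q
  unfolding Q(2) ext_times[OF c prM(1)] using that ext_M[OF that(1)] ext_M by (auto simp: p12)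
 then have "{a:ext (cb J). EX q:G. pr a q:ext Q} = {z:ext (cb J). tr z}"
  unfolding tr_def using G_p G_M by blast
 then have "NN.coded (cv ` {z:ext (cb J). tr z})" using of_nice[OF c Q(1)] by simp
 then show "GG:N" "extN GG = cv ` {z:ext (cb J). tr z}" using NN.mk unfolding GG_def by auto
qed

lemma GG_mem: assumes "i:M" "y:N"
 shows "NN.pr (NN.pr (cv i) (NN.num k)) y:extN GG <-> i:ext J & y = NN.num (g i k)"
proof
 assume "NN.pr (NN.pr (cv i) (NN.num k)) y:extN GG"
 then obtain z where z: "z:ext (cb J)" "tr z" "NN.pr (NN.pr (cv i) (NN.num k)) y = cv z" unfolding GG(2) by blast
 then obtain j k' l where j: "z = t3 j k' l" "j:ext J" unfolding cb(2)[OF J] by blast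
 have jM: "j:M" using j ext_M by blast
 have "NN.pr (NN.pr (cv i) (NN.num k)) y = NN.pr (NN.pr (cv j) (NN.num k')) (NN.num l)"
  unfolding z(3) j(1) using jM by (simp add: cv_pr cv_num del: num.simps NN.num.simps)
 then have "i = j" "k = k'" "y = NN.num l" using assms jM by simp_all
 then show "i:ext J & y = NN.num (g i k)" using j z(2) g_iff by auto
next
 assume h: "i:ext J & y = NN.num (g i k)"
 then have "tr (t3 i k (g i k))" using g_iff by blast
 then have "cv (t3 i k (g i k)):extN GG" unfolding GG(2) using tr_cb by blast
 then show "NN.pr (NN.pr (cv i) (NN.num k)) y:extN GG" using h assms by (simp add: cv_pr cv_num del: num.simps NN.num.simps)
qed

subsection \<open>Cardinal preservation\<close>

text \<open>Fix a value \<open>b\<close>. Conditions that make \<open>b\<close> the value of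
  different arguments, and exclude any other argument for it, are pairwise incompatible, so the
  countable chain condition leaves only countably many possible arguments for each \<open>b\<close>.
  These sets cover \<open>ka\<close>.\<close>

lemma card_le_preserved:
 assumes "ka:M" "mu:M" "NN.card_le (cv ka) (cv mu)" "card_le (times mu mu) mu" "card_le om mu"
 shows "card_le ka mu"
proof -
 obtain f where f: "f:N" "NN.is_fun f (cv ka) (cv mu)" "inj_on (NN.ap f) (extN (cv ka))"
   "!!x. x:extN (cv ka) ==> NN.ap f x:extN (cv mu)" using NN.card_leE[OF assms(3)] by blast
 obtain Q where Q: "Q:M" "ext Q <= ext (times (times ka mu) (cp J))"
  "!!a. a:ext (times ka mu) ==> cv a:extN f <-> (EX c:G. pr a c:ext Q)"
  "!!a c c'. a:M ==> pr a c:ext Q ==> le c' c ==> pr a c':ext Q"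
  using nice_name[OF f(1) times_M[OF assms(1,2)]] by blast
 \<comment> \<open>\<open>c\<close> places \<open>x\<close> over \<open>b\<close>, and no stronger
   condition places another argument over \<open>b\<close>. The second clause is what makes
   witnesses for different arguments incompatible.\<close>
 define wit where "wit c x b <-> c:ext (cp J) & pr (pr x b) c:ext Q &
  (ALL y:ext ka. y ~= x --> (ALL c':ext (cp J). le c' c --> pr (pr y b) c' ~: ext Q))" for c x b
 define W where "W b = sepm ka (%x. EX c:ext (cp J). wit c x b)" for b
 have WD: "DefF (%e. W (e 0))" unfolding W_def wit_def by (intro def_intro assms Q)
 have W: "W b:M & ext (W b) = {x:ext ka. EX c:ext (cp J). wit c x b}" if b: "b:M" for b
 proof -
  have d: "Def (%e. EX c:ext (cp J). wit c (e 0) b)" unfolding wit_def by (intro def_intro assms Q b)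
  show ?thesis using sepm[OF assms(1) d] unfolding W_def by auto
 qed
 have cnt: "card_le (W b) om" if b: "b:ext mu" for b
 proof -
  have bM: "b:M" using b ext_M by blast
  note W = W[OF bM]
  have "Def (%e. wit (e 1) (e 0) b)" unfolding wit_def by (intro def_intro assms Q bM)
  then obtain c where c: "c:M" "is_fun c (W b) (cp J)" "!!x. x:ext (W b) ==> wit (ap c x) x b"
   using choice[of "W b" "cp J" "%x c. wit c x b"] W prM(1) by blast
  have cc: "coded (ap c ` ext (W b))" by (rule repl_DefF) (use W in blast, intro def_intro c)
  define a where "a = mk (ap c ` ext (W b))"
  have a: "a:M" "ext a = ap c ` ext (W b)" using mk[OF cc] unfolding a_def by auto
  have inc: "x = y" if xy: "x:ext (W b)" "y:ext (W b)" "compatible (cp J) (cr J) (ap c x) (ap c y)" for x y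
  proof (rule ccontr)
   assume ne: "x ~= y"
   obtain z where z: "z:ext (cp J)" "le z (ap c x)" "le z (ap c y)" using xy(3) unfolding compatible_def le_def by blast
   have m: "x:ext ka" "y:ext ka" using xy W by blast+
   have "pr (pr y b) z:ext Q" using Q(4)[of "pr y b" "ap c y" z] c(3)[OF xy(2)] z(3) ext_M[OF m(2)] bM unfolding wit_def by simp
   then show False using c(3)[OF xy(1)] z m(2) ne[symmetric] unfolding wit_def by blast
  qed
  have "is_countable a"
  proof -
   have "ext a <= ext (cp J)" unfolding a(2) using is_funD(1)[OF c(2)] by blast
   moreover have "ALL u:ext a. ALL v:ext a. u ~= v --> ~compatible (cp J) (cr J) u v"
    unfolding a(2) using inc by blast
   ultimately show ?thesis using cp_ccc[OF J] a(1) unfolding is_ccc_def by blast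
  qed
  then have ao: "card_le a om" unfolding is_countable_iff .
  have refl: "compatible (cp J) (cr J) u u" if "u:ext (cp J)" for u
   using that unfolding compatible_def cr_iff[OF J] by blast
  have "card_le (W b) a"
  proof (rule card_leI[of _ _ "ap c"])
   show "inj_on (ap c) (ext (W b))"
   proof (rule inj_onI)
    fix x y assume xy: "x:ext (W b)" "y:ext (W b)" "ap c x = ap c y"
    show "x = y" using inc[OF xy(1,2)] xy(3) refl[OF is_funD(1)[OF c(2) xy(2)]] by simp
   qed
  qed (use W a in auto, intro def_intro c)
  then show ?thesis using card_le_trans[OF _ ao] W om_M by blast
 qed
 have cov: "ext ka <= (UN b:ext mu. ext (W b))"
 proof
  fix x assume x: "x:ext ka"
  have xM: "x:M" using x ext_M by blast
  have cx: "cv x:extN (cv ka)" unfolding ext_cv[OF assms(1)] using x by blast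
  then obtain b where b: "b:ext mu" "NN.ap f (cv x) = cv b" using f(4) unfolding ext_cv[OF assms(2)] by blast
  have bM: "b:M" using b ext_M by blast
  have tim: "pr y b:ext (times ka mu)" if "y:ext ka" for y unfolding ext_times[OF assms(1,2)] using that b by blast
  have "cv (pr x b):extN f" using NN.is_funD(2)[OF f(2) cx] unfolding b(2) cv_pr[OF xM bM] .
  then obtain c where c: "c:G" "pr (pr x b) c:ext Q" unfolding Q(3)[OF tim[OF x]] by blast
  \<comment> \<open>Otherwise a second argument with value \<open>b\<close> would appear densely
    below \<open>c\<close>, hence in the extension, against injectivity of \<open>f\<close>. The
    condition found need not be in \<open>G\<close>; it only has to exist.\<close>
  have "EX c'. le c' c & ~(EX s. le s c' & (EX y:ext ka. y ~= x & pr (pr y b) s:ext Q))"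
  proof (rule ccontr)
   assume n: "~?thesis"
   have "EX s:G. EX y:ext ka. y ~= x & pr (pr y b) s:ext Q"
    by (rule generic_below[OF c(1)], intro def_intro assms Q bM xM) (use n in blast)
   then obtain s y where s: "s:G" "y:ext ka" "y ~= x" "pr (pr y b) s:ext Q" by blast
   have yM: "y:M" using s ext_M by blast
   have cy: "cv y:extN (cv ka)" unfolding ext_cv[OF assms(1)] using s by blast
   have "cv (pr y b):extN f" unfolding Q(3)[OF tim[OF s(2)]] using s by blast
   then have "NN.pr (cv y) (cv b):extN f" unfolding cv_pr[OF yM bM] .
   then have "cv b = NN.ap f (cv y)" using NN.is_funD(3)[OF f(2) cy] bM by blast
   then have "cv x = cv y" using f(3) cx cy b(2) unfolding inj_on_def by simp
   then show False using cv_inj[OF xM yM] s(3) by blast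
  qed
  then obtain c' where c': "le c' c" "!!s y. le s c' ==> y:ext ka ==> y ~= x ==> pr (pr y b) s ~: ext Q" by blast
  have "pr (pr x b) c':ext Q" by (rule Q(4)[OF _ c(2) c'(1)]) (use xM bM in simp)
  then have "wit c' x b" unfolding wit_def using c' le_p(1)[OF c'(1)] by blast
  then have "x:ext (W b)" using W[OF bM] x le_p(1)[OF c'(1)] by blast
  then show "x:(UN b:ext mu. ext (W b))" using b(1) by blast
 qed
 show ?thesis
  by (rule card_le_UN'[OF assms(2) om_M WD cnt assms(1) cov card_le_sub[OF assms(2,2)] assms(5,4,2)]) auto
qed

lemma next_preserved:
 assumes "is_ordinal a" "is_cardinal a" "NN.is_cardinal (cv a)" "card_le (times a a) a" "card_le om a"
 shows "NN.is_next_cardinal (cv (hart a)) (cv a)"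
proof -
 have aM: "a:M" using assms(1) ordM by blast
 note h = hart_M[OF aM] ord_hart[OF aM] hart_not[OF aM]
 have no: "~NN.card_le (cv (hart a)) (cv a)" using card_le_preserved[OF h(1) aM _ assms(4,5)] h(3) by blast
 have el: "NN.card_le x (cv a) & x:N" if x: "x:extN (cv (hart a))" for x
 proof -
  obtain y where y: "y:ext (hart a)" "x = cv y" using x unfolding ext_cv[OF h(1)] by blast
  then show ?thesis using cv_card_le[of y a] hart_iff[OF aM] aM ext_M by blast
 qed
 have "NN.is_cardinal (cv (hart a))" unfolding NN.is_cardinal_def
 proof (intro conjI ballI notI)
  show "NN.is_ordinal (cv (hart a))" using cv_ordinal h(2) by blast
  fix x assume x: "x:extN (cv (hart a))" and "NN.card_eq x (cv (hart a))"
  then have "NN.card_eq (cv (hart a)) x" using NN.card_eq_sym el h(1) by blast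
  then have "NN.card_le (cv (hart a)) x" using NN.card_eq_le el[OF x] h(1) by blast
  then show False using no NN.card_le_trans el[OF x] h(1) aM by blast
 qed
 moreover have "cv a:extN (cv (hart a))" unfolding ext_cv[OF h(1)] using hart_iff[OF aM] assms(1) card_le_sub[OF aM aM] by blast
 moreover have "cv a ~: extN x" if x: "x:extN (cv (hart a))" "NN.is_cardinal x" for x
 proof
  assume ax: "cv a:extN x"
  have xo: "NN.is_ordinal x" using x(2) unfolding NN.is_cardinal_def by blast
  have "extN (cv a) <= extN x" using ax xo unfolding NN.is_ordinal_def NN.is_transitive_def by blast
  then have "NN.card_le (cv a) x" using NN.card_le_sub el[OF x(1)] aM by blast
  then have "NN.card_eq (cv a) x" using NN.cantor_bernstein el[OF x(1)] aM by blast
  then show False using x(2) ax unfolding NN.is_cardinal_def by blast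
 qed
 ultimately show ?thesis unfolding NN.is_next_cardinal_def by blast
qed

lemma omegas: "NN.is_omega_n 1 (cv w1)" "NN.is_omega_n 2 (cv w2)"
  "~NN.card_le (cv w1) NN.om" "~NN.card_le (cv w2) (cv w1)"
proof -
 have oo: "card_le om om" by (rule card_le_sub) auto
 have ow: "card_le om w1" by (rule card_le_sub) (use ord_trans[OF ord_w(1) om_w1] in auto)
 have 1: "NN.is_next_cardinal (cv w1) NN.om"
  unfolding w1_def cv_om[symmetric]
  by (rule next_preserved[OF ord_om is_cardinal_om _ om_sq oo]) (simp add: cv_om NN.is_cardinal_om)
 then have c1: "NN.is_cardinal (cv w1)" unfolding NN.is_next_cardinal_def by blast
 have 2: "NN.is_next_cardinal (cv w2) (cv w1)"
  unfolding w2_def by (rule next_preserved[OF ord_w(1) is_cardinal_w1 c1 w1_sq ow])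
 have o: "NN.is_omega_n 0 NN.om" using NN.is_omega_iff by simp
 show i1: "NN.is_omega_n 1 (cv w1)" using o 1 by auto
 then have "NN.is_omega_n (Suc 1) (cv w2)" using 2 unfolding NN.is_omega_n.simps(2)[of 1] by blast
 then show "NN.is_omega_n 2 (cv w2)" by (simp only: Suc_1)
 show "~NN.card_le (cv w1) NN.om" using card_le_preserved[OF w1_M om_M _ om_sq oo] not_w1 cv_om by metis
 show "~NN.card_le (cv w2) (cv w1)" using card_le_preserved[OF w2_M w1_M _ w1_sq ow] not_w2 by blast
qed

end

context zmod begin

lemma Def_card_le [def_intro]: assumes "DefF s" "DefF t" shows "Def (%e. card_le (s e) (t e))"
proof (rule Def_R2[OF _ assms])
 have "Def (%e. EX f:M. (ALL x:ext (e 0). ap f x:ext (e 1)) &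
  (ALL x:ext (e 0). ALL y:ext (e 0). ap f x = ap f y --> x = y))" by (intro def_intro)
 then show "Def (%e. card_le (e 0) (e 1))"
 proof (rule Def_cong)
  fix e :: "nat => 'a" assume "range e <= M"
  then have m: "e 0:M" "e 1:M" by blast+
  show "card_le (e 0) (e 1) <-> (EX f:M. (ALL x:ext (e 0). ap f x:ext (e 1)) &
   (ALL x:ext (e 0). ALL y:ext (e 0). ap f x = ap f y --> x = y))" (is "?l <-> ?r")
  proof
   assume ?l
   then show ?r by (rule card_leE) (auto simp: inj_on_def)
  next
   assume ?r
   then obtain f where f: "f:M" "ALL x:ext (e 0). ap f x:ext (e 1)"
    "ALL x:ext (e 0). ALL y:ext (e 0). ap f x = ap f y --> x = y" by blast
   show ?l by (rule card_leI[OF m, of "ap f"]) (use f in \<open>auto simp: inj_on_def intro!: def_intro\<close>)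
  qed
 qed
qed

end

section \<open>Restricted forcings and countable supports\<close>

context cohen begin

lemma rst: assumes "q:ext (cp J)" "A:M" "ext A <= ext J"
 obtains q' where "q':ext (cp A)" "ext q' = ext q Int ext (cb A)"
proof -
 have q: "q:M" "finite (ext q)" "sfun (ext q)" using assms(1) unfolding cp_iff[OF J] by auto
 have d: "Def (%e. e 0:ext (cb A))" by (intro def_intro cb assms)
 have e: "sepm q (%z. z:ext (cb A)):M" "ext (sepm q (%z. z:ext (cb A))) = ext q Int ext (cb A)"
  using sepm[OF q(1) d] by auto
 then have "sepm q (%z. z:ext (cb A)):ext (cp A)" unfolding cp_iff[OF assms(2)]
  using q unfolding sfun_def by auto
 then show ?thesis using that e(2) by blast
qed

text \<open>A condition is compatible with every condition over \<open>A\<close> that extends its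
  own restriction to \<open>A\<close>. So sets dense over \<open>A\<close> are met by
  \<open>G\<close> through conditions of the full poset.\<close>

lemma cohen_restrict:
 assumes A: "A:M" "ext A <= ext J"
 shows "cohen M E A (G Int ext (cp A))"
proof -
 note r = cr_iff[OF A(1)]
 have sub: "x:ext (cp J)" if "x:ext (cp A)" for x by (rule cp_mono[OF J A that])
 have "is_generic_filter (cp A) (cr A) (G Int ext (cp A))" unfolding is_generic_filter_def
 proof (intro conjI ballI impI allI)
  show "G Int ext (cp A) ~= {}" using one_G emp_cp[OF A(1)] by blast
  fix x y assume x: "x:G Int ext (cp A)"
  show "y:G Int ext (cp A)" if y: "y:ext (cp A)" "(x, y):rel (cr A)"
   using G_up[of x y] x y sub unfolding le_iff r by blast
  assume y: "y:G Int ext (cp A)"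
  obtain z where z: "z:G" "le z x" "le z y" using x y G_dir by blast
  obtain z' where z': "z':ext (cp A)" "ext z' = ext z Int ext (cb A)" using rst[OF G_p[OF z(1)] A] by blast
  have "ext x <= ext (cb A)" "ext y <= ext (cb A)" using x y unfolding Int_iff cp_iff[OF A(1)] by auto
  then have "ext x <= ext z'" "ext y <= ext z'" using z z' unfolding le_iff by blast+
  moreover have "z':G" by (rule G_up[OF z(1)]) (use z z' sub G_p in \<open>auto simp: le_iff\<close>)
  ultimately show "EX z:G Int ext (cp A). (z, x):rel (cr A) & (z, y):rel (cr A)"
   unfolding r using x y z' by blast
 next
  fix d assume "is_dense (cp A) (cr A) d"
  then have d: "d:M" "ext d <= ext (cp A)" "!!x. x:ext (cp A) ==> EX y:ext d. ext x <= ext y"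
   unfolding is_dense_def r by blast+
  have "EX s:G. EX c:ext d. ext c <= ext s"
  proof (rule generic_below[OF one_G])
   show "Def (%e. EX c:ext d. ext c <= ext (e 0))" by (intro def_intro d)
   fix q assume "le q emp"
   then have q: "q:ext (cp J)" unfolding le_iff by blast
   obtain q' where q': "q':ext (cp A)" "ext q' = ext q Int ext (cb A)" using rst[OF q A] by blast
   obtain c where c: "c:ext d" "ext q' <= ext c" using d(3)[OF q'(1)] by blast
   have cA: "c:ext (cp A)" using c d by blast
   have "cup q c:ext (cp J)"
   proof (rule amalg[OF J q sub[OF cA]])
    fix j k l l' assume h: "j:ext J" "t3 j k l:ext q" "t3 j k l':ext c"
    have cc: "ext c <= ext (cb A)" "sfun (ext c)" using cA unfolding cp_iff[OF A(1)] by auto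
    have jM: "j:M" using h ext_M by blast
    obtain j' a b where "t3 j k l' = t3 j' a b" "j':ext A" using cc(1) h(3) unfolding cb(2)[OF A(1)] by blast
    then have "j:ext A" using jM ext_M[of j' A] by simp
    then have "t3 j k l:ext c" using c(2) h(2) q'(2) unfolding cb(2)[OF A(1)] by blast
    then show "l = l'" using sfun_t3[OF cc(2) jM _ h(3)] by blast
   qed
   moreover have "ext (cup q c) = ext q Un ext c" using q c ext_M by simp
   ultimately show "EX s. le s q & (EX c:ext d. ext c <= ext s)" using q c(1) unfolding le_iff by blast
  qed
  then obtain s c where "s:G" "c:ext d" "ext c <= ext s" by blast
  then have "c:G Int ext (cp A) Int ext d" using G_up[of s c] G_p d(2) sub unfolding le_iff by blast
  then show "G Int ext (cp A) Int ext d ~= {}" by blast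
 qed (use r in blast)+
 then show ?thesis unfolding cohen_def cohen_axioms_def using A(1) zfc_axioms by blast
qed

text \<open>The product lemma, phrased without a second extension: \<open>Q\<close> together with
  the part of \<open>G\<close> over \<open>A\<close> describes a dense subset of
  \<open>cp B\<close>, and the part of \<open>G\<close> over \<open>B\<close> meets it.\<close>

lemma product_generic:
 assumes A: "A:M" "ext A <= ext J" and B: "B:M" "ext B <= ext J" and disj: "ext A Int ext B = {}" and Q: "Q:M"
  and dense: "!!s. s:ext (cp B) ==> EX s':ext (cp B). ext s <= ext s' & (EX c:G Int ext (cp A). pr s' c:ext Q)"
 shows "EX s:G Int ext (cp B). EX c:G Int ext (cp A). pr s c:ext Q"
proof -
 \<comment> \<open>Some \<open>x\<close> in \<open>G\<close> either includes a pair from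
   \<open>Q\<close> or has no extension that does. In the latter case density at the
   \<open>B\<close> part of \<open>x\<close>, followed by amalgamation with a compatible
   \<open>c\<close> over \<open>A\<close>, produces such an extension.\<close>
 define D where "D x <-> (EX s:ext (cp B). EX c:ext (cp A). ext s <= ext x & ext c <= ext x & pr s c:ext Q)" for x
 have pA: "cp A:M" "cp B:M" using cp_M A B by blast+
 have DD: "DefF s ==> Def (%e. D (s e))" for s by (rule Def_R1[of D]) (unfold D_def, intro def_intro pA Q)
 have "EX x:G. D x \<or> (ALL y:M. le y x --> ~D y)"
 proof (rule generic_below[OF one_G])
  show "Def (%e. D (e 0) \<or> (ALL y:M. le y (e 0) --> ~D y))" by (intro def_intro DD)
  fix q assume q: "le q emp"
  show "EX s. le s q & (D s \<or> (ALL y:M. le y s --> ~D y))"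
   using le_refl[OF le_p(1)[OF q]] by blast
 qed
 then obtain x where x: "x:G" "D x \<or> (ALL y:M. le y x --> ~D y)" by blast
 have "D x"
 proof (rule ccontr)
  assume n: "~D x"
  obtain x2 where x2: "x2:ext (cp B)" "ext x2 = ext x Int ext (cb B)" using rst[OF G_p[OF x(1)] B] by blast
  obtain s c where s: "s:ext (cp B)" "ext x2 <= ext s" "c:G Int ext (cp A)" "pr s c:ext Q" using dense[OF x2(1)] by blast
  obtain y where y: "y:G" "le y x" "le y c" using G_dir x(1) s(3) by blast
  obtain z where z: "z:ext (cp J)" "ext z = ext x Un ext c"
  proof -
   have m: "cup x c:M" "ext (cup x c) = ext x Un ext c" using x s G_M by auto
   have "cup x c:ext (cp J)" by (rule cp_sub[OF J G_p[OF y(1)] m(1)]) (use y m in \<open>auto simp: le_iff\<close>)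
   then show thesis using that m by blast
  qed
  have sJ: "s:ext (cp J)" by (rule cp_mono[OF J B s(1)])
  have "cup z s:ext (cp J)"
  proof (rule amalg[OF J z(1) sJ])
   fix j k l l' assume h: "j:ext J" "t3 j k l:ext z" "t3 j k l':ext s"
   have ss: "ext s <= ext (cb B)" "sfun (ext s)" using s(1) unfolding cp_iff[OF B(1)] by auto
   have jM: "j:M" using h ext_M by blast
   obtain j' a b where "t3 j k l' = t3 j' a b" "j':ext B" using ss(1) h(3) unfolding cb(2)[OF B(1)] by blast
   then have jB: "j:ext B" using jM ext_M[of j' B] by simp
   have "t3 j k l ~: ext c"
   proof
    assume "t3 j k l:ext c"
    then obtain j' a b where "t3 j k l = t3 j' a b" "j':ext A" using s(3) unfolding Int_iff cp_iff[OF A(1)] cb(2)[OF A(1)] by blast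
    then show False using jM ext_M[of j' A] jB disj by auto
   qed
   then have "t3 j k l:ext s" using s(2) h(2) z(2) x2(2) jB unfolding cb(2)[OF B(1)] by blast
   then show "l = l'" using sfun_t3[OF ss(2) jM _ h(3)] by blast
  qed
  moreover have "ext (cup z s) = ext x Un ext c Un ext s" using z s ext_M by simp
  ultimately have "le (cup z s) x" "D (cup z s)" unfolding le_iff D_def using G_p[OF x(1)] s by blast+
  then show False using x(2) n le_p(1) ext_M by blast
 qed
 then obtain s c where s: "s:ext (cp B)" "c:ext (cp A)" "ext s <= ext x" "ext c <= ext x" "pr s c:ext Q" unfolding D_def by blast
 have "s:G" "c:G" using G_up[OF x(1)] cp_mono[OF J B s(1)] cp_mono[OF J A s(2)] s G_p[OF x(1)] unfolding le_iff by blast+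
 then show ?thesis using s by blast
qed

text \<open>\<open>closing\<close>, applied to the conditions that put \<open>a\<close> into
  \<open>Z\<close>, yields a countable set of indices whose part of \<open>G\<close> already decides
  the membership of \<open>a\<close>. The supports are chosen for all \<open>a\<close> at once, as
  one function \<open>u\<close>.\<close>

lemma support_name:
 assumes Z: "Z:N" and A: "A:M"
 obtains Q u where "Q:M" "u:M" "!!a. a:ext A ==> ap u a:M" "!!a. a:ext A ==> ext (ap u a) <= ext J"
  "!!a. a:ext A ==> card_le (ap u a) om"
  "!!a. a:ext A ==> cv a:extN Z <-> (EX c:G Int ext (cp (ap u a)). pr a c:ext Q)"
proof -
 obtain Q where Q: "Q:M" "ext Q <= ext (times A (cp J))"
  "!!a. a:ext A ==> cv a:extN Z <-> (EX c:G. pr a c:ext Q)"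
  "!!a c c'. a:M ==> pr a c:ext Q ==> le c' c ==> pr a c':ext Q" using nice_name[OF Z A] by blast
 define P where "P a U <-> card_le U om & (ALL q:ext (cp J). pr a q:ext Q -->
  (EX q':ext (cp J). pr a q':ext Q & q':ext (cp U) & cup q q':ext (cp J)))" for a U
 have PD: "Def (%e. P (e 0) (e 1))" unfolding P_def by (intro def_intro Q)
 have ex: "EX U:ext (pw J). P a U" if a: "a:ext A" for a
 proof -
  have aM: "a:M" using a ext_M by blast
  have d: "Def (%e. pr a (e 0):ext Q)" by (intro def_intro Q aM)
  note s = sepm[OF prM(1) d]
  obtain U where U: "U:M" "ext U <= ext J" "card_le U om"
   "!!q. q:ext (sepm (cp J) (%c. pr a c:ext Q)) ==>
     EX q':ext (sepm (cp J) (%c. pr a c:ext Q)). ext (sup J q') <= ext U & cup q q':ext (cp J)"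
   using closing[OF J s(1)] s(2) by blast
  have "P a U" unfolding P_def
  proof (intro conjI U ballI impI)
   fix q assume "q:ext (cp J)" "pr a q:ext Q"
   then obtain q' where "q':ext (cp J)" "pr a q':ext Q" "ext (sup J q') <= ext U" "cup q q':ext (cp J)"
    using U(4)[of q] unfolding s(2) by blast
   then show "EX q':ext (cp J). pr a q':ext Q & q':ext (cp U) & cup q q':ext (cp J)" using sup_cp[OF J U(1)] by blast
  qed
  moreover have "U:ext (pw J)" using U by simp
  ultimately show ?thesis by blast
 qed
 have pJ: "pw J:M" by simp
 obtain u where u: "u:M" "is_fun u A (pw J)" "!!a. a:ext A ==> P a (ap u a)" using choice[OF A pJ PD ex] by blast
 have uJ: "ap u a:M & ext (ap u a) <= ext J" if a: "a:ext A" for a using is_funD(1)[OF u(2) a] by simp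
 have key: "EX c':G Int ext (cp (ap u a)). pr a c':ext Q" if a: "a:ext A" and c: "c:G" "pr a c:ext Q" for a c
 proof -
  have aM: "a:M" using a ext_M by blast
  have cu: "cp (ap u a):M" using cp_M uJ[OF a] by blast
  have "EX s:G. EX c':ext (cp (ap u a)). pr a c':ext Q & c':ext (cp J) & ext c' <= ext s"
  proof (rule generic_below[OF c(1)])
   show "Def (%e. EX c':ext (cp (ap u a)). pr a c':ext Q & c':ext (cp J) & ext c' <= ext (e 0))"
    by (intro def_intro Q aM cu)
   fix q assume q: "le q c"
   have qq: "q:ext (cp J)" "pr a q:ext Q" using le_p(1)[OF q] Q(4)[OF aM c(2) q] by auto
   then obtain q' where q': "q':ext (cp J)" "pr a q':ext Q" "q':ext (cp (ap u a))" "cup q q':ext (cp J)"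
    using u(3)[OF a] unfolding P_def by blast
   have "ext (cup q q') = ext q Un ext q'" using qq q' ext_M by simp
   then have "le (cup q q') q" "ext q' <= ext (cup q q')" unfolding le_iff using qq q' by auto
   then show "EX s. le s q & (EX c':ext (cp (ap u a)). pr a c':ext Q & c':ext (cp J) & ext c' <= ext s)"
    using q' by blast
  qed
  then obtain s c' where s: "s:G" "c':ext (cp (ap u a))" "pr a c':ext Q" "c':ext (cp J)" "ext c' <= ext s" by blast
  have "c':G" by (rule G_up[OF s(1)]) (use s G_p in \<open>auto simp: le_iff\<close>)
  then show ?thesis using s by blast
 qed
 show thesis
 proof (rule that[OF Q(1) u(1)])
  fix a assume a: "a:ext A"
  show "ap u a:M" "ext (ap u a) <= ext J" using uJ[OF a] by auto
  show "card_le (ap u a) om" using u(3)[OF a] unfolding P_def by blast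
  show "cv a:extN Z <-> (EX c:G Int ext (cp (ap u a)). pr a c:ext Q)"
   unfolding Q(3)[OF a] using key[OF a] by blast
 qed
qed

end

section \<open>The sets produced at one stage\<close>

definition unb :: "nat set => bool" where "unb A <-> (ALL n. EX m. n <= m & m:A)"
definition asub :: "nat set => nat set => bool" where "asub A B <-> (EX n. ALL m. n <= m --> m:A --> m:B)"

text \<open>The notion is defined with number quantifiers so that the rules for definability apply;
  here it is tied to the usual one.\<close>

lemma unb_iff: "unb A <-> infinite A" 
 unfolding unb_def finite_nat_set_iff_bounded by (metis not_le)

lemma asub_iff: "asub A B <-> finite (A - B)"
 unfolding asub_def finite_nat_set_iff_bounded by (auto simp: Ball_def) (metis not_le)+

text \<open>\<open>st U g a k\<close> is the index of the \<open>k\<close>-th term of the almost decreasing sequence that \<open>g\<close> guides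
  through the sets \<open>U n\<close>, starting at \<open>U a\<close>; \<open>pib U g a\<close> is a pseudo-intersection of that sequence.\<close>

definition st :: "(nat => nat set) => (nat => nat) => nat => nat => nat" where
 "st U g a k = rec_nat a (%l x. if unb (U (g l)) & asub (U (g l)) (U x) then g l else x) k"

definition pib :: "(nat => nat set) => (nat => nat) => nat => nat set" where
 "pib U g a = {v. EX k. k <= v & (ALL l. l <= k --> v:U (st U g a l)) &
   (ALL u. u < v --> k <= u --> ~(ALL l. l <= k --> u:U (st U g a l)))}"

text \<open>The last component of a number \<open>enc n x\<close> is an environment and the first one the top of a
  stack; the eight partial functions below are the instructions for evaluating arithmetical terms.\<close>

definition pre :: "nat => nat => nat => bool" where
 "pre l v w <-> (l = 0 & w = enc 0 v) \<or> (l = 1 & (EX n x. v = enc n x & w = enc (Suc n) x)) \<or>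
  (l = 2 & (EX m n x. v = enc m (enc n x) & w = enc (n + m) x)) \<or>
  (l = 3 & (EX m n x. v = enc m (enc n x) & w = enc (n * m) x)) \<or> (l = 4 & w = enc v v) \<or>
  (l = 5 & (EX a b x. v = enc (enc a b) x & w = enc a x)) \<or>
  (l = 6 & (EX a b x. v = enc (enc a b) x & w = enc b x)) \<or> (l = 7 & (EX x. v = enc w x))"

definition step :: "(nat => nat set) => (nat => nat) => (nat => nat set) => nat => nat set" where
 "step U g T m = {v. EX c j l. m = enc c (enc j l) & ((c = 0 & v:U j) \<or> (c = 1 & v:pib U g j) \<or>
   (c = 2 & (EX k. v = enc k (g k))) \<or> (c = 3 & v ~: T j) \<or> (c = 4 & v:T j & v:T l) \<or>
   (c = 5 & (ALL n. enc n v:T j)) \<or> (c = 6 & (EX w. pre l v w & w:T j)) \<or>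
   (c = 7 & (EX n x. v = enc n (enc n x))))}"

lemma enc_gt: "0 < c ==> x < enc c x" "0 < c ==> j < enc c (enc j l)" "0 < c ==> l < enc c (enc j l)"
proof -
 show *: "x < enc c x" if "0 < c" for x
 proof -
  have "x < c + x" using that by simp
  also have "... <= (c + x) * (c + x)" by (rule le_square)
  also have "... <= enc c x" unfolding enc_def by simp
  finally show ?thesis .
 qed
 show "0 < c ==> j < enc c (enc j l)" "0 < c ==> l < enc c (enc j l)"
  using le_less_trans[OF enc_ge(1)[of j l] *] le_less_trans[OF enc_ge(2)[of l j] *] by auto
qed

text \<open>For \<open>c > 0\<close> the arguments \<open>j\<close> and \<open>l\<close> are smaller
  than \<open>enc c (enc j l)\<close>, and for \<open>c = 0\<close> no earlier value is consulted.
  So \<open>step\<close> may be used as a course-of-values recursion.\<close>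

lemma step_cong: assumes "!!n. n < m ==> T n = T' n" shows "step U g T m = step U g T' m"
proof -
 have sub: "step U g T m <= step U g T' m" if h: "!!n. n < m ==> T n = T' n" for T T'
 proof
  fix v assume "v:step U g T m"
  then obtain c j l where m: "m = enc c (enc j l)" and c: "(c = 0 & v:U j) \<or> (c = 1 & v:pib U g j) \<or>
   (c = 2 & (EX k. v = enc k (g k))) \<or> (c = 3 & v ~: T j) \<or> (c = 4 & v:T j & v:T l) \<or>
   (c = 5 & (ALL n. enc n v:T j)) \<or> (c = 6 & (EX w. pre l v w & w:T j)) \<or>
   (c = 7 & (EX n x. v = enc n (enc n x)))" unfolding step_def by blast
  have "0 < c ==> T j = T' j" "0 < c ==> T l = T' l" using h enc_gt(2,3)[of c] unfolding m by auto
  then show "v:step U g T' m" using c unfolding step_def m mem_Collect_eq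
   by (intro exI[of _ c] exI[of _ j] exI[of _ l] conjI refl) (cases "c = 0"; simp)
 qed
 show ?thesis by (rule equalityI; rule sub) (simp_all only: assms)
qed

context zmod begin

lemma DefF_cong: assumes "DefF s" "!!e. range e <= M ==> s e = t e" shows "DefF t"
 unfolding DefF_def
proof (intro conjI allI impI)
 fix e :: "nat => 'a" assume e: "range e <= M"
 show "t e:M" using DefF_in[OF assms(1) e] assms(2)[OF e] by simp
next
 have "Def (%e. e 0 = s (%n. e (Suc n)))" using assms(1) unfolding DefF_def by blast
 then show "Def (%e. e 0 = t (%n. e (Suc n)))"
 proof (rule Def_cong)
  fix e :: "nat => 'a" assume "range e <= M"
  then have "range (%n. e (Suc n)) <= M" by blast
  then show "e 0 = t (%n. e (Suc n)) <-> e 0 = s (%n. e (Suc n))" using assms(2) by simp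
 qed
qed

lemma DefN_if: assumes "Def P" "DefN s" "DefN t" shows "DefN (%e. if P e then s e else t e)"
proof -
 have "num (if P e then s e else t e) = (if P e then num (s e) else num (t e))" for e by simp
 then show ?thesis using DefF_if[OF assms] by simp
qed

lemma Def_unb: assumes "Def (%e. dn (e 0):A (%n. e (Suc n)))" shows "Def (%e. unb (A e))"
proof -
 have "Def (%e. dn (e 0):A (%n. e (Suc (Suc n))))"
  using Def_reindex[OF assms, of "%n. if n = 0 then 0 else Suc n"] by (simp add: inj_on_def)
 then show ?thesis unfolding unb_def by (intro def_intro)
qed

lemma Def_asub:
 assumes "Def (%e. dn (e 0):A (%n. e (Suc n)))" "Def (%e. dn (e 0):B (%n. e (Suc n)))"
 shows "Def (%e. asub (A e) (B e))"
proof -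
 have i: "inj (%n::nat. if n = 0 then 0 else Suc n)" by (simp add: inj_on_def)
 have "Def (%e. dn (e 0):A (%n. e (Suc (Suc n))))" "Def (%e. dn (e 0):B (%n. e (Suc (Suc n))))"
  using Def_reindex[OF assms(1) i] Def_reindex[OF assms(2) i] by simp_all
 then show ?thesis unfolding asub_def by (intro def_intro)
qed

context
 fixes U T :: "'a => nat => nat set" and g :: "'a => nat => nat"
 assumes UD: "!!r s t. DefF r ==> DefN s ==> DefN t ==> Def (%e. s e:U (r e) (t e))"
  and gD: "!!r s. DefF r ==> DefN s ==> DefN (%e. g (r e) (s e))"
begin

lemma DefN_st: assumes "DefF r" "DefN s" "DefN t" shows "DefN (%e. st (U (r e)) (g (r e)) (s e) (t e))"
proof -
 define F where "F z k = st (U (p1 z)) (g (p1 z)) (dn (p2 z)) k" for z k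
 have "DefN (%e. F (pr (r e) (num (s e))) (t e))"
 proof (rule DefN_iter[of F "%z. dn (p2 z)" "%z l x. if unb (U (p1 z) (g (p1 z) l)) &
   asub (U (p1 z) (g (p1 z) l)) (U (p1 z) x) then g (p1 z) l else x"])
  fix s t u assume "DefF s" "DefN t" "DefN u"
  then show "DefN (%e. if unb (U (p1 (s e)) (g (p1 (s e)) (t e))) &
   asub (U (p1 (s e)) (g (p1 (s e)) (t e))) (U (p1 (s e)) (u e)) then g (p1 (s e)) (t e) else u e)"
   by (intro DefN_if Def_unb Def_asub gD UD def_intro)
    (auto intro!: DefF_shift[where r = Suc] DefF_shift[where r = Suc and t = "%e. num (u e)" for u])
 qed (auto simp: F_def st_def intro!: def_intro assms)
 then show ?thesis by (rule DefF_cong) (use DefF_in[OF assms(1)] in \<open>simp add: F_def\<close>)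
qed

lemma Def_pib: assumes "DefF r" "DefN s" "DefN t" shows "Def (%e. s e:pib (U (r e)) (g (r e)) (t e))"
proof -
 have "Def (%e. dn (e 0):pib (U (e 1)) (g (e 1)) (dn (e 2)))"
  unfolding pib_def mem_Collect_eq by (intro def_intro UD DefN_st)
 then have "Def (%e. dn (num (s e)):pib (U (r e)) (g (r e)) (dn (num (t e))))"
  by (rule Def_R3[where R = "%x y z. dn x:pib (U y) (g y) (dn z)"]) (use assms in auto)
 then show ?thesis by simp
qed

lemma Def_step:
 assumes TD: "!!r s t. DefF r ==> DefN s ==> DefN t ==> Def (%e. s e:T (r e) (t e))"
  and "DefF r" "DefN s" "DefN t"
 shows "Def (%e. s e:step (U (r e)) (g (r e)) (T (r e)) (t e))"
proof -
 have "Def (%e. dn (e 0):step (U (e 1)) (g (e 1)) (T (e 1)) (dn (e 2)))"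
  unfolding step_def mem_Collect_eq pre_def by (intro def_intro UD gD Def_pib TD)
 then have "Def (%e. dn (num (s e)):step (U (r e)) (g (r e)) (T (r e)) (dn (num (t e))))"
  by (rule Def_R3[where R = "%x y z. dn x:step (U y) (g y) (T y) (dn z)"]) (use assms in auto)
 then show ?thesis by simp
qed

end

end

text \<open>The recursion over stages depends only on a transitive well-founded order and on a
  coding relation that respects it. The four arguments of \<open>uu\<close> are packed into two
  pairs, places of the form (stage, number), which is how they are represented in the
  structure.\<close>

locale idx = zfc M E for M :: "'a set" and E +
 fixes X :: 'a and LL :: "'a => 'a => bool" and uu :: "'a => nat => 'a => nat => bool"
 assumes XM [simp, def_intro]: "X:M" and LL_X: "LL j i ==> j:ext X & i:ext X"
  and LL_trans: "LL i j ==> LL j i' ==> LL i i'" and LL_wf: "wf {(j, i). LL j i}"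
  and LL_Def: "Def (%e. LL (e 0) (e 1))"
  and uu_LL: "uu i k j n ==> LL j i" and uu_Def: "Def (%e. uu (p1 (e 0)) (dn (p2 (e 0))) (p1 (e 1)) (dn (p2 (e 1))))"
begin

definition RL where "RL = {(j, i). LL j i} <*lex*> {(m, n :: nat). m < n}"

lemma wf_RL: "wf RL" unfolding RL_def by (intro wf_lex_prod LL_wf wf)

lemma RL_iff: "((j, n), (i, m)):RL <-> LL j i \<or> (j = i & n < m)" unfolding RL_def by auto

text \<open>\<open>EE h i m\<close> is the \<open>m\<close>-th set produced at stage \<open>i\<close> from the reals \<open>h\<close>. The relation \<open>uu i k j n\<close> makes
  the \<open>n\<close>-th set of the earlier stage \<open>j\<close> the \<open>k\<close>-th set \<open>UE h i k\<close> available at stage \<open>i\<close>.\<close>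

definition EEr where
 "EEr h = wfrec RL (%f (i, m). step (%k. {v. EX j n. uu i k j n & v:f (j, n)}) (h i) (%n. f (i, n)) m)"

definition EE where "EE h i m = EEr h (i, m)"
definition UE where "UE h i k = {v. EX j n. uu i k j n & v:EE h j n}"

lemma EE_eq: "EE h i m = step (UE h i) (h i) (EE h i) m"
proof -
 let ?c = "cut (EEr h) RL (i, m)"
 have c: "?c (j, n) = EE h j n" if "((j, n), (i, m)):RL" for j n
  using that unfolding EE_def cut_def by simp
 have "EE h i m = step (%k. {v. EX j n. uu i k j n & v:?c (j, n)}) (h i) (%n. ?c (i, n)) m"
  unfolding EE_def EEr_def by (subst wfrec[OF wf_RL]) simp
 also have "(%k. {v. EX j n. uu i k j n & v:?c (j, n)}) = UE h i"
  unfolding UE_def using c uu_LL unfolding RL_iff by (intro HOL.ext) blast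
 also have "step (UE h i) (h i) (%n. ?c (i, n)) m = step (UE h i) (h i) (EE h i) m"
  by (rule step_cong) (rule c, simp add: RL_iff)
 finally show ?thesis .
qed

text \<open>Locality: the sets of a stage depend only on the reals of that stage and of earlier
  ones, so changing a real elsewhere leaves them alone.\<close>

lemma EE_cong: assumes "!!j. LL j i \<or> j = i ==> h j = h' j" shows "EE h i m = EE h' i m"
proof -
 have "ALL i m. im = (i, m) --> (ALL j. LL j i \<or> j = i --> h j = h' j) --> EE h i m = EE h' i m" for im
 proof (induction im rule: wf_induct[OF wf_RL])
  case (1 im)
  show ?case
  proof (intro allI impI)
   fix i m assume im: "im = (i, m)" and a: "ALL j. LL j i \<or> j = i --> h j = h' j"
   have IH: "EE h j n = EE h' j n" if "((j, n), (i, m)):RL" for j n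
   proof -
    have "ALL k. LL k j \<or> k = j --> h k = h' k" using a that LL_trans unfolding RL_iff by blast
    then show ?thesis using 1 that unfolding im by blast
   qed
   have "UE h i = UE h' i" unfolding UE_def using IH uu_LL unfolding RL_iff by (intro HOL.ext) blast
   moreover have "step (UE h' i) (h' i) (EE h i) m = step (UE h' i) (h' i) (EE h' i) m"
    by (rule step_cong) (rule IH, simp add: RL_iff)
   ultimately show "EE h i m = EE h' i m" unfolding EE_eq[of h i m] EE_eq[of h' i m] using a by simp
  qed
 qed
 then show ?thesis using assms by blast
qed

text \<open>The sets available at stage \<open>i\<close> are independent even of \<open>h i\<close>.
  Hence the Cohen real of the stage is generic over the very sets through which it guides its
  sequences.\<close>

lemma UE_cong: assumes "!!j. LL j i ==> h j = h' j" shows "UE h i k = UE h' i k"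
proof -
 have "EE h j n = EE h' j n" if "uu i k j n" for j n
  by (rule EE_cong) (use uu_LL[OF that] LL_trans assms in blast)
 then show ?thesis unfolding UE_def by blast
qed

definition XO where "XO = times X om"
text \<open>The coding relation and the order of places as elements of \<open>M\<close>; through
  their canonical names the extension can follow the recursion.\<close>

definition UU where "UU = sepm (times XO XO) (%z. uu (p1 (p1 z)) (dn (p2 (p1 z))) (p1 (p2 z)) (dn (p2 (p2 z))))"
definition LS where "LS = sepm (times XO XO) (%z. LL (p1 (p1 z)) (p1 (p2 z)) \<or>
  (p1 (p1 z) = p1 (p2 z) & dn (p2 (p1 z)) < dn (p2 (p2 z))))"

lemma XO: "XO:M" "ext XO = {pr i (num k) | i k. i:ext X}"
 unfolding XO_def using ext_times[OF XM om_M] ext_om by auto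

lemma UU: "UU:M" "ext UU = {pr (pr i (num k)) (pr j (num n)) | i k j n. uu i k j n}"
proof -
 note X2 = times_M[OF XO(1) XO(1)] ext_times[OF XO(1) XO(1)]
 have "Def (%e. uu (p1 (p1 (e 0))) (dn (p2 (p1 (e 0)))) (p1 (p2 (e 0))) (dn (p2 (p2 (e 0)))))"
  by (rule Def_R2[OF uu_Def]) (intro def_intro)+
 note s = sepm[OF X2(1) this]
 show "UU:M" unfolding UU_def by (rule s)
 show "ext UU = {pr (pr i (num k)) (pr j (num n)) | i k j n. uu i k j n}" (is "_ = ?R")
 proof (intro equalityI subsetI)
  fix z assume "z:ext UU"
  then obtain i k j n where z: "z = pr (pr i (num k)) (pr j (num n))" "i:ext X" "j:ext X"
   "uu (p1 (p1 z)) (dn (p2 (p1 z))) (p1 (p2 z)) (dn (p2 (p2 z)))"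
   unfolding UU_def s X2 XO(2) by blast
  have "i:M" "j:M" using z ext_M by blast+
  then have "uu i k j n" using z(4) unfolding z(1) by simp
  then show "z:?R" using z(1) by blast
 next
  fix z assume "z:?R"
  then obtain i k j n where z: "z = pr (pr i (num k)) (pr j (num n))" "uu i k j n" by blast
  have x: "i:ext X" "j:ext X" using LL_X uu_LL[OF z(2)] by blast+
  then have "i:M" "j:M" using ext_M by blast+
  then have "uu (p1 (p1 z)) (dn (p2 (p1 z))) (p1 (p2 z)) (dn (p2 (p2 z)))" using z(2) unfolding z(1) by simp
  then show "z:ext UU" unfolding UU_def s X2 XO(2) using z(1) x by blast
 qed
qed

lemma LS: "LS:M" "i:ext X ==> j:ext X ==> pr (pr j (num n)) (pr i (num m)):ext LS <-> ((j, n), (i, m)):RL"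
  "z:ext LS ==> EX j n i m. z = pr (pr j (num n)) (pr i (num m)) & i:ext X & j:ext X & ((j, n), (i, m)):RL"
proof -
 note X2 = times_M[OF XO(1) XO(1)] ext_times[OF XO(1) XO(1)]
 have "Def (%e. LL (p1 (p1 (e 0))) (p1 (p2 (e 0))))"
  by (rule Def_R2[OF LL_Def]) (intro def_intro)+
 then have "Def (%e. LL (p1 (p1 (e 0))) (p1 (p2 (e 0))) \<or> (p1 (p1 (e 0)) = p1 (p2 (e 0)) & dn (p2 (p1 (e 0))) < dn (p2 (p2 (e 0)))))"
  by (intro def_intro)
 note s = sepm[OF X2(1) this]
 show "LS:M" unfolding LS_def by (rule s)
 have v: "p1 (p1 (pr (pr j (num n)) (pr i (num m)))) = j & p1 (p2 (pr (pr j (num n)) (pr i (num m)))) = i &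
   dn (p2 (p1 (pr (pr j (num n)) (pr i (num m))))) = n & dn (p2 (p2 (pr (pr j (num n)) (pr i (num m))))) = m"
   if h: "i:ext X" "j:ext X" for i j n m
 proof -
  have "i:M" "j:M" using h ext_M by blast+
  then show ?thesis by simp
 qed
 show "pr (pr j (num n)) (pr i (num m)):ext LS <-> ((j, n), (i, m)):RL" if "i:ext X" "j:ext X" for i j n m
  unfolding LS_def s X2 XO(2) mem_Collect_eq using v[OF that, of n m] that unfolding RL_iff by metis
 show "EX j n i m. z = pr (pr j (num n)) (pr i (num m)) & i:ext X & j:ext X & ((j, n), (i, m)):RL" if z: "z:ext LS" for z
 proof -
  obtain i j n m where zz: "z = pr (pr j (num n)) (pr i (num m))" "i:ext X" "j:ext X"
   "LL (p1 (p1 z)) (p1 (p2 z)) \<or> (p1 (p1 z) = p1 (p2 z) & dn (p2 (p1 z)) < dn (p2 (p2 z)))"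
   using z unfolding LS_def s X2 XO(2) by blast
  then show ?thesis using v[of i j n m] unfolding RL_iff by metis
 qed
qed

end

text \<open>The stages are indexed by all of \<open>X\<close>, whereas Cohen reals are added only
  for \<open>J\<close>. Taking \<open>J\<close> smaller by one index lets the same recursion be run
  in the smaller extension.\<close>

locale cidx = idx M E X LL uu + cohen M E J G for M :: "'a set" and E X LL uu J G +
 assumes JX: "ext J <= ext X"
begin

definition gz where "gz z k = NN.dn (NN.ap GG (NN.pr z (NN.num k)))"

lemma gz: assumes "i:ext X" shows "gz (cv i) k = g i k"
proof -
 have iM: "i:M" using assms ext_M by blast
 have "NN.ap GG (NN.pr (cv i) (NN.num k)) = NN.num (g i k)"
 proof (cases "i:ext J")
  case True
  show ?thesis by (rule NN.ap_eq) (use GG_mem[OF iM] True GG(1) iM in auto)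
 next
  case False
  \<comment> \<open>No pair in \<open>GG\<close> has this first component, so application returns
    the empty set, which is the number 0 and agrees with the default of \<open>g\<close>.\<close>
  then have "extN (NN.ap GG (NN.pr (cv i) (NN.num k))) = {}"
   using NN.ap_def'(2)[of GG "NN.pr (cv i) (NN.num k)"] GG_mem[OF iM] GG(1) iM by auto
  then show ?thesis using NN.emp_iff NN.ap_M GG(1) iM False by (simp add: g_def)
 qed
 then show ?thesis unfolding gz_def by simp
qed

text \<open>The counterpart of \<open>UE\<close> inside the extension. Here \<open>z\<close> is a
  pair of the current place, itself a pair of stage and number, and the table of the values found so
  far; \<open>Tz\<close> is the counterpart of \<open>EE\<close> at the current stage.\<close>

definition Uz where "Uz z k = {v. EX Y:extN (cv X). EX n. NN.pr (NN.pr (NN.p1 (NN.p1 z)) (NN.num k)) (NN.pr Y (NN.num n)):extN (cv UU) &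
  v:NN.ns (NN.ap (NN.p2 z) (NN.pr Y (NN.num n)))}"
definition Tz where "Tz z n = NN.ns (NN.ap (NN.p2 z) (NN.pr (NN.p1 (NN.p1 z)) (NN.num n)))"
definition Op where "Op x f = NN.real {v. v:step (Uz (NN.pr x f)) (gz (NN.p1 (NN.p1 (NN.pr x f)))) (Tz (NN.pr x f)) (NN.dn (NN.p2 x))}"

lemma Def_stepz: "NN.DefF r ==> NN.DefN s ==> NN.DefN t ==>
  NN.Def (%e. s e:step (Uz (r e)) (gz (NN.p1 (NN.p1 (r e)))) (Tz (r e)) (t e))"
proof (rule NN.Def_step[where g = "%z. gz (NN.p1 (NN.p1 z))"])
 note [def_intro] = GG(1) cv_N[OF XM] cv_N[OF UU(1)]
 show "NN.Def (%e. s e:Uz (r e) (t e))" if "NN.DefF r" "NN.DefN s" "NN.DefN t" for r s t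
 proof -
  have "NN.Def (%e. NN.dn (e 0):Uz (e 1) (NN.dn (e 2)))" unfolding Uz_def mem_Collect_eq by (intro def_intro)
  then have "NN.Def (%e. NN.dn (NN.num (s e)):Uz (r e) (NN.dn (NN.num (t e))))"
   by (rule NN.Def_R3[where R = "%x y z. NN.dn x:Uz y (NN.dn z)"]) (use that in auto)
  then show ?thesis by simp
 qed
 show "NN.DefN (%e. gz (NN.p1 (NN.p1 (r e))) (s e))" if "NN.DefF r" "NN.DefN s" for r s
  unfolding gz_def by (intro def_intro that)
 show "NN.Def (%e. s e:Tz (r e) (t e))" if "NN.DefF r" "NN.DefN s" "NN.DefN t" for r s t
  unfolding Tz_def by (intro def_intro that)
qed

text \<open>The HOL recursion \<open>EE\<close> is repeated in the extension along the canonical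
  copy of the order of places, with values bounded by the power set of omega. Induction along
  \<open>RL\<close> shows that both recursions agree, so every \<open>EE g i m\<close> is a real of
  the extension.\<close>

lemma EE_table:
 obtains TB where "TB:N" "!!i m. i:ext X ==> NN.ns (NN.ap TB (NN.pr (cv i) (NN.num m))) = EE g i m"
  "!!i m. i:ext X ==> NN.ap TB (NN.pr (cv i) (NN.num m)) = NN.real (EE g i m)"
  "!!i m. i:ext X ==> EE g i m:NN.RR"
proof -
 define lt where "lt x y <-> (x, y):NN.rel (cv LS)" for x y
 have cp: "cv (pr i (num m)) = NN.pr (cv i) (NN.num m)" if "i:ext X" for i m
  using cv_pr ext_M[OF that] cv_num num_M by metis
 have elA: "extN (cv XO) = {cv (pr i (num m)) | i m. i:ext X}" unfolding ext_cv[OF XO(1)] XO(2) by blast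
 have ltI: "lt (cv (pr j (num n))) (cv (pr i (num m))) <-> ((j, n), (i, m)):RL" if "i:ext X" "j:ext X" for i j n m
 proof -
  have "pr j (num n):M" "pr i (num m):M" using that ext_M by simp_all
  then show ?thesis unfolding lt_def NN.rel_iff using pr_cv_iff[OF LS(1)] LS(2)[OF that] by simp
 qed
 have ltE: "EX j n i m. x = cv (pr j (num n)) & y = cv (pr i (num m)) & i:ext X & j:ext X & ((j, n), (i, m)):RL"
  if xy: "lt x y" for x y
 proof -
  have h: "x:N" "y:N" "NN.pr x y:extN (cv LS)" using xy unfolding lt_def NN.rel_iff by auto
  then obtain z where z: "z:ext LS" "NN.pr x y = cv z" unfolding ext_cv[OF LS(1)] by blast
  obtain j n i m where zz: "z = pr (pr j (num n)) (pr i (num m))" "i:ext X" "j:ext X" "((j, n), (i, m)):RL"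
   using LS(3)[OF z(1)] by blast
  have m: "pr j (num n):M" "pr i (num m):M" using zz ext_M by simp_all
  then have "NN.pr x y = NN.pr (cv (pr j (num n))) (cv (pr i (num m)))" unfolding z(2) zz(1) by (rule cv_pr)
  then have "x = cv (pr j (num n)) & y = cv (pr i (num m))" using NN.pr_inject[OF h(1,2)] m by blast
  then show ?thesis using zz by blast
 qed
 \<comment> \<open>Decodes a place from its canonical copy; it serves to pull well-foundedness and
   transitivity back from \<open>RL\<close>.\<close>
 define bk where "bk Z = (SOME im. fst im:ext X & Z = cv (pr (fst im) (num (snd im))))" for Z
 have bk: "bk (cv (pr i (num m))) = (i, m)" if i: "i:ext X" for i m
 proof -
  have "fst im:ext X & cv (pr i (num m)) = cv (pr (fst im) (num (snd im))) <-> im = (i, m)" for im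
  proof (cases "fst im:ext X")
   case True
   then have "fst im:M" "i:M" using i ext_M by blast+
   then show ?thesis using i by (cases im) auto
  qed (use i in auto)
  then show ?thesis unfolding bk_def by simp
 qed
 have wf: "wfp_on (extN (cv XO)) lt"
  by (rule NN.wfp_on_wf[OF wf_inv_image[OF wf_RL, of bk]]) (auto dest!: ltE simp: bk inv_image_def)
 have tr: "transp lt"
 proof (rule transpI)
  fix x y z assume xy: "lt x y" "lt y z"
  obtain j n i m where a: "x = cv (pr j (num n))" "y = cv (pr i (num m))" "i:ext X" "j:ext X" "((j, n), (i, m)):RL" using ltE[OF xy(1)] by blast
  obtain i' m' k q where b: "y = cv (pr i' (num m'))" "z = cv (pr k (num q))" "k:ext X" "i':ext X" "((i', m'), (k, q)):RL" using ltE[OF xy(2)] by blast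
  have "(i', m') = (i, m)" using bk[OF a(3)] bk[OF b(4)] a(2) b(1) by metis
  then have "((j, n), (k, q)):RL" using a(5) b(5) LL_trans unfolding RL_iff by auto
  then show "lt x z" unfolding a(1) b(2) ltI[OF b(3) a(4)] .
 qed
 have ltD: "NN.Def (%e. lt (e 0) (e 1))" unfolding lt_def by (intro def_intro cv_N LS)
 have OpD: "NN.DefF (%e. Op (e 0) (e 1))" unfolding Op_def by (intro def_intro Def_stepz)
 have OpR: "{v. v:step (Uz (NN.pr x f)) (gz (NN.p1 (NN.p1 (NN.pr x f)))) (Tz (NN.pr x f)) (NN.dn (NN.p2 x))}:NN.RR"
  if "x:N" "f:N" for x f by (rule NN.RR_Def) (intro def_intro Def_stepz that)
 have OpB: "Op x f:extN (NN.pw NN.om)" if "x:extN (cv XO)" "f:N" for x f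
  using NN.RR_D[OF OpR[of x f]] that NN.ext_M[OF that(1)] unfolding Op_def NN.ext_om
  by (auto simp: NN.ext_om)
 have pO: "NN.pw NN.om:N" by simp
 obtain F where F: "!!x. x:extN (cv XO) ==> F x = Op x (NN.mk {NN.pr j (F j) | j. j:extN (cv XO) & lt j x})"
  "!!x. x:extN (cv XO) ==> F x:N" "NN.coded {NN.pr j (F j) | j. j:extN (cv XO)}"
  "!!x. x:extN (cv XO) ==> NN.coded {NN.pr j (F j) | j. j:extN (cv XO) & lt j x}"
  using NN.bounded_recursion[OF cv_N[OF XO(1)] pO wf tr ltD OpD OpB] by blast
 have main: "ALL i m. im = (i, m) --> i:ext X --> EE g i m:NN.RR & F (cv (pr i (num m))) = NN.real (EE g i m)" for im
 proof (induction im rule: wf_induct[OF wf_RL])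
  case (1 im)
  show ?case
  proof (intro allI impI)
   fix i m assume im: "im = (i, m)" and i: "i:ext X"
   define x where "x = cv (pr i (num m))"
   define f where "f = NN.mk {NN.pr j (F j) | j. j:extN (cv XO) & lt j x}"
   have iM: "i:M" using i ext_M by blast
   have x: "x:extN (cv XO)" "x:N" unfolding elA x_def using i iM by auto
   have fN: "f:N" unfolding f_def by (rule NN.mk_M[OF F(4)[OF x(1)]])
   have T: "NN.ns (NN.ap f (NN.pr (cv j) (NN.num n))) = EE g j n" if jn: "((j, n), (i, m)):RL" for j n
   proof -
    have j: "j:ext X" using jn LL_X i unfolding RL_iff by blast
    have IH: "EE g j n:NN.RR & F (cv (pr j (num n))) = NN.real (EE g j n)" using 1 jn j unfolding im by blast
    have "NN.ap f (cv (pr j (num n))) = F (cv (pr j (num n)))" unfolding f_def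
    proof (rule NN.graph_ap[where J = "{j. j:extN (cv XO) & lt j x}", unfolded mem_Collect_eq])
     show "NN.coded {NN.pr j (F j) |j. j:extN (cv XO) & lt j x}" by (rule F(4)[OF x(1)])
     show "cv (pr j (num n)):extN (cv XO) & lt (cv (pr j (num n))) x"
      unfolding x_def ltI[OF i j] elA using jn j by blast
    qed (use F(2) NN.ext_M in auto)
    then show ?thesis using IH cp[OF j] NN.ns_real by simp
   qed
   have z: "NN.p1 x = cv i" "NN.dn (NN.p2 x) = m" unfolding x_def cp[OF i] using iM by (simp_all del: num.simps NN.num.simps)
   have z1: "NN.p1 (NN.pr x f) = x" "NN.p2 (NN.pr x f) = f" using x fN by simp_all
   have U: "Uz (NN.pr x f) = UE g i"
   proof (rule HOL.ext, rule set_eqI)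
    fix k v
    have *: "NN.pr (NN.pr (cv i) (NN.num k)) (NN.pr (cv j) (NN.num n)):extN (cv UU) <-> uu i k j n" if j: "j:ext X" for j n
    proof -
     have jM: "j:M" using j ext_M by blast
     have "pr (pr i (num k)) (pr j (num n)):ext UU <-> uu i k j n" (is "?l = ?r")
     proof
      assume ?l
      then obtain i' k' j' n' where h: "pr (pr i (num k)) (pr j (num n)) = pr (pr i' (num k')) (pr j' (num n'))" "uu i' k' j' n'"
       unfolding UU(2) by blast
      then have "i':M" "j':M" using LL_X uu_LL[OF h(2)] ext_M by blast+
      then show ?r using h iM jM by simp
     qed (use UU(2) in blast)
     then show ?thesis unfolding cp[OF i, symmetric] cp[OF j, symmetric]
      using pr_cv_iff[OF UU(1), of "pr i (num k)" "pr j (num n)"] iM jM by simp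
    qed
    show "v:Uz (NN.pr x f) k <-> v:UE g i k"
    proof
     assume "v:Uz (NN.pr x f) k"
     then obtain Y n where Y: "Y:extN (cv X)" "NN.pr (NN.pr (cv i) (NN.num k)) (NN.pr Y (NN.num n)):extN (cv UU)"
      "v:NN.ns (NN.ap f (NN.pr Y (NN.num n)))" unfolding Uz_def mem_Collect_eq z1 z by blast
     obtain j where j: "j:ext X" "Y = cv j" using Y(1) unfolding ext_cv[OF XM] by blast
     have u: "uu i k j n" using Y(2) *[OF j(1)] unfolding j(2) by blast
     then have "v:EE g j n" using Y(3) T[of j n] uu_LL[OF u] unfolding j(2) RL_iff by blast
     then show "v:UE g i k" unfolding UE_def using u by blast
    next
     assume "v:UE g i k"
     then obtain j n where jn: "uu i k j n" "v:EE g j n" unfolding UE_def by blast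
     have j: "j:ext X" "((j, n), (i, m)):RL" using LL_X uu_LL[OF jn(1)] unfolding RL_iff by blast+
     have "cv j:extN (cv X)" unfolding ext_cv[OF XM] using j by blast
     then show "v:Uz (NN.pr x f) k" unfolding Uz_def mem_Collect_eq z1 z
      using *[OF j(1), of n] jn T[OF j(2)] by blast
    qed
   qed
   have "step (Uz (NN.pr x f)) (gz (NN.p1 (NN.p1 (NN.pr x f)))) (Tz (NN.pr x f)) m = step (UE g i) (g i) (EE g i) m"
   proof -
    have "gz (cv i) = g i" using gz[OF i] by (intro HOL.ext)
    moreover have "step (UE g i) (g i) (Tz (NN.pr x f)) m = step (UE g i) (g i) (EE g i) m"
     by (rule step_cong) (use T in \<open>simp add: Tz_def z1 z RL_iff del: NN.num.simps\<close>)
    ultimately show ?thesis unfolding U z1 z by simp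
   qed
   also have "... = EE g i m" unfolding EE_eq[symmetric] ..
   finally have e: "step (Uz (NN.pr x f)) (gz (NN.p1 (NN.p1 (NN.pr x f)))) (Tz (NN.pr x f)) (NN.dn (NN.p2 x)) = EE g i m" unfolding z .
   have "Op x f = NN.real (EE g i m)" unfolding Op_def e by simp
   moreover have "F x = Op x f" using F(1)[OF x(1)] unfolding f_def .
   ultimately show "EE g i m:NN.RR & F (cv (pr i (num m))) = NN.real (EE g i m)"
    using OpR[OF x(2) fN, unfolded e] unfolding x_def by simp
  qed
 qed
 define TB where "TB = NN.mk {NN.pr j (F j) | j. j:extN (cv XO)}"
 have ap: "NN.ap TB (NN.pr (cv i) (NN.num m)) = NN.real (EE g i m)" if i: "i:ext X" for i m
 proof -
  have "NN.ap TB (cv (pr i (num m))) = F (cv (pr i (num m)))" unfolding TB_def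
   by (rule NN.graph_ap[OF F(3)]) (use F(2) NN.ext_M in blast, use F(2) in blast, use elA i in blast)
  moreover have "F (cv (pr i (num m))) = NN.real (EE g i m)" using main[of "(i, m)"] i by blast
  ultimately show ?thesis unfolding cp[OF i] by simp
 qed
 show thesis by (rule that[of TB]) (use NN.mk_M[OF F(3)] ap main NN.ns_real in \<open>auto simp: TB_def\<close>)
qed

end

section \<open>Pseudo-intersections and arithmetical closure\<close>

lemma st_simps: "st U g a 0 = a"
 "st U g a (Suc k) = (if unb (U (g k)) & asub (U (g k)) (U (st U g a k)) then g k else st U g a k)"
 unfolding st_def by simp_all

lemma st_unb: "unb (U a) ==> unb (U (st U g a k))" by (induction k) (auto simp: st_simps)

lemma asub_trans: assumes "asub A B" "asub B C" shows "asub A C"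
proof -
 have "A - C <= (A - B) Un (B - C)" by blast
 then show ?thesis using assms finite_subset unfolding asub_iff by blast
qed

lemma st_mono: "l <= k ==> asub (U (st U g a k)) (U (st U g a l))"
proof (induction k)
 case (Suc k)
 have "asub (U (st U g a (Suc k))) (U (st U g a k))" by (auto simp: st_simps asub_def)
 then show ?case using Suc asub_trans by (cases "l = Suc k") (auto simp: asub_def)
qed (simp add: asub_def)

text \<open>\<open>pib U g a\<close> collects, for every \<open>k\<close>, the least number from
  \<open>k\<close> on that lies in the first \<open>k + 1\<close> terms; it exists because the terms
  are almost decreasing and infinite. Numbers collected for \<open>k\<close> or later lie in term
  \<open>k\<close>, so at most \<open>k\<close> elements fall outside of it.\<close>

lemma pib: assumes "unb (U a)"
 shows "infinite (pib U g a)" "pib U g a <= U a" "finite (pib U g a - U (st U g a k))"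
proof -
 let ?P = "%k v. k <= v & (ALL l. l <= k --> v:U (st U g a l))"
 have ex: "EX v. ?P k v" for k
 proof -
  have "finite (UN l<=k. U (st U g a k) - U (st U g a l))" using st_mono[of _ k U g a] asub_iff by blast
  then have "infinite (U (st U g a k) - (UN l<=k. U (st U g a k) - U (st U g a l)))"
   using st_unb[of U a g k] assms unfolding unb_iff by (simp add: Diff_infinite_finite)
  then obtain v where "k <= v" "v:U (st U g a k) - (UN l<=k. U (st U g a k) - U (st U g a l))"
   unfolding unb_iff[symmetric] unb_def by blast
  then show ?thesis by blast
 qed
 have mem: "(LEAST v. ?P k v):pib U g a & k <= (LEAST v. ?P k v)" for k
  using LeastI_ex[OF ex[of k]] not_less_Least[of _ "?P k"] unfolding pib_def mem_Collect_eq by blast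
 show "infinite (pib U g a)" unfolding unb_iff[symmetric] unb_def using mem by blast
 show "pib U g a <= U a"
 proof
  fix v assume "v:pib U g a"
  then obtain j where "ALL l. l <= j --> v:U (st U g a l)" unfolding pib_def mem_Collect_eq by blast
  then have "v:U (st U g a 0)" by blast
  then show "v:U a" by (simp add: st_simps)
 qed
 have "pib U g a - U (st U g a k) <= (%j. LEAST v. ?P j v) ` {..<k}"
 proof
  fix v assume v: "v:pib U g a - U (st U g a k)"
  then obtain j where j: "?P j v" "ALL u. u < v --> j <= u --> ~(ALL l. l <= j --> u:U (st U g a l))"
   unfolding pib_def by blast
  have "j < k" using v j(1) by (meson DiffD2 not_le)
  moreover have "(LEAST v. ?P j v) = v" using j by (intro Least_equality) (auto simp: not_le[symmetric])
  ultimately show "v:(%j. LEAST v. ?P j v) ` {..<k}" by blast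
 qed
 then show "finite (pib U g a - U (st U g a k))" using finite_subset by blast
qed

primrec encl :: "nat list => nat => nat" where
 "encl [] r = r" | "encl (x # xs) r = enc x (encl xs r)"

text \<open>A variable is mapped to its place on the stack of quantified values. A place beyond the
  stack reads the tail \<open>r\<close>, which is the one free variable of the defined set, and
  variables without a place have the value 0, as \<open>arith_definable_from\<close>
  demands.\<close>

definition env :: "(nat => nat option) => nat list => nat => nat => nat" where
 "env rho xs r i = (case rho i of None => 0 | Some p => if p < length xs then xs ! p else r)"

definition shf :: "(nat => nat option) => nat => nat option" where "shf rho i = map_option Suc (rho i)"

lemma env_shf: "env (shf rho) (x # xs) r = env rho xs r"
 unfolding env_def shf_def by (rule HOL.ext) (auto split: option.splits)

lemma env_upd: "env ((shf rho)(i := Some 0)) (x # xs) r = (env rho xs r)(i := x)"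
 unfolding env_def shf_def by (rule HOL.ext) (auto split: option.splits)

primrec pars :: "arith_fm => nat set" where
 "pars (Eq_afm t u) = {}" | "pars (In_afm t k) = {k}" | "pars (Neg_afm f) = pars f"
| "pars (Conj_afm f g) = pars f Un pars g" | "pars (Forall_afm i f) = pars f"

lemma finite_pars: "finite (pars f)" by (induction f) auto

text \<open>Formulas are evaluated on numbers that encode a finite environment; all the sets needed on the
  way are obtained by Boolean operations, number quantification and preimages under \<open>pre\<close>.\<close>

context
 fixes B :: "nat set set"
 assumes compl: "!!S. S:B ==> - S:B" and int: "!!S T. S:B ==> T:B ==> S Int T:B"
  and all: "!!S. S:B ==> {v. ALL n. enc n v:S}:B"
  and pre: "!!S l. S:B ==> {v. EX w. pre l v w & w:S}:B"
  and diag: "{v. EX n x. v = enc n (enc n x)}:B"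
begin

text \<open>Instruction 6 discards entries of the environment until the wanted one is in front, and
  instruction 5 extracts it; if the stack is exhausted, the tail is already in place.\<close>

lemma fetch:
 "p <= n ==> S:B ==> EX S':B. ALL xs r w. length xs = n -->
  (enc (encl xs r) w:S' <-> enc (if p < length xs then xs ! p else r) w:S)"
proof (induction p arbitrary: n)
 case 0
 show ?case
 proof (cases n)
  case 0 then show ?thesis using \<open>S:B\<close> by (intro bexI[of _ S]) auto
 next
  case (Suc m)
  show ?thesis by (rule bexI[OF _ pre[OF 0(2), of 5]]) (auto simp: Suc length_Suc_conv pre_def)
 qed
next
 case (Suc p)
 then obtain m where m: "n = Suc m" "p <= m" by (cases n) auto
 obtain S' where S': "S':B" "ALL xs r w. length xs = m -->
  (enc (encl xs r) w:S' <-> enc (if p < length xs then xs ! p else r) w:S)" using Suc.IH[OF m(2) Suc.prems(2)] by blast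
 show ?case by (rule bexI[OF _ pre[OF S'(1), of 6]]) (use S'(2) in \<open>auto simp: m length_Suc_conv pre_def\<close>)
qed

text \<open>Binary operations: the value of the first term is pushed onto the stack before the
  second term is evaluated, so the places seen by the latter are shifted by one.
  \<open>shift_env\<close> accounts for that shift.\<close>

lemma two_step:
 assumes "EX S:B. ALL xs r. length xs = Suc n --> (encl xs r:S <-> enc (b (tl xs) r) (encl xs r):S1)"
  and "!!S. S:B ==> EX S':B. ALL xs r. length xs = n --> (encl xs r:S' <-> enc (a xs r) (encl xs r):S)"
 shows "EX S':B. ALL xs r. length xs = n --> (encl xs r:S' <-> enc (b xs r) (enc (a xs r) (encl xs r)):S1)"
proof -
 obtain S2 where S2: "S2:B" "ALL xs r. length xs = Suc n --> (encl xs r:S2 <-> enc (b (tl xs) r) (encl xs r):S1)"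
  using assms(1) by blast
 obtain S3 where S3: "S3:B" "ALL xs r. length xs = n --> (encl xs r:S3 <-> enc (a xs r) (encl xs r):S2)"
  using assms(2)[OF S2(1)] by blast
 show ?thesis
 proof (rule bexI[OF _ S3(1)], intro allI impI)
  fix xs :: "nat list" and r assume "length xs = n"
  then show "encl xs r:S3 <-> enc (b xs r) (enc (a xs r) (encl xs r)):S1"
   using S3(2) S2(2)[rule_format, of "a xs r # xs" r] by simp
 qed
qed

lemma shift_env:
 assumes "!!rho n S. ALL i p. rho i = Some p --> p <= n ==> S:B ==> EX S':B. ALL xs r. length xs = n -->
  (encl xs r:S' <-> enc (tm_val u (env rho xs r)) (encl xs r):S)"
  and rho: "ALL i p. rho i = Some p --> p <= n" and S: "S:B"
 shows "EX S':B. ALL xs r. length xs = Suc n --> (encl xs r:S' <-> enc (tm_val u (env rho (tl xs) r)) (encl xs r):S)"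
proof -
 have "ALL i p. shf rho i = Some p --> p <= Suc n" using rho unfolding shf_def by auto
 from assms(1)[OF this S] obtain S' where "S':B" "ALL xs r. length xs = Suc n -->
  (encl xs r:S' <-> enc (tm_val u (env (shf rho) xs r)) (encl xs r):S)" by blast
 then show ?thesis by (intro bexI[of _ S']) (auto simp: length_Suc_conv env_shf)
qed

lemma term_step:
 "(ALL i p. rho i = Some p --> p <= n) ==> S:B ==> EX S':B. ALL xs r. length xs = n -->
  (encl xs r:S' <-> enc (tm_val t (env rho xs r)) (encl xs r):S)"
proof (induction t arbitrary: rho n S)
 case (Var_tm i)
 show ?case
 proof (cases "rho i")
  case None
  show ?thesis by (rule bexI[OF _ pre[OF Var_tm(2), of 0]]) (auto simp: None env_def pre_def)
 next
  case (Some p)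
  obtain S' where S': "S':B" "ALL xs r w. length xs = n -->
   (enc (encl xs r) w:S' <-> enc (if p < length xs then xs ! p else r) w:S)"
   using fetch[OF Var_tm(1)[rule_format, OF Some] Var_tm(2)] by blast
  show ?thesis by (rule bexI[OF _ pre[OF S'(1), of 4]]) (use S'(2) in \<open>auto simp: Some env_def pre_def\<close>)
 qed
next
 case Zero_tm
 show ?case by (rule bexI[OF _ pre[OF Zero_tm(2), of 0]]) (auto simp: pre_def)
next
 case (Succ_tm t)
 obtain S' where S': "S':B" "ALL xs r. length xs = n -->
  (encl xs r:S' <-> enc (tm_val t (env rho xs r)) (encl xs r):{v. EX w. pre 1 v w & w:S})"
  using Succ_tm(1)[of rho n, OF Succ_tm(2) pre[OF Succ_tm(3), of 1]] by blast
 show ?case by (rule bexI[OF _ S'(1)]) (use S'(2) in \<open>auto simp: pre_def\<close>)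
next
 case (Plus_tm t u)
 show ?case using two_step[OF shift_env[OF Plus_tm(2) Plus_tm(3) pre[OF Plus_tm(4), of 2]] Plus_tm(1)[OF Plus_tm(3)]] by (auto simp: pre_def)
next
 case (Times_tm t u)
 show ?case using two_step[OF shift_env[OF Times_tm(2) Times_tm(3) pre[OF Times_tm(4), of 3]] Times_tm(1)[OF Times_tm(3)]] by (auto simp: pre_def)
qed

lemma formula_step:
 "(ALL i p. rho i = Some p --> p <= n) ==> (ALL k:pars f. A k:B) ==> EX S:B. ALL xs r. length xs = n -->
  (encl xs r:S <-> arith_sat A f (env rho xs r))"
proof (induction f arbitrary: rho n)
 case (Eq_afm t u)
 show ?case using two_step[OF shift_env[OF term_step Eq_afm(1) diag, of u] term_step[OF Eq_afm(1), of _ t]] by auto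
next
 case (In_afm t k)
 have a: "A k:B" using In_afm(2) by simp
 obtain S where S: "S:B" "ALL xs r. length xs = n -->
  (encl xs r:S <-> enc (tm_val t (env rho xs r)) (encl xs r):{v. EX w. pre 7 v w & w:A k})"
  using term_step[of rho n _ t, OF In_afm(1) pre[OF a, of 7]] by blast
 show ?case by (rule bexI[OF _ S(1)]) (use S(2) in \<open>auto simp: pre_def\<close>)
next
 case (Neg_afm f)
 obtain S where "S:B" "ALL xs r. length xs = n --> (encl xs r:S <-> arith_sat A f (env rho xs r))"
  using Neg_afm(1)[of rho n, OF Neg_afm(2)] Neg_afm(3) by auto
 then show ?case by (intro bexI[OF _ compl]) auto
next
 case (Conj_afm f g)
 obtain S where S: "S:B" "ALL xs r. length xs = n --> (encl xs r:S <-> arith_sat A f (env rho xs r))"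
  using Conj_afm(1)[of rho n, OF Conj_afm(3)] Conj_afm(4) by auto
 obtain T where T: "T:B" "ALL xs r. length xs = n --> (encl xs r:T <-> arith_sat A g (env rho xs r))"
  using Conj_afm(2)[of rho n, OF Conj_afm(3)] Conj_afm(4) by auto
 show ?case by (rule bexI[OF _ int[OF S(1) T(1)]]) (use S T in auto)
next
 case (Forall_afm i f)
 have sh: "ALL j p. ((shf rho)(i := Some 0)) j = Some p --> p <= Suc n"
  using Forall_afm(2) unfolding shf_def by (auto split: if_splits)
 obtain S where S: "S:B" "ALL xs r. length xs = Suc n --> (encl xs r:S <-> arith_sat A f (env ((shf rho)(i := Some 0)) xs r))"
  using Forall_afm(1)[of "(shf rho)(i := Some 0)" "Suc n", OF sh] Forall_afm(3)[unfolded pars.simps] by blast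
 have "enc a (encl xs r):S <-> arith_sat A f ((env rho xs r)(i := a))" if "length xs = n" for a xs r
  using S(2)[rule_format, of "a # xs" r] that by (simp add: env_upd)
 then show ?case by (intro bexI[OF _ all[OF S(1)]]) auto
qed

lemma arith_closure:
 assumes "!!k. k:pars f ==> A k:B" shows "{n. arith_sat A f ((%_. 0)(0 := n))}:B"
proof -
 have "EX S:B. ALL xs r. length xs = 0 --> (encl xs r:S <-> arith_sat A f (env ((%_. None)(0 := Some 0)) xs r))"
  by (rule formula_step) (use assms in \<open>auto split: if_splits\<close>)
 then obtain S where S: "S:B" "ALL r. r:S <-> arith_sat A f (env ((%_. None)(0 := Some 0)) [] r)" by auto
 have "env ((%_. None)(0 := Some 0)) [] r = (%_. 0)(0 := r)" for r unfolding env_def by (rule HOL.ext) auto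
 then have "S = {n. arith_sat A f ((%_. 0)(0 := n))}" using S(2) by auto
 then show ?thesis using S(1) by simp
qed

end

context idx begin

lemma EE_codes:
 "EE h i (enc 0 (enc j l)) = UE h i j" "EE h i (enc 1 (enc j l)) = pib (UE h i) (h i) j"
 "EE h i (enc 2 (enc j l)) = {enc k (h i k) | k. True}" "EE h i (enc 3 (enc j l)) = - EE h i j"
 "EE h i (enc 4 (enc j l)) = EE h i j Int EE h i l" "EE h i (enc 5 (enc j l)) = {v. ALL n. enc n v:EE h i j}"
 "EE h i (enc 6 (enc j l)) = {v. EX w. pre l v w & w:EE h i j}"
 "EE h i (enc 7 (enc j l)) = {v. EX n x. v = enc n (enc n x)}"
proof -
 have e: "v:EE h i (enc c (enc j l)) <-> ((c = 0 & v:UE h i j) \<or> (c = 1 & v:pib (UE h i) (h i) j) \<or>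
   (c = 2 & (EX k. v = enc k (h i k))) \<or> (c = 3 & v ~: EE h i j) \<or> (c = 4 & v:EE h i j & v:EE h i l) \<or>
   (c = 5 & (ALL n. enc n v:EE h i j)) \<or> (c = 6 & (EX w. pre l v w & w:EE h i j)) \<or>
   (c = 7 & (EX n x. v = enc n (enc n x))))" for c v
  unfolding EE_eq[of h i "enc c (enc j l)"] step_def by simp
 show "EE h i (enc 0 (enc j l)) = UE h i j" "EE h i (enc 1 (enc j l)) = pib (UE h i) (h i) j"
 "EE h i (enc 2 (enc j l)) = {enc k (h i k) | k. True}" "EE h i (enc 3 (enc j l)) = - EE h i j"
 "EE h i (enc 4 (enc j l)) = EE h i j Int EE h i l" "EE h i (enc 5 (enc j l)) = {v. ALL n. enc n v:EE h i j}"
 "EE h i (enc 6 (enc j l)) = {v. EX w. pre l v w & w:EE h i j}"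
 "EE h i (enc 7 (enc j l)) = {v. EX n x. v = enc n (enc n x)}" by (auto simp: e)
qed

lemma EE_arith:
 assumes "!!k. k:pars f ==> A k:range (EE h i)"
 shows "{n. arith_sat A f ((%_. 0)(0 := n))}:range (EE h i)"
proof (rule arith_closure[OF _ _ _ _ _ assms])
 show "- S:range (EE h i)" if S: "S:range (EE h i)" for S using S EE_codes(4)[of h i _ 0, symmetric] by auto
 show "S Int T:range (EE h i)" if S: "S:range (EE h i)" "T:range (EE h i)" for S T using S EE_codes(5)[of h i, symmetric] by auto
 show "{v. ALL n. enc n v:S}:range (EE h i)" if S: "S:range (EE h i)" for S using S EE_codes(6)[of h i _ 0, symmetric] by auto
 show "{v. EX w. pre l v w & w:S}:range (EE h i)" if S: "S:range (EE h i)" for S l using S EE_codes(7)[of h i _ l, symmetric] by auto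
 show "{v. EX n x. v = enc n (enc n x)}:range (EE h i)" unfolding EE_codes(8)[of h i 0 0, symmetric] by blast
qed

end

context zmod begin

lemma surj_card:
 assumes "card_le a w" "is_ordinal w" "a:M" "b:M" "DefF (%e. t (e 0))" "ext b <= t ` ext a"
 shows "card_le b w"
 using card_le_trans[OF surj_back[OF assms] assms(1,4)] ordM[OF assms(2)] by blast

end

section \<open>Countable ordinals and the index set\<close>

context zfc begin

lemma om_refl: "card_le om om" by (rule card_le_sub) auto
lemma om_le_w1: "card_le om w1" by (rule card_le_sub) (use ord_trans[OF ord_w(1) om_w1] in auto)
lemma w1_sub_w2: "ext w1 <= ext w2" using ord_trans[OF ord_w(2) w1_w2] by blast

lemma card_le_suc: assumes "card_le x k" "x:M" "card_le om k" "card_le (times k k) k" "k:M" shows "card_le (suc x) k"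
proof (rule card_le_UN'[of "num 2" k "%i. if i = num 0 then x else upr x x"])
 show "DefF (%e. if e 0 = num 0 then x else upr x x)" by (intro def_intro assms)
 show "card_le (if i = num 0 then x else upr x x) k" for i
  using assms card_le_trans[OF finite_le_om assms(3), of "upr x x"] by auto
 show "ext (suc x) <= (UN i:ext (num 2). ext (if i = num 0 then x else upr x x))"
 proof -
  have "num 0:ext (num 2)" "num 1:ext (num 2)" "num 1 ~= num 0" unfolding num_mem_num num_eq by simp_all
  moreover have "ext (suc x) = ext x Un ext (upr x x)" using assms(2) by simp
  ultimately show ?thesis by fastforce
 qed
 have "card_le (num 2) om" by (rule finite_le_om) (simp_all only: num_M ext_num finite_imageI finite_lessThan)
 then show "card_le (num 2) k" using card_le_trans assms(3,5) num_M by blast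
 show "card_le k k" by (rule card_le_sub) (use assms in auto)
qed (use assms in auto)

lemma suc_w1: "x:ext w1 ==> suc x:ext w1"
 using w1_iff ord_suc card_le_suc[OF _ _ om_refl om_sq om_M] ordM by blast

text \<open>Regularity of omega_1: the union of countably many countable ordinals is countable. Its
  successor is taken because the bound has to be strict.\<close>

lemma w1_bounded: assumes C: "C:M" "ext C <= ext w1" "card_le C om" obtains al where "al:ext w1" "ext C <= ext al"
proof -
 have o: "is_ordinal c" "card_le c om" "c:M" if "c:ext C" for c using that C(2) w1_iff ordM by blast+
 have "is_ordinal (un C)"
 proof (rule is_ordinalI)
  show "un C:M" using C by simp
  show "is_ordinal y" if y: "y:ext (un C)" for y using y o(1) ord_elem unfolding un(2)[OF C(1)] by blast
  show "ext y <= ext (un C)" if y: "y:ext (un C)" for y using y o(1) ord_trans unfolding un(2)[OF C(1)] by blast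
 qed
 moreover have "card_le (un C) om"
  by (rule card_le_UN'[OF C(1) om_M DefF_var o(2) _ _ C(3) om_refl om_sq om_M]) (use C in auto)
 ultimately have u: "un C:ext w1" using w1_iff by blast
 have "ext C <= ext (suc (un C))"
 proof
  fix c assume c: "c:ext C"
  have uo: "is_ordinal (un C)" "un C:M" using u w1_iff ordM by blast+
  have "un C ~: ext c"
  proof
   assume "un C:ext c"
   then have "un C:ext (un C)" using c C(1) by auto
   then show False using E_irrefl uo by blast
  qed
  then have "c:ext (un C) \<or> c = un C" using ord_linear[OF o(1)[OF c] uo(1)] by blast
  then show "c:ext (suc (un C))" using uo by auto
 qed
 then show ?thesis using that suc_w1[OF u] by blast
qed

definition ctb where "ctb y = sepm (pw y) (%x. card_le x om)"

text \<open>A set of indices that contains, up to coding, a name for every real of the extension.\<close>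

lemma closed_ex:
 assumes A: "A:M"
 shows "EX K. K:M & ext A <= ext K & (ALL x:M. ext x <= ext K --> card_le x om --> x:ext K)"
proof -
 have cD: "DefF s ==> DefF (%e. ctb (s e))" for s by (rule Def_lift[of ctb]) (unfold ctb_def, intro def_intro)
 have c: "x:ext (ctb y) <-> x:M & ext x <= ext y & card_le x om" if y: "y:M" for x y
 proof -
  have "Def (%e. card_le (e 0) om)" by (intro def_intro)
  from sepm(2)[OF pw(1)[OF y] this] show ?thesis unfolding ctb_def using y by simp
 qed
 define Op where "Op i f = cup A (un (mk {ctb v | v. v:ext (rgm f)}))" for i f :: 'a
 have OpD: "DefF (%e. Op (e 0) (e 1))" unfolding Op_def
  by (intro DefF_cup DefF_const A DefF_un DefF_img[of "%x e. ctb x"] cD def_intro)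
 have wM: "ext w1 <= M" using ext_M by blast
 obtain F where F: "!!i. i:ext w1 ==> F i = Op i (mk {pr j (F j) | j. j:ext w1 & ordlt j i})"
  "!!i. i:ext w1 ==> F i:M" "coded {pr j (F j) | j. j:ext w1}"
  "!!i. i:ext w1 ==> coded {pr j (F j) | j. j:ext w1 & ordlt j i}"
  using zfc_recursion[OF w1_M wfp_on_ordlt[OF wM] ordlt_trans Def_ordlt[OF DefF_var DefF_var] OpD] by blast
 have e: "ext (F i) = ext A Un (UN j:ext i. ext (ctb (F j)))" if i: "i:ext w1" for i
 proof -
  have J: "j:ext w1 & ordlt j i <-> j:ext i" for j
   using ord_trans[OF ord_w(1) i] i w1_iff unfolding ordlt_def by blast
  note c' = F(4)[OF i, unfolded J]
  let ?f = "mk {pr j (F j) | j. j:ext i}"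
  have fw: "j:ext w1" if "j:ext i" for j using ord_trans[OF ord_w(1) i that] .
  have r: "rgm ?f:M" "ext (rgm ?f) = F ` ext i"
   using rgm_M(1)[OF mk_M[OF c']] rgm_graph[OF c'] F(2) fw wM by (blast, blast)
  have "coded (ctb ` ext (rgm ?f))" by (rule repl_DefF[OF r(1)]) (intro cD def_intro)
  then have cc: "coded {ctb v | v. v:ext (rgm ?f)}" by (simp add: setcompr_eq_image)
  note m = mk[OF cc]
  have m2: "ext (mk {ctb v | v. v:ext (rgm ?f)}) = ctb ` F ` ext i" unfolding m(2) unfolding r(2) by blast
  show ?thesis unfolding F(1)[OF i] J Op_def cup(2)[OF A un(1)[OF m(1)]] un(2)[OF m(1)] m2 by blast
 qed
 have mono: "ext (F i) <= ext (F j)" if "i:ext j" "j:ext w1" for i j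
 proof -
  have "is_ordinal j" using that w1_iff by blast
  then have "ext i <= ext j" using ord_trans that(1) by blast
  then show ?thesis unfolding e[OF that(2)] e[OF ord_trans[OF ord_w(1) that(2,1)]] by blast
 qed
 have G: "rgm (mk {pr j (F j) | j. j:ext w1}):M" "ext (rgm (mk {pr j (F j) | j. j:ext w1})) = F ` ext w1"
  using rgm_M(1)[OF mk_M[OF F(3)]] rgm_graph[OF F(3)] F(2) wM by (blast, blast)
 define K where "K = un (rgm (mk {pr j (F j) | j. j:ext w1}))"
 have K: "K:M" "ext K = (UN i:ext w1. ext (F i))" unfolding K_def using G by auto
 have "x:ext K" if x: "x:M" "ext x <= ext K" "card_le x om" for x
 proof -
  define g where "g = mk {pr j (F j) | j. j:ext w1}"
  have g: "g:M" "!!i. i:ext w1 ==> ap g i = F i" unfolding g_def by (rule mk_M[OF F(3)], rule graph_ap[OF F(3) wM F(2)])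
  have ex: "EX i:ext w1. y:ext (ap g i)" if yx: "y:ext x" for y
  proof -
   obtain i where "i:ext w1" "y:ext (F i)" using yx x(2) unfolding K(2) by blast
   then show ?thesis using g(2) by auto
  qed
  have d: "Def (%e. e 0:ext (ap g (e 1)))" by (intro def_intro g(1))
  obtain f where f: "f:M" "is_fun f x w1" "!!y. y:ext x ==> y:ext (ap g (ap f y))" using choice[OF x(1) w1_M d ex] by blast
  have "coded (ap f ` ext x)" by (rule repl_DefF[OF x(1)]) (intro def_intro f)
  note m = mk[OF this]
  have "card_le (mk (ap f ` ext x)) om"
   by (rule surj_card[OF x(3) ord_om x(1) m(1), of "ap f"]) (intro def_intro f, simp add: m)
  \<comment> \<open>A countable subset of the union of omega_1 layers is included in a single layer
    by regularity, and so it is an element of the next one.\<close>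
  then obtain mu where mu: "mu:ext w1" "ap f ` ext x <= ext mu" using w1_bounded[OF m(1)] is_funD(1)[OF f(2)] unfolding m(2) by blast
  have "ext x <= ext (F mu)"
  proof
   fix y assume y: "y:ext x"
   then have "ap f y:ext mu" using mu(2) by blast
   then show "y:ext (F mu)" using mono[OF _ mu(1)] f(3)[OF y] g(2)[OF is_funD(1)[OF f(2) y]] by auto
  qed
  then have "x:ext (ctb (F mu))" using c F(2)[OF mu(1)] x by blast
  moreover have "mu:ext (suc mu)" using mu(1) ext_M by simp
  ultimately have "x:ext (F (suc mu))" unfolding e[OF suc_w1[OF mu(1)]] by blast
  then show ?thesis unfolding K(2) using suc_w1[OF mu(1)] by blast
 qed
 moreover have "ext A <= ext K" unfolding K(2) using e num_w1[of 0] by blast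
 ultimately show ?thesis using K(1) by blast
qed

definition KK where "KK = (SOME K. K:M & ext w2 <= ext K & (ALL x:M. ext x <= ext K --> card_le x om --> x:ext K))"
definition XX where "XX = times KK (times w2 w1)"
definition ix where "ix xi ga al = pr xi (pr ga al)"

lemma KK [simp, def_intro]: "KK:M" and KK_w2: "ext w2 <= ext KK"
 and KK_closed: "x:M ==> ext x <= ext KK ==> card_le x om ==> x:ext KK"
 using someI_ex[OF closed_ex[OF w2_M]] unfolding KK_def[symmetric] by blast+

lemma KK_pr: assumes "x:ext KK" "y:ext KK" shows "pr x y:ext KK"
proof -
 have "upr a b:ext KK" if "a:ext KK" "b:ext KK" for a b
  by (rule KK_closed[OF _ _ finite_le_om]) (use that ext_M in simp_all)
 then show ?thesis unfolding pr_def using assms by blast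
qed

lemma XX: "XX:M" "ext XX = {ix xi ga al | xi ga al. xi:ext KK & ga:ext w2 & al:ext w1}"
 unfolding XX_def ix_def by (simp, unfold ext_times[OF KK times_M[OF w2_M w1_M]] ext_times[OF w2_M w1_M], blast)

lemma ix_inj: "xi:ext KK ==> ga:ext w2 ==> al:ext w1 ==> xi':ext KK ==> ga':ext w2 ==> al':ext w1 ==>
 ix xi ga al = ix xi' ga' al' <-> xi = xi' & ga = ga' & al = al'"
 unfolding ix_def using ext_M by simp
lemma DefF_ix [def_intro]: "DefF r ==> DefF s ==> DefF t ==> DefF (%e. ix (r e) (s e) (t e))" unfolding ix_def by (intro def_intro)

text \<open>The names (stage, number) of all sets produced up to \<open>ga\<close> for a fixed first
  coordinate. There are only omega_1 many, which makes coding them by countable ordinals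
  possible.\<close>

definition dom3 where "dom3 ga = times (times (suc ga) w1) om"
lemma dom3: assumes "ga:M" shows "dom3 ga:M" "ext (dom3 ga) = {pr (pr ga' al) (num n) | ga' al n. ga':ext (suc ga) & al:ext w1}"
proof -
 have s: "suc ga:M" using assms by simp
 show "dom3 ga:M" unfolding dom3_def using s by simp
 show "ext (dom3 ga) = {pr (pr ga' al) (num n) | ga' al n. ga':ext (suc ga) & al:ext w1}"
  unfolding dom3_def ext_times[OF times_M[OF s w1_M] om_M] ext_times[OF s w1_M] ext_om by blast
qed

lemma suc_w2: "x:ext w2 ==> suc x:ext w2"
 using w2_iff ord_suc card_le_suc[OF _ _ om_le_w1 w1_sq w1_M] ordM by blast

lemma dom3_le: assumes "ga:ext w2" shows "card_le (dom3 ga) w1"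
proof -
 have s: "suc ga:M" "card_le (suc ga) w1" using suc_w2[OF assms] w2_iff ordM by blast+
 have ww: "card_le w1 w1" by (rule card_le_sub) auto
 note t = times_M[OF s(1) w1_M] times_M[OF w1_M w1_M]
 have 1: "card_le (times (suc ga) w1) w1"
  by (rule card_le_trans[OF card_le_times[OF s(2) ww s(1) w1_M w1_M w1_M] w1_sq t(1) w1_M])
 show ?thesis unfolding dom3_def
  by (rule card_le_trans[OF card_le_times[OF 1 om_le_w1 t(1) om_M w1_M w1_M] w1_sq times_M[OF t(1) om_M] w1_M])
qed

lemma injections:
 assumes "a:M" "b:M" "DefF (%e. S (e 0))" "!!x. x:ext a ==> card_le (S x) b"
 obtains f where "f:M" "!!x. x:ext a ==> ap f x:M & inj_on (ap (ap f x)) (ext (S x)) & (ALL y:ext (S x). ap (ap f x) y:ext b)"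
proof -
 define P where "P x g <-> (ALL y:ext (S x). ap g y:ext b) & (ALL y:ext (S x). ALL z:ext (S x). ap g y = ap g z --> y = z)" for x g
 have SD: "DefF s ==> DefF (%e. S (s e))" for s by (rule Def_lift[OF assms(3)])
 have SM: "S x:M" if "x:M" for x using DefF_in[OF assms(3), of "%_. x"] that by auto
 have cc: "coded (S ` ext a)" by (rule repl_DefF[OF assms(1,3)])
 define B where "B = pw (times (un (mk (S ` ext a))) b)"
 have m: "mk (S ` ext a):M" "ext (mk (S ` ext a)) = S ` ext a" using mk[OF cc] by auto
 have u: "un (mk (S ` ext a)):M" "ext (un (mk (S ` ext a))) = (UN x:ext a. ext (S x))" using m by auto
 have B: "B:M" unfolding B_def using u assms by simp
 have PD: "Def (%e. P (e 0) (e 1))" unfolding P_def by (intro def_intro SD assms)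
 have ex: "EX g:ext B. P x g" if x: "x:ext a" for x
 proof -
  obtain g where g: "g:M" "is_fun g (S x) b" "inj_on (ap g) (ext (S x))" "!!y. y:ext (S x) ==> ap g y:ext b"
   using card_leE[OF assms(4)[OF x]] by blast
  have "ext g <= ext (times (un (mk (S ` ext a))) b)"
  proof
   fix z assume "z:ext g"
   then obtain y where y: "y:ext (S x)" "z = pr y (ap g y)" using is_fun_mem[OF g(2)] by blast
   then show "z:ext (times (un (mk (S ` ext a))) b)" unfolding ext_times[OF u(1) assms(2)] u(2) using g(4) x by blast
  qed
  then have "g:ext B" unfolding B_def using g(1) u(1) assms(2) by simp
  moreover have "P x g" unfolding P_def using g(3,4) unfolding inj_on_def by blast
  ultimately show ?thesis by blast
 qed
 obtain f where f: "f:M" "is_fun f a B" "!!x. x:ext a ==> P x (ap f x)" using choice[OF assms(1) B PD ex] by blast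
 show thesis by (rule that[OF f(1)]) (use f ext_M in \<open>auto simp: P_def inj_on_def\<close>)
qed

end

text \<open>The injections are fixed once as elements of the ground model, so that codes are
  definable from parameters there and keep their meaning in every extension considered.\<close>

locale conc = zfc M E for M :: "'a set" and E +
 fixes ii jj :: 'a
 assumes iiM [def_intro]: "ii:M" and jjM [def_intro]: "jj:M"
  and ii: "!!ga. ga:ext w2 ==> inj_on (ap (ap ii ga)) (ext (dom3 ga)) & (ALL y:ext (dom3 ga). ap (ap ii ga) y:ext w1)"
  and jj: "!!al. al:ext w1 ==> inj_on (ap (ap jj al)) (ext al) & (ALL y:ext al. ap (ap jj al) y:ext om)"
begin

text \<open>\<open>et ga\<close> codes the sets of the stages up to \<open>ga\<close> by countable ordinals, and \<open>io al\<close> numbers the codes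
  below \<open>al\<close>.\<close>

definition et where "et ga ga' al n = ap (ap ii ga) (pr (pr ga' al) (num n))"
definition io where "io al be = dn (ap (ap jj al) be)"

lemma et: assumes "ga:ext w2" "ga':ext (suc ga)" "al:ext w1"
 shows et_w1: "et ga ga' al n:ext w1"
  and et_inj: "de':ext (suc ga) ==> be:ext w1 ==> et ga ga' al n = et ga de' be m <-> ga' = de' & al = be & n = m"
proof -
 have g: "ga:M" using assms ext_M by blast
 have i: "pr (pr ga' al) (num n):ext (dom3 ga)" if "ga':ext (suc ga)" "al:ext w1" for ga' al n
  unfolding dom3(2)[OF g] using that by blast
 show "et ga ga' al n:ext w1" unfolding et_def using i assms ii[OF assms(1)] by blast
 assume b: "de':ext (suc ga)" "be:ext w1"
 have "et ga ga' al n = et ga de' be m <-> pr (pr ga' al) (num n) = pr (pr de' be) (num m)"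
  unfolding et_def by (rule inj_on_eq_iff[OF conjunct1[OF ii[OF assms(1)]] i[OF assms(2,3)] i[OF b]])
 moreover have "ga':M" "al:M" "de':M" "be:M" using b assms ext_M by blast+
 ultimately show "et ga ga' al n = et ga de' be m <-> ga' = de' & al = be & n = m" by simp
qed

lemma io_inj: assumes "al:ext w1" "be:ext al" "be':ext al" "io al be = io al be'" shows "be = be'"
proof -
 have "ap (ap jj al) be:ext om" "ap (ap jj al) be':ext om" using jj assms by blast+
 then have "ap (ap jj al) be = ap (ap jj al) be'" using num_dn assms(4) unfolding io_def by metis
 then show ?thesis using inj_onD[OF conjunct1[OF jj[OF assms(1)]] _ assms(2,3)] by blast
qed

lemma et_io_Def [def_intro]: "DefF q ==> DefF r ==> DefF s ==> DefN t ==> DefF (%e. et (q e) (r e) (s e) (t e))"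
 "DefF q ==> DefF r ==> DefN (%e. io (q e) (r e))"
 unfolding et_def io_def by (intro def_intro; assumption)+

definition llt where "llt ga' al' ga al <-> ga':ext ga \<or> (ga' = ga & al':ext al)"

text \<open>The first coordinate never changes along the order: stages with different
  \<open>xi\<close> do not see each other, which will keep the families for different
  \<open>xi\<close> apart.\<close>

definition LL where "LL j i <-> (EX xi:ext KK. EX ga:ext w2. EX ga':ext w2. EX al:ext w1. EX al':ext w1.
 j = ix xi ga' al' & i = ix xi ga al & llt ga' al' ga al)"
definition uu where "uu i k j n <-> (EX xi:ext KK. EX ga:ext w2. EX ga':ext w2. EX al:ext w1. EX al':ext w1.
 j = ix xi ga' al' & i = ix xi ga al & llt ga' al' ga al & et ga ga' al' n:ext al & k = io al (et ga ga' al' n))"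

lemma idx_axioms: "idx M E XX LL uu"
proof
 show "XX:M" by (rule XX)
 show "j:ext XX & i:ext XX" if h: "LL j i" for i j using h unfolding LL_def XX(2) by blast
 show "LL j i" if h: "uu i k j n" for i j k n using h unfolding LL_def uu_def by blast
 show "LL i i'" if h: "LL i j" "LL j i'" for i i' j
 proof -
  obtain xi ga ga' al al' where a: "xi:ext KK" "ga:ext w2" "ga':ext w2" "al:ext w1" "al':ext w1"
   "i = ix xi ga' al'" "j = ix xi ga al" "llt ga' al' ga al" using h(1) unfolding LL_def by blast
  obtain xi' de de' be be' where b: "xi':ext KK" "de:ext w2" "de':ext w2" "be:ext w1" "be':ext w1"
   "j = ix xi' de' be'" "i' = ix xi' de be" "llt de' be' de be" using h(2) unfolding LL_def by blast
  have e: "xi' = xi" "de' = ga" "be' = al" using ix_inj a b by metis+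
  have o: "is_ordinal de" "is_ordinal be" using b ord_elem ord_w by blast+
  have "llt ga' al' de be" using a(8) b(8) ord_trans[OF o(1)] ord_trans[OF o(2)] unfolding e llt_def by blast
  then show ?thesis unfolding LL_def using a b e by blast
 qed
 show "wf {(j, i). LL j i}"
 proof (rule wf_subset)
  let ?R = "{(x, y). y:M & x:ext y}"
  show "wf (inv_image (?R <*lex*> ?R) (%i. (p1 (p2 i), p2 (p2 i))))" by (intro wf_inv_image wf_lex_prod wf_E)
  show "{(j, i). LL j i} <= inv_image (?R <*lex*> ?R) (%i. (p1 (p2 i), p2 (p2 i)))"
  proof clarify
   fix j i assume "LL j i"
   then obtain xi ga ga' al al' where a: "xi:M" "ga:M" "ga':M" "al:M" "al':M"
    "j = ix xi ga' al'" "i = ix xi ga al" "llt ga' al' ga al" unfolding LL_def using ext_M by metis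
   then show "(j, i):inv_image (?R <*lex*> ?R) (%i. (p1 (p2 i), p2 (p2 i)))" unfolding ix_def llt_def by auto
  qed
 qed
 show "Def (%e. LL (e 0) (e 1))" unfolding LL_def llt_def by (intro def_intro)
 have "Def (%e. uu (p1 (e 0)) (dn (p2 (e 0))) (p1 (e 1)) (dn (p2 (e 1))))" unfolding uu_def llt_def by (intro def_intro)
 then show "Def (%e. uu (p1 (e 0)) (dn (p2 (e 0))) (p1 (e 1)) (dn (p2 (e 1))))" .
qed

end

sublocale conc < idx M E XX LL uu by (rule idx_axioms)

context conc begin

lemma UE_eval:
 assumes "xi:ext KK" "ga:ext w2" "ga':ext (suc ga)" "al:ext w1" "al':ext al" "et ga ga' al' n:ext al"
 shows "UE h (ix xi ga al) (io al (et ga ga' al' n)) = EE h (ix xi ga' al') n"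
proof -
 have g: "ga:M" using assms ext_M by blast
 have a': "al':ext w1" using ord_trans[OF ord_w(1) assms(4,5)] .
 have g': "ga':ext w2" using ord_trans[OF ord_w(2) suc_w2[OF assms(2)] assms(3)] .
 have l: "llt ga' al' ga al" unfolding llt_def using assms(3,5) g by auto
 have "uu (ix xi ga al) (io al (et ga ga' al' n)) j m <-> j = ix xi ga' al' & m = n" for j m
 proof
  assume "uu (ix xi ga al) (io al (et ga ga' al' n)) j m"
  then obtain xi0 ga0 de al0 be where b: "xi0:ext KK" "ga0:ext w2" "de:ext w2" "al0:ext w1" "be:ext w1"
   "j = ix xi0 de be" "ix xi ga al = ix xi0 ga0 al0" "llt de be ga0 al0" "et ga0 de be m:ext al0"
   "io al (et ga ga' al' n) = io al0 (et ga0 de be m)" unfolding uu_def by blast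
  have e: "xi0 = xi" "ga0 = ga" "al0 = al" using ix_inj[OF assms(1,2,4) b(1,2,4)] b(7) by auto
  have d: "de:ext (suc ga)" using b(8) g unfolding e llt_def by auto
  have "et ga ga' al' n = et ga de be m" using io_inj[OF assms(4,6)] b(9,10) unfolding e by blast
  then have "ga' = de & al' = be & n = m" using et_inj[OF assms(2,3) a' d b(5)] by blast
  then show "j = ix xi ga' al' & m = n" using b(6) e by blast
 next
  assume "j = ix xi ga' al' & m = n"
  then show "uu (ix xi ga al) (io al (et ga ga' al' n)) j m" unfolding uu_def using assms a' g' l by blast
 qed
 then show ?thesis unfolding UE_def by auto
qed

definition XS where "XS h xi ga = {EE h (ix xi ga' al) n | ga' al n. ga':ext (suc ga) & al:ext w1}"

text \<open>A formula has finitely many set parameters. Their stages and codes are bounded by some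
  countable \<open>al\<close>, so all of them are available at stage \<open>(ga, al)\<close>, whose
  sets are closed under the evaluation of formulas.\<close>

lemma XS_arith: assumes "xi:ext KK" "ga:ext w2" shows "arith_closed (XS h xi ga)"
 unfolding arith_closed_def arith_definable_from_def
proof (intro allI impI, elim exE conjE)
 fix B A f assume A: "ALL k. A k:XS h xi ga" and B: "B = {n. arith_sat A f ((%_. 0)(0 := n))}"
 have gM: "ga:M" using assms ext_M by blast
 have "ALL k. EX c a n. A k = EE h (ix xi c a) n & c:ext (suc ga) & a:ext w1" using A unfolding XS_def by blast
 then obtain c a n where can: "!!k. A k = EE h (ix xi (c k) (a k)) (n k) & c k:ext (suc ga) & a k:ext w1" by metis
 let ?F = "a ` pars f Un (%k. et ga (c k) (a k) (n k)) ` pars f"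
 have F: "finite ?F" "?F <= ext w1" using finite_pars can et_w1[OF assms(2)] by auto
 then have FM: "?F <= M" using ext_M by blast
 have cF: "coded ?F" by (rule coded_finite[OF F(1) FM])
 have "card_le (mk ?F) om" by (rule finite_le_om) (unfold ext_mk[OF cF], rule mk_M[OF cF], rule F(1))
 then obtain al where al: "al:ext w1" "?F <= ext al" using w1_bounded[OF mk_M[OF cF]] F(2) unfolding ext_mk[OF cF] by blast
 have "B:range (EE h (ix xi ga al))" unfolding B
 proof (rule EE_arith)
  fix k assume k: "k:pars f"
  have "A k = UE h (ix xi ga al) (io al (et ga (c k) (a k) (n k)))"
   using UE_eval[OF assms, of "c k" al "a k" "n k" h] can[of k] al k by auto
  then show "A k:range (EE h (ix xi ga al))" unfolding EE_codes(1)[of h _ _ 0, symmetric] by blast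
 qed
 then show "B:XS h xi ga" unfolding XS_def using al(1) gM by auto
qed

end

lemma st_agree: "(!!l. l < k ==> g l = g' l) ==> st U g a k = st U g' a k"
 by (induction k) (auto simp: st_simps)

section \<open>Genericity of one Cohen real over the others\<close>

locale piece = conc M E ii jj + cohen M E XX G for M :: "'a set" and E ii jj G

sublocale piece < cidx M E XX LL uu XX G by unfold_locales simp

context piece begin

definition XV where "XV nu = sepm XX (%j. j ~= nu)"

lemma XV: assumes "nu:M" shows "XV nu:M" "ext (XV nu) = ext XX - {nu}"
proof -
 have "Def (%e. e 0 ~= nu)" by (intro def_intro assms)
 from sepm[OF XX(1) this] show "XV nu:M" "ext (XV nu) = ext XX - {nu}" unfolding XV_def by auto
qed

abbreviation GV where "GV nu \<equiv> G Int ext (cp (XV nu))"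

text \<open>The extension by all Cohen reals except the one at \<open>nu\<close> is of the same
  kind, and by \<open>g_omit\<close> it computes the same reals at all other indices.\<close>

lemma omit: assumes "nu:ext XX" shows "cidx M E XX LL uu (XV nu) (GV nu)"
proof -
 have m: "nu:M" using assms ext_M by blast
 have "cohen M E (XV nu) (GV nu)" by (rule cohen_restrict) (use XV[OF m] in auto)
 then show ?thesis using XV[OF m] idx_axioms unfolding cidx_def cidx_axioms_def by auto
qed

lemma g_omit: assumes "nu:ext XX" "j:ext XX" "j ~= nu" shows "cohen.g M E (XV nu) (GV nu) j = g j"
proof (rule HOL.ext)
 interpret P': cidx M E XX LL uu "XV nu" "GV nu" by (rule omit[OF assms(1)])
 fix k
 have j: "j:ext (XV nu)" using XV(2)[OF ext_M[OF assms(1)]] assms by blast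
 have "P'.tr (t3 j k (P'.g j k))" using P'.g_iff[OF j] by blast
 then have "tr (t3 j k (P'.g j k))" unfolding P'.tr_def tr_def by blast
 then show "P'.g j k = g j k" using g_iff[OF assms(2)] by metis
qed

lemma LL_ne: "LL j i ==> j ~= i" using LL_wf wf_not_refl by fastforce

text \<open>A finite condition at \<open>nu\<close> determines the sequence up to its first
  undefined argument. By hypothesis the current term almost includes a set with index in
  \<open>T\<close>, and declaring that index to be the next value moves the sequence there. The sets
  in question and \<open>T\<close> belong to the extension without \<open>nu\<close>, so the real at
  \<open>nu\<close> is generic over this requirement.\<close>

lemma gen_pib:
 assumes nu: "nu:ext XX" and T: "T:zmod.RR (forcing.N M E (cp (XV nu)) (GV nu)) (forcing.EN M E (cp (XV nu)) (GV nu))"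
  and a: "unb (UE g nu a)" and dn: "!!x. unb (UE g nu x) ==> EX y:T. unb (UE g nu y) & asub (UE g nu y) (UE g nu x)"
 shows "EX k. st (UE g nu) (g nu) a k:T"
proof -
 interpret P': cidx M E XX LL uu "XV nu" "GV nu" by (rule omit[OF nu])
 have nuM: "nu:M" using nu ext_M by blast
 note T = T
 define U where "U = UE g nu"
 have U': "U = UE P'.g nu" unfolding U_def
  by (rule HOL.ext, rule UE_cong) (use g_omit[OF nu] LL_X LL_ne in metis)
 obtain TB where TB: "TB:P'.N" "!!i m. i:ext XX ==> P'.NN.ns (P'.NN.ap TB (P'.NN.pr (P'.cv i) (P'.NN.num m))) = EE P'.g i m"
  using P'.EE_table by metis
 have UT: "U k = P'.NN.ns (P'.NN.ap TB (P'.NN.pr (P'.cv nu) (P'.NN.num (enc 0 (enc k 0)))))" for k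
  unfolding U' TB(2)[OF nu] EE_codes ..
 \<comment> \<open>The guiding function read off from a finite condition instead of the full real,
   with 0 where the condition is silent.\<close>
 define gs where "gs x l = P'.NN.dn (P'.NN.ap x (P'.NN.pr (P'.cv nu) (P'.NN.num l)))" for x l
 define B where "B = upr nu nu"
 have B: "B:M" "ext B = {nu}" unfolding B_def using nuM by auto
 have cB: "cp B:M" using cp_M[OF B(1)] .
 have lv: "P'.NN.pr (P'.NN.pr (P'.cv nu) (P'.NN.num l)) (P'.NN.num y) = P'.cv (t3 nu l y)" for l y
  using nuM by (simp add: P'.cv_pr P'.cv_num del: num.simps P'.NN.num.simps)
 have mem: "P'.NN.pr (P'.NN.pr (P'.cv nu) (P'.NN.num l)) (P'.NN.num y):P'.extN (P'.cv s) <-> t3 nu l y:ext s" if "s:M" for s l y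
  unfolding lv by (rule P'.cv_mem) (use nuM that in simp_all)
 have gs: "gs (P'.cv s) l = y" if s: "s:ext (cp B)" "t3 nu l y:ext s" for s l y
 proof -
  have sM: "s:M" using s ext_M by blast
  have "P'.NN.ap (P'.cv s) (P'.NN.pr (P'.cv nu) (P'.NN.num l)) = P'.NN.num y"
  proof (rule P'.NN.ap_eq)
   show "P'.NN.pr (P'.NN.pr (P'.cv nu) (P'.NN.num l)) (P'.NN.num y):P'.extN (P'.cv s)" using mem[OF sM] s by blast
   fix z assume z: "z:P'.N" "P'.NN.pr (P'.NN.pr (P'.cv nu) (P'.NN.num l)) z:P'.extN (P'.cv s)"
   then obtain w where w: "w:ext s" "P'.NN.pr (P'.NN.pr (P'.cv nu) (P'.NN.num l)) z = P'.cv w" unfolding P'.ext_cv[OF sM] by blast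
   then obtain j k m where j: "w = t3 j k m" "j = nu" using s(1) unfolding cp_iff[OF B(1)] cb(2)[OF B(1)] B(2) by blast
   have "P'.NN.pr (P'.NN.pr (P'.cv nu) (P'.NN.num l)) z = P'.NN.pr (P'.NN.pr (P'.cv nu) (P'.NN.num k)) (P'.NN.num m)"
    unfolding w(2) j lv ..
   then have km: "k = l" "z = P'.NN.num m" using z nuM by simp_all
   have "m = y" using sfun_t3[of "ext s" nu l m y] s w(1) nuM unfolding j km cp_iff[OF B(1)] by blast
   then show "z = P'.NN.num y" using km by simp
  qed (use sM nuM in auto)
  then show ?thesis unfolding gs_def by simp
 qed
 \<comment> \<open>\<open>x\<close> is defined on all arguments below \<open>k\<close>, so it
   decides the sequence up to term \<open>k\<close>, and that term has its index in
   \<open>T\<close>.\<close>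
 define Dl where "Dl x <-> (EX k. (ALL l. l < k --> (EX y. P'.NN.pr (P'.NN.pr (P'.cv nu) (P'.NN.num l)) (P'.NN.num y):P'.extN x)) &
   st U (gs x) a k:P'.NN.ns (P'.NN.real T))" for x
 note [def_intro] = TB(1) P'.cv_N[OF nuM] P'.NN.real_M[OF T]
 have "P'.NN.Def (%e. Dl (e 0))" unfolding Dl_def
  by (intro def_intro P'.NN.DefN_st[where U = "%z. U" and g = gs]) (unfold gs_def UT, intro def_intro; assumption)+
 then have Z: "P'.NN.sepm (P'.cv (cp B)) Dl:P'.N" "P'.extN (P'.NN.sepm (P'.cv (cp B)) Dl) = {x:P'.extN (P'.cv (cp B)). Dl x}"
  using P'.NN.sepm[OF P'.cv_N[OF cB]] by auto
 obtain Q where Q: "Q:M"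
  "!!s. s:ext (cp B) ==> P'.cv s:P'.extN (P'.NN.sepm (P'.cv (cp B)) Dl) <-> (EX c:GV nu. pr s c:ext Q)"
  by (rule P'.nice_name[OF Z(1) cB]) blast
 have ZD: "(EX c:GV nu. pr s c:ext Q) <-> Dl (P'.cv s)" if s: "s:ext (cp B)" for s
  unfolding Q(2)[OF s, symmetric] Z(2) P'.ext_cv[OF cB] using s by blast
 have DlI: "Dl (P'.cv s) <-> (EX k. (ALL l. l < k --> (EX y. t3 nu l y:ext s)) & st U (gs (P'.cv s)) a k:T)" if s: "s:ext (cp B)" for s
  unfolding Dl_def P'.NN.ns_real[OF T] mem[OF ext_M[OF s]] ..
 have "EX s:G Int ext (cp B). EX c:GV nu. pr s c:ext Q"
 proof (rule product_generic[OF XV(1)[OF nuM] _ B(1) _ _ Q(1)])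
  show "ext (XV nu) <= ext XX" "ext B <= ext XX" "ext (XV nu) Int ext B = {}" unfolding XV(2)[OF nuM] B(2) using nu by auto
  fix s assume s: "s:ext (cp B)"
  have sM: "s:M" using s ext_M by blast
  have "finite (ext s)" using s unfolding cp_iff[OF B(1)] by blast
  then have "EX k. ALL y. t3 nu k y ~: ext s" using fresh nuM by blast
  \<comment> \<open>The least argument at which \<open>s\<close> is undefined. Minimality matters:
    every smaller argument is decided, so extending \<open>s\<close> at \<open>k\<close> does not
    alter the terms up to \<open>k\<close>.\<close>
  then obtain k where k: "ALL y. t3 nu k y ~: ext s" "!!l. l < k ==> EX y. t3 nu l y:ext s"
   using exists_least_iff[of "%k. ALL y. t3 nu k y ~: ext s"] by blast
  define x where "x = st U (gs (P'.cv s)) a k"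
  have "unb (U x)" unfolding x_def by (rule st_unb) (use a in \<open>simp add: U_def\<close>)
  then obtain y where y: "y:T" "unb (U y)" "asub (U y) (U x)" using dn unfolding U_def by blast
  define s' where "s' = cup s (upr (t3 nu k y) (t3 nu k y))"
  have s': "s':ext (cp B)" "ext s' = insert (t3 nu k y) (ext s)" unfolding s'_def
   using cp_insert[OF B(1) s, of nu k y] k(1) B(2) by auto
  have "st U (gs (P'.cv s')) a k = x" unfolding x_def
  proof (rule st_agree)
   fix l assume "l < k"
   then obtain z where "t3 nu l z:ext s" using k(2) by blast
   then show "gs (P'.cv s') l = gs (P'.cv s) l" using gs[OF s] gs[OF s'(1)] s'(2) by (metis insertCI)
  qed
  moreover have "gs (P'.cv s') k = y" using gs[OF s'(1)] s'(2) by blast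
  ultimately have "st U (gs (P'.cv s')) a (Suc k):T" using y by (simp add: st_simps)
  moreover have "ALL l. l < Suc k --> (EX y. t3 nu l y:ext s')" 
  proof (intro allI impI)
   fix l assume "l < Suc k"
   then consider "l < k" | "l = k" by linarith
   then show "EX y. t3 nu l y:ext s'" using k(2) unfolding s'(2) by cases blast+
  qed
  ultimately have "Dl (P'.cv s')" unfolding DlI[OF s'(1)] by blast
  then show "EX s':ext (cp B). ext s <= ext s' & (EX c:GV nu. pr s' c:ext Q)"
   using ZD[OF s'(1)] s' by blast
 qed
 then obtain s where s: "s:G" "s:ext (cp B)" "Dl (P'.cv s)" using ZD by blast
 obtain k where k: "ALL l. l < k --> (EX y. t3 nu l y:ext s)" "st U (gs (P'.cv s)) a k:T" using s(3) unfolding DlI[OF s(2)] by blast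
 have "st U (gs (P'.cv s)) a k = st U (g nu) a k"
 proof (rule st_agree)
  fix l assume "l < k"
  then obtain z where z: "t3 nu l z:ext s" using k(1) by blast
  then have "tr (t3 nu l z)" unfolding tr_def using s(1) by blast
  then show "gs (P'.cv s) l = g nu l" using g_iff[OF nu] gs[OF s(2) z] by simp
 qed
 then show ?thesis using k(2) unfolding U_def by auto
qed

text \<open>\<open>be\<close> is the code at level \<open>ga\<close> of the set \<open>A\<close>: an
  enumeration of the family of level \<open>ga\<close> by countable ordinals, possibly with
  repetitions.\<close>

definition er where "er xi ga be A <-> (EX ga':ext (suc ga). EX al':ext w1. EX n. be = et ga ga' al' n & A = EE g (ix xi ga' al') n)"

definition TB where "TB = (SOME T. T:N & (ALL i:ext XX. ALL m. NN.ap T (NN.pr (cv i) (NN.num m)) = NN.real (EE g i m)))"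

lemma TB: "TB:N" "i:ext XX ==> NN.ap TB (NN.pr (cv i) (NN.num m)) = NN.real (EE g i m)"
proof -
 have "EX T. T:N & (ALL i:ext XX. ALL m. NN.ap T (NN.pr (cv i) (NN.num m)) = NN.real (EE g i m))"
  by (rule EE_table) blast
 from someI_ex[OF this] show "TB:N" "i:ext XX ==> NN.ap TB (NN.pr (cv i) (NN.num m)) = NN.real (EE g i m)"
  unfolding TB_def by blast+
qed

lemma ix_XX: assumes "xi:ext KK" "ga:ext w2" "ga':ext (suc ga)" "al:ext w1"
 shows "ix xi ga' al:ext XX" "ix xi ga' al:M" "cv (ix xi ga' al) = NN.pr (cv xi) (NN.pr (cv ga') (cv al))"
proof -
 have g: "ga':ext w2" using ord_trans[OF ord_w(2) suc_w2[OF assms(2)] assms(3)] .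
 then show "ix xi ga' al:ext XX" using XX(2) assms(1,4) by blast
 then show "ix xi ga' al:M" using ext_M by blast
 have "xi:M" "ga':M" "al:M" using g assms ext_M by blast+
 then show "cv (ix xi ga' al) = NN.pr (cv xi) (NN.pr (cv ga') (cv al))" unfolding ix_def by (simp add: cv_pr)
qed

lemma EE_RR: "i:ext XX ==> EE g i m:NN.RR" by (rule EE_table) blast

text \<open>A relation between ground-model objects and places that is definable in the ground model
  is turned into a set of the extension by looking up the places in the table. The enumeration of a
  family and the assignment of pseudo-intersections are obtained this way.\<close>

lemma TB_set:
 assumes A: "A:M" and P: "Def (%e. P (p1 (e 0)) (p1 (p2 (e 0))) (dn (p2 (p2 (e 0)))))"
 obtains Z where "Z:N" "extN Z = {NN.pr (cv a) (NN.real (EE g i n)) | a i n. a:ext A & i:ext XX & P a i n}"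
proof -
 define H where "H = sepm (times A XO) (%z. P (p1 z) (p1 (p2 z)) (dn (p2 (p2 z))))"
 note H = sepm[OF times_M[OF A XO(1)] P, folded H_def]
 have pH: "z:ext H <-> (EX a i n. z = pr a (pr i (num n)) & a:ext A & i:ext XX & P a i n)" for z
 proof -
  have "P (p1 z) (p1 (p2 z)) (dn (p2 (p2 z))) <-> P a i n" if "z = pr a (pr i (num n))" "a:ext A" "i:ext XX" for a i n
   unfolding that(1) using ext_M[OF that(2)] ext_M[OF that(3)] by simp
  then show ?thesis unfolding H(2) ext_times[OF A XO(1)] XO(2) by blast
 qed
 have "NN.Def (%e. EX y:extN (cv H). e 0 = NN.pr (NN.p1 y) (NN.ap TB (NN.p2 y)))" by (intro def_intro TB cv_N H)
 note S = NN.sepm[OF NN.times_M[OF cv_N[OF A] NN.pw(1)[OF NN.om_M]] this]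
 define S where "S = NN.sepm (NN.times (cv A) (NN.pw NN.om)) (%z. EX y:extN (cv H). z = NN.pr (NN.p1 y) (NN.ap TB (NN.p2 y)))"
 note S = S[folded S_def]
 have v: "NN.pr (NN.p1 (cv (pr a (pr i (num n))))) (NN.ap TB (NN.p2 (cv (pr a (pr i (num n)))))) = NN.pr (cv a) (NN.real (EE g i n))"
  "NN.pr (cv a) (NN.real (EE g i n)):extN (NN.times (cv A) (NN.pw NN.om))" if h: "a:ext A" "i:ext XX" for a i n
 proof -
  show "NN.pr (NN.p1 (cv (pr a (pr i (num n))))) (NN.ap TB (NN.p2 (cv (pr a (pr i (num n)))))) = NN.pr (cv a) (NN.real (EE g i n))"
   using ext_M[OF h(1)] ext_M[OF h(2)] TB(2)[OF h(2)] by (simp add: cv_pr cv_num del: num.simps NN.num.simps)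
  have "NN.real (EE g i n):extN (NN.pw NN.om)" using NN.RR_D[OF EE_RR[OF h(2), of n]] NN.ext_om by auto
  then show "NN.pr (cv a) (NN.real (EE g i n)):extN (NN.times (cv A) (NN.pw NN.om))"
   unfolding NN.ext_times[OF cv_N[OF A] NN.pw(1)[OF NN.om_M]] ext_cv[OF A] using h by blast
 qed
 show thesis
 proof (rule that[OF S(1)], intro equalityI subsetI)
  fix z assume "z:extN S"
  then obtain y where y: "y:ext H" "z = NN.pr (NN.p1 (cv y)) (NN.ap TB (NN.p2 (cv y)))" unfolding S(2) ext_cv[OF H(1)] by blast
  then show "z:{NN.pr (cv a) (NN.real (EE g i n)) | a i n. a:ext A & i:ext XX & P a i n}"
   unfolding pH using v(1) by blast
 next
  fix z assume "z:{NN.pr (cv a) (NN.real (EE g i n)) | a i n. a:ext A & i:ext XX & P a i n}"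
  then obtain a i n where h: "a:ext A" "i:ext XX" "P a i n" "z = NN.pr (cv a) (NN.real (EE g i n))" by blast
  then have "pr a (pr i (num n)):ext H" unfolding pH by blast
  then have "EX y:cv ` ext H. z = NN.pr (NN.p1 y) (NN.ap TB (NN.p2 y))" unfolding h(4) v(1)[OF h(1,2), symmetric] by blast
  moreover have "z:extN (NN.times (cv A) (NN.pw NN.om))" unfolding h(4) by (rule v(2)[OF h(1,2)])
  ultimately show "z:extN S" unfolding S(2) ext_cv[OF H(1)] by blast
 qed
qed

lemma er_rel:
 assumes "xi:ext KK" "ga:ext w2"
 obtains Z where "Z:N" "extN Z = {NN.pr (cv be) (NN.real A) | be A. er xi ga be A}"
proof -
 have gM: "xi:M" "ga:M" "suc ga:M" using assms ext_M by auto
 define P where "P b i n <-> (EX c:ext (suc ga). EX a:ext w1. b = et ga c a n & i = ix xi c a)" for b i n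
 have "Def (%e. P (p1 (e 0)) (p1 (p2 (e 0))) (dn (p2 (p2 (e 0)))))" unfolding P_def by (intro def_intro gM)
 then obtain Z where Z: "Z:N" "extN Z = {NN.pr (cv a) (NN.real (EE g i n)) | a i n. a:ext w1 & i:ext XX & P a i n}"
  using TB_set[OF w1_M] by blast
 show thesis by (rule that[OF Z(1)]) (unfold Z(2) er_def P_def, use et_w1[OF assms(2)] ix_XX[OF assms] in blast)
qed

lemma er_RR: assumes "xi:ext KK" "ga:ext w2" "er xi ga be A" shows "be:ext w1" "A:NN.RR"
proof -
 obtain ga' al' n where h: "ga':ext (suc ga)" "al':ext w1" "be = et ga ga' al' n" "A = EE g (ix xi ga' al') n"
  using assms(3) unfolding er_def by blast
 show "be:ext w1" unfolding h(3) by (rule et_w1[OF assms(2) h(1,2)])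
 show "A:NN.RR" unfolding h(4) by (rule EE_RR[OF ix_XX(1)[OF assms(1,2) h(1,2)]])
qed

text \<open>Passing from members of \<open>D\<close> to their codes replaces a family of reals by a
  subset of a ground-model set, to which \<open>support_name\<close> applies.\<close>

lemma er_set:
 assumes "xi:ext KK" "ga:ext w2" "D:N"
 obtains Z where "Z:N" "!!be. be:ext w1 ==> cv be:extN Z <-> (EX A. er xi ga be A & NN.real A:extN D)"
proof -
 obtain R where R: "R:N" "extN R = {NN.pr (cv be) (NN.real A) | be A. er xi ga be A}" using er_rel[OF assms(1,2)] by blast
 have "NN.Def (%e. EX a:extN D. NN.pr (e 0) a:extN R)" by (intro def_intro R assms)
 note s = NN.sepm[OF cv_N[OF w1_M] this]
 show thesis
 proof (rule that[OF s(1)])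
  fix be assume b: "be:ext w1"
  have pe: "NN.pr (cv be) a = NN.pr (cv be') (NN.real A) <-> be = be' & a = NN.real A" if "er xi ga be' A" "a:extN D" for be' a A
   using NN.RR_D(1)[OF er_RR(2)[OF assms(1,2) that(1)]] ext_M[OF er_RR(1)[OF assms(1,2) that(1)]] ext_M[OF b] NN.ext_M[OF that(2)] by simp
  have "cv be:extN (cv w1)" unfolding ext_cv[OF w1_M] using b by blast
  then have "cv be:extN (NN.sepm (cv w1) (%x. EX a:extN D. NN.pr x a:extN R)) <-> (EX a:extN D. NN.pr (cv be) a:extN R)"
   unfolding s(2) by blast
  also have "... <-> (EX A. er xi ga be A & NN.real A:extN D)" unfolding R(2) mem_Collect_eq using pe by metis
  finally show "cv be:extN (NN.sepm (cv w1) (%x. EX a:extN D. NN.pr x a:extN R)) <-> (EX A. er xi ga be A & NN.real A:extN D)" .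
 qed
qed

text \<open>The function \<open>f\<close> bounds the supports of a name for the set
  of codes of members of \<open>D\<close>. Hence below a closure point \<open>al\<close> that set does not depend on the Cohen real
  with index \<open>al\<close>, which is therefore generic over it.\<close>

lemma star:
 assumes x: "xi:ext KK" "ga:ext w2" and D: "D:N"
 obtains f where "f:M" "is_fun f w1 w1"
  "!!al be A. al:ext w1 ==> (ALL be:ext al. ap f be:ext al) ==>
   (ALL be:ext al. ALL A. er xi ga be A --> infinite A -->
    (EX be':ext al. EX A'. er xi ga be' A' & NN.real A':extN D & infinite A' & finite (A' - A))) ==>
   be:ext al ==> er xi ga be A ==> infinite A ==>
   A = UE g (ix xi ga al) (io al be) & (EX be':ext al. EX A'. er xi ga be' A' & NN.real A':extN D &
    finite (pib (UE g (ix xi ga al)) (g (ix xi ga al)) (io al be) - A'))"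
proof -
 have gM: "ga:M" "xi:M" "suc ga:M" using x ext_M by auto
 obtain Z where Z: "Z:N" "!!be. be:ext w1 ==> cv be:extN Z <-> (EX A. er xi ga be A & NN.real A:extN D)"
  using er_set[OF x D] by blast
 obtain Q u where Q: "Q:M" and u: "u:M" "!!a. a:ext w1 ==> ap u a:M" "!!a. a:ext w1 ==> ext (ap u a) <= ext XX"
  "!!a. a:ext w1 ==> card_le (ap u a) om"
  and ZQ: "!!a. a:ext w1 ==> cv a:extN Z <-> (EX c:G Int ext (cp (ap u a)). pr a c:ext Q)"
  using support_name[OF Z(1) w1_M] by blast
 \<comment> \<open>Two requirements on the bound for \<open>be\<close>: the indices at level
   \<open>ga\<close> in the support of \<open>be\<close> lie below it, and so does the stage at
   which the set with code \<open>be\<close> was produced. The first keeps \<open>nu\<close> out of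
   the supports, the second makes the set available at stage \<open>al\<close>.\<close>
 define P where "P be mu <-> (ALL al:ext w1. ix xi ga al:ext (ap u be) --> al:ext mu) &
  (ALL ga':ext (suc ga). ALL al:ext w1. ALL n. be = et ga ga' al n --> al:ext mu)" for be mu
 have PD: "Def (%e. P (e 0) (e 1))" unfolding P_def by (intro def_intro gM u(1))
 have ex: "EX mu:ext w1. P be mu" if b: "be:ext w1" for be
 proof -
  have bM: "be:M" using b ext_M by blast
  have "Def (%e. ix xi ga (e 0):ext (ap u be))" by (intro def_intro gM u(1) bM)
  note s = sepm[OF w1_M this]
  have "card_le (sepm w1 (%al. ix xi ga al:ext (ap u be))) (ap u be)"
  proof (rule card_leI[of _ _ "%al. ix xi ga al"])
   show "inj_on (ix xi ga) (ext (sepm w1 (%al. ix xi ga al:ext (ap u be))))"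
    unfolding s(2) inj_on_def using ix_inj[OF x _ x] by blast
  qed (use s u(2)[OF b] in auto, intro def_intro gM)
  then have "card_le (sepm w1 (%al. ix xi ga al:ext (ap u be))) om" using card_le_trans[OF _ u(4)[OF b]] s om_M by blast
  then obtain mu1 where m1: "mu1:ext w1" "ext (sepm w1 (%al. ix xi ga al:ext (ap u be))) <= ext mu1"
   using w1_bounded[OF s(1)] unfolding s(2) by blast
  obtain a0 where a0: "a0:ext w1" "ALL ga':ext (suc ga). ALL al:ext w1. ALL n. be = et ga ga' al n --> al = a0"
  proof (cases "EX ga':ext (suc ga). EX al:ext w1. EX n. be = et ga ga' al n")
   case True
   then obtain ga' al n where h: "ga':ext (suc ga)" "al:ext w1" "be = et ga ga' al n" by blast
   have "ALL ga'':ext (suc ga). ALL al':ext w1. ALL m. be = et ga ga'' al' m --> al' = al"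
    using et_inj[OF x(2) h(1,2)] h(3) by metis
   then show ?thesis using that h(2) by blast
  next
   case False
   then show ?thesis using that[OF m1(1)] by blast
  qed
  have mM: "mu1:M" "a0:M" using m1 a0 ext_M by blast+
  have "card_le (upr mu1 a0) om" by (rule finite_le_om) (use mM in auto)
  moreover have "ext (upr mu1 a0) <= ext w1" "upr mu1 a0:M" using m1 a0 mM by auto
  ultimately obtain mu where m: "mu:ext w1" "ext (upr mu1 a0) <= ext mu" using w1_bounded by blast
  then have "mu1:ext mu" "a0:ext mu" using mM by auto
  moreover have "is_ordinal mu" using m(1) w1_iff by blast
  ultimately have "P be mu" unfolding P_def using m1(2) a0(2) ord_trans[of mu mu1] unfolding s(2) by blast
  then show ?thesis using m(1) by blast
 qed
 obtain f where f: "f:M" "is_fun f w1 w1" "!!be. be:ext w1 ==> P be (ap f be)" using choice[OF w1_M w1_M PD ex] by blast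
 show thesis
 proof (rule that[OF f(1,2)])
  fix al be A assume a: "al:ext w1" and cl: "ALL be:ext al. ap f be:ext al"
   and dn: "ALL be:ext al. ALL A. er xi ga be A --> infinite A -->
    (EX be':ext al. EX A'. er xi ga be' A' & NN.real A':extN D & infinite A' & finite (A' - A))"
   and b: "be:ext al" "er xi ga be A" "infinite A"
  define nu where "nu = ix xi ga al"
  have nu: "nu:ext XX" unfolding nu_def XX(2) using x a by blast
  have nuM: "nu:M" using nu ext_M by blast
  interpret P': cidx M E XX LL uu "XV nu" "GV nu" by (rule omit[OF nu])
  have aM: "al:M" using a ext_M by blast
  have ao: "is_ordinal al" using a w1_iff by blast
  have aw: "be:ext w1" if "be:ext al" for be using ord_trans[OF ord_w(1) a that] .
  have fa: "mu:ext al" if h: "be:ext al" "mu:ext (ap f be)" for be mu using cl h ord_trans[OF ao] by blast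
  have eU: "UE g nu (io al be) = A" if h: "be:ext al" "er xi ga be A" for be A
  proof -
   obtain ga' al' n where e: "ga':ext (suc ga)" "al':ext w1" "be = et ga ga' al' n" "A = EE g (ix xi ga' al') n"
    using h(2) unfolding er_def by blast
   have "al':ext (ap f be)" using f(3)[OF aw[OF h(1)]] e unfolding P_def by blast
   then have "al':ext al" using fa h(1) by blast
   then show ?thesis unfolding nu_def e(3,4) using UE_eval[OF x e(1) a, of al' n g] h(1) e(3) by blast
  qed
  \<comment> \<open>The numbers that stage \<open>al\<close> gives to the codes of members of
    \<open>D\<close>. This is the target into which the Cohen real has to steer the
    sequence.\<close>
  define T where "T = {y. EX be:ext al. y = io al be & cv be:extN Z}"
  have T: "T:P'.NN.RR"
  proof -
   define Q' where "Q' = sepm (times om (cp (XV nu))) (%z. EX be:ext al. dn (p1 z) = io al be & pr be (p2 z):ext Q & p2 z:ext (cp (ap u be)))"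
   have cX: "cp (XV nu):M" using cp_M XV(1)[OF nuM] by blast
   have "Def (%e. EX be:ext al. dn (p1 (e 0)) = io al be & pr be (p2 (e 0)):ext Q & p2 (e 0):ext (cp (ap u be)))"
    by (intro def_intro aM Q u(1))
   note s = sepm[OF times_M[OF om_M cX] this, folded Q'_def]
   have "{a:ext om. EX c:GV nu. pr a c:ext Q'} = num ` T"
   proof (intro equalityI subsetI)
    fix a assume "a:{a:ext om. EX c:GV nu. pr a c:ext Q'}"
    then obtain c where c: "a:ext om" "c:GV nu" "pr a c:ext Q'" by blast
    have "a:M" "c:M" using c ext_M by blast+
    then obtain be where be: "be:ext al" "dn a = io al be" "pr be c:ext Q" "c:ext (cp (ap u be))"
     using c(3) unfolding s(2) by auto
    have "cv be:extN Z" unfolding ZQ[OF aw[OF be(1)]] using be c(2) by blast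
    then have "dn a:T" unfolding T_def using be by blast
    then show "a:num ` T" using num_dn[OF c(1)] by (metis imageI)
   next
    fix a assume "a:num ` T"
    then obtain be where be: "be:ext al" "a = num (io al be)" "cv be:extN Z" unfolding T_def by blast
    have bw: "be:ext w1" using aw be by blast
    obtain c where c: "c:G" "c:ext (cp (ap u be))" "pr be c:ext Q" using be(3) unfolding ZQ[OF bw] by blast
    \<comment> \<open>If \<open>nu\<close> were in the support of a code below \<open>al\<close>,
      then \<open>al\<close> would lie below the bound for that code, which is itself below
      \<open>al\<close>.\<close>
    have "nu ~: ext (ap u be)"
    proof
     assume "nu:ext (ap u be)"
     then have "al:ext (ap f be)" using f(3)[OF bw] a unfolding P_def nu_def by blast
     then show False using fa[OF be(1)] E_irrefl[OF aM] by blast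
    qed
    then have "ext (ap u be) <= ext (XV nu)" unfolding XV(2)[OF nuM] using u(3)[OF bw] by blast
    then have cV: "c:ext (cp (XV nu))" by (rule cp_mono[OF XV(1)[OF nuM] u(2)[OF bw] _ c(2)])
    have cM: "c:M" using c ext_M by blast
    have "pr a c:ext (times om (cp (XV nu)))" unfolding ext_times[OF om_M cX] ext_om be(2) using cV by blast
    then have "pr a c:ext Q'" unfolding s(2) mem_Collect_eq be(2) using be(1) c cM by auto
    then show "a:{a:ext om. EX c:GV nu. pr a c:ext Q'}" using c(1) cV be(2) ext_om by blast
   qed
   then have "P'.NN.coded (P'.cv ` num ` T)" using P'.of_nice[OF om_M s(1)] by simp
   then show ?thesis unfolding P'.NN.RR_def image_image P'.cv_num by simp
  qed
  have Te: "y:T <-> (EX be:ext al. y = io al be & (EX A. er xi ga be A & NN.real A:extN D))" for y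
   unfolding T_def using Z(2) aw by blast
  have dn': "EX y:T. unb (UE g nu y) & asub (UE g nu y) (UE g nu x')" if x': "unb (UE g nu x')" for x'
  proof -
   \<comment> \<open>A number that codes nothing yields the empty set; an infinite set therefore
     comes from an actual code below \<open>al\<close>, to which the hypothesis on \<open>D\<close>
     applies.\<close>
   obtain v where "v:UE g nu x'" using x' unfolding unb_def by blast
   then obtain j n where "uu nu x' j n" unfolding UE_def by blast
   then obtain xi0 ga0 de al0 dea where h: "xi0:ext KK" "ga0:ext w2" "de:ext w2" "al0:ext w1" "dea:ext w1"
    "nu = ix xi0 ga0 al0" "llt de dea ga0 al0" "et ga0 de dea n:ext al0" "x' = io al0 (et ga0 de dea n)" unfolding uu_def by blast
   have e: "xi0 = xi" "ga0 = ga" "al0 = al" using ix_inj[OF x a h(1,2,4)] h(6) unfolding nu_def by auto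
   have ds: "de:ext (suc ga)" using h(7) gM unfolding e llt_def by auto
   define be0 where "be0 = et ga de dea n"
   have b0: "be0:ext al" "er xi ga be0 (EE g (ix xi de dea) n)" "x' = io al be0"
    using h ds unfolding e be0_def er_def by blast+
   have Ux: "UE g nu x' = EE g (ix xi de dea) n" using eU[OF b0(1,2)] b0(3) by simp
   obtain be' A' where b': "be':ext al" "er xi ga be' A'" "NN.real A':extN D" "infinite A'" "finite (A' - UE g nu x')"
    using dn b0(1,2) x' unfolding unb_iff Ux by blast
   have "io al be':T" unfolding Te using b' by blast
   then show ?thesis using eU[OF b'(1,2)] b'(4,5) unfolding unb_iff asub_iff by blast
  qed
  have Ub: "UE g nu (io al be) = A" by (rule eU[OF b(1,2)])
  have un: "unb (UE g nu (io al be))" unfolding Ub unb_iff by (rule b(3))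
  obtain k where k: "st (UE g nu) (g nu) (io al be) k:T" using gen_pib[OF nu T un dn'] by blast
  then obtain be' A' where b': "be':ext al" "st (UE g nu) (g nu) (io al be) k = io al be'" "er xi ga be' A'" "NN.real A':extN D"
   unfolding Te by blast
  have "finite (pib (UE g nu) (g nu) (io al be) - A')"
   using pib(3)[of "UE g nu" "io al be" "g nu" k, OF un] unfolding b'(2) eU[OF b'(1,3)] .
  then show "A = UE g (ix xi ga al) (io al be) & (EX be':ext al. EX A'. er xi ga be' A' & NN.real A':extN D &
    finite (pib (UE g (ix xi ga al)) (g (ix xi ga al)) (io al be) - A'))"
   using Ub b' unfolding nu_def by blast
 qed
qed

end

subsection \<open>Properness\<close>

context zmod begin

text \<open>The Tarski-Vaught property of an elementary submodel, stated for definable predicates: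
  an existential statement over \<open>h\<close> with parameters in \<open>x\<close> has a witness
  in \<open>x\<close>.\<close>

lemma TV:
 assumes el: "is_elementary x h" and d: "dstr M E (ext h) (ext x)"
  and P: "dstr.Def E (ext h) (ext x) (%e. P (e 0))" and y: "y:ext h" "P y"
 shows "EX y:ext x. P y"
proof -
 interpret H: dstr M E "ext h" "ext x" by (rule d)
 obtain f c where f: "range c <= ext x" "ALL e. range e <= ext h --> (P (e 0) <-> set_sat (ext h) E f (mix e c))"
  using P unfolding H.Def_def by blast
 obtain x0 where x0: "x0:ext x" using H.C0 by blast
 define e where "e = (%_::nat. x0)"
 have re: "range (e(0 := v)) <= A" if "x0:A" "v:A" for v A unfolding e_def using that by auto
 have m: "(mix e c)(0 := v) = mix (e(0 := v)) c" for v
  by (rule HOL.ext) (auto simp: mix_def e_def)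
 have xh: "ext x <= ext h" by (rule H.CS)
 have E: "set_sat (ext x) E F k <-> set_sat (ext h) E F k" if "range k <= ext x" for F k
  using el that unfolding is_elementary_def by blast
 let ?F = "Neg_fm (Forall_fm 0 (Neg_fm f))"
 have "set_sat (ext h) E f (mix (e(0 := y)) c)" using f(2)[rule_format, OF re[of "ext h" y]] x0 xh y by auto
 then have "set_sat (ext h) E ?F (mix e c)" using y(1) m by auto
 moreover have "range (mix e c) <= ext x" by (rule mix_range) (use f(1) x0 in \<open>auto simp: e_def\<close>)
 ultimately have "set_sat (ext x) E ?F (mix e c)" using E by blast
 then obtain v where v: "v:ext x" "set_sat (ext x) E f (mix (e(0 := v)) c)" using m by auto
 have "range (mix (e(0 := v)) c) <= ext x" by (rule mix_range[OF re[OF x0 v(1)] f(1)])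
 then have "set_sat (ext h) E f (mix (e(0 := v)) c)" using E v(2) by blast
 then have "P v" using f(2)[rule_format, OF re[of "ext h" v]] x0 xh v(1) by auto
 then show ?thesis using v(1) by blast
qed

text \<open>Adds unordered pairs and preserves transitivity and size. Two applications yield ordered
  pairs and four yield triples, which bounds the hereditary size of relations and places them in
  \<open>H\<close>.\<close>

definition pcl where "pcl T = cup T (sepm (pw T) (%z. EX a:ext T. EX b:ext T. z = upr a b))"

lemma pcl: assumes "T:M"
 shows "pcl T:M" "ext T <= ext (pcl T)" "a:ext T ==> b:ext T ==> upr a b:ext (pcl T)"
  "is_transitive T ==> is_transitive (pcl T)"
  "is_ordinal w ==> card_le T w ==> card_le (times w w) w ==> card_le om w ==> ext T ~= {} ==> card_le (pcl T) w"
proof -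
 have d: "Def (%e. EX a:ext T. EX b:ext T. e 0 = upr a b)" by (intro def_intro assms)
 note s = sepm[OF pw(1)[OF assms] d]
 show c: "pcl T:M" unfolding pcl_def using s assms by simp
 have e: "ext (pcl T) = ext T Un {upr a b | a b. a:ext T & b:ext T}"
 proof -
  have "upr a b:ext (pw T)" if "a:ext T" "b:ext T" for a b using that ext_M assms by simp
  then show ?thesis unfolding pcl_def cup(2)[OF assms s(1)] s(2) by blast
 qed
 show "ext T <= ext (pcl T)" unfolding e by blast
 show "upr a b:ext (pcl T)" if "a:ext T" "b:ext T" unfolding e using that by blast
 show "is_transitive (pcl T)" if t: "is_transitive T" unfolding is_transitive_def
 proof (intro conjI ballI c)
  fix y assume "y:ext (pcl T)"
  then consider "y:ext T" | a b where "y = upr a b" "a:ext T" "b:ext T" unfolding e by blast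
  then show "ext y <= ext (pcl T)"
  proof cases
   case 1 then show ?thesis using t unfolding is_transitive_def e by blast
  next
   case 2
   have "a:M" "b:M" using 2 ext_M by blast+
   then show ?thesis using 2 unfolding e by simp
  qed
 qed
 assume w: "is_ordinal w" "card_le T w" "card_le (times w w) w" "card_le om w" "ext T ~= {}"
 have wM: "w:M" using w ordM by blast
 have n2: "num 2:M" "card_le (num 2) om" by (simp, rule finite_le_om) (simp_all only: num_M ext_num finite_imageI finite_lessThan)
 note TT = times_M[OF assms assms] times_M[OF wM wM]
 have 1: "card_le (times T T) w" by (rule card_le_trans[OF card_le_times[OF w(2,2) assms assms wM wM] w(3) TT(1) wM])
 have 2: "card_le (num 2) w" by (rule card_le_trans[OF n2(2) w(4) n2(1) wM])
 have 3: "card_le (times (times T T) (num 2)) w"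
  by (rule card_le_trans[OF card_le_times[OF 1 2 TT(1) n2(1) wM wM] w(3) times_M[OF TT(1) n2(1)] wM])
 show "card_le (pcl T) w"
 proof (rule surj_card[OF 3 w(1) times_M[OF TT(1) n2(1)] c])
  show "DefF (%e. if p2 (e 0) = num 0 then p1 (p1 (e 0)) else upr (p1 (p1 (e 0))) (p2 (p1 (e 0))))" by (intro def_intro)
  obtain t0 where t0: "t0:ext T" using w(5) by blast
  show "ext (pcl T) <= (%z. if p2 z = num 0 then p1 (p1 z) else upr (p1 (p1 z)) (p2 (p1 z))) ` ext (times (times T T) (num 2))"
  proof
   fix y assume y: "y:ext (pcl T)"
   have el: "pr (pr a b) (num k):ext (times (times T T) (num 2))" if "a:ext T" "b:ext T" "k < 2" for a b k
    unfolding ext_times[OF TT(1) n2(1)] ext_times[OF assms assms] using that num_mem_num by blast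
   consider "y:ext T" | a b where "y = upr a b" "a:ext T" "b:ext T" using y unfolding e by blast
   then show "y:(%z. if p2 z = num 0 then p1 (p1 z) else upr (p1 (p1 z)) (p2 (p1 z))) ` ext (times (times T T) (num 2))"
   proof cases
    case 1
    show ?thesis by (rule image_eqI[OF _ el[OF 1 t0, of 0]]) (use 1 t0 ext_M in \<open>simp_all del: num.simps\<close>)
   next
    case 2
    show ?thesis by (rule image_eqI[OF _ el[OF 2(2,3), of 1]]) (use 2 ext_M in \<open>simp_all del: num.simps\<close>)
   qed
  qed
 qed
qed

lemma card_less_sub: assumes "t:M" "u:M" "l:M" "card_le t u" "card_less u l" shows "card_less t l"
proof -
 have ul: "card_le u l" "~card_eq u l" using assms(5) unfolding card_less_def by auto
 have "~card_eq t l"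
 proof
  assume "card_eq t l"
  then have "card_le l t" using card_eq_le card_eq_sym assms(1,3) by blast
  then have "card_le l u" using card_le_trans assms by blast
  then show False using cantor_bernstein ul assms(2,3) by blast
 qed
 then show ?thesis unfolding card_less_def using card_le_trans[OF assms(4) ul(1)] assms by blast
qed

text \<open>Any transitive superset of size below \<open>l\<close> suffices, because the transitive
  closure can be separated from it.\<close>

lemma in_H: assumes h: "is_H h l" "l:M" and y: "y:M" "is_transitive T" "ext y <= ext T" "card_less T l" shows "y:ext h"
proof -
 have TM: "T:M" using y unfolding is_transitive_def by blast
 define Q where "Q v <-> (ALL u:M. (ALL a:ext u. ext a <= ext u) --> ext y <= ext u --> v:ext u)" for v
 have "Def (%e. Q (e 0))" unfolding Q_def by (intro def_intro y(1))
 note t = sepm[OF TM this]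
 have "is_trcl (sepm T Q) y" unfolding is_trcl_def is_transitive_def
 proof (intro conjI allI impI ballI t(1))
  show "ext y <= ext (sepm T Q)" unfolding t(2) Q_def using y(3) by blast
  fix v assume "v:ext (sepm T Q)"
  then show "ext v <= ext (sepm T Q)" unfolding t(2) Q_def using y(2) unfolding is_transitive_def by blast
 next
  fix u assume "(u:M & (ALL y:ext u. ext y <= ext u)) & ext y <= ext u"
  then show "ext (sepm T Q) <= ext u" unfolding t(2) Q_def by blast
 qed
 moreover have "card_le (sepm T Q) T" by (rule card_le_sub[OF t(1) TM]) (use t(2) in blast)
 then have "card_less (sepm T Q) l" using card_less_sub[OF t(1) TM h(2) _ y(4)] by blast
 ultimately show ?thesis using h(1) y(1) unfolding is_H_def by blast
qed

lemma H_trans: assumes h: "is_H h l" "l:M" "y:ext h" shows "ext y <= ext h"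
proof
 fix v assume v: "v:ext y"
 obtain t where t: "is_trcl t y" "card_less t l" using h(1,3) unfolding is_H_def by blast
 have "is_transitive t" "ext y <= ext t" using t(1) unfolding is_trcl_def by auto
 then show "v:ext h" using in_H[OF h(1,2) _ _ _ t(2), of v] v ext_M unfolding is_transitive_def by blast
qed

end

context dstr begin

lemma Def_shape [def_intro]:
 "DefF s ==> Def (%e. is_transitive (s e))" "DefF s ==> Def (%e. ext (s e) = {})"
 "DefF s ==> DefF t ==> Def (%e. ext (s e) = insert (t e) (ext (t e)))"
proof -
 show "Def (%e. is_transitive (s e))" if "DefF s"
 proof (rule Def_R1[OF _ that])
  have "Def (%e. ALL y:ext (e 0). ext y <= ext (e 0))" by (intro def_intro)
  then show "Def (%e. is_transitive (e 0))" by (rule Def_cong) (use SM in \<open>auto simp: is_transitive_def\<close>)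
 qed
 show "Def (%e. ext (s e) = {})" if "DefF s"
 proof (rule Def_R1[OF _ that])
  have "Def (%e. ALL y:ext (e 0). False)" by (intro def_intro)
  then show "Def (%e. ext (e 0) = {})" by (rule Def_cong) blast
 qed
 show "Def (%e. ext (s e) = insert (t e) (ext (t e)))" if "DefF s" "DefF t"
 proof (rule Def_R2[OF _ that])
  have "Def (%e. e 1:ext (e 0) & ext (e 1) <= ext (e 0) & (ALL y:ext (e 0). y = e 1 \<or> y:ext (e 1)))" by (intro def_intro)
  then show "Def (%e. ext (e 0) = insert (e 1) (ext (e 1)))" by (rule Def_cong) blast
 qed
qed

end

context set_structure begin

text \<open>\<open>D\<close> is dense in the part of the poset that has codes in \<open>a\<close>.
  This is what elementarity guarantees for the trace of a submodel that contains
  \<open>D\<close>.\<close>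

definition reach where "reach p r s D a <-> (ALL b:ext a. ALL A:ext p. (b, A):rel s -->
 (EX b':ext a. EX A':ext D. (b', A'):rel s & (A', A):rel r))"

text \<open>A triple in \<open>B\<close>, expressed with bounded quantifiers only, so that it is
  definable over \<open>H\<close> as well as over \<open>M\<close>.\<close>

definition tern where "tern B a b c <-> (EX z:ext B. EX y:ext z. EX u:ext y. opair u a b & opair z u c)"

text \<open>The second clause speaks of every condition that \<open>B\<close> attaches to
  \<open>a\<close> and \<open>b\<close>. A condition picked for one dense set thus serves all dense
  sets of the submodel simultaneously.\<close>

definition hit where "hit p r s B D a <-> (ALL b:ext a. ALL A:ext p. (b, A):rel s --> (EX q:ext p. tern B a b q) &
 (ALL q:ext p. tern B a b q --> (q, A):rel r & (EX b':ext a. EX A':ext D. (b', A'):rel s & (q, A'):rel r)))"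

definition inj_rel where "inj_rel j a w <-> (ALL v:ext a. EX n:ext w. (v, n):rel j) &
 (ALL v:ext a. ALL v':ext a. ALL n:ext w. (v, n):rel j --> (v', n):rel j --> v = v')"

definition closes where "closes p r w s B D f <-> (ALL b:ext w. EX c:ext w. (b, c):rel f) &
 (ALL a:ext w. (ALL b:ext a. EX c:ext a. (b, c):rel f) --> reach p r s D a --> hit p r s B D a)"

end

context zmod begin

text \<open>The submodel \<open>x\<close> need not contain \<open>w\<close>, \<open>s\<close> and \<open>B\<close>, but by elementarity it contains substitutes with
  the properties collected in \<open>Q\<close>. Their trace \<open>d\<close> on \<open>x\<close> is closed under the functions for all dense sets in
  \<open>x\<close>, so that a condition that \<open>B\<close> assigns to \<open>d\<close> is generic.\<close>

lemma proper_criterion: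
 assumes m: "is_mod_Fin F p r" "!!A. A:ext p ==> ext A <= ext om"
  and w: "is_ordinal w" "om:ext w" "~card_le w om" "!!a. a:ext w ==> card_le a om" "card_le (times w w) w" "card_le w p"
  and s: "s:M" "ext s <= ext (times w p)" "!!A. A:ext p ==> EX b:ext w. pr b A:ext s"
   "!!b A A'. b:M ==> A:ext p ==> A':ext p ==> pr b A:ext s ==> pr b A':ext s ==> A = A'"
  and B: "B:M" "ext B <= ext (times (times w w) p)"
  and st: "!!D. D:M ==> ext D <= ext p ==> (ALL x:ext p. EX y:ext D. (y, x):rel r) ==>
   EX f:M. is_fun f w w & (ALL a:ext w. (ALL b:ext a. ap f b:ext a) --> reach p r s D a --> hit p r s B D a)"
 shows "is_proper p r"
 unfolding is_proper_def
proof (intro conjI allI impI ballI)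
 have r: "p:M" "is_rel r p p" "!!x y. (x, y):rel r <-> x:ext p & y:ext p & finite (ext x - ext y)"
  using m(1) unfolding is_mod_Fin_def by auto
 have rM: "r:M" using r(2) unfolding is_rel_def by blast
 have rt: "(x, z):rel r" if "(x, y):rel r" "(y, z):rel r" for x y z
 proof -
  have "ext x - ext z <= (ext x - ext y) Un (ext y - ext z)" by blast
  then show ?thesis using that unfolding r(3) by (meson finite_UnI finite_subset)
 qed
 show pre: "is_preorder p r" unfolding is_preorder_def
 proof (intro conjI r(1,2))
  show "refl_on (ext p) (rel r)" unfolding refl_on_def using r(3) by auto
  show "trans (rel r)" by (rule transI) (rule rt)
 qed
 fix l h z pw' x c
 assume H: "is_regular_uncountable l & is_Pow pw' p & card_less pw' l & is_H h l &
    opair z p r & z:ext h & is_elementary x h & is_countable x & z:ext x" and c: "c:ext p Int ext x"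
 have lM: "l:M" using H ordM unfolding is_regular_uncountable_def is_cardinal_def by blast
 have hH: "is_H h l" and el: "is_elementary x h" and zx: "z:ext x" "opair z p r" "z:ext h" using H by auto
 have xM: "x:M" and xh: "ext x <= ext h" using el unfolding is_elementary_def by auto
 have xc: "card_le x om" using H is_countable_iff by blast
 note Ht = H_trans[OF hH lM]
 interpret H: dstr M E "ext h" "ext x" by unfold_locales (use ext_M xh zx Ht in blast)+
 note tv = TV[OF el H.dstr_axioms]
 have wM: "w:M" using ordM w by blast
 have om_w: "ext om <= ext w" using ord_trans[OF w(1,2)] by blast
 have low: "card_le om w" by (rule card_le_sub) (use wM om_w in auto)
 have sp: "ap s b = A" if "A:ext p" "pr b A:ext s" "b:M" for b A
 proof (rule ap_eq[OF s(1) that(3) ext_M[OF that(1)] that(2)])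
  fix y assume y: "y:M" "pr b y:ext s"
  then obtain b' A' where "b':ext w" "A':ext p" "pr b y = pr b' A'" using s(2) unfolding ext_times[OF wM r(1)] by blast
  then have "y:ext p" using y that(3) ext_M[of b' w] ext_M[of A' p] by simp
  then show "y = A" using s(4)[OF that(3)] that y by blast
 qed
 \<comment> \<open>Transitive, because conditions are subsets of omega, and of size at most
   \<open>w\<close> through the enumeration \<open>s\<close>. Its closures under pairing contain all
   elements of \<open>s\<close>, of \<open>B\<close> and of the closure functions.\<close>
 define T where "T = cup w p"
 have T: "T:M" "ext T = ext w Un ext p" unfolding T_def using wM r(1) by auto
 have "card_le T w"
 proof (rule surj_card[OF _ w(1) times_M[OF wM wM] T(1)])
  show "card_le (times w w) w" by (rule w)
  show "DefF (%e. if p1 (e 0) = num 0 then p2 (e 0) else ap s (p2 (e 0)))" by (intro def_intro s)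
  have n: "num 0:ext w" "num 1:ext w" using om_w ext_om by blast+
  show "ext T <= (%z. if p1 z = num 0 then p2 z else ap s (p2 z)) ` ext (times w w)"
  proof
   fix y assume "y:ext T"
   then consider "y:ext w" | "y:ext p" unfolding T by blast
   then show "y:(%z. if p1 z = num 0 then p2 z else ap s (p2 z)) ` ext (times w w)"
   proof cases
    case 1
    have "pr (num 0) y:ext (times w w)" unfolding ext_times[OF wM wM] using n 1 by blast
    then show ?thesis by (rule rev_image_eqI) (use ext_M[OF 1] in \<open>simp del: num.simps\<close>)
   next
    case 2
    then obtain b where b: "b:ext w" "pr b y:ext s" using s(3) by blast
    have "pr (num 1) b:ext (times w w)" unfolding ext_times[OF wM wM] using n b by blast
    moreover have "p1 (pr (num 1) b) \<noteq> num 0" "p2 (pr (num 1) b) = b" using ext_M[OF b(1)] by (simp_all del: num.simps)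
    ultimately show ?thesis using sp[OF 2 b(2) ext_M[OF b(1)]] by (intro rev_image_eqI[of "pr (num 1) b"]) simp_all
   qed
  qed
 qed
 moreover have "is_transitive T" unfolding is_transitive_def T(2) using T(1) ord_trans[OF w(1)] m(2) om_w by blast
 moreover have "ext T ~= {}" unfolding T(2) using w(2) by blast
 ultimately have Tn: "is_transitive T & card_le T w & ext T ~= {} & T:M" using T(1) by blast
 have pc: "is_transitive (pcl T) & card_le (pcl T) w & ext (pcl T) ~= {} & pcl T:M"
  if "is_transitive T & card_le T w & ext T ~= {} & T:M" for T
  using that pcl(1-4)[of T] pcl(5)[OF _ w(1) _ w(5) low] by blast
 define T2 where "T2 = pcl (pcl T)"
 define T4 where "T4 = pcl (pcl T2)"
 have T4: "is_transitive T4" "card_le T4 w" "T4:M" and T2: "T2:M" "pcl T:M" "pcl T2:M"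
  unfolding T4_def T2_def using pc Tn by blast+
 have prT: "pr a b:ext (pcl (pcl S))" if "S:M" "a:ext S" "b:ext S" for S a b
  unfolding pr_def using pcl(3)[OF pcl(1)] pcl(3) that by blast
 have TT: "ext T <= ext T2" "ext T2 <= ext T4" unfolding T4_def T2_def using pcl(1,2) T(1) T2 by blast+
 have pp: "card_le p pw'"
 proof (rule card_leI[of _ _ "%x. upr x x"])
  show "inj_on (%x. upr x x) (ext p)" by (rule inj_onI) (use upr_eq_iff ext_M in \<open>metis singleton_inject insert_absorb2\<close>)
 qed (use H r(1) ext_M in \<open>auto simp: is_Pow_def intro!: def_intro\<close>)
 \<comment> \<open>\<open>w\<close> embeds into \<open>p\<close>, and \<open>p\<close> embeds into
   its power set by singletons, which is smaller than \<open>l\<close>.\<close>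
 have "card_less w l" using card_less_sub[OF wM _ lM _] card_le_trans[OF w(6) pp wM] H unfolding is_Pow_def by blast
 then have "card_less T4 l" using card_less_sub[OF T4(3) wM lM T4(2)] by blast
 then have hh: "y:ext h" if "y:M" "ext y <= ext T4" for y using in_H[OF hH lM that(1) T4(1) that(2)] by blast
 have fh: "f:ext h" if fn: "is_fun f a b" "ext a <= ext T" "ext b <= ext T" for f a b
 proof (rule hh[OF is_fun_M[OF fn(1)]], rule subsetI)
  fix z assume "z:ext f"
  then obtain y where y: "y:ext a" "z = pr y (ap f y)" using is_fun_mem[OF fn(1)] by blast
  then have "z:ext T2" using prT[OF T(1)] is_funD(1)[OF fn(1) y(1)] fn(2,3) unfolding T2_def by blast
  then show "z:ext T4" using TT by blast
 qed
 have sh: "s:ext h"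
 proof (rule hh[OF s(1)])
  have "ext (times w p) <= ext T2" unfolding ext_times[OF wM r(1)] T2_def using prT[OF T(1)] T(2) by blast
  then show "ext s <= ext T4" using s(2) TT by blast
 qed
 have Bh: "B:ext h"
 proof (rule hh[OF B(1)])
  have "ext (times w w) <= ext T2" unfolding ext_times[OF wM wM] T2_def using prT[OF T(1)] T(2) by blast
  then have "ext (times (times w w) p) <= ext T4" unfolding ext_times[OF times_M[OF wM wM] r(1)] T4_def
   using prT[OF T2(1)] T(2) TT(1) by blast
  then show "ext B <= ext T4" using B(2) by blast
 qed
 have wh: "w:ext h" by (rule hh[OF wM]) (use T(2) TT in blast)
 have omh: "om:ext h" using Ht[OF wh] w(2) by blast
 have zz: "z = pr p r" using zx(2) unfolding opair_iff by blast
 have "upr p r:ext h" using Ht[OF zx(3)] ext_pr[OF r(1) rM] unfolding zz by blast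
 then have prh: "p:ext h" "r:ext h" using Ht[of "upr p r"] r(1) rM by auto
 have prx: "p:ext x" "r:ext x"
 proof -
  have "H.Def (%e. EX v:ext h. opair z (e 0) v)" by (intro def_intro zx)
  from tv[OF this prh(1)] show "p:ext x" using zx(2) prh opair_inject by blast
  have "H.Def (%e. EX v:ext h. opair z v (e 0))" by (intro def_intro zx)
  from tv[OF this prh(2)] show "r:ext x" using zx(2) prh opair_inject by blast
 qed
 \<comment> \<open>Everything about \<open>w\<close>, \<open>s\<close> and \<open>B\<close> that the
   argument uses, with quantifiers restricted to \<open>h\<close> so that it is definable there from
   \<open>p\<close> and \<open>r\<close>. The variable \<open>u\<close> stands for omega, which has
   to be found in \<open>x\<close> too.\<close>
 define Q where "Q u w s B <-> is_omega u & is_ordinal w & u:ext w & (ALL A:ext p. EX b:ext w. (b, A):rel s) &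
  (ALL b:ext w. ALL A:ext p. ALL A':ext p. (b, A):rel s --> (b, A'):rel s --> A = A') &
  (ALL a:ext w. EX j:ext h. inj_rel j a u) &
  (ALL D:ext h. ext D <= ext p --> (ALL x:ext p. EX y:ext D. (y, x):rel r) --> (EX f:ext h. closes p r w s B D f))" for u w s B
 have fr: "(b, y):rel f <-> y = ap f b" if "is_fun f a d" "b:ext a" for f a b d y
  using is_funD[OF that] ext_M unfolding rel_iff by (metis that(2))
 have Q0: "Q om w s B" unfolding Q_def
 proof (intro conjI ballI impI w)
  show "is_omega om" using is_omega_iff by blast
  show "EX b:ext w. (b, A):rel s" if "A:ext p" for A using s(3)[OF that] ext_M that unfolding rel_iff by blast
  show "A = A'" if "A:ext p" "A':ext p" "(b, A):rel s" "(b, A'):rel s" for b A A' using s(4) that unfolding rel_iff by blast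
  show "EX j:ext h. inj_rel j a om" if a: "a:ext w" for a
  proof -
   obtain j where j: "is_fun j a om" "inj_on (ap j) (ext a)" using card_leE[OF w(4)[OF a]] by blast
   have "ext a <= ext T" "ext om <= ext T" using T(2) ord_trans[OF w(1) a] om_w by blast+
   then have "j:ext h" using fh[OF j(1)] by blast
   moreover have "inj_rel j a om" unfolding inj_rel_def
   proof (intro conjI ballI impI)
    show "EX n:ext om. (v, n):rel j" if "v:ext a" for v using fr[OF j(1) that] is_funD(1)[OF j(1) that] by blast
    show "v = v'" if "v:ext a" "v':ext a" "(v, n):rel j" "(v', n):rel j" for v v' n
     using inj_onD[OF j(2) _ that(1,2)] fr[OF j(1)] that by metis
   qed
   ultimately show ?thesis by blast
  qed
  fix D assume D: "D:ext h" "ext D <= ext p" "ALL x:ext p. EX y:ext D. (y, x):rel r"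
  obtain f where f: "is_fun f w w" "ALL a:ext w. (ALL b:ext a. ap f b:ext a) --> reach p r s D a --> hit p r s B D a"
   using st[OF ext_M[OF D(1)] D(2,3)] by blast
  have "closes p r w s B D f" unfolding closes_def
  proof (intro conjI ballI impI)
   show "EX c:ext w. (b, c):rel f" if "b:ext w" for b using fr[OF f(1) that] is_funD(1)[OF f(1) that] by blast
   fix a assume a: "a:ext w" "ALL b:ext a. EX c:ext a. (b, c):rel f" "reach p r s D a"
   have "ap f b:ext a" if b: "b:ext a" for b using a(2) b by (metis fr[OF f(1) ord_trans[OF w(1) a(1) b]])
   then show "hit p r s B D a" using f(2) a by blast
  qed
  moreover have "f:ext h" by (rule fh[OF f(1)]) (use T(2) in blast)+
  ultimately show "EX f:ext h. closes p r w s B D f" by blast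
 qed
 note QD = Q_def closes_def hit_def tern_def reach_def inj_rel_def is_omega_def is_limit_def is_ordinal_def
 \<comment> \<open>The witnesses are moved into \<open>x\<close> one at a time, the remaining ones
   staying existentially quantified, since each must be chosen relative to those already
   found.\<close>
 have "H.Def (%e. EX w:ext h. EX s:ext h. EX B:ext h. Q (e 0) w s B)" unfolding QD by (intro def_intro prx)
 from tv[OF this omh] Q0 wh sh Bh obtain u where u: "u:ext x" "EX w:ext h. EX s:ext h. EX B:ext h. Q u w s B" by blast
 have "H.Def (%e. EX s:ext h. EX B:ext h. Q u (e 0) s B)" unfolding QD by (intro def_intro prx u)
 from tv[OF this] u(2) obtain w' where w': "w':ext x" "EX s:ext h. EX B:ext h. Q u w' s B" by blast
 have "H.Def (%e. EX B:ext h. Q u w' (e 0) B)" unfolding QD by (intro def_intro prx u w')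
 from tv[OF this] w'(2) obtain s' where s': "s':ext x" "EX B:ext h. Q u w' s' B" by blast
 have "H.Def (%e. Q u w' s' (e 0))" unfolding QD by (intro def_intro prx u w' s')
 from tv[OF this] s'(2) obtain B' where B': "B':ext x" "Q u w' s' B'" by blast
 have uo: "u = om" using B'(2) is_omega_iff unfolding Q_def by blast
 note omx = u(1)[unfolded uo]
 have Q: "is_ordinal w'" "!!A. A:ext p ==> EX b:ext w'. (b, A):rel s'"
  "!!b A A'. b:ext w' ==> A:ext p ==> A':ext p ==> (b, A):rel s' ==> (b, A'):rel s' ==> A = A'"
  "!!a. a:ext w' ==> EX j:ext h. inj_rel j a om"
  "!!D. D:ext h ==> ext D <= ext p ==> (ALL x:ext p. EX y:ext D. (y, x):rel r) ==> EX f:ext h. closes p r w' s' B' D f"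
  using B'(2) unfolding Q_def uo by blast+
 have numx: "num n:ext x" for n
 proof (induction n)
  case 0
  have "H.Def (%e. ext (e 0) = {})" by (intro def_intro)
  from tv[OF this, of emp] obtain y where "y:ext x" "ext y = {}" using Ht[OF omh] ext_om num.simps(1) by (metis emp(2) rangeI subsetD)
  then show ?case using emp_iff[OF ext_M[of y]] by simp
 next
  case (Suc n)
  have "H.Def (%e. ext (e 0) = insert (num n) (ext (num n)))" by (intro def_intro Suc)
  note t = tv[OF this, of "num (Suc n)"]
  have "num (Suc n):ext h" using Ht[OF omh] ext_om by blast
  moreover have "ext (num (Suc n)) = insert (num n) (ext (num n))" by simp
  ultimately obtain y where "y:ext x" "ext y = insert (num n) (ext (num n))" using t by blast
  then show ?case using ext_eqI[of y "num (Suc n)"] ext_M[of y x] by simp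
 qed
 \<comment> \<open>A countable element of a countable elementary submodel is a subset of it: each of
   its members is definable from an injection into omega in \<open>x\<close> and a number.\<close>
 have sub: "ext a <= ext x" if a: "a:ext x" "a:ext w'" for a
 proof
  fix v assume v: "v:ext a"
  have "H.Def (%e. inj_rel (e 0) a om)" unfolding inj_rel_def by (intro def_intro a omx)
  from tv[OF this] Q(4)[OF a(2)] obtain j where j: "j:ext x" "inj_rel j a om" by blast
  obtain k where k: "(v, num k):rel j" using j(2) v unfolding inj_rel_def ext_om by blast
  have "H.Def (%e. e 0:ext a & (e 0, num k):rel j)" by (intro def_intro a j numx)
  from tv[OF this, of v] obtain y where y: "y:ext x" "y:ext a" "(y, num k):rel j" using v k Ht[of a] xh a(1) by blast
  have "num k:ext om" unfolding ext_om by blast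
  then have "y = v" using j(2) y v k unfolding inj_rel_def by blast
  then show "v:ext x" using y by blast
 qed
 have sx: "A:ext x" if h: "b:ext x" "b:ext w'" "A:ext p" "(b, A):rel s'" for b A
 proof -
  have "H.Def (%e. e 0:ext p & (b, e 0):rel s')" by (intro def_intro prx h s')
  from tv[OF this, of A] obtain y where "y:ext x" "y:ext p" "(b, y):rel s'" using h Ht[OF prh(1)] by blast
  then show ?thesis using Q(3) h by blast
 qed
 have bx: "EX b:ext x. b:ext w' & (b, A):rel s'" if "A:ext p" "A:ext x" for A
 proof -
  have "H.Def (%e. e 0:ext w' & (e 0, A):rel s')" by (intro def_intro that s' w')
  from tv[OF this] show ?thesis using Q(2)[OF that(1)] Ht w'(1) xh by blast
 qed
 have w'M: "w':M" using w' ext_M by blast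
 define d where "d = sepm w' (%v. v:ext x)"
 have "Def (%e. e 0:ext x)" by (intro def_intro xM)
 from sepm[OF w'M this] have d: "d:M" "ext d = ext w' Int ext x" unfolding d_def by auto
 have "is_ordinal d"
 proof (rule is_ordinalI[OF d(1)])
  fix y assume "y:ext d"
  then have y: "y:ext w'" "y:ext x" using d(2) by auto
  show "is_ordinal y" by (rule ord_elem[OF Q(1) y(1)])
  show "ext y <= ext d" using sub[OF y(2,1)] ord_trans[OF Q(1) y(1)] d(2) by blast
 qed
 \<comment> \<open>Otherwise every condition has its code in \<open>x\<close> and so lies in
   \<open>x\<close>, which makes the poset countable although the uncountable \<open>w\<close>
   embeds into it.\<close>
 moreover have "d ~= w'"
 proof
  assume "d = w'"
  then have "ext p <= ext x" using d(2) Q(2) sx by blast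
  then have "card_le p om" using card_le_trans[OF card_le_sub xc] r(1) xM by auto
  then show False using card_le_trans[OF w(6)] w(3) wM by auto
 qed
 moreover have "w' ~: ext d" using d(2) E_irrefl[OF w'M] by blast
 ultimately have dw: "d:ext w'" using ord_linear[OF _ Q(1)] by blast
 have key: "hit p r s' B' D d" if D: "D:ext x" "ext D <= ext p" "ALL x:ext p. EX y:ext D. (y, x):rel r" for D
 proof -
  have "H.Def (%e. closes p r w' s' B' D (e 0))" unfolding QD by (intro def_intro prx s' w' B' D)
  from tv[OF this] obtain f where f: "f:ext x" "closes p r w' s' B' D f" using Q(5)[OF _ D(2,3)] D(1) xh by blast
  note f' = conjunct1[OF f(2)[unfolded closes_def]] conjunct2[OF f(2)[unfolded closes_def]]
  have "EX c:ext d. (b, c):rel f" if b: "b:ext d" for b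
  proof -
   have "H.Def (%e. e 0:ext w' & (b, e 0):rel f)" by (intro def_intro f w') (use b d(2) in blast)
   note t = tv[OF this]
   obtain c where c: "c:ext w'" "(b, c):rel f" using f'(1) b d(2) by blast
   then have "c:ext h" using Ht w'(1) xh by blast
   then show ?thesis using t c d(2) by blast
  qed
  moreover have "reach p r s' D d" unfolding reach_def
  proof (intro ballI impI)
   fix b A assume b: "b:ext d" "A:ext p" "(b, A):rel s'"
   have A: "A:ext x" using sx b d(2) by blast
   have "H.Def (%e. e 0:ext D & (e 0, A):rel r)" by (intro def_intro D prx A)
   note t = tv[OF this]
   obtain C where C: "C:ext D" "(C, A):rel r" using D(3) b(2) by blast
   then have "C:ext h" using Ht D(1) xh by blast
   then obtain A' where A': "A':ext x" "A':ext D" "(A', A):rel r" using t C by blast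
   then show "EX b':ext d. EX A':ext D. (b', A'):rel s' & (A', A):rel r" using bx[of A'] D(2) d(2) by blast
  qed
  ultimately show ?thesis using f'(2)[rule_format, OF dw] by blast
 qed
 obtain b where b: "b:ext d" "(b, c):rel s'" using bx c d(2) by blast
 have "(x, x):rel r" if "x:ext p" for x using r(3) that by simp
 then have pd: "ALL x:ext p. EX y:ext p. (y, x):rel r" by blast
 \<comment> \<open>The whole poset is a dense set in \<open>x\<close>; applied to it,
   \<open>key\<close> yields the existence of a condition assigned to \<open>d\<close> and
   \<open>b\<close>. The other dense sets are then met by this same condition.\<close>
 then obtain q where q: "q:ext p" "tern B' d b q" using key[OF prx(1) subset_refl pd] b c unfolding hit_def by blast
 have kq: "(q, c):rel r & (EX b':ext d. EX A':ext D. (b', A'):rel s' & (q, A'):rel r)"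
  if "D:ext x" "ext D <= ext p" "ALL x:ext p. EX y:ext D. (y, x):rel r" for D
  using key[OF that] b c q unfolding hit_def by blast
 have "is_generic_condition p r x q" unfolding is_generic_condition_def
 proof (intro conjI ballI impI q(1))
  fix D y assume D: "D:ext x" "is_dense p r D" and y: "y:ext p" "(y, q):rel r"
  then obtain b' A' where A': "b':ext d" "A':ext D" "(b', A'):rel s'" "(q, A'):rel r" using kq unfolding is_dense_def by meson
  then have "A':ext x" using sx d(2) r(3) by blast
  moreover have "compatible p r A' y" unfolding compatible_def using rt[OF y(2) A'(4)] y(1) r(3) by auto
  ultimately show "EX c:ext D Int ext x. compatible p r c y" using A'(2) by blast
 qed
 then show "EX q. (q, c):rel r & is_generic_condition p r x q"
  using kq[OF prx(1) subset_refl pd] by blast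
qed

end

context zmod begin

lemma mod_Fin_ex: assumes "F:M" shows "EX p r. is_mod_Fin F p r"
proof -
 have "Def (%e. ~finite (ext (e 0)))" by (intro def_intro)
 note p = sepm[OF assms this]
 define p where "p = sepm F (%x. infinite (ext x))"
 have p: "p:M" "ext p = {x:ext F. infinite (ext x)}" unfolding p_def by (rule p)+
 have e: "ext (sepm a (%v. v ~: ext b)) = ext a - ext b" if "a:M" "b:M" for a b
 proof -
  have "Def (%e. e 0 ~: ext b)" by (intro def_intro that)
  from sepm(2)[OF that(1) this] show ?thesis by blast
 qed
 have "Def (%e. finite (ext (sepm (p1 (e 0)) (%v. v ~: ext (p2 (e 0))))))" by (intro def_intro)
 note r = sepm[OF times_M[OF p(1) p(1)] this]
 define r where "r = sepm (times p p) (%z. finite (ext (sepm (p1 z) (%v. v ~: ext (p2 z)))))"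
 have r: "r:M" "ext r = {z:ext (times p p). finite (ext (sepm (p1 z) (%v. v ~: ext (p2 z))))}" unfolding r_def by (rule r)+
 have "(x, y):rel r <-> x:ext p & y:ext p & finite (ext x - ext y)" for x y
 proof (cases "x:M & y:M")
  case True
  then have "pr x y:ext (times p p) <-> x:ext p & y:ext p" unfolding ext_times[OF p(1) p(1)] using ext_M pr_inject by blast
  then show ?thesis unfolding rel_iff r(2) using True e[of x y] by simp
 next
  case False then show ?thesis unfolding rel_iff using ext_M by blast
 qed
 then have "rel r = {(x, y). x:ext p & y:ext p & finite (ext x - ext y)}" by auto
 moreover have "is_rel r p p" unfolding is_rel_def
 proof (intro conjI ballI r(1))
  fix z assume "z:ext r"
  then obtain x y where "z = pr x y" "x:ext p" "y:ext p" unfolding r(2) ext_times[OF p(1) p(1)] by blast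
  then show "EX x:ext p. EX y:ext p. opair z x y" using ext_M unfolding opair_iff by blast
 qed
 ultimately show ?thesis unfolding is_mod_Fin_def using p by blast
qed

lemma tern_iff: assumes "B:M" "a:M" "b:M" "c:M" shows "tern B a b c <-> pr (pr a b) c:ext B"
proof
 assume "tern B a b c"
 then show "pr (pr a b) c:ext B" unfolding tern_def opair_iff by auto
next
 assume h: "pr (pr a b) c:ext B"
 have m: "pr a b:M" using assms by simp
 have "upr (pr a b) c:ext (pr (pr a b) c)" "pr a b:ext (upr (pr a b) c)" using ext_pr[OF m assms(4)] m assms by auto
 then show "tern B a b c" unfolding tern_def opair_iff using h m assms by blast
qed

lemma finite_real: assumes "A:RR" "B:RR" shows "finite (ext (real A) - ext (real B)) <-> finite (A - B)" "finite (ext (real A)) <-> finite A"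
proof -
 have i: "inj num" by (simp add: inj_def)
 then show "finite (ext (real A) - ext (real B)) <-> finite (A - B)" "finite (ext (real A)) <-> finite A"
  using assms by (simp_all add: ext_real image_set_diff[OF i, symmetric] finite_image_iff inj_on_subset)
qed

end

section \<open>Distinguishing stages by their Cohen reals\<close>

context piece begin

abbreviation gr where "gr i == {enc k (g i k) | k. True}"

lemma EE_gr: "EE g i (enc 2 (enc 0 0)) = gr i" by (rule EE_codes)

text \<open>The left side is computed without the real at \<open>nu\<close>, so an equality would
  place the graph of \<open>g nu\<close> in the extension without \<open>nu\<close>. But a finite
  condition at \<open>nu\<close> can always be extended to disagree with a given set of that
  extension.\<close>

lemma EE_ne_gr: assumes i: "i:ext XX" and nu: "nu:ext XX" "nu ~= i" "~LL nu i" shows "EE g i m ~= gr nu"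
proof
 assume A: "EE g i m = gr nu"
 interpret P': cidx M E XX LL uu "XV nu" "GV nu" by (rule omit[OF nu(1)])
 have nuM: "nu:M" using nu ext_M by blast
 have "EE g i m = EE P'.g i m" by (rule EE_cong) (use g_omit[OF nu(1)] nu(2,3) i LL_X in metis)
 moreover have "EE P'.g i m:P'.NN.RR" by (rule P'.EE_table) (use i in blast)
 ultimately have R: "gr nu:P'.NN.RR" using A by simp
 define B where "B = upr nu nu"
 have B: "B:M" "ext B = {nu}" unfolding B_def using nuM by auto
 have cB: "cp B:M" using cp_M[OF B(1)] .
 define Dl where "Dl x <-> (EX k l. P'.NN.pr (P'.NN.pr (P'.cv nu) (P'.NN.num k)) (P'.NN.num l):P'.extN x & enc k l ~: P'.NN.ns (P'.NN.real (gr nu)))" for x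
 have "P'.NN.Def (%e. Dl (e 0))" unfolding Dl_def by (intro def_intro P'.cv_N[OF nuM] P'.NN.real_M[OF R])
 note Z = P'.NN.sepm[OF P'.cv_N[OF cB] this]
 obtain Q where Q: "Q:M"
  "!!s. s:ext (cp B) ==> P'.cv s:P'.extN (P'.NN.sepm (P'.cv (cp B)) Dl) <-> (EX c:GV nu. pr s c:ext Q)"
  by (rule P'.nice_name[OF Z(1) cB]) blast
 have D: "(EX c:GV nu. pr s c:ext Q) <-> (EX k l. t3 nu k l:ext s & enc k l ~: gr nu)" if s: "s:ext (cp B)" for s
 proof -
  have "P'.NN.pr (P'.NN.pr (P'.cv nu) (P'.NN.num k)) (P'.NN.num l) = P'.cv (t3 nu k l)" for k l
   using nuM by (simp add: P'.cv_pr P'.cv_num del: num.simps P'.NN.num.simps)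
  then have "Dl (P'.cv s) <-> (EX k l. t3 nu k l:ext s & enc k l ~: gr nu)"
   unfolding Dl_def P'.NN.ns_real[OF R] using P'.cv_mem[OF t3_M[OF nuM] ext_M[OF s]] by simp
  then show ?thesis unfolding Q(2)[OF s, symmetric] Z(2) P'.ext_cv[OF cB] using s by blast
 qed
 have "EX s:G Int ext (cp B). EX c:GV nu. pr s c:ext Q"
 proof (rule product_generic[OF XV(1)[OF nuM] _ B(1) _ _ Q(1)])
  show "ext (XV nu) <= ext XX" "ext B <= ext XX" "ext (XV nu) Int ext B = {}" unfolding XV(2)[OF nuM] B(2) using nu by auto
  fix s assume s: "s:ext (cp B)"
  then have "finite (ext s)" unfolding cp_iff[OF B(1)] by blast
  then obtain k where k: "!!l. t3 nu k l ~: ext s" using fresh nuM by blast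
  \<comment> \<open>At a fresh argument the condition is given a value different from
    \<open>g nu k\<close>. Under the assumption the set of such conditions is visible in the smaller
    extension, so the filter meets it, which is absurd.\<close>
  note s' = cp_insert[OF B(1) s, of nu k "Suc (g nu k)", OF _ k]
  have "enc k (Suc (g nu k)) ~: gr nu" by auto
  then show "EX s':ext (cp B). ext s <= ext s' & (EX c:GV nu. pr s' c:ext Q)"
   using D[OF s'(1)] s' B(2) by blast
 qed
 then obtain s k l where s: "s:G" "t3 nu k l:ext s" "enc k l ~: gr nu" using D by blast
 then have "g nu k = l" using g_iff[OF nu(1)] unfolding tr_def by blast
 then show False using s(3) by blast
qed

lemma gr_inj: assumes "i:ext XX" "j:ext XX" "gr i = gr j" shows "i = j"
proof (rule ccontr)
 assume n: "i ~= j"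
 have "~LL i j \<or> ~LL j i" using LL_trans LL_ne by blast
 then show False using EE_ne_gr[OF assms(1,2) n[symmetric], of "enc 2 (enc 0 0)"] EE_ne_gr[OF assms(2,1) n, of "enc 2 (enc 0 0)"] assms(3)
  unfolding EE_gr by auto
qed

lemma gr_RR: "i:ext XX ==> gr i:NN.RR" using EE_RR[of i "enc 2 (enc 0 0)"] unfolding EE_gr .

definition TG where "TG i = NN.ap TB (NN.pr i (NN.num (enc 2 (enc 0 0))))"

lemma TG: "i:ext XX ==> TG (cv i) = NN.real (gr i)" unfolding TG_def by (simp add: TB EE_gr)

lemma DefF_TG [def_intro]: "NN.DefF s ==> NN.DefF (%e. TG (s e))"
 unfolding TG_def by (intro def_intro TB)

text \<open>All lower bounds on sizes in the extension rest on the injectivity of \<open>gr\<close>.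
  The term \<open>t\<close> is the index map \<open>h\<close> as the extension computes it.\<close>

lemma gr_card:
 assumes "A:M" "F:N" "NN.DefF (%e. t (e 0))" "!!a. a:ext A ==> t (cv a) = cv (h a) & h a:ext XX & NN.real (gr (h a)):extN F"
  "inj_on h (ext A)"
 shows "NN.card_le (cv A) F"
proof (rule NN.card_leI[OF cv_N[OF assms(1)] assms(2), of "%x. TG (t x)"])
 show "NN.DefF (%e. TG (t (e 0)))" by (intro def_intro assms)
 have T: "TG (t (cv a)) = NN.real (gr (h a))" if "a:ext A" for a using assms(4)[OF that] TG by simp
 show "TG (t x):extN F" if "x:extN (cv A)" for x using that T assms(4) unfolding ext_cv[OF assms(1)] by auto
 show "inj_on (%x. TG (t x)) (extN (cv A))" unfolding ext_cv[OF assms(1)]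
 proof (rule inj_onI)
  fix x y assume "x:cv ` ext A" "y:cv ` ext A" "TG (t x) = TG (t y)"
  then obtain a b where ab: "a:ext A" "b:ext A" "x = cv a" "y = cv b" "NN.real (gr (h a)) = NN.real (gr (h b))" using T by auto
  have "gr (h a) = gr (h b)" using arg_cong[OF ab(5), of NN.ns] assms(4)[OF ab(1)] assms(4)[OF ab(2)] gr_RR by simp
  then have "h a = h b" using gr_inj assms(4) ab(1,2) by blast
  then show "x = y" using assms(5) ab unfolding inj_on_def by blast
 qed
qed

end

subsection \<open>The families\<close>

context piece begin

text \<open>The family with first coordinate \<open>x\<close> whose levels range over
  \<open>c\<close>, as a definable term of the extension. This allows chains and collections of such
  families to be separated from the double power set of omega.\<close>

definition FX where "FX x c = NN.sepm (NN.pw NN.om) (%A. EX b:extN c. EX a:extN (cv w1). EX n. A = NN.ap TB (NN.pr (NN.pr x (NN.pr b a)) (NN.num n)))"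

lemma DefF_FX [def_intro]: "NN.DefF s ==> NN.DefF t ==> NN.DefF (%e. FX (s e) (t e))"
proof (rule NN.DefF_2[of FX])
 have D: "NN.DefF (%e. FX (e 0) (e 1))" unfolding FX_def by (intro def_intro TB cv_N w1_M)
 then show "NN.Def (%e. e 0 = FX (e 1) (e 2))" unfolding NN.DefF_def by (simp add: numeral_2_eq_2)
 show "FX x y:N" if "x:N" "y:N" for x y using NN.DefF_in[OF D, of "%n. if n = 0 then x else y"] that by auto
qed

lemma cv_ix: assumes "xi:ext KK" "b:ext w2" "a:ext w1"
 shows "ix xi b a:ext XX" "NN.pr (cv xi) (NN.pr (cv b) (cv a)) = cv (ix xi b a)"
 using assms ext_M unfolding XX(2) ix_def by (blast, simp add: cv_pr)

lemma FX: assumes "xi:ext KK" "d:M" "ext d <= ext w2"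
 shows "FX (cv xi) (cv d):N" "extN (FX (cv xi) (cv d)) = {NN.real (EE g (ix xi b a) n) | b a n. b:ext d & a:ext w1}"
proof -
 have xM: "xi:M" using assms ext_M by blast
 have "NN.Def (%e. EX b:extN (cv d). EX a:extN (cv w1). EX n. e 0 = NN.ap TB (NN.pr (NN.pr (cv xi) (NN.pr b a)) (NN.num n)))"
  by (intro def_intro TB cv_N w1_M xM assms)
 note s = NN.sepm[OF NN.pw(1)[OF NN.om_M] this, folded FX_def]
 show "FX (cv xi) (cv d):N" by (rule s)
 have v: "NN.ap TB (NN.pr (NN.pr (cv xi) (NN.pr (cv b) (cv a))) (NN.num n)) = NN.real (EE g (ix xi b a) n) &
   NN.real (EE g (ix xi b a) n):extN (NN.pw NN.om)" if "b:ext d" "a:ext w1" for b a n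
 proof -
  have b: "b:ext w2" using that assms(3) by blast
  note i = cv_ix[OF assms(1) b that(2)]
  show ?thesis unfolding i(2) using TB(2)[OF i(1)] NN.RR_D[OF EE_RR[OF i(1), of n]] NN.ext_om by auto
 qed
 show "extN (FX (cv xi) (cv d)) = {NN.real (EE g (ix xi b a) n) | b a n. b:ext d & a:ext w1}"
  unfolding s(2) ext_cv[OF assms(2)] ext_cv[OF w1_M] using v by fastforce
qed

lemma FX_family: assumes "xi:ext KK" "d:M" "ext d <= ext w2" shows "NN.is_family_of_reals (FX (cv xi) (cv d))"
proof -
 have "extN A <= extN NN.om" if A: "A:extN (FX (cv xi) (cv d))" for A
 proof -
  obtain b a n where h: "A = NN.real (EE g (ix xi b a) n)" "b:ext w2" "a:ext w1" using A assms(3) unfolding FX(2)[OF assms] by blast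
  show ?thesis unfolding h(1) NN.ext_real[OF EE_RR[OF cv_ix(1)[OF assms(1) h(2,3)]]] NN.ext_om by blast
 qed
 then show ?thesis unfolding NN.is_family_of_reals_def using FX(1)[OF assms] NN.is_omega_iff by blast
qed

lemma er_fun: assumes "ga:ext w2" "er xi ga be A" "er xi ga be A'" shows "A = A'"
 using assms et_inj[OF assms(1)] unfolding er_def by metis

text \<open>\<open>proper_criterion\<close> is used with the enumeration by codes as
  \<open>s\<close> and with the pseudo-intersections of level \<open>ga\<close> as the candidates in
  \<open>B\<close>. The closure function demanded for each dense set is supplied by
  \<open>star\<close>, as a canonical copy of a function of the ground model.\<close>

lemma fx_proper: assumes x: "xi:ext KK" "ga:ext w2" shows "NN.is_proper_family (FX (cv xi) (cv (suc ga)))"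
 unfolding NN.is_proper_family_def
proof (intro conjI)
 let ?F = "FX (cv xi) (cv (suc ga))"
 have gM: "ga:M" "suc ga:M" "xi:M" using x ext_M by auto
 have sw: "ext (suc ga) <= ext w2" using ord_trans[OF ord_w(2) suc_w2[OF x(2)]] by blast
 note F = FX[OF x(1) gM(2) sw]
 show "NN.is_family_of_reals ?F" by (rule FX_family[OF x(1) gM(2) sw])
 have ixX: "ix xi b a:ext XX" if "b:ext (suc ga)" "a:ext w1" for b a using cv_ix[OF x(1)] sw that by blast
 have "NN.nat_set ` extN ?F = XS g xi ga"
 proof -
  have "NN.ns (NN.real (EE g (ix xi b a) n)) = EE g (ix xi b a) n" if "b:ext (suc ga)" "a:ext w1" for b a n
   using NN.ns_real[OF EE_RR[OF ixX[OF that]]] .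
  then show ?thesis unfolding F(2) XS_def NN.nat_set_ns[abs_def] by (auto simp: image_iff) metis+
 qed
 then show "arith_closed (NN.nat_set ` extN ?F)" using XS_arith[OF x] by simp
 obtain p r where m: "NN.is_mod_Fin ?F p r" using NN.mod_Fin_ex[OF F(1)] by blast
 then have p: "p:N" "extN p = {A:extN ?F. infinite (extN A)}" and
  r: "!!A B. (A, B):NN.rel r <-> A:extN p & B:extN p & finite (extN A - extN B)" unfolding NN.is_mod_Fin_def by auto
 note eR = er_RR[OF x]
 have pE: "NN.real A:extN p <-> infinite A" if "er xi ga be A" for be A
 proof -
  have "NN.real A:extN ?F" unfolding F(2) using that unfolding er_def by blast
  then show ?thesis unfolding p(2) using NN.finite_real(2)[OF eR(2)[OF that] eR(2)[OF that]] by simp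
 qed
 have pX: "EX be A. y = NN.real A & er xi ga be A & infinite A" if y: "y:extN p" for y
 proof -
  obtain b a n where h: "y = NN.real (EE g (ix xi b a) n)" "b:ext (suc ga)" "a:ext w1" using y unfolding p(2) F(2) by blast
  then have "er xi ga (et ga b a n) (EE g (ix xi b a) n)" unfolding er_def by blast
  then show ?thesis using pE y h(1) by blast
 qed
 obtain Z where Z: "Z:N" "extN Z = {NN.pr (cv be) (NN.real A) | be A. er xi ga be A}" using er_rel[OF x] by blast
 have D: "NN.Def (%e. NN.p2 (e 0):extN p)" by (intro def_intro p)
 \<comment> \<open>The enumeration is cut down to codes of infinite sets, the conditions of the
   poset.\<close>
 define s where "s = NN.sepm Z (%z. NN.p2 z:extN p)"
 have s: "s:N" "extN s = {z:extN Z. NN.p2 z:extN p}" unfolding s_def by (rule NN.sepm[OF Z(1) D])+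
 have wN: "cv w1:N" by simp
 have sE: "extN s = {NN.pr (cv be) (NN.real A) | be A. er xi ga be A & infinite A}"
 proof -
  have "NN.p2 (NN.pr (cv be) (NN.real A)) = NN.real A" if "er xi ga be A" for be A
   using NN.p12(2)[OF cv_N[OF ext_M[OF eR(1)[OF that]]] NN.real_M[OF eR(2)[OF that]]] .
  then show ?thesis unfolding s(2) Z(2) using pE by fastforce
 qed
 have sm: "NN.pr (cv be) y:extN s <-> (EX A. y = NN.real A & er xi ga be A & infinite A)" if "be:M" "y:N" for be y
  unfolding sE mem_Collect_eq using NN.pr_inject[OF cv_N[OF that(1)] that(2) cv_N NN.real_M] eR ext_M cv_inj[OF that(1)] by metis
 have rs: "(cv be, y):NN.rel s <-> (EX A. y = NN.real A & er xi ga be A & infinite A)" if "be:M" for be y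
  unfolding NN.rel_iff using sm[OF that] cv_N[OF that] NN.real_M eR(2) by blast
 \<comment> \<open>Instruction 1 produces pseudo-intersections: the pair of \<open>a\<close> and
   \<open>b\<close> is sent to the one that stage \<open>(ga, a)\<close> builds from the set with
   code \<open>b\<close>.\<close>
 define P where "P c i n <-> (EX a:ext w1. EX b:ext w1. c = pr a b & i = ix xi ga a & n = enc 1 (enc (io a b) 0))" for c i n
 have W: "times w1 w1:M" by simp
 have "Def (%e. P (p1 (e 0)) (p1 (p2 (e 0))) (dn (p2 (p2 (e 0)))))" unfolding P_def by (intro def_intro DefF_const gM; simp)
 then obtain Y where Y: "Y:N" "extN Y = {NN.pr (cv a) (NN.real (EE g i n)) | a i n. a:ext (times w1 w1) & i:ext XX & P a i n}"
  using TB_set[OF W] by blast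
 define B where "B = NN.sepm Y (%z. NN.p2 z:extN p)"
 have B: "B:N" "extN B = {z:extN Y. NN.p2 z:extN p}" unfolding B_def by (rule NN.sepm[OF Y(1) D])+
 define Pi where "Pi al be = pib (UE g (ix xi ga al)) (g (ix xi ga al)) (io al be)" for al be
 have gs: "ga:ext (suc ga)" using gM by simp
 have EP: "EE g (ix xi ga al) (enc 1 (enc (io al be) 0)) = Pi al be" for al be unfolding Pi_def by (rule EE_codes)
 have PR: "Pi al be:NN.RR" "NN.real (Pi al be):extN p <-> infinite (Pi al be)" if "al:ext w1" for al be
 proof -
  have "er xi ga (et ga ga al (enc 1 (enc (io al be) 0))) (Pi al be)" unfolding er_def EP[symmetric] using gs that by blast
  then show "Pi al be:NN.RR" "NN.real (Pi al be):extN p <-> infinite (Pi al be)" using eR pE by blast+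
 qed
 have YE: "extN Y = {NN.pr (NN.pr (cv al) (cv be)) (NN.real (Pi al be)) | al be. al:ext w1 & be:ext w1}"
 proof -
  have q: "cv (pr a b) = NN.pr (cv a) (cv b)" "pr a b:ext (times w1 w1)" if "a:ext w1" "b:ext w1" for a b
   unfolding ext_times[OF w1_M w1_M] using cv_pr[OF ext_M[OF that(1)] ext_M[OF that(2)]] that by blast+
  have "extN Y = {NN.pr (cv (pr a b)) (NN.real (Pi a b)) | a b. a:ext w1 & b:ext w1}"
   unfolding Y(2) P_def EP[symmetric] using q(2) ixX[OF gs] by blast
  also have "... = {NN.pr (NN.pr (cv a) (cv b)) (NN.real (Pi a b)) | a b. a:ext w1 & b:ext w1}"
   by (rule Collect_cong, rule ex_cong1, rule ex_cong1) (use q(1) in auto)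
  finally show ?thesis .
 qed
 have Bm: "NN.tern B (cv al) (cv be) q <-> q = NN.real (Pi al be) & q:extN p" if h: "al:ext w1" "be:ext w1" "q:extN p" for al be q
 proof -
  have mm: "cv al:N" "cv be:N" "q:N" using h ext_M NN.ext_M by auto
  have "NN.pr (NN.pr (cv al) (cv be)) q:extN Y <-> q = NN.real (Pi al be)"
  proof
   assume "NN.pr (NN.pr (cv al) (cv be)) q:extN Y"
   then obtain al' be' where e: "al':ext w1" "be':ext w1" "NN.pr (NN.pr (cv al) (cv be)) q = NN.pr (NN.pr (cv al') (cv be')) (NN.real (Pi al' be'))"
    unfolding YE by blast
   have "al:M" "al':M" "be:M" "be':M" using h e ext_M by blast+
   then show "q = NN.real (Pi al be)" using e(3) NN.real_M[OF PR(1)[OF e(1)]] mm by simp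
  qed (use YE h in blast)
  moreover have "NN.p2 (NN.pr (NN.pr (cv al) (cv be)) q) = q" using mm by simp
  ultimately show ?thesis unfolding NN.tern_iff[OF B(1) mm] B(2) by simp
 qed
 have "NN.is_proper p r"
 proof (rule NN.proper_criterion[OF m, where w = "cv w1" and s = s and B = B])
  show "extN A <= extN NN.om" if A: "A:extN p" for A
  proof -
   obtain be A0 where "A = NN.real A0" "er xi ga be A0" using pX[OF A] by blast
   then show ?thesis using NN.ext_real[OF eR(2)] NN.ext_om by auto
  qed
  show "NN.is_ordinal (cv w1)" by (rule cv_ordinal[OF ord_w(1)])
  show "NN.om:extN (cv w1)" unfolding cv_om[symmetric] ext_cv[OF w1_M] using om_w1 by blast
  show "~NN.card_le (cv w1) NN.om" by (rule omegas)
  show "NN.card_le a NN.om" if "a:extN (cv w1)" for a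
   using that cv_card_le[of _ om] w1_iff ordM unfolding ext_cv[OF w1_M] cv_om[symmetric] by auto
  show "NN.card_le (NN.times (cv w1) (cv w1)) (cv w1)" unfolding cv_times[OF w1_M w1_M, symmetric] by (rule cv_card_le[OF w1_sq W w1_M])
  show "NN.card_le (cv w1) p"
  proof (rule gr_card[OF w1_M p(1), of "%x. NN.pr (cv xi) (NN.pr (cv ga) x)" "ix xi ga"])
   show "NN.DefF (%e. NN.pr (cv xi) (NN.pr (cv ga) (e 0)))" by (intro def_intro cv_N gM)
   show "inj_on (ix xi ga) (ext w1)" by (rule inj_onI) (use ix_inj[OF x _ x] in blast)
   fix a assume a: "a:ext w1"
   have "er xi ga (et ga ga a (enc 2 (enc 0 0))) (gr (ix xi ga a))" unfolding er_def EE_gr[symmetric] using gs a by blast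
   moreover have "infinite (gr i)" for i
   proof -
    have "inj (%k. enc k (g i k))" by (simp add: inj_def)
    moreover have "gr i = range (%k. enc k (g i k))" by blast
    ultimately show ?thesis using finite_imageD infinite_UNIV_nat by metis
   qed
   ultimately show "NN.pr (cv xi) (NN.pr (cv ga) (cv a)) = cv (ix xi ga a) & ix xi ga a:ext XX & NN.real (gr (ix xi ga a)):extN p"
    using cv_ix[OF x a] pE by blast
  qed
  show "s:N" by (rule s)
  show "extN s <= extN (NN.times (cv w1) p)" unfolding NN.ext_times[OF wN p(1)] ext_cv[OF w1_M] sE using pE eR(1) by blast
  show "EX b:extN (cv w1). NN.pr b A:extN s" if A: "A:extN p" for A
   using pX[OF A] eR(1) unfolding ext_cv[OF w1_M] sE by blast
  show "A = A'" if bN: "b:N" and h: "A:extN p" "A':extN p" "NN.pr b A:extN s" "NN.pr b A':extN s" for b A A'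
  proof -
   obtain be A0 where h1: "NN.pr b A = NN.pr (cv be) (NN.real A0)" "er xi ga be A0" using h(3) unfolding sE by blast
   obtain be' A1 where h2: "NN.pr b A' = NN.pr (cv be') (NN.real A1)" "er xi ga be' A1" using h(4) unfolding sE by blast
   have "b = cv be" "A = NN.real A0" "b = cv be'" "A' = NN.real A1"
    using h1 h2 bN NN.ext_M[OF h(1)] NN.ext_M[OF h(2)] NN.pr_inject cv_N ext_M eR NN.real_M by metis+
   then show ?thesis using er_fun[OF x(2) h1(2)] h2(2) cv_inj ext_M eR(1) h1(2) by metis
  qed
  show "B:N" by (rule B)
  show "extN B <= extN (NN.times (NN.times (cv w1) (cv w1)) p)"
  proof
   fix z assume z: "z:extN B"
   then obtain al be where h: "al:ext w1" "be:ext w1" "z = NN.pr (NN.pr (cv al) (cv be)) (NN.real (Pi al be))" unfolding B(2) YE by blast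
   have "NN.p2 z = NN.real (Pi al be)" unfolding h(3) using NN.real_M[OF PR(1)[OF h(1)]] h(1,2) ext_M by simp
   then have "NN.real (Pi al be):extN p" using z unfolding B(2) by simp
   then show "z:extN (NN.times (NN.times (cv w1) (cv w1)) p)" using h
    unfolding NN.ext_times[OF NN.times_M[OF wN wN] p(1)] NN.ext_times[OF wN wN] ext_cv[OF w1_M] by blast
  qed
  fix D assume D: "D:N" "extN D <= extN p" "ALL x:extN p. EX y:extN D. (y, x):NN.rel r"
  obtain f where f: "f:M" "is_fun f w1 w1"
   "!!al be A. al:ext w1 ==> (ALL be:ext al. ap f be:ext al) ==>
   (ALL be:ext al. ALL A. er xi ga be A --> infinite A -->
    (EX be':ext al. EX A'. er xi ga be' A' & NN.real A':extN D & infinite A' & finite (A' - A))) ==>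
   be:ext al ==> er xi ga be A ==> infinite A ==>
   A = UE g (ix xi ga al) (io al be) & (EX be':ext al. EX A'. er xi ga be' A' & NN.real A':extN D & finite (Pi al be - A'))"
   unfolding Pi_def using star[OF x D(1)] by blast
  have fD: "NN.DefF (%e. NN.ap (cv f) (e 0))" by (intro def_intro cv_N f)
  have fv: "NN.ap (cv f) (cv b) = cv (ap f b)" if "b:ext w1" for b by (rule cv_ap[OF f(2) that])
  have fm: "NN.ap (cv f) v:extN (cv w1)" if "v:extN (cv w1)" for v
   using that fv is_funD(1)[OF f(2)] unfolding ext_cv[OF w1_M] by auto
  note L = NN.lam_fun[OF wN wN fm fD] NN.ap_lam[OF wN wN fm fD]
  show "EX f:N. NN.is_fun f (cv w1) (cv w1) & (ALL a:extN (cv w1). (ALL b:extN a. NN.ap f b:extN a) --> NN.reach p r s D a --> NN.hit p r s B D a)"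
  proof (intro bexI conjI ballI impI)
   show "NN.is_fun (NN.lam (cv w1) (cv w1) (NN.ap (cv f))) (cv w1) (cv w1)" by (rule L)
   show "NN.lam (cv w1) (cv w1) (NN.ap (cv f)):N" by (rule NN.lam_M[OF wN wN fm fD])
   fix a assume "a:extN (cv w1)" and cl: "ALL b:extN a. NN.ap (NN.lam (cv w1) (cv w1) (NN.ap (cv f))) b:extN a" and re: "NN.reach p r s D a"
   then obtain al where a: "al:ext w1" "a = cv al" unfolding ext_cv[OF w1_M] by blast
   have aM: "al:M" using a ext_M by blast
   have aw: "be:ext w1" if "be:ext al" for be using ord_trans[OF ord_w(1) a(1) that] .
   note ea = ext_cv[OF aM, folded a(2)]
   have c: "ALL be:ext al. ap f be:ext al"
   proof
    fix be assume b: "be:ext al"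
    have "cv be:extN (cv w1)" unfolding ext_cv[OF w1_M] using aw[OF b] by blast
    moreover have "cv be:extN a" unfolding ea using b by blast
    ultimately have "cv (ap f be):extN (cv al)" using cl L(2)[of "cv be"] fv[OF aw[OF b]] a(2) by fastforce
    then show "ap f be:ext al" using cv_mem[OF _ aM] f(1) ext_M[OF b] by simp
   qed
   have dn: "ALL be:ext al. ALL A. er xi ga be A --> infinite A -->
    (EX be':ext al. EX A'. er xi ga be' A' & NN.real A':extN D & infinite A' & finite (A' - A))"
   proof (intro ballI allI impI)
    fix be A assume h: "be:ext al" "er xi ga be A" "infinite A"
    have "(cv be, NN.real A):NN.rel s" "NN.real A:extN p" using rs[OF ext_M[OF h(1)]] h pE by blast+
    moreover have "cv be:extN a" unfolding ea using h(1) by blast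
    ultimately obtain b' A' where 1: "b':extN a" "A':extN D" "(b', A'):NN.rel s" "(A', NN.real A):NN.rel r"
     using re[unfolded NN.reach_def, rule_format, of "cv be" "NN.real A"] by blast
    then obtain be' where 2: "be':ext al" "b' = cv be'" unfolding ea by blast
    then obtain A0 where 3: "A' = NN.real A0" "er xi ga be' A0" "infinite A0" using 1(3) rs[OF ext_M[OF 2(1)]] by blast
    then have "finite (A0 - A)" using 1(4) NN.finite_real(1)[OF eR(2)[OF 3(2)] eR(2)[OF h(2)]] unfolding r by blast
    then show "EX be':ext al. EX A'. er xi ga be' A' & NN.real A':extN D & infinite A' & finite (A' - A)" using 1(2) 2 3 by blast
   qed
   show "NN.hit p r s B D a" unfolding NN.hit_def
   proof (intro ballI impI)
    fix b A assume h: "b:extN a" "A:extN p" "(b, A):NN.rel s"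
    then obtain be where b: "be:ext al" "b = cv be" unfolding ea by blast
    then obtain A0 where A: "A = NN.real A0" "er xi ga be A0" "infinite A0" using h(3) rs[OF ext_M[OF b(1)]] by blast
    note k = f(3)[OF a(1) c dn b(1) A(2,3)]
    have u: "unb (UE g (ix xi ga al) (io al be))" using k A(3) unfolding unb_iff by simp
    have P: "infinite (Pi al be)" "Pi al be <= A0" using pib(1,2)[of "UE g (ix xi ga al)" "io al be", OF u] k unfolding Pi_def by auto
    have q: "NN.real (Pi al be):extN p" using PR(2)[OF a(1)] P(1) by blast
    have rr: "(NN.real (Pi al be), NN.real C):NN.rel r" if "er xi ga de C" "finite (Pi al be - C)" "NN.real C:extN p" for de C
     unfolding r using q that NN.finite_real(1)[OF PR(1)[OF a(1)] eR(2)[OF that(1)]] by blast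
    obtain be' A' where A': "be':ext al" "er xi ga be' A'" "NN.real A':extN D" "finite (Pi al be - A')" using k by blast
    have "NN.real A':extN p" using A'(3) D(2) by blast
    then have "(cv be', NN.real A'):NN.rel s" "(NN.real (Pi al be), NN.real A'):NN.rel r"
     using rs[OF ext_M[OF A'(1)]] A' pE rr by blast+
    moreover have "cv be':extN a" unfolding ea using A' by blast
    moreover have "finite (Pi al be - A0)" using P by (metis Diff_eq_empty_iff finite.emptyI)
    then have "(NN.real (Pi al be), A):NN.rel r" using rr[OF A(2)] h(2) unfolding A(1) by blast
    ultimately show "(EX q:extN p. NN.tern B a b q) & (ALL q:extN p. NN.tern B a b q --> (q, A):NN.rel r &
      (EX b':extN a. EX A':extN D. (b', A'):NN.rel s & (q, A'):NN.rel r))"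
     using Bm[OF a(1) aw[OF b(1)]] q A'(3) unfolding a(2) b(2) by blast
   qed
  qed
 qed
 then show "EX p r. NN.is_mod_Fin ?F p r & NN.is_proper p r" using m by blast
qed

end

context piece begin

lemma gr_FX: assumes "xi:ext KK" "d:M" "ext d <= ext w2" "b:ext d" "a:ext w1"
 shows "NN.real (gr (ix xi b a)):extN (FX (cv xi) (cv d))"
 unfolding FX(2)[OF assms(1-3)] EE_gr[symmetric] using assms by blast

text \<open>Stages of different first coordinates are unrelated in the order, so by
  \<open>EE_ne_gr\<close> a family contains no Cohen real of a foreign coordinate. This is how
  distinct \<open>xi\<close> yield distinct families.\<close>

lemma FX_gr:
 assumes "xi:ext KK" "xi':ext KK" "b:ext w2" "a:ext w1" "NN.real (gr (ix xi' b a)):extN (FX (cv xi) (cv w2))"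
 shows "xi' = xi"
proof (rule ccontr)
 assume n: "xi' ~= xi"
 obtain c d m where h: "c:ext w2" "d:ext w1" "NN.real (gr (ix xi' b a)) = NN.real (EE g (ix xi c d) m)"
  using assms(5) unfolding FX(2)[OF assms(1) w2_M subset_refl] by blast
 note i = cv_ix(1)[OF assms(1) h(1,2)] cv_ix(1)[OF assms(2-4)]
 have "ix xi' b a ~= ix xi c d" using ix_inj[OF assms(2-4) assms(1) h(1,2)] n by blast
 moreover have "~LL (ix xi' b a) (ix xi c d)"
 proof
  assume "LL (ix xi' b a) (ix xi c d)"
  then obtain ze u v u' v' where "ze:ext KK" "u:ext w2" "u':ext w2" "v:ext w1" "v':ext w1"
   "ix xi' b a = ix ze u' v'" "ix xi c d = ix ze u v" unfolding LL_def by blast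
  then show False using n ix_inj[OF assms(2-4)] ix_inj[OF assms(1) h(1,2)] by metis
 qed
 ultimately have "EE g (ix xi c d) m ~= gr (ix xi' b a)" by (rule EE_ne_gr[OF i])
 then show False using arg_cong[OF h(3), of NN.ns] unfolding NN.ns_real[OF gr_RR[OF i(2)]] NN.ns_real[OF EE_RR[OF i(1)]] by simp
qed

text \<open>The table maps places onto the family, and the places embed into an ordinal already in
  the ground model; \<open>surj_card\<close> therefore bounds the family in the extension.\<close>

lemma FX_card:
 assumes "xi:ext KK" "d:M" "ext d <= ext w2" "card_le (times (times d w1) om) w" "is_ordinal w"
 shows "NN.card_le (FX (cv xi) (cv d)) (cv w)"
proof -
 have m: "times d w1:M" "times (times d w1) om:M" "xi:M" "w:M" using assms ext_M ordM by auto
 show ?thesis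
 proof (rule NN.surj_card[OF cv_card_le[OF assms(4) m(2,4)] cv_ordinal[OF assms(5)] cv_N[OF m(2)] FX(1)[OF assms(1-3)]])
  show "NN.DefF (%e. NN.ap TB (NN.pr (NN.pr (cv xi) (NN.p1 (e 0))) (NN.p2 (e 0))))" by (intro def_intro TB cv_N m)
  show "extN (FX (cv xi) (cv d)) <= (%z. NN.ap TB (NN.pr (NN.pr (cv xi) (NN.p1 z)) (NN.p2 z))) ` extN (cv (times (times d w1) om))"
  proof
   fix A assume "A:extN (FX (cv xi) (cv d))"
   then obtain b a n where h: "A = NN.real (EE g (ix xi b a) n)" "b:ext d" "a:ext w1" unfolding FX(2)[OF assms(1-3)] by blast
   have b: "b:ext w2" using h(2) assms(3) by blast
   note i = cv_ix[OF assms(1) b h(3)]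
   have mm: "a:M" "b:M" using h ext_M by blast+
   have "pr (pr b a) (num n):ext (times (times d w1) om)"
    unfolding ext_times[OF m(1) om_M] ext_times[OF assms(2) w1_M] ext_om using h by blast
   then have e: "cv (pr (pr b a) (num n)):extN (cv (times (times d w1) om))" unfolding ext_cv[OF m(2)] by blast
   have "A = NN.ap TB (NN.pr (cv (ix xi b a)) (NN.num n))" unfolding h(1) using TB(2)[OF i(1)] by simp
   then have "A = NN.ap TB (NN.pr (NN.pr (cv xi) (NN.p1 (cv (pr (pr b a) (num n))))) (NN.p2 (cv (pr (pr b a) (num n)))))"
    unfolding i(2)[symmetric] using mm by (simp add: cv_pr cv_num del: num.simps NN.num.simps)
   then show "A:(%z. NN.ap TB (NN.pr (NN.pr (cv xi) (NN.p1 z)) (NN.p2 z))) ` extN (cv (times (times d w1) om))"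
    using e by blast
  qed
 qed
qed

lemma union_card: assumes x: "xi:ext KK" shows "NN.card_eq (FX (cv xi) (cv w2)) (cv w2)"
proof (rule NN.cantor_bernstein)
 have m: "times w2 w1:M" "times w2 w2:M" by simp_all
 have "card_le w2 w2" "card_le w1 w2" "card_le om w2"
  using card_le_sub[OF w2_M w2_M] card_le_sub[OF w1_M w2_M w1_sub_w2] card_le_trans[OF om_le_w1 _ om_M w2_M] by auto
 then have "card_le (times (times w2 w1) om) (times w2 w2)"
  using card_le_times[OF card_le_trans[OF card_le_times w2_sq]] m by simp
 then have "card_le (times (times w2 w1) om) w2" using card_le_trans[OF _ w2_sq] m by simp
 then show "NN.card_le (FX (cv xi) (cv w2)) (cv w2)" using FX_card[OF x w2_M] ord_w by blast
 have n0: "num 0:ext w1" by (rule num_w1)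
 have m0: "num 0:M" by simp
 show "NN.card_le (cv w2) (FX (cv xi) (cv w2))"
 proof (rule gr_card[OF w2_M FX(1)[OF x w2_M subset_refl], of "%c. NN.pr (cv xi) (NN.pr c (cv (num 0)))" "%c. ix xi c (num 0)"])
  show "NN.DefF (%e. NN.pr (cv xi) (NN.pr (e 0) (cv (num 0))))" by (intro def_intro cv_N m0 ext_M[OF x])
  show "inj_on (%c. ix xi c (num 0)) (ext w2)" by (rule inj_onI) (use ix_inj[OF x _ n0 x _ n0] in blast)
 qed (use cv_ix[OF x _ n0] gr_FX[OF x w2_M subset_refl _ n0] in blast)
qed (use FX(1)[OF x w2_M] in auto)

lemma FX_pw: assumes "xi:ext KK" "d:M" "ext d <= ext w2" shows "FX (cv xi) (cv d):extN (NN.pw (NN.pw NN.om))"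
 using FX_family[OF assms] NN.ext_M unfolding NN.is_family_of_reals_def NN.is_omega_iff by auto

lemma piecewise: assumes x: "xi:ext KK" shows "NN.is_piecewise_proper_family (FX (cv xi) (cv w2))"
proof -
 have xM: "xi:M" using x ext_M by blast
 have s: "suc c:M" "ext (suc c) <= ext w2" if "c:ext w2" for c
  using ord_trans[OF ord_w(2) suc_w2[OF that]] ext_M[OF that] by (simp, blast)
 \<comment> \<open>The chain is indexed by successors, so that level \<open>c\<close> itself is
   included in its piece and the criterion applies to each link.\<close>
 define C where "C = NN.sepm (NN.pw (NN.pw NN.om)) (%X. EX c:extN (cv w2). X = FX (cv xi) (NN.suc c))"
 have "NN.Def (%e. EX c:extN (cv w2). e 0 = FX (cv xi) (NN.suc c))" by (intro def_intro cv_N xM w2_M)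
 note C = NN.sepm[OF NN.pw(1)[OF NN.pw(1)[OF NN.om_M]] this, folded C_def]
 have "FX (cv xi) (NN.suc (cv c)) = FX (cv xi) (cv (suc c))" if "c:ext w2" for c using cv_suc[OF ext_M[OF that]] by simp
 then have "(EX c:extN (cv w2). X = FX (cv xi) (NN.suc c)) <-> X:(%c. FX (cv xi) (cv (suc c))) ` ext w2" for X
  unfolding ext_cv[OF w2_M] by auto
 then have CE: "extN C = (%c. FX (cv xi) (cv (suc c))) ` ext w2" unfolding C(2) using FX_pw[OF x s] by blast
 have P: "NN.is_proper_family X & (EX k. NN.is_omega_n 1 k & NN.card_le X k)" if X: "X:extN C" for X
 proof -
  obtain c where c: "c:ext w2" "X = FX (cv xi) (cv (suc c))" using X unfolding CE by blast
  have "NN.card_le X (cv w1)" unfolding c(2)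
   by (rule FX_card[OF x s[OF c(1)] dom3_le[OF c(1), unfolded dom3_def] ord_w(1)])
  then show ?thesis using fx_proper[OF x c(1)] c(2) omegas(1) by blast
 qed
 have L: "extN X <= extN Y \<or> extN Y <= extN X" if XY: "X:extN C" "Y:extN C" for X Y
 proof -
  obtain c d where c: "c:ext w2" "X = FX (cv xi) (cv (suc c))" and d: "d:ext w2" "Y = FX (cv xi) (cv (suc d))"
   using XY unfolding CE by blast
  have o: "is_ordinal c" "is_ordinal d" using c d w2_iff by blast+
  have "ext (suc c) <= ext (suc d) \<or> ext (suc d) <= ext (suc c)"
   using ord_linear[OF o] ord_trans[OF o(1)] ord_trans[OF o(2)] ext_M[OF c(1)] ext_M[OF d(1)] by auto
  then show ?thesis unfolding c(2) d(2) FX(2)[OF x s[OF c(1)]] FX(2)[OF x s[OF d(1)]] by blast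
 qed
 have U: "extN (FX (cv xi) (cv w2)) = (UN X:extN C. extN X)"
 proof -
  have "c:ext (suc c)" if "c:ext w2" for c using ext_M[OF that] by simp
  then have "(UN c:ext w2. ext (suc c)) = ext w2" using s(2) by blast
  moreover have "(UN X:extN C. extN X) = {NN.real (EE g (ix xi b a) n) | b a n. b:(UN c:ext w2. ext (suc c)) & a:ext w1}"
   unfolding CE using FX(2)[OF x s] by (simp add: Union_eq) blast
  ultimately show ?thesis unfolding FX(2)[OF x w2_M subset_refl] by simp
 qed
 show ?thesis unfolding NN.is_piecewise_proper_family_def using FX_family[OF x w2_M subset_refl] C(1) P L U by blast
qed

end

section \<open>Counting the reals and the families\<close>

context piece begin

text \<open>A name with countable supports consists of countably many pairs of a number and a finite
  condition. Indices, pairs, finite sets and finally this countable set itself stay in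
  \<open>KK\<close>, because it is closed under countable subsets.\<close>

lemma real_index:
 assumes "Z:N"
 obtains q where "q:ext KK" "!!n. NN.num n:extN Z <-> (EX c:G. pr (num n) c:ext q)"
proof -
 obtain Q u where Q: "Q:M" and u: "u:M" "!!a. a:ext om ==> ap u a:M" "!!a. a:ext om ==> ext (ap u a) <= ext XX" "!!a. a:ext om ==> card_le (ap u a) om"
  and ZQ: "!!a. a:ext om ==> cv a:extN Z <-> (EX c:G Int ext (cp (ap u a)). pr a c:ext Q)"
  using support_name[OF assms om_M] by blast
 have "Def (%e. e 0:ext Q & p2 (e 0):ext (cp (ap u (p1 (e 0)))))" by (intro def_intro Q u(1))
 note q = sepm[OF times_M[OF om_M prM(1)] this]
 define q where "q = sepm (times om (cp XX)) (%z. z:ext Q & p2 z:ext (cp (ap u (p1 z))))"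
 note q = q[folded q_def]
 have pq: "pr a c:ext q <-> c:ext (cp XX) & pr a c:ext Q & c:ext (cp (ap u a))" if "a:ext om" "c:M" for a c
 proof -
  have "pr a c:ext (times om (cp XX)) <-> c:ext (cp XX)" unfolding ext_times[OF om_M prM(1)]
   using that ext_M pr_inject by blast
  then show ?thesis unfolding q(2) using that(2) ext_M[OF that(1)] by auto
 qed
 have qm: "EX a c. z = pr a c & a:ext om & c:ext (cp XX) & c:ext (cp (ap u a))" if z: "z:ext q" for z
 proof -
  obtain a c where "z = pr a c" "a:ext om" "c:ext (cp XX)" using z unfolding q(2) ext_times[OF om_M prM(1)] by blast
  then show ?thesis using pq ext_M z by blast
 qed
 have w2K: "num n:ext KK" for n using num_w2 KK_w2 by blast
 have "ext (cb XX) <= ext KK" unfolding cb(2)[OF XX(1)]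
 proof clarify
  fix j k l assume "j:ext XX"
  then obtain x c a where "j = ix x c a" "x:ext KK" "c:ext w2" "a:ext w1" unfolding XX(2) by blast
  then have "j:ext KK" unfolding ix_def using KK_pr KK_w2 w1_sub_w2 by (meson subsetD)
  then show "t3 j k l:ext KK" by (intro KK_pr w2K)
 qed
 then have cK: "c:ext KK" if "c:ext (cp XX)" for c
  using that KK_closed[OF _ _ finite_le_om] unfolding cp_iff[OF XX(1)] by blast
 have "ext q <= ext KK"
 proof
  fix z assume "z:ext q"
  then obtain a c where z: "z = pr a c" "a:ext om" "c:ext (cp XX)" using qm by blast
  then have "a:ext KK" using w2K unfolding ext_om by blast
  then show "z:ext KK" using KK_pr cK[OF z(3)] z(1) by blast
 qed
 moreover have "card_le q om"
 proof (rule card_le_UN'[OF om_M om_M _ _ q(1) _ om_refl om_refl om_sq om_M])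
  show "DefF (%e. times (upr (e 0) (e 0)) (cp (ap u (e 0))))" by (intro def_intro u(1))
  show "card_le (times (upr a a) (cp (ap u a))) om" if a: "a:ext om" for a
  proof -
   have m: "upr a a:M" "cp (ap u a):M" "card_le (upr a a) om"
    using ext_M[OF a] cp_M[OF u(2)[OF a]] finite_le_om[of "upr a a"] by auto
   show ?thesis by (rule card_le_trans[OF card_le_times[OF m(3) countable_cp[OF u(2,4)[OF a]] m(1,2) om_M om_M] om_sq times_M[OF m(1,2)] om_M])
  qed
  show "ext q <= (UN a:ext om. ext (times (upr a a) (cp (ap u a))))"
  proof
   fix z assume "z:ext q"
   then obtain a c where z: "z = pr a c" "a:ext om" "c:ext (cp (ap u a))" using qm by blast
   then show "z:(UN a:ext om. ext (times (upr a a) (cp (ap u a))))"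
    using ext_times[OF upr(1) cp_M[OF u(2)[OF z(2)]], of a a] ext_M[OF z(2)] by auto
  qed
 qed
 ultimately have "q:ext KK" using KK_closed q(1) by blast
 moreover have "NN.num n:extN Z <-> (EX c:G. pr (num n) c:ext q)" for n
 proof -
  have n: "num n:ext om" unfolding ext_om by blast
  show ?thesis using ZQ[OF n] pq[OF n G_M] G_p unfolding cv_num by blast
 qed
 ultimately show thesis by (rule that)
qed

lemma generic_in_N: obtains GS where "GS:N" "extN GS = cv ` G"
proof -
 have "Def (%e. p1 (e 0) = p2 (e 0))" by (intro def_intro)
 note Q = sepm[OF times_M[OF prM(1) prM(1)] this]
 have "pr a c:ext (sepm (times (cp XX) (cp XX)) (%z. p1 z = p2 z)) <-> a = c" if "a:ext (cp XX)" "c:ext (cp XX)" for a c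
  unfolding Q(2) ext_times[OF prM(1) prM(1)] using that ext_M[OF that(1)] ext_M[OF that(2)] by auto
 then have "{a:ext (cp XX). EX c:G. pr a c:ext (sepm (times (cp XX) (cp XX)) (%z. p1 z = p2 z))} = G"
  using G_p by blast
 then have "NN.coded (cv ` G)" using of_nice[OF prM(1) Q(1)] by simp
 then show thesis using that unfolding NN.coded_def by blast
qed

text \<open>Evaluation by the generic filter maps \<open>KK\<close> onto the reals, by
  \<open>real_index\<close>. A well-order of \<open>KK\<close> from the ground model remains
  available in the extension and turns this surjection into an injection of the reals into
  \<open>KK\<close>.\<close>

lemma reals_le: "NN.card_le (NN.pw NN.om) (cv KK)"
proof -
 obtain o' f where o: "is_ordinal o'" "f:M" "ext KK <= ap f ` ext o'" using well_order[OF KK] by blast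
 have oM: "o':M" using o ordM by blast
 have "card_le KK o'" by (rule card_le_surj[OF KK oM _ o(3)]) (intro def_intro o)
 then have c: "NN.card_le (cv KK) (cv o')" by (rule cv_card_le[OF _ KK oM])
 obtain GS where GS: "GS:N" "extN GS = cv ` G" using generic_in_N by blast
 define t where "t x = NN.sepm NN.om (%a. EX c:extN GS. NN.pr a c:extN x)" for x
 show ?thesis
 proof (rule NN.surj_back[OF c cv_ordinal[OF o(1)] cv_N[OF KK]])
  show "NN.pw NN.om:N" by simp
  show "NN.DefF (%e. t (e 0))" unfolding t_def by (intro def_intro GS)
  show "extN (NN.pw NN.om) <= t ` extN (cv KK)"
  proof
   fix Z assume "Z:extN (NN.pw NN.om)"
   then have Z: "Z:N" "extN Z <= extN NN.om" by auto
   obtain q where q: "q:ext KK" "!!n. NN.num n:extN Z <-> (EX c:G. pr (num n) c:ext q)" using real_index[OF Z(1)] by blast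
   have qM: "q:M" using q ext_M by blast
   have "NN.Def (%e. EX c:extN GS. NN.pr (e 0) c:extN (cv q))" by (intro def_intro GS cv_N qM)
   note s = NN.sepm[OF NN.om_M this]
   have "NN.pr (NN.num n) (cv c):extN (cv q) <-> pr (num n) c:ext q" if "c:G" for n c
    using pr_cv_iff[OF qM num_M G_M[OF that], of n] unfolding cv_num .
   then have "extN (t (cv q)) = extN Z" unfolding t_def s(2) unfolding GS(2) using q(2) Z(2) unfolding NN.ext_om by auto
   then have "Z = t (cv q)" using NN.ext_eqI[OF Z(1)] s(1) unfolding t_def by simp
   then show "Z:t ` extN (cv KK)" unfolding ext_cv[OF KK] using q(1) by blast
  qed
 qed
qed

text \<open>The families correspond one to one to the elements of \<open>KK\<close>, because each
  contains Cohen reals that the others lack. \<open>KK\<close> has exactly the size of the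
  continuum: \<open>reals_le\<close> is one direction, and the Cohen reals at level 0 and stage 0,
  one for each element of \<open>KK\<close>, give the other.\<close>

lemma continuum_many: "NN.continuum_many_piecewise_proper_of_size_omega2"
proof -
 define S where "S = NN.sepm (NN.pw (NN.pw NN.om)) (%X. EX x:extN (cv KK). X = FX x (cv w2))"
 have "NN.Def (%e. EX x:extN (cv KK). e 0 = FX x (cv w2))" by (intro def_intro cv_N KK w2_M)
 note S = NN.sepm[OF NN.pw(1)[OF NN.pw(1)[OF NN.om_M]] this, folded S_def]
 have SE: "extN S = (%x. FX (cv x) (cv w2)) ` ext KK" unfolding S(2) ext_cv[OF KK] using FX_pw[OF _ w2_M subset_refl] by auto
 have n0: "num 0:ext w1" "num 0:ext w2" by (rule num_w1 num_w2)+
 have "NN.card_eq (cv KK) S"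
 proof (rule NN.card_eqI[OF cv_N[OF KK] S(1)])
  show "NN.DefF (%e. FX (e 0) (cv w2))" by (intro def_intro cv_N w2_M)
  have "x = y" if h: "x:ext KK" "y:ext KK" "FX (cv x) (cv w2) = FX (cv y) (cv w2)" for x y
   using FX_gr[OF h(2,1) n0(2,1)] gr_FX[OF h(1) w2_M subset_refl n0(2,1)] h(3) by simp
  then show "bij_betw (%x. FX x (cv w2)) (extN (cv KK)) (extN S)"
   unfolding SE ext_cv[OF KK] bij_betw_def inj_on_def by blast
 qed
 then have "NN.card_le (cv KK) S" "NN.card_le S (cv KK)" using NN.card_eq_le NN.card_eq_sym S(1) KK by auto
 moreover have "NN.card_le (cv KK) (NN.pw NN.om)"
 proof (rule gr_card[OF KK, of _ "%x. NN.pr x (cv (pr (num 0) (num 0)))" "%x. ix x (num 0) (num 0)"])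
  show "NN.DefF (%e. NN.pr (e 0) (cv (pr (num 0) (num 0))))" by (intro def_intro cv_N pr_M num_M)
  show "inj_on (%x. ix x (num 0) (num 0)) (ext KK)" by (rule inj_onI) (use ix_inj[OF _ n0(2,1) _ n0(2,1)] in blast)
  fix a assume a: "a:ext KK"
  note i = cv_ix[OF a n0(2,1)]
  have "NN.real (gr (ix a (num 0) (num 0))):extN (NN.pw NN.om)" using NN.RR_D[OF gr_RR[OF i(1)]] NN.ext_om by auto
  then show "NN.pr (cv a) (cv (pr (num 0) (num 0))) = cv (ix a (num 0) (num 0)) & ix a (num 0) (num 0):ext XX &
    NN.real (gr (ix a (num 0) (num 0))):extN (NN.pw NN.om)" using i unfolding cv_pr[OF num_M num_M] by blast
 qed simp
 ultimately have "NN.card_eq S (NN.pw NN.om)"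
  using NN.cantor_bernstein NN.card_le_trans reals_le S(1) KK by (meson NN.om_M NN.pw(1) cv_N)
 moreover have "NN.is_Pow (NN.pw NN.om) NN.om" unfolding NN.is_Pow_def by simp
 moreover have "NN.is_piecewise_proper_family F & (EX k. NN.is_omega_n 2 k & NN.card_eq F k)" if "F:extN S" for F
  using that piecewise union_card omegas(2) unfolding SE by blast
 ultimately show ?thesis unfolding NN.continuum_many_piecewise_proper_of_size_omega2_def
  using S(1) NN.is_omega_iff by blast
qed

end

theorem theorem3p16:
  fixes M :: "'a set" and E :: "'a \<Rightarrow> 'a \<Rightarrow> bool"
  assumes "set_structure.wf_model_ZFC M E"
  shows "\<exists>p r. set_structure.is_poset M E p r \<and> set_structure.is_ccc M E p r \<and>
    (\<forall>G. set_structure.is_generic_filter M E p r G \<longrightarrow>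
      set_structure.continuum_many_piecewise_proper_of_size_omega2
        (set_structure.gen_ext M E p G) (set_structure.gen_mem M E p G))"
proof -
 interpret set_structure M E .
 have ax: "ax_extensionality" "wfp_on M E" "ax_pairing" "ax_union" "ax_powerset" "ax_infinity"
  "ax_separation" "ax_replacement" "ax_choice"
  using assms unfolding wf_model_ZFC_def ZFC_def by blast+
 interpret zfc M E
 proof (unfold_locales, goal_cases)
  case 1 then show ?case using ax(1) unfolding ax_extensionality_def by blast
 next
  case 2 then show ?case by (rule ax)
 next
  case 3 then show ?case using ax(3) unfolding ax_pairing_def by blast
 next
  case 4 then show ?case using ax(4) unfolding ax_union_def by blast
 next
  case 5 then show ?case using ax(5) unfolding ax_powerset_def is_Pow_def by blast
 next
  case 6 then show ?case using ax(6) unfolding ax_infinity_def by blast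
 next
  case 7 then show ?case using ax(7) unfolding ax_separation_def by blast
 next
  case 8 then show ?case using ax(8) unfolding ax_replacement_def by blast
 next
  case 9 then show ?case using ax(9) unfolding ax_choice_def by blast
 qed
 \<comment> \<open>The codings of all levels have to be chosen at once inside the ground model, as a
   single parameter; the index order and the poset are then fixed before any generic filter is
   considered.\<close>
 obtain ii where ii: "ii:M" "!!ga. ga:ext w2 ==> ap ii ga:M & inj_on (ap (ap ii ga)) (ext (dom3 ga)) & (ALL y:ext (dom3 ga). ap (ap ii ga) y:ext w1)"
 proof (rule injections[OF w2_M w1_M _ dom3_le])
  show "DefF (%e. dom3 (e 0))" unfolding dom3_def by (intro def_intro)
 qed (assumption, (rule that; blast))
 obtain jj where jj: "jj:M" "!!al. al:ext w1 ==> ap jj al:M & inj_on (ap (ap jj al)) (ext al) & (ALL y:ext al. ap (ap jj al) y:ext om)"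
 proof (rule injections[OF w1_M om_M DefF_var])
  show "card_le x om" if "x:ext w1" for x using that w1_iff by blast
 qed (rule that; blast)
 interpret conc M E ii jj by unfold_locales (use ii jj in blast)+
 have "set_structure.continuum_many_piecewise_proper_of_size_omega2 (gen_ext (cp XX) G) (gen_mem (cp XX) G)"
  if "is_generic_filter (cp XX) (cr XX) G" for G
 proof -
  interpret piece M E ii jj G by unfold_locales (use that XX in auto)
  show ?thesis using continuum_many unfolding N_def EN_def .
 qed
 then show ?thesis using cp_poset[OF XX(1)] cp_ccc[OF XX(1)] by blast
qed

end
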